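(* The essential spectral radius of the transfer operator $R:L\to L$ is at most $\theta$, and the spectral radius of $R:L\to L$ is at most $1$. Moreover, in the main example, where $\tilde X=\mathbb R^n$, $G\subset\mathbb R^n$ is a full-rank lattice acting by translations, $X=\mathbb R^n/G$, and $r(px)=p(Ax)$ with $A\in GL(\mathbb R^n)$ linear, $AG\subset G$, all eigenvalues $\lambda$ of $A$ satisfying $|\lambda|>1$ (so $\tilde r(x)=Ax$, the metric on $\mathbb R^n$ being given by a norm $\|\cdot\|_A$ with $\|Ax\|_A\ge\rho\|x\|_A$ for all $x$ and some $\rho>1$), the essential spectral radius of $R:L\to L$ is at most the spectral radius of $A^{-1}$.
   Context: The essential spectral radius of a bounded linear operator $T$ on a Banach space is the infimum of the numbers $\rho\ge0$ such that every $\lambda\in\mathrm{sp}(T)$ with $|\lambda|>\rho$ is an isolated eigenvalue of finite multiplicity. Geometric setting. $\tilde X$ is a locally compact metric space with metric $\mathrm{dist}$; a discrete group $G$ acts on $\tilde X$ isometrically and properly discontinuously (freely, so that the quotient map is a covering map); $X:=\tilde X/G$ is compact, $p:\tilde X\to X$ is the quotient covering map. $\tilde r:\tilde X\to\tilde X$ is a homeomorphism such that for some $0<\theta<1$, $\mathrm{dist}(x,y)\le\theta\,\mathrm{dist}(\tilde rx,\tilde ry)$ for all $x,y$; $\tilde x_0$ is the fixed point of $\tilde r$ and $x_0=p(\tilde x_0)$. There is $A\in\mathrm{End}(G)$ with $AG$ a normal subgroup of $G$ and $\tilde r(gx)=(Ag)\tilde r(x)$ for all $g\in G$, $x\in\tilde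 X$. $r:X\to X$ is defined by $r(p(x))=p(\tilde r(x))$. $g_1=1,g_2,\dots,g_q$ is a (finite) complete system of representatives of the right cosets of $AG$ in $G$, and $\psi_i=\tilde r^{-1}\circ g_i$; thus $\{p\psi_1x,\dots,p\psi_qx\}=r^{-1}(px)$. Bundle. $\xi\to X$ is a Lipschitz continuous $d$-dimensional complex vector bundle with a hermitian metric $\langle\cdot,\cdot\rangle$; $S$ is the $C(X)$-module of continuous sections; $\mathrm{End}(\xi)$ is the $C^*$-algebra of continuous bundle maps $\xi\to\xi$ over the identity with norm $\|F\|_\infty=\sup_{x\in X}\|F(x)\|$ and pointwise adjoint. The pullback $p^*\xi$ is assumed trivial and is identified, by a fiberwise isometric Lipschitz isomorphism, with $\tilde X\times\mathbb C^d$ (standard inner product); so for a section $s$ of $\xi$, $p^*s$ is a function $\tilde X\to\mathbb C^d$, and for $h\in\mathrm{End}(\xi)$, $p^*h$ is a function $\tilde X\to M_d(\mathbb C)$. $S_1$ is the set of $s\in S$ with $p^*s$ Lipschitz, normed by $\|s\|_1=\sup_x\|s(x)\|+\sup_{x\ne y}\|p^*s(x)-p^*s(y)\|/\mathrm{dist}(x,y)$; $L$ is the Banach algebra of endomorphisms of the $\mathrm{Lip}_1(X)$-module $S_1$ with operator norm $\|\cdot\|_1$. In this setting $S_1$ is a finite rank projective $\mathrm{Lip}_1(X)$-module and $L$ is dense in $\mathrm{End}(\xi)$. Transfer operator. $m:r^*\xi\to\xi$ is a bundle map, i.e. linear maps $m(y):\xi_{r(y)}\to\xi_y$, with adjoint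 $m^*(y):\xi_y\to\xi_{r(y)}$. The transfer operator $R$ acts on $h\in\mathrm{End}(\xi)$ by $(Rh)(px)=\sum_{i=1}^q m^*(p\psi_ix)h(p\psi_ix)m(p\psi_ix)$, $x\in\tilde X$; it maps $L$ to $L$. Standing assumptions: $m$ is Lipschitz continuous (i.e. $p^*m$, viewed as a function $\tilde X\to M_d(\mathbb C)$, is Lipschitz) and $\sup_k\|R^k\|_\infty<\infty$, where $\|R^k\|_\infty$ is the operator norm on $(\mathrm{End}(\xi),\|\cdot\|_\infty)$. *)

theory Defs
  imports
    "HOL-Analysis.Analysis"
    "HOL-Algebra.Group_Action"
    "HOL-Library.Function_Algebras"
begin

section \<open>Spectral notions for operators on a normed complex space\<close>

text \<open>
  The spaces of interest are subspaces \<open>V\<close> of function spaces, with a norm \<open>N\<close> that is only meaningful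
  on \<open>V\<close>. A space is therefore given by an ambient type with complex scaling \<open>sc\<close>, a carrier \<open>V\<close>,
  and \<open>N\<close>; operators are functions on the ambient type of which only the values on \<open>V\<close> matter.
\<close>

definition linear_on ::
    "(complex \<Rightarrow> 'u \<Rightarrow> 'u) \<Rightarrow> (complex \<Rightarrow> 'v \<Rightarrow> 'v) \<Rightarrow> 'u::ab_group_add set \<Rightarrow> ('u \<Rightarrow> 'v::ab_group_add) \<Rightarrow> bool"
  where "linear_on sc1 sc2 V f \<longleftrightarrow>
    (\<forall>u\<in>V. \<forall>v\<in>V. f (u + v) = f u + f v) \<and> (\<forall>c. \<forall>v\<in>V. f (sc1 c v) = sc2 c (f v))"

definition bounded_on :: "'v set \<Rightarrow> ('v \<Rightarrow> real) \<Rightarrow> ('v \<Rightarrow> 'v) \<Rightarrow> bool"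
  where "bounded_on V N T \<longleftrightarrow> (\<exists>C. \<forall>v\<in>V. N (T v) \<le> C * N v)"

definition op_norm :: "'v set \<Rightarrow> ('v \<Rightarrow> real) \<Rightarrow> ('v \<Rightarrow> 'v) \<Rightarrow> real"
  where "op_norm V N T = Sup {N (T v) | v. v \<in> V \<and> N v \<le> 1}"

definition spectrum ::
    "(complex \<Rightarrow> 'v \<Rightarrow> 'v) \<Rightarrow> 'v::ab_group_add set \<Rightarrow> ('v \<Rightarrow> real) \<Rightarrow> ('v \<Rightarrow> 'v) \<Rightarrow> complex set"
  where "spectrum sc V N T =
    {z. \<not> (bij_betw (\<lambda>v. T v - sc z v) V V \<and>
           bounded_on V N (inv_into V (\<lambda>v. T v - sc z v)))}"

text \<open>Radii are taken in \<^typ>\<open>ennreal\<close>, so that suprema and infima of arbitrary sets are meaningful.\<close>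

definition spectral_radius ::
    "(complex \<Rightarrow> 'v \<Rightarrow> 'v) \<Rightarrow> 'v::ab_group_add set \<Rightarrow> ('v \<Rightarrow> real) \<Rightarrow> ('v \<Rightarrow> 'v) \<Rightarrow> ennreal"
  where "spectral_radius sc V N T = (SUP z\<in>spectrum sc V N T. ennreal (cmod z))"

definition is_eigenvalue ::
    "(complex \<Rightarrow> 'v \<Rightarrow> 'v) \<Rightarrow> 'v::ab_group_add set \<Rightarrow> ('v \<Rightarrow> 'v) \<Rightarrow> complex \<Rightarrow> bool"
  where "is_eigenvalue sc V T z \<longleftrightarrow> (\<exists>v\<in>V. v \<noteq> 0 \<and> T v = sc z v)"

definition gen_eigenspace ::
    "(complex \<Rightarrow> 'v \<Rightarrow> 'v) \<Rightarrow> 'v::ab_group_add set \<Rightarrow> ('v \<Rightarrow> 'v) \<Rightarrow> complex \<Rightarrow> 'v set"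
  where "gen_eigenspace sc V T z = {v \<in> V. \<exists>k. ((\<lambda>w. T w - sc z w) ^^ k) v = 0}"

text \<open>
  Multiplicity is algebraic multiplicity, i.e. the rank of the Riesz projection: the generalized
  eigenspace is finite-dimensional and has a \<open>T\<close>-invariant complement \<open>H\<close> on which \<open>T - z\<close> is
  invertible. On a Banach space such an \<open>H\<close> is the range of a power of \<open>T - z\<close>, hence closed, and the
  generalized eigenspace is then the range of the Riesz projection of the isolated point \<open>z\<close>.
\<close>

definition finite_multiplicity ::
    "(complex \<Rightarrow> 'v \<Rightarrow> 'v) \<Rightarrow> 'v::ab_group_add set \<Rightarrow> ('v \<Rightarrow> real) \<Rightarrow> ('v \<Rightarrow> 'v) \<Rightarrow> complex \<Rightarrow> bool"
  where "finite_multiplicity sc V N T z \<longleftrightarrow>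
    (\<exists>B. finite B \<and> gen_eigenspace sc V T z \<subseteq> module.span sc B) \<and>
    (\<exists>H. module.subspace sc H \<and> H \<subseteq> V \<and> T ` H \<subseteq> H \<and> z \<notin> spectrum sc H N T \<and>
         V = {u + w | u w. u \<in> gen_eigenspace sc V T z \<and> w \<in> H})"

definition essential_spectral_radius ::
    "(complex \<Rightarrow> 'v \<Rightarrow> 'v) \<Rightarrow> 'v::ab_group_add set \<Rightarrow> ('v \<Rightarrow> real) \<Rightarrow> ('v \<Rightarrow> 'v) \<Rightarrow> ennreal"
  where "essential_spectral_radius sc V N T =
    Inf {\<rho>. \<forall>z\<in>spectrum sc V N T. \<rho> < ennreal (cmod z) \<longrightarrow>
           z isolated_in spectrum sc V N T \<and> is_eigenvalue sc V T z \<and> finite_multiplicity sc V N T z}"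

definition lipschitz_wrt :: "('s \<Rightarrow> 's \<Rightarrow> real) \<Rightarrow> 's set \<Rightarrow> ('s \<Rightarrow> 'b::metric_space) \<Rightarrow> bool"
  where "lipschitz_wrt D S f \<longleftrightarrow> (\<exists>C. \<forall>x\<in>S. \<forall>y\<in>S. dist (f x) (f y) \<le> C * D x y)"


section \<open>The data\<close>

text \<open>
  \<open>Xt\<close> is the covering space with metric \<open>dst\<close>, and \<open>Grp\<close> acts on it by \<open>act\<close>. The lifted map is \<open>rt\<close>,
  with contraction constant \<open>theta\<close> of its inverse and fixed point \<open>fixpt\<close>; \<open>endo\<close> is the endomorphism \<open>A\<close>,
  \<open>idx\<close> is \<open>q\<close> and \<open>rep i\<close> is \<open>g\<^sub>i\<close>. On the quotient \<open>X\<close>, whose points are orbits (of type \<open>'a set\<close>),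
  \<open>rmap\<close> is \<open>r\<close> and \<open>mmap\<close> is \<open>m\<close>.

  The fibres of the bundle are subspaces of a vector space \<open>'e\<close> with scaling \<open>scal\<close>. They may overlap, the
  total space being their disjoint union, so this is no restriction: one may take the direct sum of all fibres
  as \<open>'e\<close>. A chart is an open subset of \<open>X\<close> together with a fibrewise linear trivialization over it, and
  \<open>triv x\<close> identifies \<open>complex ^ 'd\<close> with the fibre of the pullback bundle over \<open>x\<close>.
\<close>

record ('a, 'g, 'e, 'd) transfer_system =
  Xt :: "'a set"
  dst :: "'a \<Rightarrow> 'a \<Rightarrow> real"
  Grp :: "'g monoid"
  act :: "'g \<Rightarrow> 'a \<Rightarrow> 'a"
  rt :: "'a \<Rightarrow> 'a"
  theta :: real
  fixpt :: 'a
  endo :: "'g \<Rightarrow> 'g"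
  idx :: nat
  rep :: "nat \<Rightarrow> 'g"
  rmap :: "'a set \<Rightarrow> 'a set"
  scal :: "complex \<Rightarrow> 'e \<Rightarrow> 'e"
  fibre :: "'a set \<Rightarrow> 'e set"
  herm :: "'a set \<Rightarrow> 'e \<Rightarrow> 'e \<Rightarrow> complex"
  charts :: "('a set set \<times> ('a set \<Rightarrow> 'e \<Rightarrow> complex ^ 'd)) set"
  triv :: "'a \<Rightarrow> complex ^ 'd \<Rightarrow> 'e"
  mmap :: "'a set \<Rightarrow> 'e \<Rightarrow> 'e"


section \<open>The covering and the expanding map\<close>

definition covered :: "('a, 'g, 'e, 'd::finite) transfer_system \<Rightarrow> 'a topology"
  where "covered D = Metric_space.mtopology (Xt D) (dst D)"

definition base :: "('a, 'g, 'e, 'd::finite) transfer_system \<Rightarrow> 'a set set"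
  where "base D = orbits (Grp D) (Xt D) (act D)"

definition proj :: "('a, 'g, 'e, 'd::finite) transfer_system \<Rightarrow> 'a \<Rightarrow> 'a set"
  where "proj D x = orbit (Grp D) (act D) x"

definition base_top :: "('a, 'g, 'e, 'd::finite) transfer_system \<Rightarrow> 'a set topology"
  where "base_top D =
    topology (\<lambda>U. U \<subseteq> base D \<and> openin (covered D) {x \<in> Xt D. proj D x \<in> U})"

definition base_dist :: "('a, 'g, 'e, 'd::finite) transfer_system \<Rightarrow> 'a set \<Rightarrow> 'a set \<Rightarrow> real"
  where "base_dist D P Q = Inf {dst D x y | x y. x \<in> P \<and> y \<in> Q}"

definition psi :: "('a, 'g, 'e, 'd::finite) transfer_system \<Rightarrow> nat \<Rightarrow> 'a \<Rightarrow> 'a"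
  where "psi D i x = inv_into (Xt D) (rt D) (act D (rep D i) x)"

locale covering_setting =
  fixes D :: "('a, 'g, 'e, 'd::finite) transfer_system"
  assumes metric: "Metric_space (Xt D) (dst D)"
    and locally_compact: "locally_compact_space (covered D)"
    and action: "group_action (Grp D) (Xt D) (act D)"
    and isometric: "\<And>g x y. \<lbrakk>g \<in> carrier (Grp D); x \<in> Xt D; y \<in> Xt D\<rbrakk>
      \<Longrightarrow> dst D (act D g x) (act D g y) = dst D x y"
    and properly_discontinuous: "\<And>K. compactin (covered D) K
      \<Longrightarrow> finite {g \<in> carrier (Grp D). act D g ` K \<inter> K \<noteq> {}}"
    and free: "\<And>g x. \<lbrakk>g \<in> carrier (Grp D); x \<in> Xt D; act D g x = x\<rbrakk> \<Longrightarrow> g = \<one>\<^bsub>Grp D\<^esub>"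
    and compact_quotient: "compact_space (base_top D)"
    and rt_homeomorphism: "homeomorphic_map (covered D) (covered D) (rt D)"
    and theta_range: "0 < theta D" "theta D < 1"
    and rt_expanding: "\<And>x y. \<lbrakk>x \<in> Xt D; y \<in> Xt D\<rbrakk>
      \<Longrightarrow> dst D x y \<le> theta D * dst D (rt D x) (rt D y)"
    and fixed_point: "fixpt D \<in> Xt D" "rt D (fixpt D) = fixpt D"
    and endomorphism: "endo D \<in> hom (Grp D) (Grp D)"
    and image_normal: "(endo D ` carrier (Grp D)) \<lhd> Grp D"
    and rt_equivariant: "\<And>g x. \<lbrakk>g \<in> carrier (Grp D); x \<in> Xt D\<rbrakk>
      \<Longrightarrow> rt D (act D g x) = act D (endo D g) (rt D x)"
    and rmap_proj: "\<And>x. x \<in> Xt D \<Longrightarrow> rmap D (proj D x) = proj D (rt D x)"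
    and rep_one: "1 \<le> idx D" "rep D 1 = \<one>\<^bsub>Grp D\<^esub>"
    and rep_carrier: "rep D ` {1..idx D} \<subseteq> carrier (Grp D)"
    and rep_cosets: "bij_betw (\<lambda>i. (endo D ` carrier (Grp D)) #>\<^bsub>Grp D\<^esub> rep D i)
      {1..idx D} (rcosets\<^bsub>Grp D\<^esub> (endo D ` carrier (Grp D)))"


section \<open>The bundle\<close>

definition chart_inv ::
    "('a, 'g, 'e, 'd::finite) transfer_system \<Rightarrow> ('a set \<Rightarrow> 'e \<Rightarrow> complex ^ 'd) \<Rightarrow> 'a set \<Rightarrow> complex ^ 'd \<Rightarrow> 'e"
  where "chart_inv D \<phi> y = inv_into (fibre D y) (\<phi> y)"

definition triv_inv ::
    "('a, 'g, 'e, 'd::finite) transfer_system \<Rightarrow> 'a \<Rightarrow> 'e \<Rightarrow> complex ^ 'd"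
  where "triv_inv D x = inv_into UNIV (triv D x)"

locale bundle_setting = covering_setting D
  for D :: "('a, 'g, 'e::ab_group_add, 'd::finite) transfer_system" +
  assumes scaling: "vector_space (scal D)"
    and fibre_subspace: "\<And>y. y \<in> base D \<Longrightarrow> module.subspace (scal D) (fibre D y)"
    and chart_open: "\<And>U \<phi>. (U, \<phi>) \<in> charts D \<Longrightarrow> openin (base_top D) U"
    and chart_cover: "(\<Union>(U, \<phi>)\<in>charts D. U) = base D"
    and chart_linear: "\<And>U \<phi> y. \<lbrakk>(U, \<phi>) \<in> charts D; y \<in> U\<rbrakk>
      \<Longrightarrow> linear_on (scal D) (*s) (fibre D y) (\<phi> y) \<and> bij_betw (\<phi> y) (fibre D y) UNIV"
    and transition_lipschitz: "\<And>U \<phi> V \<kappa>. \<lbrakk>(U, \<phi>) \<in> charts D; (V, \<kappa>) \<in> charts D\<rbrakk>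
      \<Longrightarrow> lipschitz_wrt (base_dist D) (U \<inter> V) (\<lambda>y. matrix (\<lambda>a. \<phi> y (chart_inv D \<kappa> y a)))"
    and herm_linear: "\<And>y w. \<lbrakk>y \<in> base D; w \<in> fibre D y\<rbrakk>
      \<Longrightarrow> linear_on (scal D) (*) (fibre D y) (\<lambda>v. herm D y v w)"
    and herm_symmetric: "\<And>y v w. \<lbrakk>y \<in> base D; v \<in> fibre D y; w \<in> fibre D y\<rbrakk>
      \<Longrightarrow> herm D y w v = cnj (herm D y v w)"
    and herm_positive: "\<And>y v. \<lbrakk>y \<in> base D; v \<in> fibre D y; v \<noteq> 0\<rbrakk> \<Longrightarrow> 0 < Re (herm D y v v)"
    and herm_continuous: "\<And>U \<phi> a b. (U, \<phi>) \<in> charts D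
      \<Longrightarrow> continuous_map (subtopology (base_top D) U) euclidean
            (\<lambda>y. herm D y (chart_inv D \<phi> y a) (chart_inv D \<phi> y b))"
    and triv_linear: "\<And>x. x \<in> Xt D
      \<Longrightarrow> linear_on (*s) (scal D) UNIV (triv D x) \<and> bij_betw (triv D x) UNIV (fibre D (proj D x))"
    and triv_isometric: "\<And>x a b. x \<in> Xt D
      \<Longrightarrow> herm D (proj D x) (triv D x a) (triv D x b) = (\<Sum>j\<in>UNIV. a $ j * cnj (b $ j))"
    and triv_lipschitz: "\<And>U \<phi>. (U, \<phi>) \<in> charts D
      \<Longrightarrow> lipschitz_wrt (dst D) {x \<in> Xt D. proj D x \<in> U}
            (\<lambda>x. matrix (\<lambda>a. \<phi> (proj D x) (triv D x a)))"
    and triv_inv_lipschitz: "\<And>U \<phi>. (U, \<phi>) \<in> charts D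
      \<Longrightarrow> lipschitz_wrt (dst D) {x \<in> Xt D. proj D x \<in> U}
            (\<lambda>x. matrix (\<lambda>a. triv_inv D x (chart_inv D \<phi> (proj D x) a)))"

definition fibre_norm :: "('a, 'g, 'e, 'd::finite) transfer_system \<Rightarrow> 'a set \<Rightarrow> 'e \<Rightarrow> real"
  where "fibre_norm D y v = sqrt (Re (herm D y v v))"

text \<open>
  Sections and bundle maps are extended by \<open>0\<close> outside \<open>X\<close> and outside the fibres, so that they form
  subspaces of function types.
\<close>

definition sections ::
    "('a, 'g, 'e::ab_group_add, 'd::finite) transfer_system \<Rightarrow> ('a set \<Rightarrow> 'e) set"
  where "sections D = {s.
    (\<forall>y\<in>base D. s y \<in> fibre D y) \<and> (\<forall>y. y \<notin> base D \<longrightarrow> s y = 0) \<and>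
    (\<forall>(U, \<phi>)\<in>charts D. continuous_map (subtopology (base_top D) U) euclidean (\<lambda>y. \<phi> y (s y)))}"

definition End_bundle ::
    "('a, 'g, 'e::ab_group_add, 'd::finite) transfer_system \<Rightarrow> ('a set \<Rightarrow> 'e \<Rightarrow> 'e) set"
  where "End_bundle D = {h.
    (\<forall>y\<in>base D. linear_on (scal D) (scal D) (fibre D y) (h y) \<and> h y ` fibre D y \<subseteq> fibre D y) \<and>
    (\<forall>y v. \<not> (y \<in> base D \<and> v \<in> fibre D y) \<longrightarrow> h y v = 0) \<and>
    (\<forall>(U, \<phi>)\<in>charts D. continuous_map (subtopology (base_top D) U) euclidean
        (\<lambda>y. matrix (\<lambda>a. \<phi> y (h y (chart_inv D \<phi> y a)))))}"

definition sup_norm_End ::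
    "('a, 'g, 'e, 'd::finite) transfer_system \<Rightarrow> ('a set \<Rightarrow> 'e \<Rightarrow> 'e) \<Rightarrow> real"
  where "sup_norm_End D h = (SUP y\<in>base D. op_norm (fibre D y) (fibre_norm D y) (h y))"

definition pull_section ::
    "('a, 'g, 'e, 'd::finite) transfer_system \<Rightarrow> ('a set \<Rightarrow> 'e) \<Rightarrow> 'a \<Rightarrow> complex ^ 'd"
  where "pull_section D s x = triv_inv D x (s (proj D x))"

definition lip_sections ::
    "('a, 'g, 'e::ab_group_add, 'd::finite) transfer_system \<Rightarrow> ('a set \<Rightarrow> 'e) set"
  where "lip_sections D = {s \<in> sections D. lipschitz_wrt (dst D) (Xt D) (pull_section D s)}"

text \<open>Pairs \<open>x = y\<close> contribute \<open>0 / 0 = 0\<close> to the second supremum.\<close>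

definition lip_norm ::
    "('a, 'g, 'e, 'd::finite) transfer_system \<Rightarrow> ('a set \<Rightarrow> 'e) \<Rightarrow> real"
  where "lip_norm D s = (SUP y\<in>base D. fibre_norm D y (s y)) +
    (SUP (x, y)\<in>Xt D \<times> Xt D. norm (pull_section D s x - pull_section D s y) / dst D x y)"

definition lip_functions ::
    "('a, 'g, 'e, 'd::finite) transfer_system \<Rightarrow> ('a set \<Rightarrow> complex) set"
  where "lip_functions D = {f. lipschitz_wrt (base_dist D) (base D) f}"

definition module_endomorphism ::
    "('a, 'g, 'e::ab_group_add, 'd::finite) transfer_system \<Rightarrow> (('a set \<Rightarrow> 'e) \<Rightarrow> ('a set \<Rightarrow> 'e)) \<Rightarrow> bool"
  where "module_endomorphism D T \<longleftrightarrow>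
    T ` lip_sections D \<subseteq> lip_sections D \<and>
    (\<forall>s\<in>lip_sections D. \<forall>t\<in>lip_sections D. T (s + t) = T s + T t) \<and>
    (\<forall>f\<in>lip_functions D. \<forall>s\<in>lip_sections D. T (\<lambda>y. scal D (f y) (s y)) = (\<lambda>y. scal D (f y) (T s y))) \<and>
    bounded_on (lip_sections D) (lip_norm D) T"

definition induced :: "('a set \<Rightarrow> 'e \<Rightarrow> 'e) \<Rightarrow> ('a set \<Rightarrow> 'e) \<Rightarrow> ('a set \<Rightarrow> 'e)"
  where "induced h s = (\<lambda>y. h y (s y))"

text \<open>
  \<open>L\<close> is regarded as a subalgebra of \<open>End(\<xi>)\<close>, an endomorphism of the module \<open>S\<^sub>1\<close> being identified with
  the bundle map that induces it.
\<close>

definition L_alg ::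
    "('a, 'g, 'e::ab_group_add, 'd::finite) transfer_system \<Rightarrow> ('a set \<Rightarrow> 'e \<Rightarrow> 'e) set"
  where "L_alg D = {h \<in> End_bundle D. module_endomorphism D (induced h)}"

definition L_norm ::
    "('a, 'g, 'e::ab_group_add, 'd::finite) transfer_system \<Rightarrow> ('a set \<Rightarrow> 'e \<Rightarrow> 'e) \<Rightarrow> real"
  where "L_norm D h = op_norm (lip_sections D) (lip_norm D) (induced h)"

definition End_scale ::
    "('a, 'g, 'e, 'd::finite) transfer_system \<Rightarrow> complex \<Rightarrow> ('a set \<Rightarrow> 'e \<Rightarrow> 'e) \<Rightarrow> ('a set \<Rightarrow> 'e \<Rightarrow> 'e)"
  where "End_scale D c h = (\<lambda>y v. scal D c (h y v))"


section \<open>The transfer operator\<close>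

definition m_adj :: "('a, 'g, 'e, 'd::finite) transfer_system \<Rightarrow> 'a set \<Rightarrow> 'e \<Rightarrow> 'e"
  where "m_adj D y w = (THE u. u \<in> fibre D (rmap D y) \<and>
    (\<forall>v\<in>fibre D (rmap D y). herm D (rmap D y) u v = herm D y w (mmap D y v)))"

text \<open>The sum does not depend on the representative \<open>x\<close> of the orbit \<open>y\<close>.\<close>

definition transfer ::
    "('a, 'g, 'e::ab_group_add, 'd::finite) transfer_system \<Rightarrow> ('a set \<Rightarrow> 'e \<Rightarrow> 'e) \<Rightarrow> ('a set \<Rightarrow> 'e \<Rightarrow> 'e)"
  where "transfer D h = (\<lambda>y v.
    if y \<in> base D \<and> v \<in> fibre D y then
      let x = (SOME x. x \<in> Xt D \<and> proj D x = y) in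
        \<Sum>i = 1..idx D. m_adj D (proj D (psi D i x))
          (h (proj D (psi D i x)) (mmap D (proj D (psi D i x)) v))
    else 0)"

locale transfer_setting = bundle_setting D
  for D :: "('a, 'g, 'e::ab_group_add, 'd::finite) transfer_system" +
  assumes m_linear: "\<And>y. y \<in> base D
      \<Longrightarrow> linear_on (scal D) (scal D) (fibre D (rmap D y)) (mmap D y) \<and>
          mmap D y ` fibre D (rmap D y) \<subseteq> fibre D y"
    and m_lipschitz: "lipschitz_wrt (dst D) (Xt D)
      (\<lambda>x. matrix (\<lambda>a. triv_inv D x (mmap D (proj D x) (triv D (rt D x) a))))"
    and power_bounded: "bdd_above (range (\<lambda>k. op_norm (End_bundle D) (sup_norm_End D) (transfer D ^^ k)))"


section \<open>The main example\<close>

definition full_rank_lattice :: "(real ^ 'n) set \<Rightarrow> bool"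
  where "full_rank_lattice \<Lambda> \<longleftrightarrow>
    (\<exists>B. independent B \<and> span B = UNIV \<and> \<Lambda> = {\<Sum>b\<in>B. of_int (c b) *\<^sub>R b | c :: real ^ 'n \<Rightarrow> int. True})"

abbreviation complexify :: "real ^ 'n ^ 'n \<Rightarrow> complex ^ 'n ^ 'n"
  where "complexify \<equiv> map_matrix complex_of_real"

locale torus_setting = transfer_setting D
  for D :: "(real ^ 'n, real ^ 'n, 'e::ab_group_add, 'd::finite) transfer_system"
    and A :: "real ^ 'n ^ 'n" and normA :: "real ^ 'n \<Rightarrow> real" and \<rho> :: real +
  assumes A_invertible: "invertible A"
    and A_eigenvalues: "\<And>z. is_eigenvalue (*s) UNIV ((*v) (complexify A)) z \<Longrightarrow> 1 < cmod z"
    and normA_zero: "\<And>x. normA x = 0 \<longleftrightarrow> x = 0"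
    and normA_scale: "\<And>c x. normA (c *\<^sub>R x) = \<bar>c\<bar> * normA x"
    and normA_triangle: "\<And>x y. normA (x + y) \<le> normA x + normA y"
    and rho_gt_1: "1 < \<rho>"
    and normA_expanding: "\<And>x. \<rho> * normA x \<le> normA (A *v x)"
    and Xt_eq: "Xt D = UNIV"
    and dst_eq: "dst D = (\<lambda>x y. normA (x - y))"
    and theta_eq: "theta D = 1 / \<rho>"
    and lattice: "full_rank_lattice (carrier (Grp D))"
    and Grp_eq: "Grp D = \<lparr>carrier = carrier (Grp D), mult = (+), one = 0\<rparr>"
    and act_eq: "\<And>g x. g \<in> carrier (Grp D) \<Longrightarrow> act D g x = g + x"
    and endo_eq: "\<And>g. g \<in> carrier (Grp D) \<Longrightarrow> endo D g = A *v g"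
    and rt_eq: "rt D = (\<lambda>x. A *v x)"

end

theory Submission
  imports Defs "HOL-Computational_Algebra.Fundamental_Theorem_Algebra"
begin

text \<open>
  In the trivialization of the pulled back bundle, an element of \<open>L\<close> is a Lipschitz function
  \<open>H\<close> on the covering space that is equivariant for a unitary cocycle, and the norm of \<open>L\<close> is
  equivalent to the sup norm of \<open>H\<close> plus its Lipschitz constant. The powers of \<open>R\<close> are sums
  over the inverse branches \<open>\<psi>\<^sub>w\<close> of the \<open>k\<close>-th iterate, \<open>R\<^sup>k H = \<Sum>\<^sub>w M\<^sub>w\<^sup>* (H \<circ> \<psi>\<^sub>w) M\<^sub>w\<close>.
  Since \<open>\<Sum>\<^sub>w M\<^sub>w\<^sup>* M\<^sub>w = R\<^sup>k 1\<close> is bounded in \<open>k\<close>, the Cauchy--Schwarz inequality gives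
  \<open>Lip (R\<^sup>k H) \<le> K \<theta>\<^sup>k Lip H + C\<^sub>k |H|\<^sub>\<infinity>\<close>. Balls of \<open>L\<close> are totally bounded in the sup norm, as in the
  theorem of Arzela and Ascoli, so Riesz theory applies to \<open>R - z\<close> for \<open>|z| > \<theta>\<close> as it does for compact
  operators: infinite chains of kernels or ranges would yield sequences that are separated under all
  powers of \<open>R\<close>, which the inequality excludes. For the torus, \<open>\<theta>\<^sup>k\<close> may be replaced by
  \<open>C \<tau>\<^sup>k\<close> for any \<open>\<tau>\<close> larger than the spectral radius of \<open>A\<^sup>-\<^sup>1\<close>, since \<open>|A\<^sup>-\<^sup>k|\<close> grows at most like \<open>\<tau>\<^sup>k\<close>.
\<close>

section \<open>Operators satisfying a Lasota--Yorke inequality\<close>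

text \<open>The norm of \<open>L\<close> is an operator norm on Lipschitz sections, whereas the
  Lasota--Yorke estimate concerns the coordinate function on the covering space. Comparing the two
  is the main obstacle: Lipschitz bounds for the coordinates must be read off from the action on
  sections, which takes sections that are constant near a given point, and the unitary cocycle must
  be Lipschitz with one constant for all group elements. The spectral argument is therefore run
  abstractly, for a strong norm \<open>N\<close> and a weak gauge \<open>W\<close>, and only its
  conclusions are carried over to the operator norm. Precompactness is assumed as a finite cover by
  sets of small \<open>W\<close>-diameter, the form that a pigeonhole argument consumes. The
  constant \<open>1 / 8\<close> is made for that argument: two unit vectors are at distance at most
  2, so the strong term contributes at most a quarter of \<open>t ^ n\<close>, the weak term is made
  at most an eighth, and the sum stays below the separation \<open>t ^ n / 2\<close> that Riesz's
  lemma provides. One exponent \<open>n\<close> for each \<open>t\<close> suffices, so the growth of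
  the weak constant with \<open>n\<close> is harmless.\<close>

locale hennion = vector_space sc
  for sc :: "complex \<Rightarrow> 'v::ab_group_add \<Rightarrow> 'v" +
  fixes V :: "'v set" and N W :: "'v \<Rightarrow> real" and T :: "'v \<Rightarrow> 'v" and \<theta> :: real
  assumes subspace_V: "subspace V"
    and N_nonneg: "v \<in> V \<Longrightarrow> 0 \<le> N v"
    and N_zero: "v \<in> V \<Longrightarrow> N v = 0 \<Longrightarrow> v = 0"
    and N_scale: "v \<in> V \<Longrightarrow> N (sc c v) = cmod c * N v"
    and N_add: "u \<in> V \<Longrightarrow> v \<in> V \<Longrightarrow> N (u + v) \<le> N u + N v"
    and W_nonneg: "v \<in> V \<Longrightarrow> 0 \<le> W v"
    and complete: "\<And>f. (\<And>n::nat. f n \<in> V) \<Longrightarrow> (\<And>e. e > 0 \<Longrightarrow> \<exists>M. \<forall>m\<ge>M. \<forall>n\<ge>M. N (f m - f n) < e)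
      \<Longrightarrow> \<exists>l\<in>V. (\<lambda>n. N (f n - l)) \<longlonglongrightarrow> 0"
    and weakly_totally_bounded: "\<And>e. e > 0 \<Longrightarrow> \<exists>\<C>. finite \<C> \<and> {v \<in> V. N v \<le> 1} \<subseteq> \<Union>\<C> \<and>
      (\<forall>C\<in>\<C>. \<forall>u\<in>C. \<forall>v\<in>C. W (u - v) < e)"
    and T_linear: "linear_on sc sc V T"
    and T_mem: "v \<in> V \<Longrightarrow> T v \<in> V"
    and T_bounded: "\<exists>C. \<forall>v\<in>V. N (T v) \<le> C * N v"
    and \<theta>_nonneg: "0 \<le> \<theta>"
    and lasota_yorke: "\<And>t. \<theta> < t \<Longrightarrow> \<exists>n C. 0 \<le> C \<and> (\<forall>v\<in>V. N ((T ^^ n) v) \<le> t ^ n / 8 * N v + C * W v)"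
begin

section \<open>Algebra and norm bounds for \<open>T\<close> and its shifts
  \<open>S z\<close>\<close>

definition S :: "complex \<Rightarrow> 'v \<Rightarrow> 'v" where "S z v = T v - sc z v"

lemma mem0 [simp]: "0 \<in> V" and mem_add: "u \<in> V \<Longrightarrow> v \<in> V \<Longrightarrow> u + v \<in> V"
  and mem_scale: "v \<in> V \<Longrightarrow> sc c v \<in> V" and mem_diff: "u \<in> V \<Longrightarrow> v \<in> V \<Longrightarrow> u - v \<in> V"
  using subspace_V by (auto simp: subspace_0 subspace_add subspace_scale subspace_diff)

lemma T_add: "u \<in> V \<Longrightarrow> v \<in> V \<Longrightarrow> T (u + v) = T u + T v"
  and T_scale: "v \<in> V \<Longrightarrow> T (sc c v) = sc c (T v)"
  using T_linear by (auto simp: linear_on_def)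

lemma T_0 [simp]: "T 0 = 0"
  using T_scale[of 0 0] by simp

lemma T_diff: "u \<in> V \<Longrightarrow> v \<in> V \<Longrightarrow> T (u - v) = T u - T v"
  using T_add[of "u - v" v] mem_diff by auto

lemma S_mem: "v \<in> V \<Longrightarrow> S z v \<in> V"
  by (simp add: S_def T_mem mem_diff mem_scale)

lemma S_add: "u \<in> V \<Longrightarrow> v \<in> V \<Longrightarrow> S z (u + v) = S z u + S z v"
  and S_scale: "v \<in> V \<Longrightarrow> S z (sc c v) = sc c (S z v)"
  by (simp_all add: S_def T_add T_scale scale_right_distrib scale_right_diff_distrib mult.commute)

lemma S_0 [simp]: "S z 0 = 0"
  by (simp add: S_def)

lemma S_diff: "u \<in> V \<Longrightarrow> v \<in> V \<Longrightarrow> S z (u - v) = S z u - S z v"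
  using S_add[of "u - v" v z] mem_diff by auto

lemma N_0 [simp]: "N 0 = 0"
  using N_scale[of 0 0] by simp

lemma N_minus_commute: "u \<in> V \<Longrightarrow> v \<in> V \<Longrightarrow> N (u - v) = N (v - u)"
proof -
  assume "u \<in> V" "v \<in> V"
  then have "N (sc (- 1) (v - u)) = N (v - u)"
    by (subst N_scale) (auto simp: mem_diff)
  then show ?thesis by simp
qed

lemma N_diff: "u \<in> V \<Longrightarrow> v \<in> V \<Longrightarrow> N (u - v) \<le> N u + N v"
  using N_add[of u "0 - v"] N_minus_commute[of v 0] mem_diff[of 0 v] by simp

lemma N_triangle: "u \<in> V \<Longrightarrow> v \<in> V \<Longrightarrow> w \<in> V \<Longrightarrow> N (u - w) \<le> N (u - v) + N (v - w)"
  using N_add[of "u - v" "v - w"] mem_diff by simp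

lemma T_pow_mem: "v \<in> V \<Longrightarrow> (T ^^ n) v \<in> V"
  by (induction n) (auto simp: T_mem)

lemma T_pow_diff: "u \<in> V \<Longrightarrow> v \<in> V \<Longrightarrow> (T ^^ n) (u - v) = (T ^^ n) u - (T ^^ n) v"
  by (induction n) (auto simp: T_diff T_pow_mem)

lemma S_pow_mem: "v \<in> V \<Longrightarrow> (S z ^^ n) v \<in> V"
  by (induction n) (auto simp: S_mem)

lemma S_pow_add: "u \<in> V \<Longrightarrow> v \<in> V \<Longrightarrow> (S z ^^ n) (u + v) = (S z ^^ n) u + (S z ^^ n) v"
  by (induction n) (auto simp: S_add S_pow_mem)

lemma S_pow_scale: "v \<in> V \<Longrightarrow> (S z ^^ n) (sc c v) = sc c ((S z ^^ n) v)"
  by (induction n) (auto simp: S_scale S_pow_mem)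

lemma S_pow_0 [simp]: "(S z ^^ n) 0 = 0"
  by (induction n) auto

lemma S_bounded: obtains C where "C > 0" "\<And>v. v \<in> V \<Longrightarrow> N (S z v) \<le> C * N v"
proof -
  obtain C where C: "\<forall>v\<in>V. N (T v) \<le> C * N v" using T_bounded by blast
  show thesis
  proof (rule that[of "\<bar>C\<bar> + cmod z + 1"])
    fix v assume v: "v \<in> V"
    have "N (S z v) \<le> N (T v) + N (sc z v)"
      unfolding S_def by (intro N_diff T_mem mem_scale v)
    also have "\<dots> \<le> \<bar>C\<bar> * N v + cmod z * N v"
      using C v N_nonneg[OF v] by (smt (verit) N_scale mult_right_mono)
    also have "\<dots> \<le> (\<bar>C\<bar> + cmod z + 1) * N v"
      using N_nonneg[OF v] by (simp add: algebra_simps)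
    finally show "N (S z v) \<le> (\<bar>C\<bar> + cmod z + 1) * N v" .
  qed (simp add: add_nonneg_pos)
qed

text \<open>The difference of the \<open>n\<close>-th powers of \<open>T\<close> and of
  \<open>z\<close> is divisible by \<open>S z\<close>. The induction peels off one factor: the next
  difference is \<open>T\<close> applied to the present one, plus \<open>z ^ n\<close> times
  \<open>S z v\<close>.\<close>

lemma T_pow_S: "\<exists>C\<ge>0. \<forall>v\<in>V. N ((T ^^ n) v - sc (z ^ n) v) \<le> C * N (S z v)"
proof (induction n)
  case 0
  show ?case by (auto intro!: exI[of _ 0])
next
  case (Suc n)
  then obtain C where C: "C \<ge> 0" "\<forall>v\<in>V. N ((T ^^ n) v - sc (z ^ n) v) \<le> C * N (S z v)" by blast
  obtain C' where C': "\<forall>v\<in>V. N (T v) \<le> C' * N v" using T_bounded by blast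
  show ?case
  proof (intro exI[of _ "\<bar>C'\<bar> * C + cmod z ^ n"] conjI ballI)
    show "0 \<le> \<bar>C'\<bar> * C + cmod z ^ n" using C by simp
    fix v assume v: "v \<in> V"
    let ?u = "(T ^^ n) v - sc (z ^ n) v"
    have u: "?u \<in> V" by (intro mem_diff T_pow_mem mem_scale v)
    have "(T ^^ Suc n) v - sc (z ^ Suc n) v = T ?u + sc (z ^ n) (S z v)"
      by (simp add: S_def T_diff T_pow_mem mem_scale v T_scale scale_right_diff_distrib mult.commute)
    then have "N ((T ^^ Suc n) v - sc (z ^ Suc n) v) \<le> N (T ?u) + N (sc (z ^ n) (S z v))"
      using N_add[OF T_mem[OF u] mem_scale[OF S_mem[OF v]]] by simp
    also have "\<dots> \<le> \<bar>C'\<bar> * N ?u + cmod z ^ n * N (S z v)"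
      using C' u N_nonneg[OF u] N_scale[OF S_mem[OF v]]
      by (smt (verit) mult_right_mono norm_power)
    also have "\<dots> \<le> \<bar>C'\<bar> * (C * N (S z v)) + cmod z ^ n * N (S z v)"
      using C v by (intro add_mono mult_left_mono) auto
    finally show "N ((T ^^ Suc n) v - sc (z ^ Suc n) v) \<le> (\<bar>C'\<bar> * C + cmod z ^ n) * N (S z v)"
      by (simp add: algebra_simps)
  qed
qed

text \<open>Up to a multiple of \<open>N (S z v)\<close>, the vector \<open>(T ^^ n) v\<close> is
  \<open>z ^ n\<close> times \<open>v\<close>. In the Lasota--Yorke inequality at
  \<open>t = cmod z\<close> the strong term is only an eighth of \<open>cmod z ^ n * N v\<close>, so
  it can be absorbed on the left. Together with the finite weak covers this does the work of
  compactness of \<open>T\<close> in classical Riesz theory.\<close>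

lemma a_priori:
  assumes "\<theta> < cmod z"
  obtains C where "C > 0" "\<And>v. v \<in> V \<Longrightarrow> N v \<le> C * (W v + N (S z v))"
proof -
  obtain n C where C: "0 \<le> C" "\<forall>v\<in>V. N ((T ^^ n) v) \<le> cmod z ^ n / 8 * N v + C * W v"
    using lasota_yorke[OF assms] by blast
  obtain C' where C': "C' \<ge> 0" "\<forall>v\<in>V. N ((T ^^ n) v - sc (z ^ n) v) \<le> C' * N (S z v)"
    using T_pow_S by blast
  define r where "r = cmod z ^ n"
  have r: "r > 0" using assms \<theta>_nonneg unfolding r_def by (intro zero_less_power) linarith
  show thesis
  proof (rule that[of "2 * (C + C' + 1) / r"])
    fix v assume v: "v \<in> V"
    have "r * N v = N (sc (z ^ n) v)"
      by (simp add: N_scale v r_def norm_power)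
    also have "\<dots> \<le> N ((T ^^ n) v) + N ((T ^^ n) v - sc (z ^ n) v)"
      using N_diff[of "(T ^^ n) v" "(T ^^ n) v - sc (z ^ n) v"] by (simp add: mem_diff T_pow_mem mem_scale v)
    also have "\<dots> \<le> (r / 8 * N v + C * W v) + C' * N (S z v)"
      using C(2) C'(2) v by (simp add: r_def add_mono)
    finally have "r * N v \<le> r / 8 * N v + C * W v + C' * N (S z v)" .
    moreover have "C * W v + C' * N (S z v) \<le> (C + C' + 1) * (W v + N (S z v))"
      using C(1) C'(1) W_nonneg[OF v] N_nonneg[OF S_mem[OF v, of z]] by (simp add: algebra_simps)
    moreover have "r * N v \<ge> 0" using r N_nonneg[OF v] by simp
    ultimately have "r * N v \<le> 2 * ((C + C' + 1) * (W v + N (S z v)))" by simp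
    then show "N v \<le> 2 * (C + C' + 1) / r * (W v + N (S z v))"
      using r by (simp add: field_simps)
  qed (use C(1) C'(1) r in auto)
qed

text \<open>The ambient type carries no topology and \<open>N\<close> is meaningful on
  \<open>V\<close> only, hence sequential closedness with limits taken in \<open>V\<close>.\<close>

definition norm_closed :: "'v set \<Rightarrow> bool" where
  "norm_closed Y \<longleftrightarrow> (\<forall>f l. (\<forall>n::nat. f n \<in> Y) \<longrightarrow> l \<in> V \<longrightarrow> (\<lambda>n. N (f n - l)) \<longlonglongrightarrow> 0 \<longrightarrow> l \<in> Y)"

lemma norm_closedD:
  "norm_closed Y \<Longrightarrow> (\<And>n::nat. f n \<in> Y) \<Longrightarrow> l \<in> V \<Longrightarrow> (\<lambda>n. N (f n - l)) \<longlonglongrightarrow> 0 \<Longrightarrow> l \<in> Y"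
  unfolding norm_closed_def by blast

section \<open>Limits and compactness along sequences in the carrier\<close>

lemma lim_unique:
  assumes "\<And>n::nat. f n \<in> V" "l \<in> V" "m \<in> V" "(\<lambda>n. N (f n - l)) \<longlonglongrightarrow> 0" "(\<lambda>n. N (f n - m)) \<longlonglongrightarrow> 0"
  shows "l = m"
proof -
  have "(\<lambda>n. N (f n - l) + N (f n - m)) \<longlonglongrightarrow> 0"
    using tendsto_add[OF assms(4,5)] by simp
  moreover have "N (l - m) \<le> N (f n - l) + N (f n - m)" for n
    using N_triangle[of l "f n" m] N_minus_commute assms by simp
  ultimately have "N (l - m) \<le> 0"
    by (intro LIMSEQ_le_const[of "\<lambda>n. N (f n - l) + N (f n - m)" 0 "N (l - m)"]) auto
  then have "N (l - m) = 0" using N_nonneg[of "l - m"] assms mem_diff by force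
  then have "l - m = 0" using N_zero assms mem_diff by blast
  then show ?thesis by simp
qed

lemma tendsto_S:
  assumes "\<And>n::nat. f n \<in> V" "l \<in> V" "(\<lambda>n. N (f n - l)) \<longlonglongrightarrow> 0"
  shows "(\<lambda>n. N (S z (f n) - S z l)) \<longlonglongrightarrow> 0"
proof -
  obtain C where C: "C > 0" "\<And>v. v \<in> V \<Longrightarrow> N (S z v) \<le> C * N v" using S_bounded by blast
  have "(\<lambda>n. C * N (f n - l)) \<longlonglongrightarrow> 0" using tendsto_mult_left[OF assms(3), of C] by simp
  then show ?thesis
    by (rule tendsto_sandwich[OF _ _ tendsto_const, rotated 2])
       (use C(2) assms S_mem mem_diff N_nonneg in \<open>auto simp flip: S_diff\<close>)
qed

text \<open>The default \<open>0\<close> off the carrier keeps the distance nonnegative and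
  symmetric for all arguments, which \<open>Metric_space\<close> demands beyond its carrier.\<close>

abbreviation V_dist :: "'v \<Rightarrow> 'v \<Rightarrow> real" where
  "V_dist u v \<equiv> if u \<in> V \<and> v \<in> V then N (u - v) else 0"

lemma metric: "Metric_space V V_dist"
proof
  show "V_dist x y = 0 \<longleftrightarrow> x = y" if "x \<in> V" "y \<in> V" for x y
    using that N_zero[of "x - y"] mem_diff by auto
qed (use N_nonneg N_minus_commute N_triangle mem_diff in \<open>auto split: if_splits\<close>)

text \<open>By the a priori estimate, a finite cover by weakly small sets yields a finite cover by small
  sets along any sequence whose images under \<open>S z\<close> form a Cauchy sequence.\<close>

lemma convergent_subsequence:
  assumes z: "\<theta> < cmod z" and f: "\<And>n::nat. f n \<in> V" and bd: "\<And>n. N (f n) \<le> 1"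
    and l: "l \<in> V" "(\<lambda>n. N (S z (f n) - l)) \<longlonglongrightarrow> 0"
  obtains r :: "nat \<Rightarrow> nat" and m where "strict_mono r" "m \<in> V" "(\<lambda>n. N (f (r n) - m)) \<longlonglongrightarrow> 0"
proof -
  interpret M: Metric_space V V_dist by (rule metric)
  obtain C where C: "C > 0" "\<And>v. v \<in> V \<Longrightarrow> N v \<le> C * (W v + N (S z v))" using a_priori[OF z] by blast
  have "M.mtotally_bounded (range f)"
    unfolding M.mtotally_bounded_def
  proof (intro allI impI)
    fix e :: real assume e: "e > 0"
    \<comment> \<open>Three errors of size \<open>d\<close> will add up, one weak distance and two
      distances of images to \<open>l\<close>; after the factor \<open>C\<close> this makes
      \<open>3 * e / 4\<close>.\<close>
    define d where "d = e / (4 * C)"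
    have d: "d > 0" using e C by (simp add: d_def)
    obtain n0 where n0: "\<And>n. n \<ge> n0 \<Longrightarrow> \<bar>N (S z (f n) - l)\<bar> < d"
      using LIMSEQ_D[OF l(2) d] by auto
    obtain \<C> where \<C>: "finite \<C>" "{v \<in> V. N v \<le> 1} \<subseteq> \<Union>\<C>" "\<And>A u v. A \<in> \<C> \<Longrightarrow> u \<in> A \<Longrightarrow> v \<in> A \<Longrightarrow> W (u - v) < d"
      using weakly_totally_bounded[OF d] by metis
    define J where "J = {A \<in> \<C>. \<exists>n\<ge>n0. f n \<in> A}"
    have "\<forall>A\<in>J. \<exists>n\<ge>n0. f n \<in> A" by (auto simp: J_def)
    then obtain c where c: "\<And>A. A \<in> J \<Longrightarrow> c A \<ge> n0 \<and> f (c A) \<in> A" by metis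
    \<comment> \<open>The uncontrolled early terms enter the net themselves; each class that is met
      after \<open>n0\<close> contributes one late representative.\<close>
    define K where "K = f ` ({..<n0} \<union> c ` J)"
    have "finite K" using \<C>(1) by (simp add: K_def J_def)
    moreover have "K \<subseteq> range f" by (auto simp: K_def)
    moreover have "range f \<subseteq> (\<Union>x\<in>K. M.mball x e)"
    proof clarify
      fix n
      show "f n \<in> (\<Union>x\<in>K. M.mball x e)"
      proof (cases "n < n0")
        case True
        then have "f n \<in> K" by (auto simp: K_def)
        then show ?thesis using e f by (intro UN_I[of "f n"]) auto
      next
        case False
        obtain A where A: "A \<in> \<C>" "f n \<in> A" using \<C>(2) f bd by blast
        then have AJ: "A \<in> J" using False by (auto simp: J_def not_less)
        let ?m = "c A"
        have m: "?m \<ge> n0" "f ?m \<in> A" using c AJ by auto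
        have "N (S z (f ?m - f n)) \<le> N (S z (f ?m) - l) + N (l - S z (f n))"
          using N_triangle S_mem f l by (simp add: S_diff)
        also have "\<dots> < 2 * d"
          using n0[of n] n0[of ?m] False m N_minus_commute[OF l(1) S_mem[OF f[of n]]] by simp
        finally have "N (f ?m - f n) < C * (d + 2 * d)"
          using C(2)[of "f ?m - f n"] \<C>(3)[OF A(1) m(2) A(2)] C(1) f mem_diff
          by (smt (verit, best) mult_strict_left_mono)
        also have "\<dots> < e" using e C by (simp add: d_def)
        finally have "f n \<in> M.mball (f ?m) e" using f by simp
        moreover have "f ?m \<in> K" using AJ by (auto simp: K_def)
        ultimately show ?thesis by blast
      qed
    qed
    ultimately show "\<exists>K. finite K \<and> K \<subseteq> range f \<and> range f \<subseteq> (\<Union>x\<in>K. M.mball x e)" by blast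
  qed
  then obtain r :: "nat \<Rightarrow> nat" where r: "strict_mono r" "M.MCauchy (f \<circ> r)"
    using M.mtotally_bounded_sequentially by blast
  then have "\<exists>m\<in>V. (\<lambda>n. N ((f \<circ> r) n - m)) \<longlonglongrightarrow> 0"
    by (intro complete) (use f in \<open>simp_all add: M.MCauchy_def\<close>)
  then show thesis using that r(1) by auto
qed

text \<open>Riesz's lemma. A nearest point of \<open>Y\<close> need not exist, so \<open>y\<close>
  is only taken within twice the distance from \<open>v\<close>, whence the constant 1/2 after
  normalization. The explicit form of \<open>u\<close> is exported because
  \<open>image_estimate\<close> has to compute \<open>S z u\<close> and
  \<open>norm_closed_span_insert\<close> has to express \<open>v\<close> through
  \<open>u\<close>.\<close>

lemma riesz:
  assumes Y: "subspace Y" "norm_closed Y" "Y \<subseteq> V" and Z: "subspace Z" "Y \<subseteq> Z" "Z \<subseteq> V" and v: "v \<in> Z" "v \<notin> Y"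
  obtains u y c where "u \<in> Z" "N u = 1" "\<And>y. y \<in> Y \<Longrightarrow> 1 / 2 \<le> N (u - y)"
    "y \<in> Y" "c > 0" "u = sc (of_real c) (v - y)"
proof -
  define d where "d = (INF y\<in>Y. N (v - y))"
  have vV: "v \<in> V" and Y0: "0 \<in> Y" using v Z Y by (auto simp: subspace_0)
  have bdd: "bdd_below ((\<lambda>y. N (v - y)) ` Y)"
    using N_nonneg mem_diff vV Y(3) by (intro bdd_belowI2[of _ 0]) blast
  have d_le: "d \<le> N (v - y)" if "y \<in> Y" for y
    unfolding d_def using bdd that by (rule cINF_lower)
  have "d \<ge> 0" unfolding d_def using Y0 N_nonneg mem_diff vV Y(3) by (intro cINF_greatest) auto
  moreover have "d \<noteq> 0"
  proof
    assume "d = 0"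
    have "\<exists>y\<in>Y. N (v - y) < 1 / real (Suc n)" for n
      using cINF_less_iff[OF _ bdd, of "1 / real (Suc n)"] Y0 \<open>d = 0\<close> by (auto simp: d_def)
    then obtain f where f: "\<And>n. f n \<in> Y" "\<And>n. N (v - f n) < 1 / real (Suc n)" by metis
    have "(\<lambda>n. N (f n - v)) \<longlonglongrightarrow> 0"
    proof (rule tendsto_sandwich[OF _ _ tendsto_const LIMSEQ_inverse_real_of_nat])
      show "\<forall>\<^sub>F n in sequentially. 0 \<le> N (f n - v)"
        by (rule always_eventually) (use f(1) Y(3) vV N_nonneg mem_diff in blast)
      show "\<forall>\<^sub>F n in sequentially. N (f n - v) \<le> inverse (real (Suc n))"
      proof (intro always_eventually allI)
        fix n
        have "f n \<in> V" using f(1) Y(3) by blast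
        then show "N (f n - v) \<le> inverse (real (Suc n))"
          using f(2)[of n] vV N_minus_commute[of v "f n"] by (simp add: inverse_eq_divide)
      qed
    qed
    then show False using norm_closedD[of Y f v] Y(2) f(1) vV v by blast
  qed
  ultimately have d: "d > 0" by simp
  obtain y where y: "y \<in> Y" "N (v - y) < 2 * d"
    using cINF_less_iff[OF _ bdd, of "2 * d"] Y0 d by (auto simp: d_def)
  let ?c = "1 / N (v - y)"
  have pos: "N (v - y) > 0" using d d_le[OF y(1)] by simp
  have dist: "1 / 2 \<le> ?c * N (v - w)" if "w \<in> Y" for w
    using d_le[OF that] y(2) pos by (simp add: field_simps)
  have vy: "v - y \<in> V" "v - y \<in> Z" using vV y v Y Z mem_diff by (auto simp: subspace_diff subset_iff)
  define u where "u = sc (of_real ?c) (v - y)"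
  show thesis
  proof (rule that[of u y ?c])
    show "u \<in> Z" unfolding u_def using vy Z by (simp add: subspace_scale)
    have cn: "cmod (complex_of_real ?c) = ?c" using pos by (metis norm_of_real abs_of_pos divide_pos_pos zero_less_one)
    show "N u = 1" unfolding u_def N_scale[OF vy(1)] cn using pos by simp
    fix w assume w: "w \<in> Y"
    have "u - w = sc (of_real ?c) (v - (y + sc (of_real (N (v - y))) w))"
      using pos by (simp add: u_def scale_right_diff_distrib scale_right_distrib)
    moreover have w': "y + sc (of_real (N (v - y))) w \<in> Y"
      using Y(1) y(1) w by (simp add: subspace_add subspace_scale)
    ultimately have "N (u - w) = ?c * N (v - (y + sc (of_real (N (v - y))) w))"
      using N_scale[of "v - (y + sc (of_real (N (v - y))) w)" "of_real ?c"] cn mem_diff[OF vV] Y(3)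
      by (metis subsetD)
    then show "1 / 2 \<le> N (u - w)" using dist[OF w'] by simp
  qed (use y pos u_def in auto)
qed

text \<open>Pigeonhole: two of the vectors fall into the same weakly small set. Their difference has
  strong norm at most 2 and small \<open>W\<close>, so the Lasota--Yorke inequality puts their
  \<open>n\<close>-th images closer together than \<open>cmod z ^ n / 2\<close>. The separation is
  required for every \<open>n\<close> because the relevant exponent is dictated by that
  inequality.\<close>

lemma no_separated_sequence:
  assumes z: "\<theta> < cmod z" and f: "\<And>k::nat. f k \<in> V" "\<And>k. N (f k) \<le> 1"
    and sep: "\<And>n j k. j < k \<Longrightarrow> cmod z ^ n / 2 \<le> N ((T ^^ n) (f j) - (T ^^ n) (f k))"
  shows False
proof -
  obtain n C where C: "0 \<le> C" "\<forall>v\<in>V. N ((T ^^ n) v) \<le> cmod z ^ n / 8 * N v + C * W v"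
    using lasota_yorke[OF z] by blast
  define r where "r = cmod z ^ n"
  have r: "r > 0" using z \<theta>_nonneg unfolding r_def by (intro zero_less_power) linarith
  \<comment> \<open>Chosen to make \<open>C * e\<close> at most \<open>r / 8\<close>; the summand 1
    covers the case \<open>C = 0\<close>.\<close>
  define e where "e = r / (8 * (C + 1))"
  have e: "e > 0" "C * e \<le> r / 8" using r C(1) by (auto simp: e_def field_simps)
  obtain \<C> where \<C>: "finite \<C>" "{v \<in> V. N v \<le> 1} \<subseteq> \<Union>\<C>" "\<And>A u v. A \<in> \<C> \<Longrightarrow> u \<in> A \<Longrightarrow> v \<in> A \<Longrightarrow> W (u - v) < e"
    using weakly_totally_bounded[OF e(1)] by metis
  have "\<forall>k. \<exists>A\<in>\<C>. f k \<in> A" using \<C>(2) f by blast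
  then obtain c where c: "\<And>k. c k \<in> \<C>" "\<And>k. f k \<in> c k" by metis
  have "\<not> inj c" using \<C>(1) c(1) by (meson finite_subset image_subsetI infinite_UNIV_nat finite_imageD)
  then obtain j k where jk: "j < k" "c j = c k" by (metis injI linorder_neqE_nat)
  have u: "f j - f k \<in> V" using f mem_diff by simp
  have "N (f j - f k) \<le> 2" using N_diff[OF f(1) f(1), of j k] f(2)[of j] f(2)[of k] by simp
  moreover have "W (f j - f k) \<le> e" using \<C>(3)[OF c(1)[of j] c(2), of "f k"] c(2)[of k] jk by simp
  ultimately have "r / 8 * N (f j - f k) + C * W (f j - f k) \<le> r / 8 * 2 + C * e"
    using C(1) r by (intro add_mono mult_left_mono) auto
  moreover have "N ((T ^^ n) (f j - f k)) \<le> r / 8 * N (f j - f k) + C * W (f j - f k)"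
    using C(2) u by (simp add: r_def)
  ultimately have "N ((T ^^ n) (f j - f k)) \<le> r / 8 * 2 + C * e" by linarith
  then show False using sep[OF jk(1), of n] e r f by (simp add: r_def T_pow_diff)
qed

text \<open>\<open>S z\<close> is bounded below on \<open>Y\<close> modulo its kernel there.
  Otherwise Riesz's lemma, applied relative to the kernel \<open>K\<close>, yields unit vectors at
  distance at least 1/2 from \<open>K\<close> whose images under \<open>S z\<close> tend to 0. A
  subsequence converges by \<open>convergent_subsequence\<close>, and its limit lies in
  \<open>K\<close>, which is absurd.\<close>

lemma image_estimate:
  assumes z: "\<theta> < cmod z" and Y: "subspace Y" "norm_closed Y" "Y \<subseteq> V"
  obtains C where "C > 0" "\<And>v. v \<in> Y \<Longrightarrow> \<exists>k\<in>Y. S z k = 0 \<and> N (v - k) \<le> C * N (S z v)"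
proof (rule ccontr)
  assume nt: "\<not> thesis"
  define K where "K = {k \<in> Y. S z k = 0}"
  have K_V: "K \<subseteq> V" and K_Y: "K \<subseteq> Y" using Y by (auto simp: K_def)
  have K: "subspace K"
    using Y by (auto simp: K_def subspace_def S_add S_scale subset_iff)
  have K_closed: "norm_closed K"
    unfolding norm_closed_def
  proof (intro allI impI)
    fix f l assume f: "\<forall>n::nat. f n \<in> K" and l: "l \<in> V" and lim: "(\<lambda>n. N (f n - l)) \<longlonglongrightarrow> 0"
    have fV: "f n \<in> V" for n using f K_V by blast
    have "l \<in> Y" using norm_closedD[OF Y(2) _ l lim] f by (simp add: K_def)
    moreover have "S z l = 0"
    proof (rule lim_unique)
      show "(\<lambda>n. N (S z (f n) - S z l)) \<longlonglongrightarrow> 0" by (rule tendsto_S[OF fV l lim])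
      show "(\<lambda>n. N (S z (f n) - 0)) \<longlonglongrightarrow> 0" using f by (simp add: K_def)
    qed (use fV S_mem l in auto)
    ultimately show "l \<in> K" by (simp add: K_def)
  qed
  have "\<exists>v\<in>Y. \<forall>k\<in>K. N (v - k) > real (Suc n) * N (S z v)" for n
    using that[of "real (Suc n)"] nt by (force simp: K_def not_le)
  then obtain f where f: "\<And>n. f n \<in> Y" "\<And>n k. k \<in> K \<Longrightarrow> N (f n - k) > real (Suc n) * N (S z (f n))"
    by metis
  have fV: "f n \<in> V" for n using f(1) Y(3) by blast
  have fK: "f n \<notin> K" for n
  proof
    assume "f n \<in> K"
    then show False using f(2)[of "f n" n] N_nonneg[OF S_mem[OF fV[of n], of z]]
      by (simp add: K_def)
  qed
  have "\<exists>u. u \<in> Y \<and> N u = 1 \<and> (\<forall>k\<in>K. 1 / 2 \<le> N (u - k)) \<and> N (S z u) \<le> inverse (real (Suc n))" for n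
  proof -
    obtain u y c where u: "u \<in> Y" "N u = 1" "\<And>k. k \<in> K \<Longrightarrow> 1 / 2 \<le> N (u - k)"
        and y: "y \<in> K" "c > 0" "u = sc (of_real c) (f n - y)"
      using riesz[OF K K_closed K_V Y(1) _ Y(3) f(1) fK, of n] K_Y by blast
    have yV: "y \<in> V" and Sy: "S z y = 0" using y(1) K_V by (auto simp: K_def)
    \<comment> \<open>\<open>S z\<close> does not see the subtraction of the kernel element
      \<open>y\<close>, so both sides of the failed inequality scale by the same \<open>c\<close>
      and the failure survives normalization.\<close>
    have "N u = c * N (f n - y)" using y N_scale mem_diff[OF fV yV] by simp
    moreover have "N (S z u) = c * N (S z (f n))"
      using y N_scale S_scale S_mem mem_diff[OF fV yV] S_diff[OF fV yV] fV Sy by simp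
    moreover have "c * (real (Suc n) * N (S z (f n))) < c * N (f n - y)"
      using f(2)[OF y(1), of n] y(2) by (intro mult_strict_left_mono)
    ultimately have "N (S z u) * real (Suc n) \<le> 1" using u(2) by (simp add: algebra_simps)
    then have "N (S z u) \<le> inverse (real (Suc n))" by (simp add: field_simps)
    then show ?thesis using u by blast
  qed
  then obtain u where u: "\<And>n. u n \<in> Y" "\<And>n. N (u n) = 1" "\<And>n k. k \<in> K \<Longrightarrow> 1 / 2 \<le> N (u n - k)"
      "\<And>n. N (S z (u n)) \<le> inverse (real (Suc n))" by metis
  have uV: "u n \<in> V" for n using u(1) Y(3) by blast
  have Su: "(\<lambda>n. N (S z (u n) - 0)) \<longlonglongrightarrow> 0"
    by (rule tendsto_sandwich[OF _ _ tendsto_const LIMSEQ_inverse_real_of_nat])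
       (use u(4) N_nonneg[OF S_mem[OF uV]] in auto)
  obtain r :: "nat \<Rightarrow> nat" and m where r: "strict_mono r" "m \<in> V" "(\<lambda>n. N (u (r n) - m)) \<longlonglongrightarrow> 0"
    using convergent_subsequence[OF z uV _ mem0 Su] u(2) by auto
  have "m \<in> Y" using norm_closedD[OF Y(2) _ r(2,3)] u(1) by blast
  moreover have "S z m = 0"
  proof (rule lim_unique)
    show "(\<lambda>n. N (S z (u (r n)) - S z m)) \<longlonglongrightarrow> 0" by (rule tendsto_S[OF uV r(2,3)])
    show "(\<lambda>n. N (S z (u (r n)) - 0)) \<longlonglongrightarrow> 0"
      using LIMSEQ_subseq_LIMSEQ[OF Su r(1)] by (simp add: o_def)
  qed (use uV S_mem r(2) in auto)
  ultimately have "m \<in> K" by (simp add: K_def)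
  then have "1 / 2 \<le> N (u (r n) - m)" for n using u(3) by blast
  then have "1 / 2 \<le> (0::real)" using LIMSEQ_le_const[OF r(3)] by blast
  then show False by simp
qed

section \<open>Closedness of ranges\<close>

lemma subspace_image_S:
  assumes "subspace Y" "Y \<subseteq> V"
  shows "subspace (S z ` Y)" "S z ` Y \<subseteq> V"
proof -
  show "S z ` Y \<subseteq> V" using S_mem assms by blast
  have Y: "0 \<in> Y" "\<And>u v. u \<in> Y \<Longrightarrow> v \<in> Y \<Longrightarrow> u + v \<in> Y" "\<And>c v. v \<in> Y \<Longrightarrow> sc c v \<in> Y"
    using assms by (auto simp: subspace_def)
  show "subspace (S z ` Y)"
    unfolding subspace_def
  proof (intro conjI ballI allI)
    show "0 \<in> S z ` Y" using Y(1) by (intro image_eqI[of 0 "S z" 0]) auto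
    fix x assume "x \<in> S z ` Y"
    then obtain u where u: "u \<in> Y" "x = S z u" by blast
    show "sc c x \<in> S z ` Y" for c
      using u Y(3)[of u c] assms by (intro image_eqI[of _ _ "sc c u"]) (auto simp: S_scale subset_iff)
    fix y assume "y \<in> S z ` Y"
    then obtain v where v: "v \<in> Y" "y = S z v" by blast
    show "x + y \<in> S z ` Y"
      using u v Y(2)[of u v] assms by (intro image_eqI[of _ _ "u + v"]) (auto simp: S_add subset_iff)
  qed
qed

text \<open>By \<open>image_estimate\<close> the preimages of a convergent sequence can be chosen
  bounded: a kernel element is subtracted from each. Scaled into the unit ball they have a
  convergent subsequence, whose limit is a preimage of the scaled limit.\<close>

lemma norm_closed_image:
  assumes z: "\<theta> < cmod z" and Y: "subspace Y" "norm_closed Y" "Y \<subseteq> V"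
  shows "norm_closed (S z ` Y)"
  unfolding norm_closed_def
proof (intro allI impI)
  fix g l assume g: "\<forall>n::nat. g n \<in> S z ` Y" and l: "l \<in> V" and lim: "(\<lambda>n. N (g n - l)) \<longlonglongrightarrow> 0"
  obtain C where C: "C > 0" "\<And>v. v \<in> Y \<Longrightarrow> \<exists>k\<in>Y. S z k = 0 \<and> N (v - k) \<le> C * N (S z v)"
    using image_estimate[OF z Y] by blast
  have gV: "g n \<in> V" for n using g subspace_image_S(2)[OF Y(1,3)] by blast
  have "\<exists>v\<in>Y. S z v = g n \<and> N v \<le> C * N (g n)" for n
  proof -
    obtain v where v: "v \<in> Y" "g n = S z v" using g by blast
    obtain k where k: "k \<in> Y" "S z k = 0" "N (v - k) \<le> C * N (S z v)" using C(2)[OF v(1)] by blast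
    show ?thesis
      using v k Y S_diff[of v k z] by (intro bexI[of _ "v - k"]) (auto simp: subspace_diff subset_iff)
  qed
  then obtain f where f: "\<And>n. f n \<in> Y" "\<And>n. S z (f n) = g n" "\<And>n. N (f n) \<le> C * N (g n)" by metis
  have fV: "f n \<in> V" for n using f(1) Y(3) by blast
  obtain B where B: "\<And>n. \<bar>N (g n - l)\<bar> \<le> B"
    using Bseq_iff convergent_imp_Bseq convergentI[OF lim] by (metis BseqD real_norm_def)
  \<comment> \<open>A common bound for the chosen preimages; the summand 1 makes it positive, so
    that division by \<open>M\<close> is possible.\<close>
  define M where "M = C * (\<bar>B\<bar> + N l) + 1"
  have M: "M > 0" using C(1) N_nonneg[OF l] by (simp add: M_def add_nonneg_pos)
  have fM: "N (f n) \<le> M" for n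
  proof -
    have "N (g n) \<le> \<bar>B\<bar> + N l" using N_add[of "g n - l" l] B[of n] gV l mem_diff by fastforce
    then have "C * N (g n) \<le> C * (\<bar>B\<bar> + N l)" using C(1) by (intro mult_left_mono) auto
    then show ?thesis using f(3)[of n] by (simp add: M_def)
  qed
  define c where "c = complex_of_real (1 / M)"
  have c: "cmod c = 1 / M" using M by (simp add: c_def norm_divide)
  have "(\<lambda>n. N (S z (sc c (f n)) - sc c l)) = (\<lambda>n. 1 / M * N (g n - l))"
    by (simp only: S_scale[OF fV] f(2) flip: scale_right_diff_distrib c N_scale[OF mem_diff[OF gV l]])
  then have lim': "(\<lambda>n. N (S z (sc c (f n)) - sc c l)) \<longlonglongrightarrow> 0"
    using tendsto_mult_left[OF lim, of "1 / M"] by simp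
  have bd: "N (sc c (f n)) \<le> 1" for n
    unfolding N_scale[OF fV] c using fM M by simp
  obtain r :: "nat \<Rightarrow> nat" and m where r: "strict_mono r" "m \<in> V" "(\<lambda>n. N (sc c (f (r n)) - m)) \<longlonglongrightarrow> 0"
    using convergent_subsequence[OF z mem_scale[OF fV] bd mem_scale[OF l] lim'] by blast
  have mY: "m \<in> Y" using norm_closedD[OF Y(2) _ r(2,3)] f(1) Y(1) by (simp add: subspace_scale)
  have "S z m = sc c l"
  proof (rule lim_unique)
    show "(\<lambda>n. N (S z (sc c (f (r n))) - S z m)) \<longlonglongrightarrow> 0" by (rule tendsto_S[OF mem_scale[OF fV] r(2,3)])
    show "(\<lambda>n. N (S z (sc c (f (r n))) - sc c l)) \<longlonglongrightarrow> 0"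
      using LIMSEQ_subseq_LIMSEQ[OF lim' r(1)] by (simp add: o_def)
  qed (use fV S_mem r(2) l mem_scale in auto)
  then have "S z (sc (inverse c) m) = sc (inverse c * c) l" using r(2) by (simp add: S_scale)
  moreover have "inverse c * c = 1" using c M by (metis left_inverse norm_zero divide_eq_0_iff less_numeral_extra(3) zero_neq_one)
  ultimately have "l = S z (sc (inverse c) m)" by simp
  moreover have "sc (inverse c) m \<in> Y" using mY Y(1) by (simp add: subspace_scale)
  ultimately show "l \<in> S z ` Y" by blast
qed

text \<open>The hypothesis on \<open>S z\<close> says that \<open>T\<close> acts as multiplication
  by \<open>z\<close> on the quotient of \<open>F'\<close> by \<open>F\<close>, and so its powers
  act as powers of \<open>z\<close>.\<close>

lemma T_pow_mod:
  assumes F: "subspace F" "F \<subseteq> F'" "F' \<subseteq> V" and SF: "S z ` F' \<subseteq> F" and v: "v \<in> F'"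
  shows "(T ^^ n) v - sc (z ^ n) v \<in> F"
proof (induction n)
  case 0
  show ?case using F by (simp add: subspace_0)
next
  case (Suc n)
  let ?u = "(T ^^ n) v - sc (z ^ n) v"
  have vV: "v \<in> V" using v F by blast
  have "T ?u = S z ?u + sc z ?u" by (simp add: S_def)
  moreover have "S z ?u \<in> F" using Suc F SF by blast
  ultimately have "T ?u \<in> F" using Suc F by (simp add: subspace_add subspace_scale)
  moreover have "sc (z ^ n) (S z v) \<in> F" using SF v F by (auto simp: subspace_scale)
  moreover have "(T ^^ Suc n) v - sc (z ^ Suc n) v = T ?u + sc (z ^ n) (S z v)"
    by (simp add: S_def T_diff T_pow_mem mem_scale vV T_scale scale_right_diff_distrib mult.commute)
  ultimately show ?case using F by (simp add: subspace_add)
qed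

text \<open>Modulo \<open>F\<close> the vector \<open>(T ^^ n) v\<close> equals \<open>z ^ n\<close>
  times \<open>v\<close>, while \<open>(T ^^ n) u\<close> stays in \<open>F\<close>. The distance
  1/2 of \<open>v\<close> from \<open>F\<close> is thereby multiplied by \<open>cmod z ^ n\<close>,
  for all \<open>n\<close> simultaneously.\<close>

lemma separated:
  assumes F: "subspace F" "F \<subseteq> F'" "F' \<subseteq> V" and SF: "S z ` F' \<subseteq> F" and v: "v \<in> F'" and u: "u \<in> F"
    and dist: "\<And>w. w \<in> F \<Longrightarrow> 1 / 2 \<le> N (v - w)" and z: "z \<noteq> 0"
  shows "cmod z ^ n / 2 \<le> N ((T ^^ n) v - (T ^^ n) u)"
proof -
  have vV: "v \<in> V" and uV: "u \<in> V" using v u F by auto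
  have "(T ^^ n) u - sc (z ^ n) u \<in> F" by (rule T_pow_mod[OF F SF]) (use u F in auto)
  then have "((T ^^ n) u - sc (z ^ n) u) + sc (z ^ n) u \<in> F"
    using u F(1) subspace_add subspace_scale by blast
  then have "(T ^^ n) u \<in> F" by simp
  then have "(T ^^ n) u - ((T ^^ n) v - sc (z ^ n) v) \<in> F"
    using T_pow_mod[OF F SF v] F(1) subspace_diff by blast
  then have w: "sc (inverse (z ^ n)) ((T ^^ n) u - ((T ^^ n) v - sc (z ^ n) v)) \<in> F" (is "?w \<in> F")
    using F(1) subspace_scale by blast
  have wV: "?w \<in> V" using w F by blast
  have "(T ^^ n) v - (T ^^ n) u = sc (z ^ n) (v - ?w)"
    using z by (simp add: scale_right_diff_distrib)
  then have "N ((T ^^ n) v - (T ^^ n) u) = cmod z ^ n * N (v - ?w)"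
    using N_scale[OF mem_diff[OF vV wV], of "z ^ n"] by (simp only: norm_power)
  moreover have "cmod z ^ n * (1 / 2) \<le> cmod z ^ n * N (v - ?w)"
    by (rule mult_left_mono[OF dist[OF w]]) simp
  ultimately show ?thesis by simp
qed

text \<open>Riesz's lemma picks a unit vector \<open>f k\<close> in \<open>F (Suc k)\<close> away
  from \<open>F k\<close>. For \<open>j < k\<close> the vector \<open>f j\<close> already lies in
  \<open>F k\<close>, so \<open>separated\<close> applies with \<open>f k\<close> as the far vector
  and the sequence contradicts \<open>no_separated_sequence\<close>.\<close>

lemma no_ascending_chain:
  assumes z: "\<theta> < cmod z" and F: "\<And>k::nat. subspace (F k)" "\<And>k. norm_closed (F k)" "\<And>k. F k \<subseteq> V"
    and chain: "\<And>k. F k \<subset> F (Suc k)" and SF: "\<And>k. S z ` F (Suc k) \<subseteq> F k"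
  shows False
proof -
  have "\<exists>f. f \<in> F (Suc k) \<and> N f = 1 \<and> (\<forall>w\<in>F k. 1 / 2 \<le> N (f - w))" for k
  proof -
    obtain v where "v \<in> F (Suc k)" "v \<notin> F k" using chain by blast
    then show ?thesis
      using riesz[of "F k" "F (Suc k)" v] F chain by (metis psubset_imp_subset)
  qed
  then obtain f where f: "\<And>k. f k \<in> F (Suc k)" "\<And>k. N (f k) = 1" "\<And>k w. w \<in> F k \<Longrightarrow> 1 / 2 \<le> N (f k - w)"
    by metis
  have mono: "F (Suc j) \<subseteq> F k" if "j < k" for j k
    by (rule lift_Suc_mono_le[of F, OF psubset_imp_subset[OF chain]]) (use that in simp)
  have z0: "z \<noteq> 0" using z \<theta>_nonneg by auto
  have fV: "f k \<in> V" for k using f(1) F(3) by blast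
  show False
  proof (rule no_separated_sequence[OF z, of f])
    fix n j k :: nat assume "j < k"
    have "cmod z ^ n / 2 \<le> N ((T ^^ n) (f k) - (T ^^ n) (f j))"
      by (rule separated[OF F(1) psubset_imp_subset[OF chain] F(3) SF f(1) subsetD[OF mono[OF \<open>j < k\<close>] f(1)] f(3) z0])
    then show "cmod z ^ n / 2 \<le> N ((T ^^ n) (f j) - (T ^^ n) (f k))"
      using N_minus_commute T_pow_mem fV by simp
  qed (use fV f(2) in auto)
qed

text \<open>The mirror image of the ascending case: for \<open>j < k\<close> the later vector
  \<open>f k\<close> lies in \<open>F (Suc j)\<close>, from which \<open>f j\<close> keeps its
  distance, so the earlier vector is now the far one.\<close>

lemma no_descending_chain:
  assumes z: "\<theta> < cmod z" and F: "\<And>k::nat. subspace (F k)" "\<And>k. norm_closed (F k)" "\<And>k. F k \<subseteq> V"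
    and chain: "\<And>k. F (Suc k) \<subset> F k" and SF: "\<And>k. S z ` F k \<subseteq> F (Suc k)"
  shows False
proof -
  have "\<exists>f. f \<in> F k \<and> N f = 1 \<and> (\<forall>w\<in>F (Suc k). 1 / 2 \<le> N (f - w))" for k
  proof -
    obtain v where "v \<in> F k" "v \<notin> F (Suc k)" using chain by blast
    then show ?thesis
      using riesz[of "F (Suc k)" "F k" v] F chain by (metis psubset_imp_subset)
  qed
  then obtain f where f: "\<And>k. f k \<in> F k" "\<And>k. N (f k) = 1" "\<And>k w. w \<in> F (Suc k) \<Longrightarrow> 1 / 2 \<le> N (f k - w)"
    by metis
  have mono: "F k \<subseteq> F (Suc j)" if "j < k" for j k
    by (rule lift_Suc_antimono_le[of F, OF psubset_imp_subset[OF chain]]) (use that in simp)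
  have z0: "z \<noteq> 0" using z \<theta>_nonneg by auto
  have fV: "f k \<in> V" for k using f(1) F(3) by blast
  show False
  proof (rule no_separated_sequence[OF z, of f])
    fix n j k :: nat assume "j < k"
    show "cmod z ^ n / 2 \<le> N ((T ^^ n) (f j) - (T ^^ n) (f k))"
      by (rule separated[OF F(1) psubset_imp_subset[OF chain] F(3) SF f(1) subsetD[OF mono[OF \<open>j < k\<close>] f(1)] f(3) z0])
  qed (use fV f(2) in auto)
qed

text \<open>A unit vector \<open>u\<close> at distance at least 1/2 from the old span makes the
  coefficient along \<open>u\<close> a bounded functional, by \<open>lower\<close>. The coefficients
  of a convergent sequence therefore form a Cauchy sequence in the complex numbers, and the
  remainders converge in the old span.\<close>

lemma norm_closed_span_insert:
  assumes B: "norm_closed (span B)" "B \<subseteq> V" and v: "v \<in> V"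
  shows "norm_closed (span (insert v B))"
proof (cases "v \<in> span B")
  case True
  then show ?thesis using B by (simp add: span_redundant)
next
  case False
  let ?Y = "span B"
  have Y: "subspace ?Y" "?Y \<subseteq> V" using B subspace_V by (auto simp: span_minimal)
  have Vs: "subspace V" by (rule subspace_V)
  obtain u y c where u: "N u = 1" "\<And>w. w \<in> ?Y \<Longrightarrow> 1 / 2 \<le> N (u - w)" "u \<in> V"
      and y: "y \<in> ?Y" "c > 0" "u = sc (of_real c) (v - y)"
    using riesz[OF Y(1) B(1) Y(2) Vs Y(2) _ v False] by (metis order_refl)
  have mem: "x \<in> span (insert v B) \<longleftrightarrow> (\<exists>a. x - sc a u \<in> ?Y)" for x
  proof -
    have c0: "complex_of_real c \<noteq> 0" using y by simp
    have "x - sc a u = (x - sc (a * of_real c) v) + sc (a * of_real c) y" for a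
      by (simp add: y scale_right_diff_distrib)
    note eq = this
    have "x - sc a u \<in> ?Y \<longleftrightarrow> x - sc (a * of_real c) v \<in> ?Y" for a
      by (subst eq) (rule span_add_eq2[OF span_scale[OF y(1)]])
    then show ?thesis unfolding span_breakdown_eq
      using c0 by (metis nonzero_divide_eq_eq)
  qed
  have lower: "cmod a / 2 \<le> N (sc a u + w)" if "w \<in> ?Y" for a w
  proof (cases "a = 0")
    case True
    then show ?thesis using that Y N_nonneg by auto
  next
    case False
    have w': "- sc (inverse a) w \<in> ?Y" using that by (simp add: span_scale span_neg)
    have "sc a u + w = sc a (u - (- sc (inverse a) w))"
      using False by (simp add: scale_right_distrib)
    then have "N (sc a u + w) = cmod a * N (u - (- sc (inverse a) w))"
      using N_scale[OF mem_diff[OF u(3), of "- sc (inverse a) w"]] w' Y by (metis subsetD)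
    moreover have "cmod a * (1 / 2) \<le> cmod a * N (u - (- sc (inverse a) w))"
      by (rule mult_left_mono[OF u(2)[OF w']]) simp
    ultimately show ?thesis by simp
  qed
  show ?thesis
    unfolding norm_closed_def
  proof (intro allI impI)
    fix g l assume g: "\<forall>n::nat. g n \<in> span (insert v B)" and l: "l \<in> V" and lim: "(\<lambda>n. N (g n - l)) \<longlonglongrightarrow> 0"
    obtain a where a: "\<And>n. g n - sc (a n) u \<in> ?Y" using g unfolding mem by metis
    have gV: "g n \<in> V" for n
      using a[of n] Y(2) mem_add[OF _ mem_scale[OF u(3)], of "g n - sc (a n) u" "a n"] by auto
    have bound: "cmod (a m - a n) \<le> 2 * (N (g m - l) + N (g n - l))" for m n
    proof -
      have "(g m - sc (a m) u) - (g n - sc (a n) u) \<in> ?Y" using a by (simp add: span_diff)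
      then have "cmod (a m - a n) / 2 \<le> N (sc (a m - a n) u + ((g m - sc (a m) u) - (g n - sc (a n) u)))"
        by (rule lower)
      also have "sc (a m - a n) u + ((g m - sc (a m) u) - (g n - sc (a n) u)) = g m - g n"
        by (simp add: scale_left_diff_distrib algebra_simps)
      also have "N (g m - g n) \<le> N (g m - l) + N (g n - l)"
        using N_triangle[OF gV l gV, of m n] N_minus_commute[OF gV l, of n] by simp
      finally show ?thesis by simp
    qed
    have "Cauchy a"
    proof (rule metric_CauchyI)
      fix e :: real assume "e > 0"
      then obtain M where M: "\<And>n. n \<ge> M \<Longrightarrow> \<bar>N (g n - l)\<bar> < e / 4"
        using LIMSEQ_D[OF lim, of "e / 4"] by auto
      show "\<exists>M. \<forall>m\<ge>M. \<forall>n\<ge>M. dist (a m) (a n) < e"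
      proof (intro exI[of _ M] allI impI)
        fix m n assume "m \<ge> M" "n \<ge> M"
        then show "dist (a m) (a n) < e"
          using M[of m] M[of n] bound[of m n] by (simp add: dist_norm)
      qed
    qed
    then obtain a' where a': "a \<longlonglongrightarrow> a'" using Cauchy_convergent convergent_def by blast
    have "l - sc a' u \<in> ?Y"
    proof (rule norm_closedD[OF B(1) a])
      show "l - sc a' u \<in> V" using l u mem_diff mem_scale by simp
      have up: "N (g n - sc (a n) u - (l - sc a' u)) \<le> N (g n - l) + cmod (a n - a')" for n
      proof -
        have eq: "g n - sc (a n) u - (l - sc a' u) = (g n - l) - sc (a n - a') u"
          by (simp add: scale_left_diff_distrib)
        show ?thesis
          unfolding eq using N_diff[OF mem_diff[OF gV l] mem_scale[OF u(3)], of n "a n - a'"]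
          unfolding N_scale[OF u(3)] u(1) by simp
      qed
      have lim': "(\<lambda>n. N (g n - l) + cmod (a n - a')) \<longlonglongrightarrow> 0"
        using tendsto_add[OF lim tendsto_norm_zero[OF LIM_zero[OF a']]] by simp
      have low: "0 \<le> N (g n - sc (a n) u - (l - sc a' u))" for n
        by (intro N_nonneg mem_diff mem_scale gV l u(3))
      show "(\<lambda>n. N (g n - sc (a n) u - (l - sc a' u))) \<longlonglongrightarrow> 0"
        by (rule tendsto_sandwich[OF always_eventually[OF allI[OF low]] always_eventually[OF allI[OF up]] tendsto_const lim'])
    qed
    then show "l \<in> span (insert v B)" using mem by blast
  qed
qed

lemma norm_closed_span:
  assumes "finite B" "B \<subseteq> V"
  shows "norm_closed (span B)"
  using assms
proof (induction B rule: finite_induct)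
  case empty
  have "l = 0" if "l \<in> V" "(\<lambda>n::nat. N (0 - l)) \<longlonglongrightarrow> 0" for l
    using that lim_unique[of "\<lambda>_. 0" l 0] by simp
  then show ?case by (auto simp: norm_closed_def)
qed (simp add: norm_closed_span_insert)

section \<open>Generalized eigenspaces and the splitting of the space\<close>

lemma norm_closed_range: "\<theta> < cmod z \<Longrightarrow> norm_closed ((S z ^^ n) ` V) \<and> subspace ((S z ^^ n) ` V)"
proof (induction n)
  case 0
  show ?case using subspace_V by (auto simp: norm_closed_def)
next
  case (Suc n)
  have *: "(S z ^^ Suc n) ` V = S z ` ((S z ^^ n) ` V)" by (auto simp: image_image)
  have V: "(S z ^^ n) ` V \<subseteq> V" using S_pow_mem by auto
  show ?case unfolding * using Suc norm_closed_image subspace_image_S(1) V by blast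
qed

abbreviation "G z \<equiv> gen_eigenspace sc V T z"

lemma S_eq: "(\<lambda>v. T v - sc z v) = S z"
  by (simp add: S_def fun_eq_iff)

lemma mem_G: "v \<in> G z \<longleftrightarrow> v \<in> V \<and> (\<exists>k. (S z ^^ k) v = 0)"
  by (simp add: gen_eigenspace_def S_eq)

lemma S_pow_zero_mono: "(S z ^^ k) v = 0 \<Longrightarrow> k \<le> n \<Longrightarrow> (S z ^^ n) v = 0"
  by (metis S_pow_0 comp_apply funpow_add le_add_diff_inverse2)

text \<open>If no finite set worked, finite subsets of the generalized eigenspace with
  \<open>S z\<close>-invariant span could be enlarged by one vector forever, with \<open>S z\<close>
  mapping each span into the preceding one. This is the ascending chain already excluded. Finitely
  many spanning vectors are then killed by one common power \<open>p\<close>.\<close>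

lemma gen_eigenspace_finite:
  assumes z: "\<theta> < cmod z"
  obtains B p where "finite B" "B \<subseteq> G z" "G z \<subseteq> span B" "\<And>v. v \<in> G z \<Longrightarrow> (S z ^^ p) v = 0"
proof -
  have GV: "G z \<subseteq> V" by (auto simp: mem_G)
  have SG: "S z v \<in> G z" if v: "v \<in> G z" for v
  proof -
    obtain k where "v \<in> V" "(S z ^^ k) v = 0" using v mem_G by blast
    then have "(S z ^^ k) (S z v) = 0" by (metis S_0 funpow_swap1)
    then show ?thesis using \<open>v \<in> V\<close> S_mem mem_G by blast
  qed
  define P where "P B \<longleftrightarrow> finite B \<and> B \<subseteq> G z \<and> S z ` span B \<subseteq> span B" for B
  have "\<exists>B. P B \<and> G z \<subseteq> span B"
  proof (rule ccontr)
    assume nt: "\<not> (\<exists>B. P B \<and> G z \<subseteq> span B)"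
    have step: "\<exists>B'. P B' \<and> span B \<subset> span B' \<and> S z ` span B' \<subseteq> span B" if B: "P B" for B
    proof -
      obtain v where v: "v \<in> G z" "v \<notin> span B" using nt B by blast
      then obtain k where k: "(S z ^^ k) v = 0" using mem_G by blast
      \<comment> \<open>The orbit of \<open>v\<close> under \<open>S z\<close> ends in 0, hence
        enters the span. The last iterate before it enters is a new vector \<open>w\<close> with
        \<open>S z w\<close> inside the old span.\<close>
      define j where "j = (LEAST j. (S z ^^ j) v \<in> span B)"
      have j: "(S z ^^ j) v \<in> span B" unfolding j_def by (rule LeastI[of _ k]) (simp add: k span_zero)
      then obtain i where i: "j = Suc i" using v by (cases j) auto
      define w where "w = (S z ^^ i) v"
      have w: "w \<notin> span B" using not_less_Least[of i "\<lambda>j. (S z ^^ j) v \<in> span B"] i by (simp add: j_def w_def)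
      have Sw: "S z w \<in> span B" using j i by (simp add: w_def)
      have wG: "w \<in> G z" unfolding w_def by (induction i) (auto simp: v SG)
      have BV: "span B \<subseteq> V" using B GV by (intro span_minimal subspace_V) (auto simp: P_def)
      have sub: "S z ` span (insert w B) \<subseteq> span B"
      proof
        fix x assume "x \<in> S z ` span (insert w B)"
        then obtain y where "x = S z y" "y \<in> span (insert w B)" by blast
        then obtain a where y: "x = S z y" "y - sc a w \<in> span B" unfolding span_breakdown_eq by blast
        have wV: "w \<in> V" "y - sc a w \<in> V" using wG GV y BV by auto
        have "S z y = S z (y - sc a w) + sc a (S z w)"
          using S_add[OF wV(2) mem_scale[OF wV(1)], of z a] S_scale[OF wV(1)] by simp
        moreover have "S z (y - sc a w) \<in> span B" using B y by (auto simp: P_def)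
        ultimately show "x \<in> span B" using Sw y by (simp add: span_add span_scale)
      qed
      have mono: "span B \<subseteq> span (insert w B)" by (simp add: span_mono subset_insertI)
      moreover have "w \<in> span (insert w B)" by (simp add: span_base)
      ultimately show ?thesis
        using w sub B wG by (intro exI[of _ "insert w B"]) (auto simp: P_def)
    qed
    have "P {}" by (simp add: P_def)
    then obtain B where B: "\<And>n. P (B n)" "\<And>n. span (B n) \<subset> span (B (Suc n)) \<and> S z ` span (B (Suc n)) \<subseteq> span (B n)"
      using dependent_nat_choice[of "\<lambda>_. P" "\<lambda>_ B B'. span B \<subset> span B' \<and> S z ` span B' \<subseteq> span B"] step by metis
    have BV: "finite (B n)" "B n \<subseteq> V" for n using B(1)[of n] GV by (auto simp: P_def)
    have BS: "span (B n) \<subseteq> V" for n by (intro span_minimal subspace_V BV)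
    show False
      by (rule no_ascending_chain[where F = "\<lambda>n. span (B n)", OF z subspace_span norm_closed_span[OF BV] BS conjunct1[OF B(2)] conjunct2[OF B(2)]])
  qed
  then obtain B where B: "finite B" "B \<subseteq> G z" "G z \<subseteq> span B" by (auto simp: P_def)
  have "\<forall>b\<in>B. \<exists>k. (S z ^^ k) b = 0" using B mem_G by blast
  then obtain k where k: "\<And>b. b \<in> B \<Longrightarrow> (S z ^^ k b) b = 0" by metis
  define p where "p = Max (insert 0 (k ` B))"
  have p: "(S z ^^ p) b = 0" if "b \<in> B" for b
    by (rule S_pow_zero_mono[OF k[OF that]]) (use that B in \<open>auto simp: p_def\<close>)
  have BV: "B \<subseteq> V" using B GV by blast
  have "subspace {v \<in> V. (S z ^^ p) v = 0}"
    by (auto simp: subspace_def S_pow_add S_pow_scale mem_add mem_scale)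
  then have "span B \<subseteq> {v \<in> V. (S z ^^ p) v = 0}"
    using p BV by (intro span_minimal) auto
  then show thesis using that[of B p] B by blast
qed

text \<open>The complement is \<open>R\<close>, the range of the power \<open>p\<close> of
  \<open>S z\<close> that kills the generalized eigenspace. No power of \<open>S z\<close> kills a
  nonzero element of \<open>R\<close>, and stabilization of the ranges makes \<open>S z\<close>
  surjective on \<open>R\<close>. Lifting \<open>(S z ^^ p) v\<close> to \<open>R\<close> then
  splits off the component of \<open>v\<close> in the generalized eigenspace. The lower bound comes
  from \<open>image_estimate\<close>, as the kernel in \<open>R\<close> is trivial.\<close>

lemma riesz_decomposition:
  assumes z: "\<theta> < cmod z"
  obtains B p R C where "finite B" "G z \<subseteq> span B" "\<And>v. v \<in> G z \<Longrightarrow> (S z ^^ p) v = 0"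
    "subspace R" "R \<subseteq> V" "S z ` R \<subseteq> R" "bij_betw (S z) R R" "G z \<inter> R = {0}"
    "\<And>v. v \<in> V \<Longrightarrow> \<exists>u\<in>G z. \<exists>w\<in>R. v = u + w" "C > 0" "\<And>v. v \<in> R \<Longrightarrow> N v \<le> C * N (S z v)"
proof -
  obtain B p where B: "finite B" "B \<subseteq> G z" "G z \<subseteq> span B" and p: "\<And>v. v \<in> G z \<Longrightarrow> (S z ^^ p) v = 0"
    using gen_eigenspace_finite[OF z] by blast
  define R where "R = (S z ^^ p) ` V"
  have R: "subspace R" "norm_closed R" using norm_closed_range[OF z] by (auto simp: R_def)
  have RV: "R \<subseteq> V" using S_pow_mem by (auto simp: R_def)
  have SR: "S z ` R \<subseteq> R"
  proof
    fix x assume "x \<in> S z ` R"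
    then obtain v where "v \<in> V" "x = S z ((S z ^^ p) v)" by (auto simp: R_def)
    then have "x = (S z ^^ p) (S z v)" "S z v \<in> V" by (simp_all add: funpow_swap1 S_mem)
    then show "x \<in> R" unfolding R_def by blast
  qed
  \<comment> \<open>A preimage of \<open>x\<close> under the \<open>p\<close>-th power is a
    generalized eigenvector, and these are all killed by the exponent \<open>p\<close>
    already.\<close>
  have disj: "x = 0" if x: "x \<in> R" "(S z ^^ k) x = 0" for x k
  proof -
    obtain v where v: "v \<in> V" "x = (S z ^^ p) v" using x by (auto simp: R_def)
    then have "(S z ^^ (k + p)) v = 0" using x by (simp add: funpow_add)
    then show "x = 0" using v p mem_G by blast
  qed
  have pow_R: "(S z ^^ k) x \<in> R" if "x \<in> R" for x k
    using that SR by (induction k) auto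
  define F where "F j = (S z ^^ (p + j)) ` V" for j
  have F: "norm_closed (F j) \<and> subspace (F j)" for j
    unfolding F_def by (rule norm_closed_range[OF z])
  have FV: "F j \<subseteq> V" for j using S_pow_mem by (auto simp: F_def)
  have SF: "S z ` F k \<subseteq> F (Suc k)" for k by (auto simp: F_def)
  have F_Suc: "F (Suc k) \<subseteq> F k" for k
  proof
    fix x assume "x \<in> F (Suc k)"
    then obtain v where "v \<in> V" "x = (S z ^^ Suc (p + k)) v" by (auto simp: F_def)
    then have "x = (S z ^^ (p + k)) (S z v)" "S z v \<in> V" by (simp_all add: funpow_swap1 S_mem)
    then show "x \<in> F k" unfolding F_def by blast
  qed
  obtain j where j: "F (Suc j) = F j"
    using no_descending_chain[OF z, of F] F FV SF F_Suc by (metis psubsetI)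
  \<comment> \<open>Stabilization at some unknown \<open>j\<close> yields the equation
    \<open>x = S z y\<close> only after \<open>j\<close> further applications of \<open>S z\<close>;
    \<open>disj\<close> cancels them.\<close>
  have surj: "R \<subseteq> S z ` R"
  proof
    fix x assume x: "x \<in> R"
    then obtain v where v: "v \<in> V" "x = (S z ^^ p) v" by (auto simp: R_def)
    have "(S z ^^ j) x \<in> F j" using v by (auto simp: F_def funpow_add add.commute[of p])
    then obtain w where w: "w \<in> V" "(S z ^^ j) x = (S z ^^ (p + Suc j)) w" using j by (auto simp: F_def)
    define y where "y = (S z ^^ p) w"
    have y: "y \<in> R" using w by (simp add: y_def R_def)
    have Sy: "S z y \<in> R" using y SR by blast
    have "(S z ^^ (p + Suc j)) w = (S z ^^ (j + Suc 0 + p)) w" by (simp add: add.commute)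
    also have "\<dots> = (S z ^^ j) (S z y)" unfolding funpow_add y_def by simp
    finally have "(S z ^^ j) x = (S z ^^ j) (S z y)" using w by simp
    moreover have "(S z ^^ j) x = (S z ^^ j) (x - S z y) + (S z ^^ j) (S z y)"
    proof -
      have "x - S z y \<in> V" "S z y \<in> V" using x Sy RV mem_diff by auto
      from S_pow_add[OF this, of j z] show ?thesis by simp
    qed
    ultimately have "(S z ^^ j) (x - S z y) = 0" by simp
    then have "x - S z y = 0" using disj x Sy R(1) subspace_diff by blast
    then show "x \<in> S z ` R" using y by simp
  qed
  have inj: "inj_on (S z) R"
  proof (rule inj_onI)
    fix x y assume xy: "x \<in> R" "y \<in> R" "S z x = S z y"
    then have "(S z ^^ 1) (x - y) = 0" using RV by (auto simp: S_diff subset_iff)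
    then have "x - y = 0" using disj xy R(1) subspace_diff by blast
    then show "x = y" by simp
  qed
  have surj_pow: "R \<subseteq> (S z ^^ k) ` R" for k
  proof (induction k)
    case (Suc k)
    then have "S z ` R \<subseteq> S z ` (S z ^^ k) ` R" by blast
    then show ?case using surj by (auto simp: image_image)
  qed simp
  have GR: "\<exists>u\<in>G z. \<exists>w\<in>R. v = u + w" if v: "v \<in> V" for v
  proof -
    have "(S z ^^ p) v \<in> (S z ^^ p) ` R" using v surj_pow[of p] by (auto simp: R_def)
    then obtain w where w: "w \<in> R" "(S z ^^ p) v = (S z ^^ p) w"
      by blast
    have wV: "w \<in> V" using w RV by blast
    have "(S z ^^ p) (v - w) = 0"
      using S_pow_add[of "v - w" w p z] w v wV mem_diff by simp
    then have "v - w \<in> G z" using mem_G v wV mem_diff by blast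
    then show ?thesis using w by (intro bexI[of _ "v - w"] bexI[of _ w]) auto
  qed
  obtain C where C: "C > 0" "\<And>v. v \<in> R \<Longrightarrow> \<exists>k\<in>R. S z k = 0 \<and> N (v - k) \<le> C * N (S z v)"
    using image_estimate[OF z R RV] by blast
  have C': "N v \<le> C * N (S z v)" if "v \<in> R" for v
  proof -
    obtain k where k: "k \<in> R" "S z k = 0" "N (v - k) \<le> C * N (S z v)" using C(2)[OF \<open>v \<in> R\<close>] by blast
    have "k = 0" using disj[OF k(1), of 1] k(2) by simp
    then show ?thesis using k(3) by simp
  qed
  have "0 \<in> R" using R by (simp add: subspace_0)
  then have GR0: "G z \<inter> R = {0}" using disj mem_G by (auto intro: exI[of _ 0])
  have bij: "bij_betw (S z) R R" using inj surj SR by (auto simp: bij_betw_def)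
  show thesis
    by (rule that[OF B(1) B(3) p R(1) RV SR bij GR0 GR C(1) C'])
qed

section \<open>The spectrum outside the disc of radius \<open>\<theta>\<close>\<close>

lemma bounded_inverse:
  assumes "bij_betw (S z) R R" and "C > 0" "\<And>v. v \<in> R \<Longrightarrow> N v \<le> C * N (S z v)"
  shows "z \<notin> spectrum sc R N T"
proof -
  have "N (inv_into R (S z) v) \<le> C * N v" if "v \<in> R" for v
    using assms(3)[of "inv_into R (S z) v"] assms(1) that
    by (metis bij_betw_def f_inv_into_f inv_into_into)
  then show ?thesis using assms(1) by (auto simp: spectrum_def S_eq bounded_on_def)
qed

text \<open>If \<open>S z\<close> is injective, the generalized eigenspace vanishes and the
  complement \<open>R\<close> is the whole space, where \<open>S z\<close> has a bounded
  inverse.\<close>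

lemma spectrum_eigenvalue:
  assumes z: "\<theta> < cmod z" and sp: "z \<in> spectrum sc V N T"
  shows "is_eigenvalue sc V T z"
proof (rule ccontr)
  assume "\<not> is_eigenvalue sc V T z"
  then have inj: "v = 0" if "v \<in> V" "S z v = 0" for v
    using that by (auto simp: is_eigenvalue_def S_def)
  have pow: "v = 0" if "v \<in> V" "(S z ^^ k) v = 0" for v k
    using that by (induction k) (auto intro: inj S_pow_mem)
  obtain B p R C where R: "finite B" "G z \<subseteq> span B" "\<And>v. v \<in> G z \<Longrightarrow> (S z ^^ p) v = 0"
    "subspace R" "R \<subseteq> V" "S z ` R \<subseteq> R" "bij_betw (S z) R R" "G z \<inter> R = {0}"
    "\<And>v. v \<in> V \<Longrightarrow> \<exists>u\<in>G z. \<exists>w\<in>R. v = u + w" "C > 0" "\<And>v. v \<in> R \<Longrightarrow> N v \<le> C * N (S z v)"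
    by (rule riesz_decomposition[OF z]) (rule that; assumption)
  have "G z \<subseteq> {0}" using pow mem_G by auto
  have "R = V"
  proof
    show "V \<subseteq> R"
    proof
      fix v assume "v \<in> V"
      then obtain u w where "u \<in> G z" "w \<in> R" "v = u + w" using R(9) by blast
      then show "v \<in> R" using \<open>G z \<subseteq> {0}\<close> by auto
    qed
  qed (rule R(5))
  then show False using bounded_inverse[OF R(7,10,11)] sp by simp
qed

lemma spectrum_finite_multiplicity:
  assumes z: "\<theta> < cmod z"
  shows "finite_multiplicity sc V N T z"
proof -
  obtain B p R C where R: "finite B" "G z \<subseteq> span B" "\<And>v. v \<in> G z \<Longrightarrow> (S z ^^ p) v = 0"
    "subspace R" "R \<subseteq> V" "S z ` R \<subseteq> R" "bij_betw (S z) R R" "G z \<inter> R = {0}"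
    "\<And>v. v \<in> V \<Longrightarrow> \<exists>u\<in>G z. \<exists>w\<in>R. v = u + w" "C > 0" "\<And>v. v \<in> R \<Longrightarrow> N v \<le> C * N (S z v)"
    by (rule riesz_decomposition[OF z]) (rule that; assumption)
  have "T v \<in> R" if v: "v \<in> R" for v
  proof -
    have "T v = S z v + sc z v" by (simp add: S_def)
    then show ?thesis using R(4,6) v by (auto simp: subspace_add subspace_scale image_subset_iff)
  qed
  moreover have "V = {u + w | u w. u \<in> G z \<and> w \<in> R}"
  proof (intro equalityI subsetI)
    show "v \<in> V" if "v \<in> {u + w | u w. u \<in> G z \<and> w \<in> R}" for v
      using that R(5) mem_G mem_add by auto
  qed (use R(9) in blast)
  ultimately show ?thesis
    unfolding finite_multiplicity_def
    by (intro conjI exI[of _ B] exI[of _ R] R(1,2,4,5) bounded_inverse[OF R(7,10,11)]) auto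
qed

text \<open>A spectral value \<open>w\<close> near \<open>z\<close> still exceeds
  \<open>\<theta>\<close> in modulus, so it has an eigenvector, which is an eigenvector of
  \<open>S z\<close> for \<open>\<mu> = w - z\<close>. On \<open>R\<close> the lower bound
  \<open>1 / C\<close> excludes such a small \<open>\<mu>\<close>; on the generalized eigenspace
  \<open>S z\<close> is nilpotent, which excludes a nonzero \<open>\<mu>\<close>. The two terms of
  the minimum \<open>e\<close> serve these two needs.\<close>

lemma spectrum_isolated:
  assumes z: "\<theta> < cmod z" and sp: "z \<in> spectrum sc V N T"
  shows "z isolated_in spectrum sc V N T"
proof -
  obtain B p R C where R: "finite B" "G z \<subseteq> span B" "\<And>v. v \<in> G z \<Longrightarrow> (S z ^^ p) v = 0"
    "subspace R" "R \<subseteq> V" "S z ` R \<subseteq> R" "bij_betw (S z) R R" "G z \<inter> R = {0}"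
    "\<And>v. v \<in> V \<Longrightarrow> \<exists>u\<in>G z. \<exists>w\<in>R. v = u + w" "C > 0" "\<And>v. v \<in> R \<Longrightarrow> N v \<le> C * N (S z v)"
    by (rule riesz_decomposition[OF z]) (rule that; assumption)
  define e where "e = min (1 / C) (cmod z - \<theta>)"
  have e: "e > 0" using R(10) z by (simp add: e_def)
  have "w = z" if w: "w \<in> spectrum sc V N T" "dist z w < e" for w
  proof (rule ccontr)
    assume neq: "w \<noteq> z"
    define \<mu> where "\<mu> = w - z"
    have \<mu>: "\<mu> \<noteq> 0" "cmod \<mu> < e" using w neq by (auto simp: \<mu>_def dist_norm norm_minus_commute)
    have "\<theta> < cmod w" using \<mu>(2) norm_triangle_ineq2[of z w] by (simp add: e_def \<mu>_def norm_minus_commute)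
    then obtain v where v: "v \<in> V" "v \<noteq> 0" "T v = sc w v"
      using spectrum_eigenvalue[OF _ w(1)] by (auto simp: is_eigenvalue_def)
    have Sv: "S z v = sc \<mu> v" by (simp add: S_def v \<mu>_def scale_left_diff_distrib)
    obtain u h where uh: "u \<in> G z" "h \<in> R" "v = u + h" using R(9)[OF v(1)] by blast
    have uV: "u \<in> V" and hV: "h \<in> V" using uh mem_G R(5) by auto
    \<comment> \<open>One side lies in the generalized eigenspace, the other in \<open>R\<close>; as
      the sum is direct both vanish, so each component of \<open>v\<close> satisfies the eigenvalue
      equation separately.\<close>
    have eq: "S z u - sc \<mu> u = sc \<mu> h - S z h"
      using Sv uV hV by (simp add: uh S_add scale_right_distrib algebra_simps)
    have inR: "sc \<mu> h - S z h \<in> R"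
      using R(4,6) uh(2) by (auto simp: subspace_diff subspace_scale image_subset_iff)
    have inG: "S z u - sc \<mu> u \<in> G z"
    proof -
      have "(S z ^^ p) (S z u + sc (- \<mu>) u) = (S z ^^ p) (S z u) + (S z ^^ p) (sc (- \<mu>) u)"
        by (intro S_pow_add S_mem mem_scale uV)
      also have "\<dots> = S z ((S z ^^ p) u) + sc (- \<mu>) ((S z ^^ p) u)"
        by (simp only: S_pow_scale[OF uV] funpow_swap1[of "S z" p u])
      also have "\<dots> = 0" by (simp add: R(3)[OF uh(1)])
      finally have "(S z ^^ p) (S z u - sc \<mu> u) = 0" by simp
      moreover have "S z u - sc \<mu> u \<in> V" by (intro mem_diff S_mem mem_scale uV)
      ultimately show ?thesis unfolding mem_G by blast
    qed
    have "S z u - sc \<mu> u \<in> G z \<inter> R" using inG inR[folded eq] by (rule IntI)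
    then have zero: "S z u - sc \<mu> u = 0" unfolding R(8) by (rule singletonD)
    then have "sc \<mu> h - S z h = 0" unfolding eq .
    with zero have Su: "S z u = sc \<mu> u" and Sh: "S z h = sc \<mu> h" by (simp_all only: right_minus_eq)
    have "N h \<le> C * (cmod \<mu> * N h)" using R(11)[OF uh(2)] Sh hV by (simp add: N_scale)
    moreover have "C * cmod \<mu> < 1" using \<mu>(2) R(10) by (simp add: e_def field_simps)
    ultimately have "N h = 0"
      using N_nonneg[OF hV] mult_strict_right_mono[of "C * cmod \<mu>" 1 "N h"] by (cases "N h = 0") (simp_all add: mult.assoc)
    then have "h = 0" using N_zero hV by blast
    have "(S z ^^ k) u = sc (\<mu> ^ k) u" for k
      by (induction k) (auto simp: S_scale uV Su mult.commute)
    then have "sc (\<mu> ^ p) u = 0" using R(3)[OF uh(1)] by simp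
    then have "u = 0" using \<mu>(1) by simp
    then show False using uh \<open>h = 0\<close> v(2) by simp
  qed
  then have "ball z e \<inter> spectrum sc V N T = {z}" using sp e by auto
  then show ?thesis using sp unfolding isolated_in_def by (intro conjI exI[of _ "ball z e"]) auto
qed

theorem essential_spectral_radius_le: "essential_spectral_radius sc V N T \<le> ennreal \<theta>"
  unfolding essential_spectral_radius_def
proof (intro Inf_lower CollectI ballI impI)
  fix z assume z: "z \<in> spectrum sc V N T" "ennreal \<theta> < ennreal (cmod z)"
  then have "\<theta> < cmod z" using \<theta>_nonneg by (simp add: ennreal_less_iff)
  then show "z isolated_in spectrum sc V N T \<and> is_eigenvalue sc V T z \<and> finite_multiplicity sc V N T z"
    using spectrum_isolated spectrum_eigenvalue spectrum_finite_multiplicity z(1) by blast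
qed

end

section \<open>The covering\<close>

context covering_setting
begin

sublocale M: Metric_space "Xt D" "dst D" by (rule metric)

sublocale Act: group_action "Grp D" "Xt D" "act D" by (rule action)

lemma group_Grp: "group (Grp D)"
  using Act.group_hom by (simp add: group_hom_def)

sublocale Grp: group "Grp D" by (rule group_Grp)

lemma topspace_covered [simp]: "topspace (covered D) = Xt D"
  by (simp add: covered_def)

lemma act_mem: "g \<in> carrier (Grp D) \<Longrightarrow> x \<in> Xt D \<Longrightarrow> act D g x \<in> Xt D"
  using Act.element_image by blast

lemma act_mult: "g \<in> carrier (Grp D) \<Longrightarrow> h \<in> carrier (Grp D) \<Longrightarrow> x \<in> Xt D
    \<Longrightarrow> act D (g \<otimes>\<^bsub>Grp D\<^esub> h) x = act D g (act D h x)"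
  by (rule Act.composition_rule)

lemma act_one: "x \<in> Xt D \<Longrightarrow> act D \<one>\<^bsub>Grp D\<^esub> x = x"
  using fun_cong[OF Act.id_eq_one, of x] by simp

lemma act_inv: "g \<in> carrier (Grp D) \<Longrightarrow> x \<in> Xt D \<Longrightarrow> act D (inv\<^bsub>Grp D\<^esub> g) (act D g x) = x"
  using act_mult[of "inv\<^bsub>Grp D\<^esub> g" g x] act_one[of x] by simp

lemma proj_act:
  assumes g: "g \<in> carrier (Grp D)" and x: "x \<in> Xt D"
  shows "proj D (act D g x) = proj D x"
proof (rule Set.set_eqI)
  fix y
  show "y \<in> proj D (act D g x) \<longleftrightarrow> y \<in> proj D x"
  proof
    assume "y \<in> proj D (act D g x)"
    then obtain h where h: "h \<in> carrier (Grp D)" "y = act D h (act D g x)" by (auto simp: proj_def orbit_def)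
    then have "y = act D (h \<otimes>\<^bsub>Grp D\<^esub> g) x" by (simp add: act_mult g x)
    then show "y \<in> proj D x" using h g unfolding proj_def orbit_def by blast
  next
    assume "y \<in> proj D x"
    then obtain h where h: "h \<in> carrier (Grp D)" "y = act D h x" by (auto simp: proj_def orbit_def)
    then have "y = act D (h \<otimes>\<^bsub>Grp D\<^esub> inv\<^bsub>Grp D\<^esub> g) (act D g x)" by (simp add: act_mult g x act_mem act_inv)
    moreover have "h \<otimes>\<^bsub>Grp D\<^esub> inv\<^bsub>Grp D\<^esub> g \<in> carrier (Grp D)" using h g by simp
    ultimately show "y \<in> proj D (act D g x)" unfolding proj_def orbit_def by blast
  qed
qed

lemma proj_eqD:
  assumes "x \<in> Xt D" "y \<in> Xt D" "proj D x = proj D y"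
  obtains g where "g \<in> carrier (Grp D)" "y = act D g x"
proof -
  have "y \<in> proj D y" unfolding proj_def using Act.orbit_refl assms(2) by simp
  then have "y \<in> proj D x" using assms(3) by simp
  then show thesis using that by (auto simp: proj_def orbit_def)
qed

lemma base_eq: "base D = proj D ` Xt D"
  by (auto simp: base_def orbits_def proj_def)

lemma proj_mem [simp]: "x \<in> Xt D \<Longrightarrow> proj D x \<in> base D"
  by (simp add: base_eq)

lemma openin_base_top:
  "openin (base_top D) U \<longleftrightarrow> U \<subseteq> base D \<and> openin (covered D) {x \<in> Xt D. proj D x \<in> U}"
proof -
  have "istopology (\<lambda>U. U \<subseteq> base D \<and> openin (covered D) {x \<in> Xt D. proj D x \<in> U})"
    unfolding istopology_def
  proof (intro conjI allI impI)
    fix S T assume S: "S \<subseteq> base D \<and> openin (covered D) {x \<in> Xt D. proj D x \<in> S}"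
      and T: "T \<subseteq> base D \<and> openin (covered D) {x \<in> Xt D. proj D x \<in> T}"
    have "{x \<in> Xt D. proj D x \<in> S \<inter> T} = {x \<in> Xt D. proj D x \<in> S} \<inter> {x \<in> Xt D. proj D x \<in> T}" by auto
    then show "openin (covered D) {x \<in> Xt D. proj D x \<in> S \<inter> T}" using S T by auto
    show "S \<inter> T \<subseteq> base D" using S by auto
  next
    fix \<K> assume K: "\<forall>K\<in>\<K>. K \<subseteq> base D \<and> openin (covered D) {x \<in> Xt D. proj D x \<in> K}"
    have "{x \<in> Xt D. proj D x \<in> \<Union>\<K>} = (\<Union>K\<in>\<K>. {x \<in> Xt D. proj D x \<in> K})" by auto
    then show "openin (covered D) {x \<in> Xt D. proj D x \<in> \<Union>\<K>}" using K by auto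
    show "\<Union>\<K> \<subseteq> base D" using K by auto
  qed
  then show ?thesis unfolding base_top_def by simp
qed

lemma topspace_base_top: "topspace (base_top D) = base D"
proof -
  have "{x \<in> Xt D. proj D x \<in> base D} = topspace (covered D)" by auto
  then have "openin (base_top D) (base D)"
    unfolding openin_base_top by (simp only: openin_topspace order_refl simp_thms)
  then have "base D \<subseteq> topspace (base_top D)" by (rule openin_subset)
  moreover have "topspace (base_top D) \<subseteq> base D"
    using openin_topspace[of "base_top D"] unfolding openin_base_top by (rule conjunct1)
  ultimately show ?thesis by (rule subset_antisym[rotated])
qed

lemma openin_covered:
  "openin (covered D) U \<longleftrightarrow> U \<subseteq> Xt D \<and> (\<forall>x\<in>U. \<exists>r>0. \<forall>y\<in>Xt D. dst D x y < r \<longrightarrow> y \<in> U)"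
proof -
  have "M.mball x r \<subseteq> U \<longleftrightarrow> (\<forall>y\<in>Xt D. dst D x y < r \<longrightarrow> y \<in> U)" if "x \<in> Xt D" for x r
    using that by auto
  then show ?thesis unfolding covered_def M.openin_mtopology by (meson subsetD)
qed

lemma preimage_ball:
  assumes "openin (base_top D) U" "x \<in> Xt D" "proj D x \<in> U"
  obtains r where "r > 0" "\<And>y. y \<in> Xt D \<Longrightarrow> dst D x y < r \<Longrightarrow> proj D y \<in> U"
  using assms that unfolding openin_base_top openin_covered by blast

text \<open>Compactness of the quotient in the form used throughout: finitely many balls upstairs
  meet every orbit, with radii that may depend on the centre. The images of balls are open
  downstairs because the action is isometric.\<close>

lemma finite_cover:
  assumes \<epsilon>: "\<And>x. x \<in> Xt D \<Longrightarrow> 0 < \<epsilon> x"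
  obtains F where "finite F" "F \<subseteq> Xt D"
    "\<And>x. x \<in> Xt D \<Longrightarrow> \<exists>z\<in>F. \<exists>g\<in>carrier (Grp D). dst D z (act D g x) < \<epsilon> z"
proof -
  define U where "U z = {proj D x | x. x \<in> Xt D \<and> (\<exists>g\<in>carrier (Grp D). dst D z (act D g x) < \<epsilon> z)}" for z
  have U_iff: "proj D x \<in> U z \<longleftrightarrow> (\<exists>g\<in>carrier (Grp D). dst D z (act D g x) < \<epsilon> z)" if x: "x \<in> Xt D" for x z
  proof
    assume "proj D x \<in> U z"
    then obtain y g where y: "y \<in> Xt D" "proj D x = proj D y" and g: "g \<in> carrier (Grp D)" "dst D z (act D g y) < \<epsilon> z"
      by (auto simp: U_def)
    obtain h where h: "h \<in> carrier (Grp D)" "y = act D h x" using proj_eqD[OF x y] by blast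
    then show "\<exists>g\<in>carrier (Grp D). dst D z (act D g x) < \<epsilon> z"
      using g act_mult[OF g(1) h(1) x] by (intro bexI[of _ "g \<otimes>\<^bsub>Grp D\<^esub> h"]) auto
  qed (use x in \<open>auto simp: U_def\<close>)
  have "openin (base_top D) (U z)" if z: "z \<in> Xt D" for z
    unfolding openin_base_top openin_covered
  proof (intro conjI ballI)
    show "U z \<subseteq> base D" by (auto simp: U_def)
    fix x assume x: "x \<in> {x \<in> Xt D. proj D x \<in> U z}"
    then obtain g where g: "g \<in> carrier (Grp D)" "dst D z (act D g x) < \<epsilon> z" using U_iff by blast
    show "\<exists>r>0. \<forall>y\<in>Xt D. dst D x y < r \<longrightarrow> y \<in> {x \<in> Xt D. proj D x \<in> U z}"
    proof (intro exI[of _ "\<epsilon> z - dst D z (act D g x)"] conjI ballI impI)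
      fix y assume y: "y \<in> Xt D" "dst D x y < \<epsilon> z - dst D z (act D g x)"
      have "dst D z (act D g y) \<le> dst D z (act D g x) + dst D (act D g x) (act D g y)"
        using x y g z by (intro M.triangle act_mem) auto
      also have "\<dots> < \<epsilon> z" using isometric[of g x y] x y g by simp
      finally show "y \<in> {x \<in> Xt D. proj D x \<in> U z}" using U_iff[OF y(1)] g y by auto
    qed (use g in simp)
  qed auto
  moreover have "topspace (base_top D) \<subseteq> \<Union>(U ` Xt D)"
  proof
    fix y assume "y \<in> topspace (base_top D)"
    then obtain x where x: "x \<in> Xt D" "y = proj D x" unfolding topspace_base_top base_eq by blast
    have "proj D x \<in> U x" using U_iff[OF x(1)] \<epsilon>[OF x(1)] act_one[OF x(1)] x(1)
      by (intro iffD2[OF U_iff[OF x(1)]] bexI[of _ "\<one>\<^bsub>Grp D\<^esub>"]) auto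
    then show "y \<in> \<Union>(U ` Xt D)" using x by blast
  qed
  ultimately obtain \<F> where \<F>: "finite \<F>" "\<F> \<subseteq> U ` Xt D" "topspace (base_top D) \<subseteq> \<Union>\<F>"
    using compact_quotient[unfolded compact_space_alt] by (metis (no_types, lifting) imageE)
  obtain F where F: "finite F" "F \<subseteq> Xt D" "\<F> = U ` F" using \<F>(1,2) by (meson finite_subset_image)
  show thesis
  proof (rule that[OF F(1,2)])
    fix x assume x: "x \<in> Xt D"
    then obtain z where "z \<in> F" "proj D x \<in> U z" using \<F>(3) F(3) proj_mem[OF x] unfolding topspace_base_top by blast
    then show "\<exists>z\<in>F. \<exists>g\<in>carrier (Grp D). dst D z (act D g x) < \<epsilon> z" using U_iff[OF x] by blast
  qed
qed

text \<open>Only finitely many group elements move a compact neighbourhood \<open>K\<close> of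
  \<open>x\<close> to a set that meets \<open>K\<close>, and freeness gives those other than the
  identity a positive displacement of \<open>x\<close>. All the others carry \<open>x\<close> out of
  a ball contained in \<open>K\<close>. This is what leaves room for a bump around
  \<open>x\<close>.\<close>

lemma uniform_separation:
  assumes x: "x \<in> Xt D"
  obtains \<epsilon> where "\<epsilon> > 0" "\<And>g. g \<in> carrier (Grp D) \<Longrightarrow> g \<noteq> \<one>\<^bsub>Grp D\<^esub> \<Longrightarrow> \<epsilon> \<le> dst D x (act D g x)"
proof -
  obtain U K where U: "openin (covered D) U" "compactin (covered D) K" "x \<in> U" "U \<subseteq> K"
    using locally_compact x unfolding locally_compact_space_def by auto
  obtain r where r: "r > 0" "\<And>y. y \<in> Xt D \<Longrightarrow> dst D x y < r \<Longrightarrow> y \<in> U"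
    using U(1,3) unfolding openin_covered by blast
  define S where "S = {g \<in> carrier (Grp D). act D g ` K \<inter> K \<noteq> {}}"
  have S: "finite S" unfolding S_def by (rule properly_discontinuous[OF U(2)])
  define E where "E = insert r ((\<lambda>g. dst D x (act D g x)) ` (S - {\<one>\<^bsub>Grp D\<^esub>}))"
  have E: "finite E" using S by (simp add: E_def)
  have pos: "0 < dst D x (act D g x)" if g: "g \<in> carrier (Grp D)" "g \<noteq> \<one>\<^bsub>Grp D\<^esub>" for g
    using M.mdist_pos_less[OF _ x act_mem[OF g(1) x]] free[OF g(1) x] g(2) by metis
  show thesis
  proof (rule that[of "Min E"])
    show "0 < Min E" using E r pos by (subst Min_gr_iff) (auto simp: E_def S_def)
    fix g assume g: "g \<in> carrier (Grp D)" "g \<noteq> \<one>\<^bsub>Grp D\<^esub>"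
    show "Min E \<le> dst D x (act D g x)"
    proof (cases "g \<in> S")
      case True
      then show ?thesis using E g by (intro Min_le) (auto simp: E_def)
    next
      case False
      then have "act D g x \<notin> U" using U(3,4) g by (auto simp: S_def)
      then have "r \<le> dst D x (act D g x)" using r(2)[OF act_mem[OF g(1) x]] by force
      moreover have "Min E \<le> r" using E by (intro Min_le) (auto simp: E_def)
      ultimately show ?thesis by simp
    qed
  qed
qed

section \<open>The inverse branches of the expanding map\<close>

lemma rt_bij: "bij_betw (rt D) (Xt D) (Xt D)"
  using homeomorphic_imp_injective_map[OF rt_homeomorphism] homeomorphic_imp_surjective_map[OF rt_homeomorphism]
  by (simp add: bij_betw_def)

lemma rt_mem: "x \<in> Xt D \<Longrightarrow> rt D x \<in> Xt D"
  using rt_bij by (auto simp: bij_betw_def)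

lemma rep_mem: "i \<in> {1..idx D} \<Longrightarrow> rep D i \<in> carrier (Grp D)"
  using rep_carrier by blast

lemma psi_mem: "i \<in> {1..idx D} \<Longrightarrow> x \<in> Xt D \<Longrightarrow> psi D i x \<in> Xt D"
  and rt_psi: "i \<in> {1..idx D} \<Longrightarrow> x \<in> Xt D \<Longrightarrow> rt D (psi D i x) = act D (rep D i) x"
  unfolding psi_def using rt_bij act_mem[OF rep_mem]
  by (metis bij_betw_def inv_into_into, metis bij_betw_def f_inv_into_f)

lemma rmap_psi: "i \<in> {1..idx D} \<Longrightarrow> x \<in> Xt D \<Longrightarrow> rmap D (proj D (psi D i x)) = proj D x"
  by (simp add: rmap_proj psi_mem rt_psi proj_act rep_mem)

lemma endo_mem: "g \<in> carrier (Grp D) \<Longrightarrow> endo D g \<in> carrier (Grp D)"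
  using endomorphism by (auto simp: hom_def)

text \<open>Right multiplication by \<open>g\<close> permutes the right cosets of \<open>AG\<close>.\<close>

lemma psi_act_permutes:
  assumes g: "g \<in> carrier (Grp D)" and x: "x \<in> Xt D"
  obtains \<sigma> where "bij_betw \<sigma> {1..idx D} {1..idx D}"
    "\<And>i. i \<in> {1..idx D} \<Longrightarrow> proj D (psi D i (act D g x)) = proj D (psi D (\<sigma> i) x)"
proof -
  let ?G = "carrier (Grp D)" and ?A = "endo D ` carrier (Grp D)"
  have sub: "subgroup ?A (Grp D)" using image_normal by (rule normal_imp_subgroup)
  have "\<exists>j\<in>{1..idx D}. ?A #>\<^bsub>Grp D\<^esub> rep D j = ?A #>\<^bsub>Grp D\<^esub> (rep D i \<otimes>\<^bsub>Grp D\<^esub> g)" if i: "i \<in> {1..idx D}" for i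
  proof -
    have "?A #>\<^bsub>Grp D\<^esub> (rep D i \<otimes>\<^bsub>Grp D\<^esub> g) \<in> rcosets\<^bsub>Grp D\<^esub> ?A"
      using rep_mem[OF i] g by (intro Grp.rcosetsI subgroup.subset[OF sub]) auto
    then show ?thesis using rep_cosets unfolding bij_betw_def by (metis (mono_tags, lifting) imageE)
  qed
  then obtain \<sigma> where \<sigma>: "\<And>i. i \<in> {1..idx D} \<Longrightarrow> \<sigma> i \<in> {1..idx D}"
      "\<And>i. i \<in> {1..idx D} \<Longrightarrow> ?A #>\<^bsub>Grp D\<^esub> rep D (\<sigma> i) = ?A #>\<^bsub>Grp D\<^esub> (rep D i \<otimes>\<^bsub>Grp D\<^esub> g)" by metis
  have AG: "?A \<subseteq> ?G" using endo_mem by blast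
  have "inj_on \<sigma> {1..idx D}"
  proof (rule inj_onI)
    fix i j assume ij: "i \<in> {1..idx D}" "j \<in> {1..idx D}" "\<sigma> i = \<sigma> j"
    have "?A #>\<^bsub>Grp D\<^esub> rep D k = (?A #>\<^bsub>Grp D\<^esub> (rep D k \<otimes>\<^bsub>Grp D\<^esub> g)) #>\<^bsub>Grp D\<^esub> inv\<^bsub>Grp D\<^esub> g" if "k \<in> {1..idx D}" for k
      using rep_mem[OF that] g AG by (simp add: Grp.coset_mult_assoc Grp.m_assoc)
    then have "?A #>\<^bsub>Grp D\<^esub> rep D i = ?A #>\<^bsub>Grp D\<^esub> rep D j" using \<sigma>(2)[OF ij(1)] \<sigma>(2)[OF ij(2)] ij by metis
    then show "i = j" using rep_cosets ij unfolding bij_betw_def inj_on_def by blast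
  qed
  then have bij: "bij_betw \<sigma> {1..idx D} {1..idx D}"
    using \<sigma>(1) by (simp add: bij_betw_def endo_inj_surj image_subset_iff)
  show thesis
  proof (rule that[OF bij])
    fix i assume i: "i \<in> {1..idx D}"
    have ri: "rep D i \<in> ?G" and rs: "rep D (\<sigma> i) \<in> ?G" using rep_mem \<sigma>(1) i by auto
    have "rep D i \<otimes>\<^bsub>Grp D\<^esub> g \<in> ?A #>\<^bsub>Grp D\<^esub> (rep D i \<otimes>\<^bsub>Grp D\<^esub> g)"
      using ri g sub by (intro Grp.rcos_self) auto
    \<comment> \<open>Equality of cosets produces a factor \<open>endo D h\<close> on the left;
      equivariance pulls it back through \<open>rt D\<close> to the factor \<open>h\<close>, which
      \<open>proj D\<close> forgets.\<close>
    then obtain h where h: "h \<in> ?G" "rep D i \<otimes>\<^bsub>Grp D\<^esub> g = endo D h \<otimes>\<^bsub>Grp D\<^esub> rep D (\<sigma> i)"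
      using \<sigma>(2)[OF i] by (auto simp: r_coset_def)
    have "act D (rep D i) (act D g x) = act D (endo D h) (act D (rep D (\<sigma> i)) x)"
      using act_mult[OF ri g x] act_mult[OF endo_mem[OF h(1)] rs x] h(2) by simp
    then have "rt D (psi D i (act D g x)) = act D (endo D h) (rt D (psi D (\<sigma> i) x))"
      using rt_psi i \<sigma>(1) x act_mem[OF g x] by simp
    also have "\<dots> = rt D (act D h (psi D (\<sigma> i) x))"
      using rt_equivariant h psi_mem \<sigma>(1) i x by simp
    finally have "psi D i (act D g x) = act D h (psi D (\<sigma> i) x)"
      using rt_bij psi_mem i \<sigma>(1) x act_mem[OF g x] act_mem[OF h(1)]
      by (meson bij_betw_imp_inj_on inj_onD)
    then show "proj D (psi D i (act D g x)) = proj D (psi D (\<sigma> i) x)"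
      using proj_act h psi_mem \<sigma>(1) i x by simp
  qed
qed

text \<open>The quotient topology is final for \<open>proj D\<close>, so continuity downstairs may
  be tested by limits upstairs, where the Lipschitz estimates live.\<close>

lemma continuous_on_base:
  fixes F :: "'a set \<Rightarrow> 'b::topological_space"
  assumes U: "openin (base_top D) U"
    and lim: "\<And>x. x \<in> Xt D \<Longrightarrow> proj D x \<in> U \<Longrightarrow> ((\<lambda>y. F (proj D y)) \<longlongrightarrow> F (proj D x)) (atin (covered D) x)"
  shows "continuous_map (subtopology (base_top D) U) euclidean F"
  unfolding continuous_map_def
proof (intro conjI allI impI)
  fix W :: "'b set" assume "openin euclidean W"
  then have W: "open W" by simp
  let ?P = "{x \<in> Xt D. proj D x \<in> U \<and> F (proj D x) \<in> W}"
  have "openin (covered D) ?P"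
  proof (subst openin_subopen, intro ballI)
    fix x assume "x \<in> ?P"
    then have x: "x \<in> Xt D" "proj D x \<in> U" "F (proj D x) \<in> W" by auto
    have "\<forall>\<^sub>F y in atin (covered D) x. F (proj D y) \<in> W"
      using topological_tendstoD[OF lim[OF x(1,2)] W x(3)] .
    then obtain Q where Q: "openin (covered D) Q" "x \<in> Q" "\<And>y. y \<in> Q - {x} \<Longrightarrow> F (proj D y) \<in> W"
      using x(1) unfolding eventually_atin by auto
    have U': "openin (covered D) {x \<in> Xt D. proj D x \<in> U}" using U openin_base_top by blast
    show "\<exists>T. openin (covered D) T \<and> x \<in> T \<and> T \<subseteq> ?P"
      using openin_Int[OF Q(1) U'] Q x by (intro exI[of _ "Q \<inter> {x \<in> Xt D. proj D x \<in> U}"]) auto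
  qed
  moreover have "{x \<in> Xt D. proj D x \<in> {y \<in> U. F y \<in> W}} = ?P" by auto
  ultimately have "openin (base_top D) {y \<in> U. F y \<in> W}"
    using openin_subset[OF U] unfolding openin_base_top topspace_base_top by auto
  moreover have "{y \<in> topspace (subtopology (base_top D) U). F y \<in> W} = {y \<in> U. F y \<in> W}"
    using openin_subset[OF U] by auto
  ultimately show "openin (subtopology (base_top D) U) {y \<in> topspace (subtopology (base_top D) U). F y \<in> W}"
    using openin_subtopology_Int2 by (metis (no_types, lifting) U openin_open_subtopology mem_Collect_eq subsetI)
qed simp

lemma lipschitz_tendsto:
  fixes f :: "'a \<Rightarrow> 'b::real_normed_vector"
  assumes x: "x \<in> Xt D" and r: "r > 0" and f: "\<And>y. y \<in> Xt D \<Longrightarrow> dst D x y < r \<Longrightarrow> norm (f y - f x) \<le> K * dst D x y"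
  shows "(f \<longlongrightarrow> f x) (atin (covered D) x)"
proof (rule tendstoI)
  fix e :: real assume e: "e > 0"
  define s where "s = min r (e / (\<bar>K\<bar> + 1))"
  have s: "s > 0" using r e by (simp add: s_def)
  have "openin (covered D) (M.mball x s)" by (simp add: covered_def)
  moreover have "dist (f y) (f x) < e" if "y \<in> M.mball x s" for y
  proof -
    have y: "y \<in> Xt D" "dst D x y < r" "dst D x y < e / (\<bar>K\<bar> + 1)" using that by (auto simp: s_def)
    have "norm (f y - f x) \<le> K * dst D x y" using f y by simp
    also have "\<dots> \<le> (\<bar>K\<bar> + 1) * dst D x y" by (intro mult_right_mono) auto
    also have "\<dots> < e" using y(3) by (simp add: field_simps)
    finally show ?thesis by (simp add: dist_norm)
  qed
  ultimately show "\<forall>\<^sub>F y in atin (covered D) x. dist (f y) (f x) < e"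
    unfolding eventually_atin using s x by (intro disjI2 exI[of _ "M.mball x s"]) auto
qed

text \<open>Pairs at distance at least \<open>\<delta>\<close> need no local information: the
  difference is at most \<open>2 * B\<close>, which is at most \<open>2 * B / \<delta>\<close> times
  the distance.\<close>

lemma lipschitz_from_local:
  fixes f :: "'a \<Rightarrow> 'b::real_normed_vector"
  assumes "\<delta> > 0" "0 \<le> B" "0 \<le> L" and B: "\<And>x. x \<in> Xt D \<Longrightarrow> norm (f x) \<le> B"
    and L: "\<And>x y. x \<in> Xt D \<Longrightarrow> y \<in> Xt D \<Longrightarrow> dst D x y < \<delta> \<Longrightarrow> norm (f x - f y) \<le> L * dst D x y"
    and x: "x \<in> Xt D" and y: "y \<in> Xt D"
  shows "norm (f x - f y) \<le> (L + 2 * B / \<delta>) * dst D x y"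
proof (cases "dst D x y < \<delta>")
  case True
  have "norm (f x - f y) \<le> L * dst D x y" using L x y True by simp
  also have "\<dots> \<le> (L + 2 * B / \<delta>) * dst D x y" using assms(1,2) by (intro mult_right_mono) auto
  finally show ?thesis .
next
  case False
  have "norm (f x - f y) \<le> 2 * B" using norm_triangle_ineq4[of "f x" "f y"] B[OF x] B[OF y] by simp
  also have "\<dots> = 2 * B / \<delta> * \<delta>" using assms(1) by simp
  also have "\<dots> \<le> 2 * B / \<delta> * dst D x y" using False assms(1,2) by (intro mult_left_mono) auto
  also have "\<dots> \<le> (L + 2 * B / \<delta>) * dst D x y" using assms(3) by (intro mult_right_mono) auto
  finally show ?thesis .
qed

end

section \<open>Linear maps between coordinate spaces\<close>

lemma norm_matrix_vector_mult_le:
  fixes A :: "complex ^ 'n ^ 'm"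
  shows "norm (A *v a) \<le> norm A * norm a"
proof -
  have "norm ((A *v a) $ i) \<le> norm (A $ i) * norm a" for i
  proof -
    have "norm ((A *v a) $ i) \<le> (\<Sum>j\<in>UNIV. \<bar>norm (A $ i $ j)\<bar> * \<bar>norm (a $ j)\<bar>)"
      unfolding matrix_vector_mult_def using norm_sum[of "\<lambda>j. A $ i $ j * a $ j" UNIV] by (simp add: norm_mult)
    also have "\<dots> \<le> L2_set (\<lambda>j. norm (A $ i $ j)) UNIV * L2_set (\<lambda>j. norm (a $ j)) UNIV"
      by (rule L2_set_mult_ineq)
    finally show ?thesis by (simp add: norm_vec_def)
  qed
  then have "L2_set (\<lambda>i. norm ((A *v a) $ i)) UNIV \<le> L2_set (\<lambda>i. norm (A $ i) * norm a) UNIV"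
    by (intro L2_set_mono) auto
  also have "\<dots> = L2_set (\<lambda>i. norm (A $ i)) UNIV * norm a"
    by (simp add: L2_set_left_distrib)
  finally show ?thesis by (simp add: norm_vec_def)
qed

abbreviation clinear_op :: "(complex ^ 'n \<Rightarrow> complex ^ 'm) \<Rightarrow> bool" where
  "clinear_op \<equiv> linear_on (*s) (*s) UNIV"

lemma clinear_opI:
  "(\<And>a b. f (a + b) = f a + f b) \<Longrightarrow> (\<And>c a. f (c *s a) = c *s f a) \<Longrightarrow> clinear_op f"
  by (simp add: linear_on_def)

lemma clinear_op_add: "clinear_op f \<Longrightarrow> f (a + b) = f a + f b"
  and clinear_op_scale: "clinear_op f \<Longrightarrow> f (c *s a) = c *s f a"
  by (simp_all add: linear_on_def)

lemma clinear_op_diff: "clinear_op f \<Longrightarrow> f (a - b) = f a - f b"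
  using clinear_op_add[of f "a - b" b] by (simp add: algebra_simps)

lemma clinear_op_0: "clinear_op f \<Longrightarrow> f 0 = 0"
  using clinear_op_diff[of f 0 0] by simp

lemma clinear_op_sum: "clinear_op f \<Longrightarrow> f (\<Sum>i\<in>I. g i) = (\<Sum>i\<in>I. f (g i))"
  by (induction I rule: infinite_finite_induct) (auto simp: clinear_op_0 clinear_op_add)

lemma clinear_op_compose: "clinear_op f \<Longrightarrow> clinear_op g \<Longrightarrow> clinear_op (\<lambda>a. f (g a))"
  by (simp add: linear_on_def)

lemma norm_vector_scalar_mult: "norm (c *s a) = cmod c * norm (a :: complex ^ 'n)"
  by (simp add: norm_vec_def norm_mult L2_set_right_distrib)

lemma of_real_vector_scalar_mult: "complex_of_real r *s a = r *\<^sub>R (a :: complex ^ 'n)"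
  by (simp add: vec_eq_iff scaleR_conv_of_real[where 'a = complex])

lemma matrix_clinear_op:
  fixes f :: "complex ^ 'n \<Rightarrow> complex ^ 'm"
  assumes "clinear_op f"
  shows "matrix f *v a = f a"
proof (rule matrix_works)
  show "Vector_Spaces.linear (*s) (*s) f"
    using assms by unfold_locales (auto simp: linear_on_def)
qed

lemma clinear_op_bounded:
  fixes f :: "complex ^ 'n \<Rightarrow> complex ^ 'm"
  assumes "clinear_op f"
  obtains B where "B \<ge> 0" "\<And>a. norm (f a) \<le> B * norm a"
  using norm_matrix_vector_mult_le[of "matrix f"] that[of "norm (matrix f)"] matrix_clinear_op[OF assms] by simp

lemma lipschitz_matrix_op:
  fixes F :: "'s \<Rightarrow> complex ^ 'n \<Rightarrow> complex ^ 'm"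
  assumes lip: "lipschitz_wrt d S (\<lambda>x. matrix (F x))" and F: "\<And>x. x \<in> S \<Longrightarrow> clinear_op (F x)"
    and d: "\<And>x y. 0 \<le> d x y"
  obtains L where "L \<ge> 0" "\<And>x y a. x \<in> S \<Longrightarrow> y \<in> S \<Longrightarrow> norm (F x a - F y a) \<le> L * d x y * norm a"
proof -
  obtain L where L: "\<And>x y. x \<in> S \<Longrightarrow> y \<in> S \<Longrightarrow> dist (matrix (F x)) (matrix (F y)) \<le> L * d x y"
    using lip unfolding lipschitz_wrt_def by blast
  show thesis
  proof (rule that[of "\<bar>L\<bar>"])
    fix x y a assume x: "x \<in> S" and y: "y \<in> S"
    have "F x a - F y a = (matrix (F x) - matrix (F y)) *v a"
      by (simp add: matrix_vector_mult_diff_rdistrib matrix_clinear_op F x y)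
    then have "norm (F x a - F y a) \<le> dist (matrix (F x)) (matrix (F y)) * norm a"
      using norm_matrix_vector_mult_le[of "matrix (F x) - matrix (F y)" a] by (simp add: dist_norm)
    also have "\<dots> \<le> (\<bar>L\<bar> * d x y) * norm a"
      using L[OF x y] mult_right_mono[OF abs_ge_self[of L] d[of x y]] by (intro mult_right_mono) auto
    finally show "norm (F x a - F y a) \<le> \<bar>L\<bar> * d x y * norm a" .
  qed simp
qed

text \<open>The standard hermitian product, linear in the first argument, in agreement with
  \<open>triv_isometric\<close>.\<close>

definition cip :: "complex ^ 'n \<Rightarrow> complex ^ 'n \<Rightarrow> complex" where
  "cip a b = (\<Sum>j\<in>UNIV. a $ j * cnj (b $ j))"

lemma cip_add_left: "cip (a + b) c = cip a c + cip b c"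
  and cip_diff_left: "cip (a - b) c = cip a c - cip b c"
  and cip_diff_right: "cip a (b - c) = cip a b - cip a c"
  and cip_scale_left: "cip (z *s a) b = z * cip a b"
  and cip_0_left [simp]: "cip 0 b = 0"
  by (simp_all add: cip_def sum.distrib sum_subtractf sum_distrib_left algebra_simps)

lemma cip_axis_right: "cip a (axis j 1) = a $ j"
  unfolding cip_def axis_def
  by (simp_all add: if_distrib if_distribR cong: if_cong)

lemma cip_self: "cip a a = of_real ((norm a)\<^sup>2)"
proof -
  have "cip a a = (\<Sum>j\<in>UNIV. of_real ((norm (a $ j))\<^sup>2))"
    unfolding cip_def by (intro sum.cong refl) (simp only: complex_norm_square)
  then show ?thesis by (simp add: norm_vec_def L2_set_def sum_nonneg)
qed

lemma cip_cauchy_schwarz: "cmod (cip a b) \<le> norm a * norm b"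
proof -
  have "cmod (cip a b) \<le> (\<Sum>j\<in>UNIV. \<bar>norm (a $ j)\<bar> * \<bar>norm (b $ j)\<bar>)"
    unfolding cip_def using norm_sum[of "\<lambda>j. a $ j * cnj (b $ j)" UNIV] by (simp add: norm_mult)
  also have "\<dots> \<le> L2_set (\<lambda>j. norm (a $ j)) UNIV * L2_set (\<lambda>j. norm (b $ j)) UNIV"
    by (rule L2_set_mult_ineq)
  finally show ?thesis by (simp add: norm_vec_def)
qed

text \<open>Testing with \<open>b = a\<close> gives the bound. It is the exit from computations with
  sesquilinear forms, in which adjoints never have to be written out.\<close>

lemma norm_le_of_cip:
  assumes "\<And>b. cmod (cip a b) \<le> B * norm b"
  shows "norm a \<le> B"
proof (cases "a = 0")
  case True
  then show ?thesis using assms[of "axis undefined 1"] by (simp add: norm_axis_1)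
next
  case False
  have "norm a * norm a \<le> B * norm a" using assms[of a] unfolding cip_self norm_of_real by (simp add: power2_eq_square)
  then show ?thesis using False by simp
qed

lemma vec_expand: "a = (\<Sum>j\<in>UNIV. (a $ j) *s axis j (1 :: complex))"
  by (simp add: vec_eq_iff axis_def if_distrib if_distribR cong: if_cong)

section \<open>Equivariant functions on the covering space\<close>

context bundle_setting
begin

sublocale E: vector_space "scal D" by (rule scaling)

lemma fibre_add: "y \<in> base D \<Longrightarrow> u \<in> fibre D y \<Longrightarrow> v \<in> fibre D y \<Longrightarrow> u + v \<in> fibre D y"
  and fibre_scale: "y \<in> base D \<Longrightarrow> v \<in> fibre D y \<Longrightarrow> scal D c v \<in> fibre D y"
  and fibre_0: "y \<in> base D \<Longrightarrow> 0 \<in> fibre D y"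
  and fibre_sum: "y \<in> base D \<Longrightarrow> (\<And>i. i \<in> I \<Longrightarrow> f i \<in> fibre D y) \<Longrightarrow> (\<Sum>i\<in>I. f i) \<in> fibre D y"
  using fibre_subspace[of y] by (auto intro: E.subspace_add E.subspace_scale E.subspace_0 E.subspace_sum)

lemma triv_mem: "x \<in> Xt D \<Longrightarrow> triv D x a \<in> fibre D (proj D x)"
  using triv_linear[of x] by (auto simp: bij_betw_def)

lemma triv_add: "x \<in> Xt D \<Longrightarrow> triv D x (a + b) = triv D x a + triv D x b"
  and triv_scale: "x \<in> Xt D \<Longrightarrow> triv D x (c *s a) = scal D c (triv D x a)"
  using triv_linear[of x] by (auto simp: linear_on_def)

lemma triv_inv_triv [simp]: "x \<in> Xt D \<Longrightarrow> triv_inv D x (triv D x a) = a"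
  using triv_linear[of x] unfolding triv_inv_def by (intro inv_into_f_f) (auto simp: bij_betw_def)

lemma triv_triv_inv: "x \<in> Xt D \<Longrightarrow> v \<in> fibre D (proj D x) \<Longrightarrow> triv D x (triv_inv D x v) = v"
  using triv_linear[of x] unfolding triv_inv_def by (intro f_inv_into_f) (auto simp: bij_betw_def)

lemma triv_inv_add:
  assumes "x \<in> Xt D" "u \<in> fibre D (proj D x)" "v \<in> fibre D (proj D x)"
  shows "triv_inv D x (u + v) = triv_inv D x u + triv_inv D x v"
  using triv_inv_triv[of x "triv_inv D x u + triv_inv D x v"] assms by (simp add: triv_add triv_triv_inv)

lemma triv_inv_scale:
  assumes "x \<in> Xt D" "v \<in> fibre D (proj D x)"
  shows "triv_inv D x (scal D c v) = c *s triv_inv D x v"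
  using triv_inv_triv[of x "c *s triv_inv D x v"] assms by (simp add: triv_scale triv_triv_inv)

lemma triv_inv_0 [simp]: "x \<in> Xt D \<Longrightarrow> triv_inv D x 0 = 0"
  using triv_inv_scale[of x 0 0] fibre_0 by simp

lemma herm_triv: "x \<in> Xt D \<Longrightarrow> herm D (proj D x) (triv D x a) (triv D x b) = cip a b"
  by (simp add: triv_isometric cip_def)

lemma herm_triv_inv:
  "x \<in> Xt D \<Longrightarrow> u \<in> fibre D (proj D x) \<Longrightarrow> v \<in> fibre D (proj D x)
    \<Longrightarrow> herm D (proj D x) u v = cip (triv_inv D x u) (triv_inv D x v)"
  using herm_triv[of x "triv_inv D x u" "triv_inv D x v"] by (simp add: triv_triv_inv)

lemma fibre_norm_triv_inv: "x \<in> Xt D \<Longrightarrow> v \<in> fibre D (proj D x) \<Longrightarrow> fibre_norm D (proj D x) v = norm (triv_inv D x v)"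
  by (simp add: fibre_norm_def herm_triv_inv cip_self)

text \<open>The unitary cocycle comparing the trivializations at \<open>x\<close> and \<open>gx\<close>.\<close>

definition coc :: "'g \<Rightarrow> 'a \<Rightarrow> complex ^ 'd \<Rightarrow> complex ^ 'd" where
  "coc g x a = triv_inv D (act D g x) (triv D x a)"

lemma triv_mem_act: "g \<in> carrier (Grp D) \<Longrightarrow> x \<in> Xt D \<Longrightarrow> triv D x a \<in> fibre D (proj D (act D g x))"
  by (simp add: proj_act triv_mem)

lemma coc_clinear: "g \<in> carrier (Grp D) \<Longrightarrow> x \<in> Xt D \<Longrightarrow> clinear_op (coc g x)"
  by (rule clinear_opI)
     (simp_all add: coc_def triv_add triv_scale triv_inv_add triv_inv_scale triv_mem_act act_mem)

lemma triv_coc: "g \<in> carrier (Grp D) \<Longrightarrow> x \<in> Xt D \<Longrightarrow> triv D (act D g x) (coc g x a) = triv D x a"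
  by (simp add: coc_def triv_triv_inv act_mem triv_mem_act)

lemma coc_triv_inv:
  "g \<in> carrier (Grp D) \<Longrightarrow> x \<in> Xt D \<Longrightarrow> v \<in> fibre D (proj D x) \<Longrightarrow> coc g x (triv_inv D x v) = triv_inv D (act D g x) v"
  by (simp add: coc_def triv_triv_inv)

lemma cip_coc: "g \<in> carrier (Grp D) \<Longrightarrow> x \<in> Xt D \<Longrightarrow> cip (coc g x a) (coc g x b) = cip a b"
  using herm_triv[of "act D g x" "coc g x a" "coc g x b"]
  by (simp add: triv_coc act_mem proj_act herm_triv)

lemma norm_coc: "g \<in> carrier (Grp D) \<Longrightarrow> x \<in> Xt D \<Longrightarrow> norm (coc g x a) = norm a"
  using cip_coc[of g x a a] unfolding cip_self of_real_eq_iff by simp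

lemma coc_mult:
  "g \<in> carrier (Grp D) \<Longrightarrow> h \<in> carrier (Grp D) \<Longrightarrow> x \<in> Xt D
    \<Longrightarrow> coc (g \<otimes>\<^bsub>Grp D\<^esub> h) x a = coc g (act D h x) (coc h x a)"
  by (simp add: coc_def[of _ x] coc_triv_inv act_mem triv_mem_act act_mult)

lemma coc_one: "x \<in> Xt D \<Longrightarrow> coc \<one>\<^bsub>Grp D\<^esub> x a = a"
  by (simp add: coc_def act_one)

lemma coc_inv: "g \<in> carrier (Grp D) \<Longrightarrow> x \<in> Xt D \<Longrightarrow> coc (inv\<^bsub>Grp D\<^esub> g) (act D g x) (coc g x a) = a"
  using coc_mult[of "inv\<^bsub>Grp D\<^esub> g" g x a] by (simp add: coc_one)

text \<open>The change of coordinates from the trivialization upstairs to a chart downstairs;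
  \<open>Psi\<close> is the change back.\<close>

definition Phi :: "('a set \<Rightarrow> 'e \<Rightarrow> complex ^ 'd) \<Rightarrow> 'a \<Rightarrow> complex ^ 'd \<Rightarrow> complex ^ 'd" where
  "Phi \<phi> x a = \<phi> (proj D x) (triv D x a)"

definition Psi :: "('a set \<Rightarrow> 'e \<Rightarrow> complex ^ 'd) \<Rightarrow> 'a \<Rightarrow> complex ^ 'd \<Rightarrow> complex ^ 'd" where
  "Psi \<phi> x a = triv_inv D x (chart_inv D \<phi> (proj D x) a)"

context
  fixes U \<phi> assumes chart: "(U, \<phi>) \<in> charts D"
begin

lemma chart_subset: "U \<subseteq> base D"
  using chart_open[OF chart] unfolding openin_base_top by blast

lemma chart_add: "y \<in> U \<Longrightarrow> u \<in> fibre D y \<Longrightarrow> v \<in> fibre D y \<Longrightarrow> \<phi> y (u + v) = \<phi> y u + \<phi> y v"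
  and chart_scale: "y \<in> U \<Longrightarrow> v \<in> fibre D y \<Longrightarrow> \<phi> y (scal D c v) = c *s \<phi> y v"
  using chart_linear[OF chart, of y] by (auto simp: linear_on_def)

lemma chart_inv_mem: "y \<in> U \<Longrightarrow> chart_inv D \<phi> y a \<in> fibre D y"
  using chart_linear[OF chart, of y] unfolding chart_inv_def by (intro inv_into_into) (auto simp: bij_betw_def)

lemma chart_chart_inv: "y \<in> U \<Longrightarrow> \<phi> y (chart_inv D \<phi> y a) = a"
  using chart_linear[OF chart, of y] unfolding chart_inv_def by (intro f_inv_into_f) (auto simp: bij_betw_def)

lemma chart_inv_chart: "y \<in> U \<Longrightarrow> v \<in> fibre D y \<Longrightarrow> chart_inv D \<phi> y (\<phi> y v) = v"
  using chart_linear[OF chart, of y] unfolding chart_inv_def by (intro inv_into_f_f) (auto simp: bij_betw_def)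

lemma chart_inv_add: "y \<in> U \<Longrightarrow> chart_inv D \<phi> y (a + b) = chart_inv D \<phi> y a + chart_inv D \<phi> y b"
  using chart_inv_chart[of y "chart_inv D \<phi> y a + chart_inv D \<phi> y b"] chart_subset
  by (simp add: chart_add chart_inv_mem chart_chart_inv fibre_add subset_iff)

lemma chart_inv_scale: "y \<in> U \<Longrightarrow> chart_inv D \<phi> y (c *s a) = scal D c (chart_inv D \<phi> y a)"
  using chart_inv_chart[of y "scal D c (chart_inv D \<phi> y a)"] chart_subset
  by (simp add: chart_scale chart_inv_mem chart_chart_inv fibre_scale subset_iff)

lemma Phi_clinear: "x \<in> Xt D \<Longrightarrow> proj D x \<in> U \<Longrightarrow> clinear_op (Phi \<phi> x)"
  by (rule clinear_opI) (simp_all add: Phi_def triv_add triv_scale chart_add chart_scale triv_mem)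

lemma Psi_clinear: "x \<in> Xt D \<Longrightarrow> proj D x \<in> U \<Longrightarrow> clinear_op (Psi \<phi> x)"
  by (rule clinear_opI)
     (simp_all add: Psi_def chart_inv_add chart_inv_scale triv_inv_add triv_inv_scale chart_inv_mem)

text \<open>\<open>x\<close> and its translate lie over the same point of the quotient, so the
  cocycle is the passage into one chart at \<open>x\<close> and out of it at the translate. The
  Lipschitz bounds assumed for charts thereby reach the cocycle.\<close>

lemma coc_Phi_Psi:
  "g \<in> carrier (Grp D) \<Longrightarrow> x \<in> Xt D \<Longrightarrow> proj D x \<in> U \<Longrightarrow> coc g x a = Psi \<phi> (act D g x) (Phi \<phi> x a)"
  by (simp add: coc_def Psi_def Phi_def chart_inv_chart triv_mem proj_act)

text \<open>At a translate, \<open>Psi\<close> is \<open>Psi\<close> at \<open>x\<close> followed by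
  a unitary map. A bound near one point thus holds near all its translates.\<close>

lemma norm_Psi_act:
  "g \<in> carrier (Grp D) \<Longrightarrow> x \<in> Xt D \<Longrightarrow> proj D x \<in> U \<Longrightarrow> norm (Psi \<phi> (act D g x) a) = norm (Psi \<phi> x a)"
proof -
  assume g: "g \<in> carrier (Grp D)" and x: "x \<in> Xt D" "proj D x \<in> U"
  have "Psi \<phi> (act D g x) a = coc g x (Psi \<phi> x a)"
    using g x by (simp add: Psi_def proj_act coc_triv_inv chart_inv_mem)
  then show ?thesis by (simp add: norm_coc g x)
qed

lemma Phi_lipschitz:
  obtains L where "L \<ge> 0" "\<And>x y a. x \<in> Xt D \<Longrightarrow> proj D x \<in> U \<Longrightarrow> y \<in> Xt D \<Longrightarrow> proj D y \<in> U
    \<Longrightarrow> norm (Phi \<phi> x a - Phi \<phi> y a) \<le> L * dst D x y * norm a"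
proof -
  have lip: "lipschitz_wrt (dst D) {x \<in> Xt D. proj D x \<in> U} (\<lambda>x. matrix (Phi \<phi> x))"
    using triv_lipschitz[OF chart] unfolding Phi_def[abs_def] .
  obtain L where L: "L \<ge> 0" "\<And>x y a. x \<in> {x \<in> Xt D. proj D x \<in> U} \<Longrightarrow> y \<in> {x \<in> Xt D. proj D x \<in> U}
      \<Longrightarrow> norm (Phi \<phi> x a - Phi \<phi> y a) \<le> L * dst D x y * norm a"
    by (rule lipschitz_matrix_op[OF lip]) (auto intro: Phi_clinear)
  show thesis by (rule that[OF L(1)]) (simp add: L(2))
qed

lemma Psi_lipschitz:
  obtains L where "L \<ge> 0" "\<And>x y a. x \<in> Xt D \<Longrightarrow> proj D x \<in> U \<Longrightarrow> y \<in> Xt D \<Longrightarrow> proj D y \<in> U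
    \<Longrightarrow> norm (Psi \<phi> x a - Psi \<phi> y a) \<le> L * dst D x y * norm a"
proof -
  have lip: "lipschitz_wrt (dst D) {x \<in> Xt D. proj D x \<in> U} (\<lambda>x. matrix (Psi \<phi> x))"
    using triv_inv_lipschitz[OF chart] unfolding Psi_def[abs_def] .
  obtain L where L: "L \<ge> 0" "\<And>x y a. x \<in> {x \<in> Xt D. proj D x \<in> U} \<Longrightarrow> y \<in> {x \<in> Xt D. proj D x \<in> U}
      \<Longrightarrow> norm (Psi \<phi> x a - Psi \<phi> y a) \<le> L * dst D x y * norm a"
    by (rule lipschitz_matrix_op[OF lip]) (auto intro: Psi_clinear)
  show thesis by (rule that[OF L(1)]) (simp add: L(2))
qed

end

lemma chart_at: "y \<in> base D \<Longrightarrow> \<exists>U \<phi>. (U, \<phi>) \<in> charts D \<and> y \<in> U"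
  using chart_cover by blast

text \<open>In the factorization through a chart both factors are Lipschitz on the whole preimage of
  the chart domain, and bounded near \<open>z\<close> and, by \<open>norm_Psi_act\<close>, near its
  translates. Translates of \<open>x\<close> and \<open>y\<close> are as far apart as
  \<open>x\<close> and \<open>y\<close>, so the product rule gives a constant that does not depend
  on \<open>g\<close>.\<close>

lemma coc_locally_lipschitz:
  assumes z: "z \<in> Xt D"
  obtains r C where "r > 0" "C \<ge> 0" "\<And>g x y a. g \<in> carrier (Grp D) \<Longrightarrow> x \<in> Xt D \<Longrightarrow> y \<in> Xt D
    \<Longrightarrow> dst D z x < r \<Longrightarrow> dst D z y < r \<Longrightarrow> norm (coc g x a - coc g y a) \<le> C * dst D x y * norm a"
proof -
  obtain U \<phi> where chart: "(U, \<phi>) \<in> charts D" and zU: "proj D z \<in> U" using chart_at[OF proj_mem[OF z]] by blast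
  obtain r where r: "r > 0" "\<And>y. y \<in> Xt D \<Longrightarrow> dst D z y < r \<Longrightarrow> proj D y \<in> U"
    using preimage_ball[OF chart_open[OF chart] z zU] by blast
  obtain L1 where L1: "L1 \<ge> 0" "\<And>x y a. x \<in> Xt D \<Longrightarrow> proj D x \<in> U \<Longrightarrow> y \<in> Xt D \<Longrightarrow> proj D y \<in> U
    \<Longrightarrow> norm (Phi \<phi> x a - Phi \<phi> y a) \<le> L1 * dst D x y * norm a" using Phi_lipschitz[OF chart] by blast
  obtain L2 where L2: "L2 \<ge> 0" "\<And>x y a. x \<in> Xt D \<Longrightarrow> proj D x \<in> U \<Longrightarrow> y \<in> Xt D \<Longrightarrow> proj D y \<in> U
    \<Longrightarrow> norm (Psi \<phi> x a - Psi \<phi> y a) \<le> L2 * dst D x y * norm a" using Psi_lipschitz[OF chart] by blast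
  obtain B1 where B1: "B1 \<ge> 0" "\<And>a. norm (Phi \<phi> z a) \<le> B1 * norm a"
    using clinear_op_bounded[OF Phi_clinear[OF chart z zU]] by blast
  obtain B2 where B2: "B2 \<ge> 0" "\<And>a. norm (Psi \<phi> z a) \<le> B2 * norm a"
    using clinear_op_bounded[OF Psi_clinear[OF chart z zU]] by blast
  have bd: "norm (F y a) \<le> (B + L * r) * norm a"
    if "L \<ge> 0" "norm (F z a) \<le> B * norm a" "norm (F z a - F y a) \<le> L * dst D z y * norm a" "dst D z y < r"
    for F :: "'a \<Rightarrow> complex ^ 'd \<Rightarrow> complex ^ 'd" and y a B L
  proof -
    have "norm (F y a) \<le> norm (F z a) + norm (F z a - F y a)"
      using norm_triangle_ineq4[of "F z a" "F z a - F y a"] by simp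
    also have "\<dots> \<le> B * norm a + L * r * norm a"
      using that by (intro add_mono order_trans[OF that(3)] mult_right_mono mult_left_mono) auto
    finally show ?thesis by (simp add: algebra_simps)
  qed
  let ?B1 = "B1 + L1 * r" and ?B2 = "B2 + L2 * r"
  show thesis
  proof (rule that[of r "?B2 * L1 + L2 * ?B1"])
    fix g x y a
    assume g: "g \<in> carrier (Grp D)" and x: "x \<in> Xt D" and y: "y \<in> Xt D" and d: "dst D z x < r" "dst D z y < r"
    have xU: "proj D x \<in> U" and yU: "proj D y \<in> U" using r(2) x y d by auto
    let ?gx = "act D g x" and ?gy = "act D g y"
    have gxU: "proj D ?gx \<in> U" "?gx \<in> Xt D" and gyU: "proj D ?gy \<in> U" "?gy \<in> Xt D"
      using xU yU x y g by (auto simp: proj_act act_mem)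
    have n1: "norm (Phi \<phi> y a) \<le> ?B1 * norm a"
      by (rule bd[OF L1(1) B1(2) L1(2)[OF z zU y yU] d(2)])
    have n2: "norm (Psi \<phi> ?gx b) \<le> ?B2 * norm b" for b
      unfolding norm_Psi_act[OF chart g x xU] by (rule bd[OF L2(1) B2(2) L2(2)[OF z zU x xU] d(1)])
    have "coc g x a - coc g y a = Psi \<phi> ?gx (Phi \<phi> x a - Phi \<phi> y a) + (Psi \<phi> ?gx (Phi \<phi> y a) - Psi \<phi> ?gy (Phi \<phi> y a))"
      by (simp add: coc_Phi_Psi[OF chart g] x y xU yU clinear_op_diff[OF Psi_clinear[OF chart gxU(2,1)]])
    then have "norm (coc g x a - coc g y a) \<le> norm (Psi \<phi> ?gx (Phi \<phi> x a - Phi \<phi> y a))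
        + norm (Psi \<phi> ?gx (Phi \<phi> y a) - Psi \<phi> ?gy (Phi \<phi> y a))"
      using norm_triangle_ineq by metis
    also have "\<dots> \<le> ?B2 * (L1 * dst D x y * norm a) + L2 * dst D ?gx ?gy * norm (Phi \<phi> y a)"
      using L1(1) L2(1) B2(1) r(1)
      by (intro add_mono order_trans[OF n2] mult_left_mono L1(2) L2(2) x y xU yU gxU gyU) auto
    also have "\<dots> \<le> ?B2 * (L1 * dst D x y * norm a) + L2 * dst D x y * (?B1 * norm a)"
      unfolding isometric[OF g x y] using L2(1) by (intro add_left_mono mult_left_mono n1) auto
    finally show "norm (coc g x a - coc g y a) \<le> (?B2 * L1 + L2 * ?B1) * dst D x y * norm a"
      by (simp add: algebra_simps)
  qed (use r L1 L2 B1 B2 in auto)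
qed

text \<open>For nearby \<open>x\<close> and \<open>y\<close>, some \<open>h\<close> moves both into
  the ball around one of finitely many centres. The cocycle of \<open>g\<close> is then the cocycle
  of \<open>g\<close> times the inverse of \<open>h\<close>, taken near the centre, after the
  cocycle of \<open>h\<close>. Each factor costs \<open>L\<close>, whence \<open>2 * L\<close>;
  distant pairs cost \<open>2 / \<delta>\<close> by unitarity.\<close>

lemma coc_uniformly_lipschitz:
  obtains C where "C \<ge> 0" "\<And>g x y a. g \<in> carrier (Grp D) \<Longrightarrow> x \<in> Xt D \<Longrightarrow> y \<in> Xt D
    \<Longrightarrow> norm (coc g x a - coc g y a) \<le> C * dst D x y * norm a"
proof -
  define P where "P z r C \<longleftrightarrow> r > 0 \<and> C \<ge> 0 \<and> (\<forall>g\<in>carrier (Grp D). \<forall>x\<in>Xt D. \<forall>y\<in>Xt D. \<forall>a.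
    dst D z x < r \<longrightarrow> dst D z y < r \<longrightarrow> norm (coc g x a - coc g y a) \<le> C * dst D x y * norm a)" for z r C
  have "\<forall>z\<in>Xt D. \<exists>r C. P z r C"
    unfolding P_def using coc_locally_lipschitz by (metis (no_types, lifting))
  then obtain r C where P: "\<And>z. z \<in> Xt D \<Longrightarrow> P z (r z) (C z)" by metis
  obtain F where F: "finite F" "F \<subseteq> Xt D" "\<And>x. x \<in> Xt D \<Longrightarrow> \<exists>z\<in>F. \<exists>g\<in>carrier (Grp D). dst D z (act D g x) < r z / 2"
    using finite_cover[of "\<lambda>z. r z / 2"] P unfolding P_def by (metis half_gt_zero)
  define \<delta> where "\<delta> = Min (insert 1 ((\<lambda>z. r z / 2) ` F))"
  define L where "L = Max (insert 0 (C ` F))"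
  have \<delta>: "\<delta> > 0" unfolding \<delta>_def using F(1,2) P by (subst Min_gr_iff) (auto simp: P_def)
  have \<delta>_le: "\<delta> \<le> r z / 2" if "z \<in> F" for z unfolding \<delta>_def using F(1) that by (intro Min_le) auto
  have L: "L \<ge> 0" unfolding L_def using F(1) by (intro Max_ge) auto
  have C_le: "C z \<le> L" if "z \<in> F" for z unfolding L_def using F(1) that by (intro Max_ge) auto
  have loc: "norm (coc g x a - coc g y a) \<le> 2 * L * dst D x y * norm a"
    if g: "g \<in> carrier (Grp D)" and x: "x \<in> Xt D" and y: "y \<in> Xt D" and d: "dst D x y < \<delta>" for g x y a
  proof -
    obtain z h where z: "z \<in> F" and h: "h \<in> carrier (Grp D)" and zx: "dst D z (act D h x) < r z / 2"
      using F(3)[OF x] by blast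
    have zX: "z \<in> Xt D" using z F(2) by blast
    let ?x = "act D h x" and ?y = "act D h y" and ?h = "inv\<^bsub>Grp D\<^esub> h"
    have xy: "?x \<in> Xt D" "?y \<in> Xt D" and hi: "?h \<in> carrier (Grp D)" using h x y by (auto simp: act_mem)
    have dxy: "dst D ?x ?y = dst D x y" using isometric[OF h x y] .
    have zy: "dst D z ?y < r z"
      using M.triangle[OF zX xy] zx d \<delta>_le[OF z] dxy by simp
    have zx': "dst D z ?x < r z" using zx P[OF zX] by (simp add: P_def)
    have lip: "norm (coc k ?x b - coc k ?y b) \<le> L * dst D x y * norm b" if k: "k \<in> carrier (Grp D)" for k b
    proof -
      have "norm (coc k ?x b - coc k ?y b) \<le> C z * dst D ?x ?y * norm b"
        using P[OF zX] k xy zx' zy unfolding P_def by blast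
      also have "\<dots> \<le> L * dst D x y * norm b"
        unfolding dxy using C_le[OF z] by (intro mult_right_mono) auto
      finally show ?thesis .
    qed
    define b c where "b = coc h x a" and "c = coc h y a"
    have nc: "norm c = norm a" by (simp add: c_def norm_coc h y)
    have a: "coc ?h ?x b = a" "coc ?h ?y c = a" by (simp_all add: b_def c_def coc_inv h x y)
    \<comment> \<open>The cocycle of \<open>h\<close> is taken at \<open>x\<close> and
      \<open>y\<close>, where no local bound is at hand. Its inverse is taken at the translates near
      the centre, and unitarity turns the bound for the inverse into one for
      \<open>b - c\<close>.\<close>
    have "norm (b - c) = norm (coc ?h ?x (b - c))" by (simp add: norm_coc hi xy)
    also have "\<dots> = norm (coc ?h ?x c - coc ?h ?y c)"
      using a by (simp add: clinear_op_diff[OF coc_clinear[OF hi xy(1)]] norm_minus_commute)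
    also have "\<dots> \<le> L * dst D x y * norm a" using lip[OF hi, of c] nc by simp
    finally have bc: "norm (b - c) \<le> L * dst D x y * norm a" .
    let ?k = "g \<otimes>\<^bsub>Grp D\<^esub> ?h"
    have k: "?k \<in> carrier (Grp D)" using g hi by simp
    have gk: "g = ?k \<otimes>\<^bsub>Grp D\<^esub> h" using g h by (simp add: Grp.m_assoc)
    have gx: "coc g x a = coc ?k ?x b" "coc g y a = coc ?k ?y c"
      using coc_mult[OF k h x, of a] coc_mult[OF k h y, of a] gk by (simp_all add: b_def c_def)
    have "coc g x a - coc g y a = coc ?k ?x (b - c) + (coc ?k ?x c - coc ?k ?y c)"
      by (simp add: gx clinear_op_diff[OF coc_clinear[OF k xy(1)]])
    then have "norm (coc g x a - coc g y a) \<le> norm (coc ?k ?x (b - c)) + norm (coc ?k ?x c - coc ?k ?y c)"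
      using norm_triangle_ineq by metis
    also have "\<dots> \<le> L * dst D x y * norm a + L * dst D x y * norm a"
      using bc lip[OF k, of c] unfolding nc norm_coc[OF k xy(1)] by (rule add_mono)
    finally show ?thesis by (simp add: algebra_simps)
  qed
  show thesis
  proof (rule that[of "2 * L + 2 / \<delta>"])
    fix g x y a assume g: "g \<in> carrier (Grp D)" and x: "x \<in> Xt D" and y: "y \<in> Xt D"
    have "norm (coc g x a - coc g y a) \<le> (2 * L * norm a + 2 * norm a / \<delta>) * dst D x y"
      by (rule lipschitz_from_local[OF \<delta>, of "norm a" "2 * L * norm a" "\<lambda>x. coc g x a"])
         (use L loc[OF g] x y in \<open>auto simp: norm_coc g mult.commute mult.left_commute\<close>)
    then show "norm (coc g x a - coc g y a) \<le> (2 * L + 2 / \<delta>) * dst D x y * norm a"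
      by (simp add: algebra_simps)
  qed (use L \<delta> in auto)
qed

section \<open>Bundle maps and sections in coordinates on the covering space\<close>

definition pullf :: "('a set \<Rightarrow> 'e \<Rightarrow> 'e) \<Rightarrow> 'a \<Rightarrow> complex ^ 'd \<Rightarrow> complex ^ 'd" where
  "pullf h x a = triv_inv D x (h (proj D x) (triv D x a))"

text \<open>\<open>End_bundle D\<close> without its continuity clause. The algebra is done here, and
  continuity is recovered from Lipschitz coordinates by \<open>fibre_map_continuous\<close>.\<close>

definition fibre_maps :: "('a set \<Rightarrow> 'e \<Rightarrow> 'e) set" where
  "fibre_maps = {h. (\<forall>y\<in>base D. linear_on (scal D) (scal D) (fibre D y) (h y) \<and> h y ` fibre D y \<subseteq> fibre D y) \<and>
    (\<forall>y v. \<not> (y \<in> base D \<and> v \<in> fibre D y) \<longrightarrow> h y v = 0)}"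

definition fibre_sections :: "('a set \<Rightarrow> 'e) set" where
  "fibre_sections = {s. (\<forall>y\<in>base D. s y \<in> fibre D y) \<and> (\<forall>y. y \<notin> base D \<longrightarrow> s y = 0)}"

lemma fibre_map_mem: "h \<in> fibre_maps \<Longrightarrow> y \<in> base D \<Longrightarrow> v \<in> fibre D y \<Longrightarrow> h y v \<in> fibre D y"
  and fibre_map_add: "h \<in> fibre_maps \<Longrightarrow> y \<in> base D \<Longrightarrow> u \<in> fibre D y \<Longrightarrow> v \<in> fibre D y \<Longrightarrow> h y (u + v) = h y u + h y v"
  and fibre_map_scale: "h \<in> fibre_maps \<Longrightarrow> y \<in> base D \<Longrightarrow> v \<in> fibre D y \<Longrightarrow> h y (scal D c v) = scal D c (h y v)"
  and fibre_map_outside: "h \<in> fibre_maps \<Longrightarrow> \<not> (y \<in> base D \<and> v \<in> fibre D y) \<Longrightarrow> h y v = 0"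
  by (auto simp: fibre_maps_def linear_on_def image_subset_iff)

lemma fibre_mapsI:
  assumes "\<And>y v. y \<in> base D \<Longrightarrow> v \<in> fibre D y \<Longrightarrow> h y v \<in> fibre D y"
    and "\<And>y u v. y \<in> base D \<Longrightarrow> u \<in> fibre D y \<Longrightarrow> v \<in> fibre D y \<Longrightarrow> h y (u + v) = h y u + h y v"
    and "\<And>y v c. y \<in> base D \<Longrightarrow> v \<in> fibre D y \<Longrightarrow> h y (scal D c v) = scal D c (h y v)"
    and "\<And>y v. \<not> (y \<in> base D \<and> v \<in> fibre D y) \<Longrightarrow> h y v = 0"
  shows "h \<in> fibre_maps"
  using assms by (auto simp: fibre_maps_def linear_on_def)

lemma fibre_map_0: "h \<in> fibre_maps \<Longrightarrow> h y 0 = 0"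
  using fibre_map_scale[of h y 0 0] fibre_map_outside[of h y 0] fibre_0[of y] by auto

lemma triv_pullf: "h \<in> fibre_maps \<Longrightarrow> x \<in> Xt D \<Longrightarrow> triv D x (pullf h x a) = h (proj D x) (triv D x a)"
  by (simp add: pullf_def triv_triv_inv fibre_map_mem triv_mem)

lemma pullf_clinear: "h \<in> fibre_maps \<Longrightarrow> x \<in> Xt D \<Longrightarrow> clinear_op (pullf h x)"
  by (rule clinear_opI)
     (simp_all add: pullf_def triv_add triv_scale fibre_map_add fibre_map_scale triv_mem fibre_map_mem triv_inv_add triv_inv_scale)

lemma pullf_act:
  "h \<in> fibre_maps \<Longrightarrow> g \<in> carrier (Grp D) \<Longrightarrow> x \<in> Xt D \<Longrightarrow> pullf h (act D g x) (coc g x a) = coc g x (pullf h x a)"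
  by (simp add: pullf_def triv_coc proj_act coc_triv_inv fibre_map_mem triv_mem)

lemma fibre_map_eq:
  "h \<in> fibre_maps \<Longrightarrow> x \<in> Xt D \<Longrightarrow> v \<in> fibre D (proj D x) \<Longrightarrow> h (proj D x) v = triv D x (pullf h x (triv_inv D x v))"
  by (simp add: triv_pullf triv_triv_inv)

lemma fibre_maps_eqI:
  assumes h: "h \<in> fibre_maps" and k: "k \<in> fibre_maps" and eq: "\<And>x a. x \<in> Xt D \<Longrightarrow> pullf h x a = pullf k x a"
  shows "h = k"
proof (intro ext)
  fix y v
  show "h y v = k y v"
  proof (cases "y \<in> base D \<and> v \<in> fibre D y")
    case True
    then obtain x where "x \<in> Xt D" "y = proj D x" by (auto simp: base_eq)
    then show ?thesis using True h k eq by (simp add: fibre_map_eq)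
  next
    case False
    then show ?thesis using h k by (simp add: fibre_map_outside)
  qed
qed

text \<open>The very choice of representative made in \<open>transfer\<close>, so that
  \<open>transfer_eq\<close> is a matter of unfolding.\<close>

definition lift :: "'a set \<Rightarrow> 'a" where "lift y = (SOME x. x \<in> Xt D \<and> proj D x = y)"

lemma lift: "y \<in> base D \<Longrightarrow> lift y \<in> Xt D \<and> proj D (lift y) = y"
  unfolding lift_def by (rule someI_ex) (auto simp: base_eq)

lemma lift_mem: "x \<in> Xt D \<Longrightarrow> lift (proj D x) \<in> Xt D" and proj_lift: "x \<in> Xt D \<Longrightarrow> proj D (lift (proj D x)) = proj D x"
  using lift[OF proj_mem] by auto

definition descend_map :: "('a \<Rightarrow> complex ^ 'd \<Rightarrow> complex ^ 'd) \<Rightarrow> 'a set \<Rightarrow> 'e \<Rightarrow> 'e" where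
  "descend_map H y v = (if y \<in> base D \<and> v \<in> fibre D y then triv D (lift y) (H (lift y) (triv_inv D (lift y) v)) else 0)"

text \<open>The chosen lift differs from \<open>x\<close> by a group element, and equivariance under
  the cocycle absorbs it.\<close>

lemma descend_map:
  assumes lin: "\<And>x. x \<in> Xt D \<Longrightarrow> clinear_op (H x)"
    and eqv: "\<And>g x a. g \<in> carrier (Grp D) \<Longrightarrow> x \<in> Xt D \<Longrightarrow> H (act D g x) (coc g x a) = coc g x (H x a)"
  shows descend_map_mem: "descend_map H \<in> fibre_maps"
    and pullf_descend_map: "x \<in> Xt D \<Longrightarrow> pullf (descend_map H) x a = H x a"
proof -
  show "descend_map H \<in> fibre_maps"
    unfolding fibre_maps_def
  proof (intro CollectI conjI ballI allI impI)
    fix y assume y: "y \<in> base D"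
    have l: "lift y \<in> Xt D" "proj D (lift y) = y" using lift[OF y] by auto
    have ti: "triv_inv D (lift y) (u + v) = triv_inv D (lift y) u + triv_inv D (lift y) v"
      "triv_inv D (lift y) (scal D c v) = c *s triv_inv D (lift y) v"
      if "u \<in> fibre D y" "v \<in> fibre D y" for u v c
      using triv_inv_add[OF l(1)] triv_inv_scale[OF l(1)] that l(2) by auto
    show "linear_on (scal D) (scal D) (fibre D y) (descend_map H y)"
      unfolding linear_on_def descend_map_def
      using y l ti lin[OF l(1)] fibre_add[OF y] fibre_scale[OF y]
      by (auto simp: clinear_op_add clinear_op_scale triv_add triv_scale)
    show "descend_map H y ` fibre D y \<subseteq> fibre D y"
      using y triv_mem[OF l(1)] l(2) by (auto simp: descend_map_def)
  qed (auto simp: descend_map_def)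
  assume x: "x \<in> Xt D"
  let ?l = "lift (proj D x)"
  obtain g where g: "g \<in> carrier (Grp D)" "x = act D g ?l"
    using proj_eqD[OF lift_mem[OF x] x proj_lift[OF x]] by blast
  have l: "?l \<in> Xt D" "proj D ?l = proj D x" using lift_mem proj_lift x by auto
  have v: "triv D x a \<in> fibre D (proj D ?l)" using triv_mem x l by simp
  let ?b = "triv_inv D ?l (triv D x a)"
  have b: "coc g ?l ?b = a" using coc_triv_inv[OF g(1) l(1) v] g(2) x by simp
  have "pullf (descend_map H) x a = triv_inv D x (triv D ?l (H ?l ?b))"
    using x triv_mem[OF x, of a] by (simp add: pullf_def descend_map_def)
  also have "\<dots> = coc g ?l (H ?l ?b)" by (simp add: coc_def flip: g(2))
  also have "\<dots> = H x a" using eqv[OF g(1) l(1), of ?b] b g(2) by simp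
  finally show "pullf (descend_map H) x a = H x a" .
qed

lemma fibre_section_mem: "s \<in> fibre_sections \<Longrightarrow> y \<in> base D \<Longrightarrow> s y \<in> fibre D y"
  by (simp add: fibre_sections_def)

lemma triv_pull_section: "s \<in> fibre_sections \<Longrightarrow> x \<in> Xt D \<Longrightarrow> triv D x (pull_section D s x) = s (proj D x)"
  by (simp add: pull_section_def triv_triv_inv fibre_section_mem)

lemma pull_section_act:
  "s \<in> fibre_sections \<Longrightarrow> g \<in> carrier (Grp D) \<Longrightarrow> x \<in> Xt D \<Longrightarrow> pull_section D s (act D g x) = coc g x (pull_section D s x)"
  by (simp add: pull_section_def proj_act coc_triv_inv fibre_section_mem)

lemma fibre_norm_section: "s \<in> fibre_sections \<Longrightarrow> x \<in> Xt D \<Longrightarrow> fibre_norm D (proj D x) (s (proj D x)) = norm (pull_section D s x)"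
  by (simp add: pull_section_def fibre_norm_triv_inv fibre_section_mem)

definition descend_section :: "('a \<Rightarrow> complex ^ 'd) \<Rightarrow> 'a set \<Rightarrow> 'e" where
  "descend_section f y = (if y \<in> base D then triv D (lift y) (f (lift y)) else 0)"

lemma descend_section:
  assumes eqv: "\<And>g x. g \<in> carrier (Grp D) \<Longrightarrow> x \<in> Xt D \<Longrightarrow> f (act D g x) = coc g x (f x)"
  shows descend_section_mem: "descend_section f \<in> fibre_sections"
    and pull_descend_section: "x \<in> Xt D \<Longrightarrow> pull_section D (descend_section f) x = f x"
proof -
  have "triv D (lift y) (f (lift y)) \<in> fibre D y" if "y \<in> base D" for y
    using triv_mem[of "lift y"] lift[OF that] by simp
  then show "descend_section f \<in> fibre_sections"
    by (simp add: fibre_sections_def descend_section_def)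
  assume x: "x \<in> Xt D"
  let ?l = "lift (proj D x)"
  obtain g where g: "g \<in> carrier (Grp D)" "x = act D g ?l"
    using proj_eqD[OF lift_mem[OF x] x proj_lift[OF x]] by blast
  have "pull_section D (descend_section f) x = triv_inv D x (triv D ?l (f ?l))"
    using x by (simp add: pull_section_def descend_section_def)
  also have "\<dots> = coc g ?l (f ?l)" by (simp add: coc_def flip: g(2))
  also have "\<dots> = f x" using eqv[OF g(1) lift_mem[OF x]] g(2) by simp
  finally show "pull_section D (descend_section f) x = f x" .
qed

text \<open>Bounds at finitely many centres spread over unit balls by the Lipschitz estimate and
  along orbits by invariance. The invariance is stated through norms alone so that it serves bundle
  maps, the map \<open>m\<close>, whose source and target transform by different cocycle values, and
  sections.\<close>

lemma equivariant_lipschitz_bounded: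
  fixes H :: "'a \<Rightarrow> complex ^ 'd \<Rightarrow> complex ^ 'd"
  assumes K: "\<And>x y a. x \<in> Xt D \<Longrightarrow> y \<in> Xt D \<Longrightarrow> norm (H x a - H y a) \<le> K * dst D x y * norm a" "0 \<le> K"
    and bd: "\<And>z. z \<in> Xt D \<Longrightarrow> \<exists>B. \<forall>a. norm (H z a) \<le> B * norm a"
    and eqv: "\<And>g x a. g \<in> carrier (Grp D) \<Longrightarrow> x \<in> Xt D \<Longrightarrow> \<exists>b. norm b = norm a \<and> norm (H x a) = norm (H (act D g x) b)"
  obtains B where "B \<ge> 0" "\<And>x a. x \<in> Xt D \<Longrightarrow> norm (H x a) \<le> B * norm a"
proof -
  obtain F where F: "finite F" "F \<subseteq> Xt D" "\<And>x. x \<in> Xt D \<Longrightarrow> \<exists>z\<in>F. \<exists>g\<in>carrier (Grp D). dst D z (act D g x) < 1"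
    using finite_cover[of "\<lambda>_. 1"] by auto
  obtain b where b: "\<And>z a. z \<in> Xt D \<Longrightarrow> norm (H z a) \<le> b z * norm a" using bd by metis
  define B where "B = Max (insert 0 (b ` F)) + K"
  have b_le: "b z \<le> Max (insert 0 (b ` F))" if "z \<in> F" for z using F(1) that by (intro Max_ge) auto
  have M0: "0 \<le> Max (insert 0 (b ` F))" using F(1) by (intro Max_ge) auto
  show thesis
  proof (rule that[of B])
    show "B \<ge> 0" using M0 K(2) by (simp add: B_def)
    fix x a assume x: "x \<in> Xt D"
    obtain z g where z: "z \<in> F" and g: "g \<in> carrier (Grp D)" and d: "dst D z (act D g x) < 1" using F(3)[OF x] by blast
    obtain c where c: "norm c = norm a" "norm (H x a) = norm (H (act D g x) c)" using eqv[OF g x] by blast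
    have zX: "z \<in> Xt D" using z F(2) by blast
    have "norm (H (act D g x) c) \<le> norm (H z c) + norm (H z c - H (act D g x) c)"
      using norm_triangle_ineq4[of "H z c" "H z c - H (act D g x) c"] by simp
    also have "\<dots> \<le> Max (insert 0 (b ` F)) * norm c + K * 1 * norm c"
      using d K by (intro add_mono order_trans[OF b[OF zX]] order_trans[OF K(1)[OF zX act_mem[OF g x]]] mult_right_mono mult_left_mono b_le z) auto
    finally show "norm (H x a) \<le> B * norm a" using c by (simp add: B_def algebra_simps)
  qed
qed

lemma product_locally_lipschitz:
  fixes P :: "'a \<Rightarrow> complex ^ 'd \<Rightarrow> complex ^ 'd"
  assumes P: "\<And>y a. y \<in> Xt D \<Longrightarrow> dst D x y < r \<Longrightarrow> norm (P y a - P x a) \<le> K1 * dst D x y * norm a" "0 \<le> K1"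
    and lin: "clinear_op (P x)"
    and f: "\<And>y. y \<in> Xt D \<Longrightarrow> dst D x y < r \<Longrightarrow> norm (f y - f x) \<le> K2 * dst D x y" "0 \<le> K2"
  obtains K where "0 \<le> K" "\<And>y. y \<in> Xt D \<Longrightarrow> dst D x y < r \<Longrightarrow> norm (P y (f y) - P x (f x)) \<le> K * dst D x y"
proof -
  obtain B where B: "B \<ge> 0" "\<And>a. norm (P x a) \<le> B * norm a" using clinear_op_bounded[OF lin] by blast
  show thesis
  proof (rule that[of "K1 * (norm (f x) + K2 * \<bar>r\<bar>) + B * K2"])
    fix y assume y: "y \<in> Xt D" "dst D x y < r"
    have "norm (f y) \<le> norm (f x) + norm (f y - f x)" using norm_triangle_ineq[of "f x" "f y - f x"] by simp
    also have "\<dots> \<le> norm (f x) + K2 * \<bar>r\<bar>"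
      using y f(2) by (intro add_left_mono order_trans[OF f(1)[OF y]] mult_left_mono) auto
    finally have fy: "norm (f y) \<le> norm (f x) + K2 * \<bar>r\<bar>" .
    have "P y (f y) - P x (f x) = (P y (f y) - P x (f y)) + P x (f y - f x)"
      by (simp add: clinear_op_diff[OF lin])
    then have "norm (P y (f y) - P x (f x)) \<le> norm (P y (f y) - P x (f y)) + norm (P x (f y - f x))"
      using norm_triangle_ineq by metis
    also have "\<dots> \<le> K1 * dst D x y * (norm (f x) + K2 * \<bar>r\<bar>) + B * (K2 * dst D x y)"
      using P(2) B(1) by (intro add_mono order_trans[OF P(1)[OF y]] order_trans[OF B(2)] mult_left_mono fy f(1)[OF y]) auto
    finally show "norm (P y (f y) - P x (f x)) \<le> (K1 * (norm (f x) + K2 * \<bar>r\<bar>) + B * K2) * dst D x y"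
      by (simp add: algebra_simps)
  qed (use P(2) f(2) B(1) in auto)
qed

lemma Phi_locally:
  assumes chart: "(U, \<phi>) \<in> charts D" and x: "x \<in> Xt D" "proj D x \<in> U"
  obtains r K where "r > 0" "\<And>y. y \<in> Xt D \<Longrightarrow> dst D x y < r \<Longrightarrow> proj D y \<in> U" "0 \<le> K"
    "\<And>y a. y \<in> Xt D \<Longrightarrow> dst D x y < r \<Longrightarrow> norm (Phi \<phi> y a - Phi \<phi> x a) \<le> K * dst D x y * norm a"
    "\<And>y a. y \<in> Xt D \<Longrightarrow> dst D x y < r \<Longrightarrow> norm (Psi \<phi> y a - Psi \<phi> x a) \<le> K * dst D x y * norm a"
proof -
  obtain r where r: "r > 0" "\<And>y. y \<in> Xt D \<Longrightarrow> dst D x y < r \<Longrightarrow> proj D y \<in> U"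
    using preimage_ball[OF chart_open[OF chart] x] by blast
  obtain L1 where L1: "L1 \<ge> 0" "\<And>x y a. x \<in> Xt D \<Longrightarrow> proj D x \<in> U \<Longrightarrow> y \<in> Xt D \<Longrightarrow> proj D y \<in> U
    \<Longrightarrow> norm (Phi \<phi> x a - Phi \<phi> y a) \<le> L1 * dst D x y * norm a" using Phi_lipschitz[OF chart] by blast
  obtain L2 where L2: "L2 \<ge> 0" "\<And>x y a. x \<in> Xt D \<Longrightarrow> proj D x \<in> U \<Longrightarrow> y \<in> Xt D \<Longrightarrow> proj D y \<in> U
    \<Longrightarrow> norm (Psi \<phi> x a - Psi \<phi> y a) \<le> L2 * dst D x y * norm a" using Psi_lipschitz[OF chart] by blast
  show thesis
  proof (rule that[OF r, of "L1 + L2"])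
    fix y a assume y: "y \<in> Xt D" "dst D x y < r"
    have "norm (Phi \<phi> y a - Phi \<phi> x a) \<le> L1 * dst D x y * norm a"
      using L1(2)[OF y(1) r(2)[OF y] x] by (simp add: M.commute)
    also have "\<dots> \<le> (L1 + L2) * dst D x y * norm a" using L2(1) by (intro mult_right_mono) auto
    finally show "norm (Phi \<phi> y a - Phi \<phi> x a) \<le> (L1 + L2) * dst D x y * norm a" .
    have "norm (Psi \<phi> y a - Psi \<phi> x a) \<le> L2 * dst D x y * norm a"
      using L2(2)[OF y(1) r(2)[OF y] x] by (simp add: M.commute)
    also have "\<dots> \<le> (L1 + L2) * dst D x y * norm a" using L1(1) by (intro mult_right_mono) auto
    finally show "norm (Psi \<phi> y a - Psi \<phi> x a) \<le> (L1 + L2) * dst D x y * norm a" .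
  qed (use L1 L2 in auto)
qed

lemma section_continuous:
  assumes s: "s \<in> fibre_sections" and chart: "(U, \<phi>) \<in> charts D"
    and K: "\<And>x y. x \<in> Xt D \<Longrightarrow> y \<in> Xt D \<Longrightarrow> norm (pull_section D s x - pull_section D s y) \<le> K * dst D x y" "0 \<le> K"
  shows "continuous_map (subtopology (base_top D) U) euclidean (\<lambda>y. \<phi> y (s y))"
proof (rule continuous_on_base[OF chart_open[OF chart]])
  fix x assume x: "x \<in> Xt D" "proj D x \<in> U"
  obtain r K1 where r: "r > 0" "\<And>y. y \<in> Xt D \<Longrightarrow> dst D x y < r \<Longrightarrow> proj D y \<in> U" "0 \<le> K1"
    "\<And>y a. y \<in> Xt D \<Longrightarrow> dst D x y < r \<Longrightarrow> norm (Phi \<phi> y a - Phi \<phi> x a) \<le> K1 * dst D x y * norm a"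
    by (rule Phi_locally[OF chart x]) blast
  have eq: "\<phi> (proj D y) (s (proj D y)) = Phi \<phi> y (pull_section D s y)" if "y \<in> Xt D" for y
    using that s by (simp add: Phi_def triv_pull_section)
  have f: "norm (pull_section D s y - pull_section D s x) \<le> K * dst D x y" if "y \<in> Xt D" "dst D x y < r" for y
    using K(1)[OF that(1) x(1)] by (simp add: M.commute)
  obtain K' where K': "0 \<le> K'" "\<And>y. y \<in> Xt D \<Longrightarrow> dst D x y < r
      \<Longrightarrow> norm (Phi \<phi> y (pull_section D s y) - Phi \<phi> x (pull_section D s x)) \<le> K' * dst D x y"
    by (rule product_locally_lipschitz[of x r "Phi \<phi>" K1 "pull_section D s" K, OF r(4,3) Phi_clinear[OF chart x] f K(2)]) (assumption+, rule that)
  show "((\<lambda>y. \<phi> (proj D y) (s (proj D y))) \<longlongrightarrow> \<phi> (proj D x) (s (proj D x))) (atin (covered D) x)"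
    by (rule lipschitz_tendsto[OF x(1) r(1)]) (use K'(2) eq x(1) in auto)
qed

text \<open>In a chart the map is the product of \<open>Phi\<close>, the coordinates of
  \<open>h\<close> and \<open>Psi\<close>, all three locally Lipschitz;
  \<open>product_locally_lipschitz\<close> is applied twice.\<close>

lemma fibre_map_continuous:
  assumes h: "h \<in> fibre_maps" and chart: "(U, \<phi>) \<in> charts D"
    and K: "\<And>x y a. x \<in> Xt D \<Longrightarrow> y \<in> Xt D \<Longrightarrow> norm (pullf h x a - pullf h y a) \<le> K * dst D x y * norm a" "0 \<le> K"
  shows "continuous_map (subtopology (base_top D) U) euclidean (\<lambda>y. matrix (\<lambda>a. \<phi> y (h y (chart_inv D \<phi> y a))))"
proof (rule continuous_on_base[OF chart_open[OF chart]])
  fix x assume x: "x \<in> Xt D" "proj D x \<in> U"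
  obtain r K1 where r: "r > 0" "\<And>y. y \<in> Xt D \<Longrightarrow> dst D x y < r \<Longrightarrow> proj D y \<in> U" "0 \<le> K1"
    "\<And>y a. y \<in> Xt D \<Longrightarrow> dst D x y < r \<Longrightarrow> norm (Phi \<phi> y a - Phi \<phi> x a) \<le> K1 * dst D x y * norm a"
    "\<And>y a. y \<in> Xt D \<Longrightarrow> dst D x y < r \<Longrightarrow> norm (Psi \<phi> y a - Psi \<phi> x a) \<le> K1 * dst D x y * norm a"
    by (rule Phi_locally[OF chart x]) blast
  have H: "norm (pullf h y a - pullf h x a) \<le> K * dst D x y * norm a" if "y \<in> Xt D" "dst D x y < r" for y a
    using K(1)[OF that(1) x(1)] by (simp add: M.commute)
  have eq: "\<phi> (proj D y) (h (proj D y) (chart_inv D \<phi> (proj D y) a)) = Phi \<phi> y (pullf h y (Psi \<phi> y a))"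
    if "y \<in> Xt D" "proj D y \<in> U" for y a
    using that h chart_inv_mem[OF chart]
    by (simp add: Phi_def Psi_def triv_pullf triv_triv_inv)
  have lim: "((\<lambda>y. \<phi> (proj D y) (h (proj D y) (chart_inv D \<phi> (proj D y) a))) \<longlongrightarrow>
      \<phi> (proj D x) (h (proj D x) (chart_inv D \<phi> (proj D x) a))) (atin (covered D) x)" for a
  proof -
    have n: "0 \<le> K1 * norm a" using r(3) by simp
    have Psi: "norm (Psi \<phi> y a - Psi \<phi> x a) \<le> (K1 * norm a) * dst D x y" if "y \<in> Xt D" "dst D x y < r" for y
      using r(5)[OF that, of a] by (simp add: mult_ac)
    obtain K2 where K2: "0 \<le> K2" "\<And>y. y \<in> Xt D \<Longrightarrow> dst D x y < r
        \<Longrightarrow> norm (pullf h y (Psi \<phi> y a) - pullf h x (Psi \<phi> x a)) \<le> K2 * dst D x y"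
      by (rule product_locally_lipschitz[of x r "pullf h" K "\<lambda>y. Psi \<phi> y a", OF H K(2) pullf_clinear[OF h x(1)] Psi n]) (assumption+, rule that)
    obtain K3 where K3: "0 \<le> K3" "\<And>y. y \<in> Xt D \<Longrightarrow> dst D x y < r
        \<Longrightarrow> norm (Phi \<phi> y (pullf h y (Psi \<phi> y a)) - Phi \<phi> x (pullf h x (Psi \<phi> x a))) \<le> K3 * dst D x y"
      by (rule product_locally_lipschitz[of x r "Phi \<phi>" K1 "\<lambda>y. pullf h y (Psi \<phi> y a)", OF r(4,3) Phi_clinear[OF chart x] K2(2,1)]) (assumption+, rule that)
    show ?thesis
      by (rule lipschitz_tendsto[OF x(1) r(1)]) (use K3(2) eq x r(2) in auto)
  qed
  show "((\<lambda>y. matrix (\<lambda>a. \<phi> (proj D y) (h (proj D y) (chart_inv D \<phi> (proj D y) a)))) \<longlongrightarrow>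
      matrix (\<lambda>a. \<phi> (proj D x) (h (proj D x) (chart_inv D \<phi> (proj D x) a)))) (atin (covered D) x)"
    unfolding matrix_def by (intro vec_tendstoI) (use tendsto_vec_nth[OF lim] in auto)
qed

section \<open>The Lipschitz norm of sections\<close>

lemma lip_sectionsD:
  assumes "s \<in> lip_sections D"
  obtains K where "s \<in> fibre_sections" "0 \<le> K"
    "\<And>x y. x \<in> Xt D \<Longrightarrow> y \<in> Xt D \<Longrightarrow> norm (pull_section D s x - pull_section D s y) \<le> K * dst D x y"
proof -
  obtain C where C: "\<And>x y. x \<in> Xt D \<Longrightarrow> y \<in> Xt D \<Longrightarrow> dist (pull_section D s x) (pull_section D s y) \<le> C * dst D x y"
    using assms unfolding lip_sections_def lipschitz_wrt_def by blast
  show thesis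
  proof (rule that[of "\<bar>C\<bar>"])
    show "s \<in> fibre_sections" using assms by (auto simp: lip_sections_def sections_def fibre_sections_def)
    fix x y assume "x \<in> Xt D" "y \<in> Xt D"
    then show "norm (pull_section D s x - pull_section D s y) \<le> \<bar>C\<bar> * dst D x y"
      using order_trans[OF C mult_right_mono[OF abs_ge_self[of C] M.nonneg]] by (simp add: dist_norm)
  qed simp
qed

lemma lip_sectionsI:
  assumes s: "s \<in> fibre_sections" and "0 \<le> K"
    and K: "\<And>x y. x \<in> Xt D \<Longrightarrow> y \<in> Xt D \<Longrightarrow> norm (pull_section D s x - pull_section D s y) \<le> K * dst D x y"
  shows "s \<in> lip_sections D"
proof -
  have "s \<in> sections D"
    using s section_continuous[OF s _ K assms(2)] by (auto simp: sections_def fibre_sections_def)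
  then show ?thesis using K by (auto simp: lip_sections_def lipschitz_wrt_def dist_norm)
qed

lemma pull_section_bounded:
  assumes "s \<in> lip_sections D"
  obtains B where "0 \<le> B" "\<And>x. x \<in> Xt D \<Longrightarrow> norm (pull_section D s x) \<le> B"
proof -
  obtain K where s: "s \<in> fibre_sections" and K: "0 \<le> K"
    "\<And>x y. x \<in> Xt D \<Longrightarrow> y \<in> Xt D \<Longrightarrow> norm (pull_section D s x - pull_section D s y) \<le> K * dst D x y"
    using lip_sectionsD[OF assms] by blast
  \<comment> \<open>A section is recast as a family of maps, nonlinear but homogeneous in norm, to
    fit the boundedness lemma; a unit vector \<open>a\<close> gives the section back.\<close>
  let ?H = "\<lambda>x (a :: complex ^ 'd). norm a *\<^sub>R pull_section D s x"
  obtain B where B: "B \<ge> 0" "\<And>x a. x \<in> Xt D \<Longrightarrow> norm (?H x a) \<le> B * norm a"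
  proof (rule equivariant_lipschitz_bounded[of ?H K])
    fix x y a assume x: "x \<in> Xt D" and y: "y \<in> Xt D"
    have "norm (?H x a - ?H y a) = norm a * norm (pull_section D s x - pull_section D s y)"
      by (simp flip: scaleR_diff_right)
    also have "\<dots> \<le> norm a * (K * dst D x y)" using K x y by (intro mult_left_mono) auto
    finally show "norm (?H x a - ?H y a) \<le> K * dst D x y * norm a" by (simp add: mult_ac)
  next
    fix z assume "z \<in> Xt D"
    show "\<exists>B. \<forall>a. norm (?H z a) \<le> B * norm a" by (intro exI[of _ "norm (pull_section D s z)"]) (simp add: mult.commute)
  next
    fix g x a assume "g \<in> carrier (Grp D)" "x \<in> Xt D"
    then show "\<exists>b. norm b = norm a \<and> norm (?H x a) = norm (?H (act D g x) b)"
      using s by (intro exI[of _ a]) (simp add: pull_section_act norm_coc)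
  qed (use K(1) in auto)
  show thesis by (rule that[OF B(1)]) (use B(2)[of _ "axis undefined 1"] in \<open>simp add: norm_axis_1\<close>)
qed

text \<open>The two real suprema in \<open>lip_norm\<close> dominate their members only once
  boundedness is known. \<open>pull_section_bounded\<close> supplies it for the first and the
  Lipschitz constant for the second.\<close>

lemma lip_norm_bounds:
  assumes s: "s \<in> lip_sections D"
  shows norm_pull_section_le: "x \<in> Xt D \<Longrightarrow> norm (pull_section D s x) \<le> lip_norm D s"
    and dist_pull_section_le: "x \<in> Xt D \<Longrightarrow> y \<in> Xt D \<Longrightarrow> norm (pull_section D s x - pull_section D s y) \<le> lip_norm D s * dst D x y"
    and lip_norm_nonneg: "0 \<le> lip_norm D s"
proof -
  obtain K where fs: "s \<in> fibre_sections" and K: "0 \<le> K"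
    "\<And>x y. x \<in> Xt D \<Longrightarrow> y \<in> Xt D \<Longrightarrow> norm (pull_section D s x - pull_section D s y) \<le> K * dst D x y"
    using lip_sectionsD[OF s] by blast
  obtain B where B: "0 \<le> B" "\<And>x. x \<in> Xt D \<Longrightarrow> norm (pull_section D s x) \<le> B" using pull_section_bounded[OF s] by blast
  define S1 where "S1 = (SUP y\<in>base D. fibre_norm D y (s y))"
  define q where "q = (\<lambda>(x, y). norm (pull_section D s x - pull_section D s y) / dst D x y)"
  define S2 where "S2 = (SUP p\<in>Xt D \<times> Xt D. q p)"
  have eq: "lip_norm D s = S1 + S2" by (simp add: lip_norm_def S1_def S2_def q_def)
  have bdd1: "bdd_above ((\<lambda>y. fibre_norm D y (s y)) ` base D)"
    using B(2) fibre_norm_section[OF fs] by (intro bdd_aboveI2[of _ _ B]) (auto simp: base_eq)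
  have bdd2: "bdd_above (q ` (Xt D \<times> Xt D))"
  proof (intro bdd_aboveI2[of _ _ K])
    fix p assume "p \<in> Xt D \<times> Xt D"
    then obtain x y where p: "p = (x, y)" "x \<in> Xt D" "y \<in> Xt D" by blast
    show "q p \<le> K"
    proof (cases "dst D x y = 0")
      case False
      then have "0 < dst D x y" using M.nonneg[of x y] by linarith
      then show ?thesis using K(2)[OF p(2,3)] p(1) by (simp add: q_def divide_le_eq)
    qed (use K(1) p(1) in \<open>simp add: q_def\<close>)
  qed
  have n1: "norm (pull_section D s x) \<le> S1" if "x \<in> Xt D" for x
    unfolding S1_def fibre_norm_section[OF fs that, symmetric] by (rule cSUP_upper[OF proj_mem[OF that] bdd1])
  have n2: "q (x, y) \<le> S2" if "x \<in> Xt D" "y \<in> Xt D" for x y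
    unfolding S2_def by (rule cSUP_upper[OF _ bdd2]) (use that in simp)
  have "0 \<le> S1" using n1[OF fixed_point(1)] norm_ge_zero order_trans by blast
  moreover have "0 \<le> S2" using n2[OF fixed_point(1) fixed_point(1)] by (simp add: q_def)
  ultimately show "0 \<le> lip_norm D s" "x \<in> Xt D \<Longrightarrow> norm (pull_section D s x) \<le> lip_norm D s"
    using n1[of x] eq by auto
  assume xy: "x \<in> Xt D" "y \<in> Xt D"
  show "norm (pull_section D s x - pull_section D s y) \<le> lip_norm D s * dst D x y"
  proof (cases "dst D x y = 0")
    case True
    then show ?thesis using M.zero[OF xy] by simp
  next
    case False
    then have "0 < dst D x y" using M.nonneg[of x y] by linarith
    moreover have "q (x, y) \<le> lip_norm D s" using n2[OF xy] \<open>0 \<le> S1\<close> eq by simp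
    ultimately show ?thesis by (simp add: q_def divide_le_eq)
  qed
qed

lemma lip_norm_le:
  assumes s: "s \<in> fibre_sections" and "0 \<le> K" and B: "\<And>x. x \<in> Xt D \<Longrightarrow> norm (pull_section D s x) \<le> B"
    and K: "\<And>x y. x \<in> Xt D \<Longrightarrow> y \<in> Xt D \<Longrightarrow> norm (pull_section D s x - pull_section D s y) \<le> K * dst D x y"
  shows "lip_norm D s \<le> B + K"
  unfolding lip_norm_def
proof (rule add_mono)
  show "(SUP y\<in>base D. fibre_norm D y (s y)) \<le> B"
  proof (rule cSUP_least)
    fix y assume "y \<in> base D"
    then obtain x where "x \<in> Xt D" "y = proj D x" by (auto simp: base_eq)
    then show "fibre_norm D y (s y) \<le> B" using B fibre_norm_section[OF s] by simp
  qed (use fixed_point base_eq in auto)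
  show "(SUP (x, y)\<in>Xt D \<times> Xt D. norm (pull_section D s x - pull_section D s y) / dst D x y) \<le> K"
  proof (rule cSUP_least)
    fix p assume "p \<in> Xt D \<times> Xt D"
    then obtain x y where p: "p = (x, y)" "x \<in> Xt D" "y \<in> Xt D" by blast
    show "(case p of (x, y) \<Rightarrow> norm (pull_section D s x - pull_section D s y) / dst D x y) \<le> K"
    proof (cases "dst D x y = 0")
      case False
      then have "0 < dst D x y" using M.nonneg[of x y] by linarith
      then show ?thesis using K[OF p(2,3)] p(1) by (simp add: divide_le_eq)
    qed (use assms(2) p(1) in simp)
  qed (use fixed_point in auto)
qed

end

section \<open>The norm of the algebra\<close>

text \<open>The infimum of admissible constants stands in for a supremum of quotients, so that
  indices with \<open>q i = 0\<close> fit in without division.\<close>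

definition best_const :: "'i set \<Rightarrow> ('i \<Rightarrow> real) \<Rightarrow> ('i \<Rightarrow> real) \<Rightarrow> real" where
  "best_const I p q = Inf {B. 0 \<le> B \<and> (\<forall>i\<in>I. p i \<le> B * q i)}"

lemma best_const_le: "0 \<le> B \<Longrightarrow> (\<And>i. i \<in> I \<Longrightarrow> p i \<le> B * q i) \<Longrightarrow> best_const I p q \<le> B"
  unfolding best_const_def by (intro cInf_lower bdd_belowI[of _ 0]) auto

lemma best_const_nonneg:
  assumes "0 \<le> B" "\<And>i. i \<in> I \<Longrightarrow> p i \<le> B * q i"
  shows "0 \<le> best_const I p q"
  unfolding best_const_def by (rule cInf_greatest) (use assms in auto)

lemma best_const_bound:
  assumes B: "0 \<le> B" "\<And>i. i \<in> I \<Longrightarrow> p i \<le> B * q i" and q: "0 \<le> q i" and i: "i \<in> I"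
  shows "p i \<le> best_const I p q * q i"
proof (cases "q i = 0")
  case True
  then show ?thesis using B(2)[OF i] by simp
next
  case False
  then have pos: "0 < q i" using q by simp
  have "p i / q i \<le> best_const I p q"
    unfolding best_const_def
  proof (rule cInf_greatest)
    fix C assume "C \<in> {B. 0 \<le> B \<and> (\<forall>i\<in>I. p i \<le> B * q i)}"
    then show "p i / q i \<le> C" using i pos by (simp add: divide_le_eq)
  qed (use B in auto)
  then show ?thesis using pos by (simp add: divide_le_eq)
qed

context bundle_setting
begin

definition is_lipschitz_map :: "('a set \<Rightarrow> 'e \<Rightarrow> 'e) \<Rightarrow> real \<Rightarrow> bool" where
  "is_lipschitz_map h K \<longleftrightarrow> 0 \<le> K \<and>
    (\<forall>x\<in>Xt D. \<forall>y\<in>Xt D. \<forall>a. norm (pullf h x a - pullf h y a) \<le> K * dst D x y * norm a)"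

definition is_bounded_map :: "('a set \<Rightarrow> 'e \<Rightarrow> 'e) \<Rightarrow> real \<Rightarrow> bool" where
  "is_bounded_map h B \<longleftrightarrow> 0 \<le> B \<and> (\<forall>x\<in>Xt D. \<forall>a. norm (pullf h x a) \<le> B * norm a)"

lemma lipschitz_map_bounded:
  assumes h: "h \<in> fibre_maps" and K: "is_lipschitz_map h K"
  obtains B where "is_bounded_map h B"
proof -
  obtain B where "B \<ge> 0" "\<And>x a. x \<in> Xt D \<Longrightarrow> norm (pullf h x a) \<le> B * norm a"
  proof (rule equivariant_lipschitz_bounded[of "pullf h" K])
    show "\<exists>B. \<forall>a. norm (pullf h z a) \<le> B * norm a" if "z \<in> Xt D" for z
      using clinear_op_bounded[OF pullf_clinear[OF h that]] by metis
    show "\<exists>b. norm b = norm a \<and> norm (pullf h x a) = norm (pullf h (act D g x) b)"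
      if "g \<in> carrier (Grp D)" "x \<in> Xt D" for g x a
      using that h by (intro exI[of _ "coc g x a"]) (simp add: norm_coc pullf_act)
  qed (use K in \<open>auto simp: is_lipschitz_map_def\<close>)
  then show thesis using that unfolding is_bounded_map_def by blast
qed

lemma L_alg_fibre_map: "h \<in> L_alg D \<Longrightarrow> h \<in> fibre_maps"
  by (simp add: L_alg_def End_bundle_def fibre_maps_def)

lemma induced_section: "h \<in> fibre_maps \<Longrightarrow> s \<in> fibre_sections \<Longrightarrow> induced h s \<in> fibre_sections"
  by (auto simp: fibre_sections_def induced_def fibre_map_mem fibre_map_0)

lemma pull_induced: "s \<in> fibre_sections \<Longrightarrow> x \<in> Xt D \<Longrightarrow> pull_section D (induced h s) x = pullf h x (pull_section D s x)"
  by (simp add: pull_section_def induced_def pullf_def triv_triv_inv fibre_section_mem)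

text \<open>The product rule: the sup norm grows by the factor \<open>B\<close>, the Lipschitz
  constant by \<open>K + B\<close>, and the two add up to \<open>2 * B + K\<close>.\<close>

lemma induced_estimate:
  assumes h: "h \<in> fibre_maps" and K: "is_lipschitz_map h K" and B: "is_bounded_map h B" and s: "s \<in> lip_sections D"
  shows induced_lip_section: "induced h s \<in> lip_sections D"
    and lip_norm_induced: "lip_norm D (induced h s) \<le> (2 * B + K) * lip_norm D s"
proof -
  define n where "n = lip_norm D s"
  have n: "0 \<le> n" unfolding n_def by (rule lip_norm_nonneg[OF s])
  have fs: "s \<in> fibre_sections" using lip_sectionsD[OF s] by blast
  let ?f = "pull_section D s"
  have B0: "0 \<le> B" and Bb: "\<And>x a. x \<in> Xt D \<Longrightarrow> norm (pullf h x a) \<le> B * norm a" using B by (auto simp: is_bounded_map_def)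
  have K0: "0 \<le> K" using K by (simp add: is_lipschitz_map_def)
  have bound: "norm (pull_section D (induced h s) x) \<le> B * n" if x: "x \<in> Xt D" for x
    unfolding pull_induced[OF fs x] n_def
    by (rule order_trans[OF Bb[OF x] mult_left_mono[OF norm_pull_section_le[OF s x] B0]])
  have lip: "norm (pull_section D (induced h s) x - pull_section D (induced h s) y) \<le> ((K + B) * n) * dst D x y"
    if x: "x \<in> Xt D" and y: "y \<in> Xt D" for x y
  proof -
    have "pullf h x (?f x) - pullf h y (?f y) = (pullf h x (?f x) - pullf h y (?f x)) + pullf h y (?f x - ?f y)"
      by (simp add: clinear_op_diff[OF pullf_clinear[OF h y]])
    then have "norm (pullf h x (?f x) - pullf h y (?f y)) \<le> norm (pullf h x (?f x) - pullf h y (?f x)) + norm (pullf h y (?f x - ?f y))"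
      using norm_triangle_ineq by metis
    also have "\<dots> \<le> K * dst D x y * norm (?f x) + B * norm (?f x - ?f y)"
      using K x y Bb[OF y] by (intro add_mono) (auto simp: is_lipschitz_map_def)
    also have "\<dots> \<le> K * dst D x y * n + B * (n * dst D x y)"
      using B0 K0 unfolding n_def
      by (intro add_mono mult_left_mono norm_pull_section_le[OF s x] dist_pull_section_le[OF s x y]) auto
    finally show ?thesis unfolding pull_induced[OF fs x] pull_induced[OF fs y] by (simp add: algebra_simps)
  qed
  have nn: "0 \<le> (K + B) * n" using B0 K0 n by simp
  show "induced h s \<in> lip_sections D" by (rule lip_sectionsI[OF induced_section[OF h fs] nn lip])
  have "lip_norm D (induced h s) \<le> B * n + (K + B) * n"
    by (rule lip_norm_le[OF induced_section[OF h fs] nn bound lip])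
  then show "lip_norm D (induced h s) \<le> (2 * B + K) * lip_norm D s" by (simp add: algebra_simps n_def)
qed

lemma zero_lip_section: "0 \<in> lip_sections D" and lip_norm_0: "lip_norm D 0 = 0"
proof -
  have fs: "0 \<in> fibre_sections" by (simp add: fibre_sections_def fibre_0)
  have p: "pull_section D 0 x = 0" if "x \<in> Xt D" for x using that by (simp add: pull_section_def)
  show z: "0 \<in> lip_sections D" by (rule lip_sectionsI[OF fs, of 0]) (simp_all add: p)
  have "lip_norm D 0 \<le> 0 + 0" by (rule lip_norm_le[OF fs]) (simp_all add: p)
  then show "lip_norm D 0 = 0" using lip_norm_nonneg[OF z] by simp
qed

text \<open>The easy half of the description of \<open>L\<close> by Lipschitz coordinates:
  compactness of the quotient gives boundedness, local products give continuity, and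
  \<open>induced_estimate\<close> gives boundedness on Lipschitz sections.\<close>

lemma L_algI:
  assumes h: "h \<in> fibre_maps" and K: "is_lipschitz_map h K"
  shows "h \<in> L_alg D"
proof -
  obtain B where B: "is_bounded_map h B" using lipschitz_map_bounded[OF h K] .
  have K': "\<And>x y a. x \<in> Xt D \<Longrightarrow> y \<in> Xt D \<Longrightarrow> norm (pullf h x a - pullf h y a) \<le> K * dst D x y * norm a" "0 \<le> K"
    using K by (auto simp: is_lipschitz_map_def)
  have "h \<in> End_bundle D"
    using h fibre_map_continuous[OF h _ K'] by (auto simp: End_bundle_def fibre_maps_def)
  moreover have "module_endomorphism D (induced h)"
    unfolding module_endomorphism_def
  proof (intro conjI ballI)
    show "induced h ` lip_sections D \<subseteq> lip_sections D" using induced_lip_section[OF h K B] by blast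
    show "bounded_on (lip_sections D) (lip_norm D) (induced h)"
      unfolding bounded_on_def using lip_norm_induced[OF h K B] by blast
    fix s assume s: "s \<in> lip_sections D"
    then have fs: "s \<in> fibre_sections" using lip_sectionsD by blast
    have s_out: "s y = 0" if "y \<notin> base D" for y using fs that by (simp add: fibre_sections_def)
    have h0: "h y 0 = 0" for y by (rule fibre_map_0[OF h])
    show "induced h (\<lambda>y. scal D (f y) (s y)) = (\<lambda>y. scal D (f y) (induced h s y))" for f
    proof
      fix y show "induced h (\<lambda>y. scal D (f y) (s y)) y = scal D (f y) (induced h s y)"
        by (cases "y \<in> base D") (simp_all add: induced_def fibre_map_scale[OF h] fibre_section_mem[OF fs] s_out h0)
    qed
    fix t assume "t \<in> lip_sections D"
    then have ft: "t \<in> fibre_sections" using lip_sectionsD by blast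
    have t_out: "t y = 0" if "y \<notin> base D" for y using ft that by (simp add: fibre_sections_def)
    show "induced h (s + t) = induced h s + induced h t"
    proof
      fix y show "induced h (s + t) y = (induced h s + induced h t) y"
        by (cases "y \<in> base D")
           (simp_all add: induced_def fibre_map_add[OF h] fibre_section_mem[OF fs] fibre_section_mem[OF ft] s_out t_out h0)
    qed
  qed
  ultimately show ?thesis by (simp add: L_alg_def)
qed

lemma L_norm_le:
  assumes h: "h \<in> fibre_maps" and K: "is_lipschitz_map h K" and B: "is_bounded_map h B"
  shows "L_norm D h \<le> 2 * B + K"
  unfolding L_norm_def op_norm_def
proof (rule cSup_least)
  show "{lip_norm D (induced h v) |v. v \<in> lip_sections D \<and> lip_norm D v \<le> 1} \<noteq> {}"
    using zero_lip_section lip_norm_0 by force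
  fix t assume "t \<in> {lip_norm D (induced h v) |v. v \<in> lip_sections D \<and> lip_norm D v \<le> 1}"
  then obtain v where v: "t = lip_norm D (induced h v)" "v \<in> lip_sections D" "lip_norm D v \<le> 1" by blast
  have BK: "0 \<le> 2 * B + K" using B K by (simp add: is_bounded_map_def is_lipschitz_map_def)
  have "t \<le> (2 * B + K) * lip_norm D v" unfolding v(1) by (rule lip_norm_induced[OF h K B v(2)])
  also have "\<dots> \<le> (2 * B + K) * 1" using BK v(3) by (intro mult_left_mono)
  finally show "t \<le> 2 * B + K" by simp
qed

lemma lip_norm_induced_le_L_norm:
  assumes h: "h \<in> L_alg D" and s: "s \<in> lip_sections D" "lip_norm D s \<le> 1"
  shows "lip_norm D (induced h s) \<le> L_norm D h"
proof -
  obtain C where C: "\<And>v. v \<in> lip_sections D \<Longrightarrow> lip_norm D (induced h v) \<le> C * lip_norm D v"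
    using h unfolding L_alg_def module_endomorphism_def bounded_on_def by blast
  have "lip_norm D (induced h v) \<le> \<bar>C\<bar>" if v: "v \<in> lip_sections D" "lip_norm D v \<le> 1" for v
  proof -
    have "C * lip_norm D v \<le> \<bar>C\<bar> * 1" using v lip_norm_nonneg[OF v(1)] by (intro mult_mono) auto
    then show ?thesis using C[OF v(1)] by simp
  qed
  then have "bdd_above {lip_norm D (induced h v) |v. v \<in> lip_sections D \<and> lip_norm D v \<le> 1}"
    by (intro bdd_aboveI[of _ "\<bar>C\<bar>"]) auto
  then show ?thesis unfolding L_norm_def op_norm_def using s by (intro cSup_upper) auto
qed

text \<open>A bump function supported in a small ball is transported by the cocycle to all translates of this ball.\<close>

lemma bump_section:
  assumes z: "z \<in> Xt D"
  obtains \<epsilon> t where "\<epsilon> > 0" "t > 0" "\<And>a. norm a \<le> 1 \<Longrightarrow> \<exists>s\<in>lip_sections D. lip_norm D s \<le> 1 \<and>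
    (\<forall>x\<in>Xt D. dst D z x < \<epsilon> \<longrightarrow> pull_section D s x = t *\<^sub>R a)"
proof -
  obtain e where e: "e > 0" "\<And>g. g \<in> carrier (Grp D) \<Longrightarrow> g \<noteq> \<one>\<^bsub>Grp D\<^esub> \<Longrightarrow> e \<le> dst D z (act D g z)"
    using uniform_separation[OF z] by blast
  \<comment> \<open>If two different group elements brought a point within
    \<open>3 * \<epsilon>\<close> and \<open>2 * \<epsilon>\<close> of \<open>z\<close>, some
    nontrivial element would displace \<open>z\<close> by less than \<open>5 * \<epsilon>\<close>,
    which is below \<open>e = 8 * \<epsilon>\<close>.\<close>
  define \<epsilon> where "\<epsilon> = e / 8"
  have \<epsilon>: "\<epsilon> > 0" using e by (simp add: \<epsilon>_def)
  obtain C where C: "C \<ge> 0" "\<And>g x y a. g \<in> carrier (Grp D) \<Longrightarrow> x \<in> Xt D \<Longrightarrow> y \<in> Xt D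
    \<Longrightarrow> norm (coc g x a - coc g y a) \<le> C * dst D x y * norm a"
    using coc_uniformly_lipschitz by blast
  define \<eta> where "\<eta> x = max 0 (min 1 (2 - dst D z x / \<epsilon>))" for x
  have \<eta>01: "0 \<le> \<eta> x" "\<eta> x \<le> 1" for x by (auto simp: \<eta>_def)
  have \<eta>1: "\<eta> x = 1" if "dst D z x < \<epsilon>" for x
  proof -
    have "dst D z x / \<epsilon> \<le> 1" using that \<epsilon> by simp
    then show ?thesis by (simp add: \<eta>_def)
  qed
  have \<eta>0: "\<eta> x = 0" if "2 * \<epsilon> \<le> dst D z x" for x
  proof -
    have "2 \<le> dst D z x / \<epsilon>" using that \<epsilon> by (simp add: le_divide_eq)
    then show ?thesis by (simp add: \<eta>_def)
  qed
  have \<eta>_lip: "\<bar>\<eta> x - \<eta> y\<bar> \<le> dst D x y / \<epsilon>" if x: "x \<in> Xt D" and y: "y \<in> Xt D" for x y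
  proof -
    have "\<bar>dst D z x - dst D z y\<bar> \<le> dst D x y"
      using M.triangle[OF z x y] M.triangle[OF z y x] M.commute[of x y] by linarith
    then have "\<bar>dst D z x / \<epsilon> - dst D z y / \<epsilon>\<bar> \<le> dst D x y / \<epsilon>"
      using \<epsilon> by (simp add: abs_divide divide_right_mono flip: diff_divide_distrib)
    then show ?thesis unfolding \<eta>_def by linarith
  qed
  have unique: "g = h" if g: "g \<in> carrier (Grp D)" and h: "h \<in> carrier (Grp D)" and x: "x \<in> Xt D"
    and d: "dst D z (act D g x) < 3 * \<epsilon>" "dst D z (act D h x) < 2 * \<epsilon>" for g h x
  proof (rule ccontr)
    assume "g \<noteq> h"
    let ?k = "h \<otimes>\<^bsub>Grp D\<^esub> inv\<^bsub>Grp D\<^esub> g"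
    have k: "?k \<in> carrier (Grp D)" using g h by simp
    have "?k \<noteq> \<one>\<^bsub>Grp D\<^esub>"
    proof
      assume "?k = \<one>\<^bsub>Grp D\<^esub>"
      then have "?k \<otimes>\<^bsub>Grp D\<^esub> g = g" using g by simp
      then have "h = g" using g h by (simp add: Grp.m_assoc)
      then show False using \<open>g \<noteq> h\<close> by simp
    qed
    then have "e \<le> dst D z (act D ?k z)" using e(2) k by blast
    also have "\<dots> \<le> dst D z (act D h x) + dst D (act D h x) (act D ?k z)"
      using g h x z k by (intro M.triangle act_mem) auto
    also have "act D h x = act D ?k (act D g x)"
      using act_mult[OF k g x] g h by (simp add: Grp.m_assoc)
    also have "dst D (act D ?k (act D g x)) (act D ?k z) = dst D z (act D g x)"
      using isometric[OF k act_mem[OF g x] z] M.commute by simp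
    finally have "e < 5 * \<epsilon>" using d act_mult[OF k g x] g h by (simp add: Grp.m_assoc)
    then show False using \<epsilon> by (simp add: \<epsilon>_def)
  qed
  \<comment> \<open>The Lipschitz constant relative to \<open>norm b\<close>: \<open>C\<close> from
    the cocycle, \<open>1 / \<epsilon>\<close> from the cutoff, \<open>2 / \<epsilon>\<close> from
    pairs at distance at least \<open>\<epsilon>\<close>. With \<open>t = 1 / (1 + Q)\<close> the
    Lipschitz norm is at most 1.\<close>
  define Q where "Q = C + 1 / \<epsilon> + 2 / \<epsilon>"
  have Q: "0 \<le> Q" using C \<epsilon> by (simp add: Q_def)
  define t where "t = 1 / (1 + Q)"
  have t: "t > 0" using Q by (simp add: t_def)
  show thesis
  proof (rule that[OF \<epsilon> t])
    fix a :: "complex ^ 'd" assume a: "norm a \<le> 1"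
    define b where "b = t *\<^sub>R a"
    have nb: "norm b \<le> t" using a t by (simp add: b_def)
    \<comment> \<open>Equivariance dictates this value at \<open>x\<close> when the translate by
      \<open>g\<close> carries the bump.\<close>
    define v where "v g x = coc (inv\<^bsub>Grp D\<^esub> g) (act D g x) (\<eta> (act D g x) *\<^sub>R b)" for g x
    define f where "f x = (if \<exists>g\<in>carrier (Grp D). dst D z (act D g x) < 2 * \<epsilon>
      then v (SOME g. g \<in> carrier (Grp D) \<and> dst D z (act D g x) < 2 * \<epsilon>) x else 0)" for x
    \<comment> \<open>The formula persists up to \<open>3 * \<epsilon>\<close>, since the cutoff
      vanishes beyond \<open>2 * \<epsilon>\<close>. This margin lets two points at distance below
      \<open>\<epsilon>\<close> be compared with one and the same \<open>g\<close>.\<close>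
    have f_eq: "f x = v g x" if g: "g \<in> carrier (Grp D)" and x: "x \<in> Xt D" and d: "dst D z (act D g x) < 3 * \<epsilon>" for g x
    proof (cases "\<exists>h\<in>carrier (Grp D). dst D z (act D h x) < 2 * \<epsilon>")
      case True
      define h where "h = (SOME h. h \<in> carrier (Grp D) \<and> dst D z (act D h x) < 2 * \<epsilon>)"
      have h: "h \<in> carrier (Grp D) \<and> dst D z (act D h x) < 2 * \<epsilon>"
        unfolding h_def by (rule someI_ex) (use True in blast)
      then have "g = h" using unique[OF g _ x d] by blast
      then show ?thesis using True by (simp add: f_def h_def)
    next
      case False
      then have "\<eta> (act D g x) = 0" using g by (intro \<eta>0) (auto simp: not_less)
      moreover have "coc (inv\<^bsub>Grp D\<^esub> g) (act D g x) 0 = 0"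
        using clinear_op_0[OF coc_clinear[of "inv\<^bsub>Grp D\<^esub> g" "act D g x"]] g x act_mem by simp
      ultimately show ?thesis using False by (simp add: f_def v_def)
    qed
    have f_0: "f x = 0" if "\<not> (\<exists>g\<in>carrier (Grp D). dst D z (act D g x) < 2 * \<epsilon>)" for x
      using that unfolding f_def by (rule if_not_P)
    have v_norm: "norm (v g x) \<le> norm b" if "g \<in> carrier (Grp D)" "x \<in> Xt D" for g x
      using that \<eta>01[of "act D g x"] mult_right_mono[OF \<eta>01(2)[of "act D g x"], of "norm b"]
      by (simp add: v_def norm_coc act_mem)
    have f_norm: "norm (f x) \<le> norm b" if x: "x \<in> Xt D" for x
    proof (cases "\<exists>h\<in>carrier (Grp D). dst D z (act D h x) < 2 * \<epsilon>")
      case True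
      then obtain h where h: "h \<in> carrier (Grp D)" "dst D z (act D h x) < 2 * \<epsilon>" by blast
      then have "dst D z (act D h x) < 3 * \<epsilon>" using \<epsilon> by simp
      then have "f x = v h x" by (rule f_eq[OF h(1) x])
      then show ?thesis using v_norm[OF h(1) x] by simp
    next
      case False
      then show ?thesis using f_0 by simp
    qed
    have eqv: "f (act D h x) = coc h x (f x)" if h: "h \<in> carrier (Grp D)" and x: "x \<in> Xt D" for h x
    proof (cases "\<exists>g\<in>carrier (Grp D). dst D z (act D g x) < 2 * \<epsilon>")
      case True
      then obtain g where g: "g \<in> carrier (Grp D)" "dst D z (act D g x) < 2 * \<epsilon>" by blast
      then have g3: "dst D z (act D g x) < 3 * \<epsilon>" using \<epsilon> by simp
      let ?k = "g \<otimes>\<^bsub>Grp D\<^esub> inv\<^bsub>Grp D\<^esub> h"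
      have k: "?k \<in> carrier (Grp D)" using g h by simp
      have khx: "act D ?k (act D h x) = act D g x"
        using act_mult[OF k h x] g h by (simp add: Grp.m_assoc)
      have "f (act D h x) = v ?k (act D h x)"
        using g3 khx by (intro f_eq k act_mem h x) simp
      also have "\<dots> = coc (h \<otimes>\<^bsub>Grp D\<^esub> inv\<^bsub>Grp D\<^esub> g) (act D g x) (\<eta> (act D g x) *\<^sub>R b)"
        using g h by (simp add: v_def khx Grp.inv_mult_group)
      also have "\<dots> = coc h x (v g x)"
        using coc_mult[OF h Grp.inv_closed[OF g(1)] act_mem[OF g(1) x]] g x by (simp add: v_def act_inv)
      finally show ?thesis using f_eq[OF g(1) x g3] by simp
    next
      case False
      have "\<not> (\<exists>g\<in>carrier (Grp D). dst D z (act D g (act D h x)) < 2 * \<epsilon>)"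
      proof
        assume "\<exists>g\<in>carrier (Grp D). dst D z (act D g (act D h x)) < 2 * \<epsilon>"
        then obtain g where g: "g \<in> carrier (Grp D)" "dst D z (act D g (act D h x)) < 2 * \<epsilon>" by blast
        then have "dst D z (act D (g \<otimes>\<^bsub>Grp D\<^esub> h) x) < 2 * \<epsilon>" by (simp add: act_mult h x)
        then show False using False Grp.m_closed[OF g(1) h] by blast
      qed
      then show ?thesis using False f_0 clinear_op_0[OF coc_clinear[OF h x]] by simp
    qed
    have v_lip: "norm (v g x - v g y) \<le> (C + 1 / \<epsilon>) * norm b * dst D x y"
      if g: "g \<in> carrier (Grp D)" and x: "x \<in> Xt D" and y: "y \<in> Xt D" for g x y
    proof -
      let ?g = "inv\<^bsub>Grp D\<^esub> g" and ?x = "act D g x" and ?y = "act D g y"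
      have gi: "?g \<in> carrier (Grp D)" and xy: "?x \<in> Xt D" "?y \<in> Xt D" using g x y by (auto simp: act_mem)
      have dxy: "dst D ?x ?y = dst D x y" by (rule isometric[OF g x y])
      have "v g x - v g y = (coc ?g ?x (\<eta> ?x *\<^sub>R b) - coc ?g ?y (\<eta> ?x *\<^sub>R b)) + coc ?g ?y (\<eta> ?x *\<^sub>R b - \<eta> ?y *\<^sub>R b)"
        by (simp add: v_def clinear_op_diff[OF coc_clinear[OF gi xy(2)]])
      then have "norm (v g x - v g y) \<le> norm (coc ?g ?x (\<eta> ?x *\<^sub>R b) - coc ?g ?y (\<eta> ?x *\<^sub>R b)) + norm (coc ?g ?y (\<eta> ?x *\<^sub>R b - \<eta> ?y *\<^sub>R b))"
        using norm_triangle_ineq by metis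
      also have "\<dots> \<le> C * dst D x y * norm (\<eta> ?x *\<^sub>R b) + \<bar>\<eta> ?x - \<eta> ?y\<bar> * norm b"
        using C(2)[OF gi xy, of "\<eta> ?x *\<^sub>R b"] dxy by (simp add: norm_coc[OF gi xy(2)] flip: scaleR_diff_left)
      also have "\<dots> \<le> C * dst D x y * norm b + (dst D x y / \<epsilon>) * norm b"
        using \<eta>_lip[OF xy] dxy \<eta>01[of ?x] C(1) mult_right_mono[OF \<eta>01(2)[of ?x], of "norm b"]
        by (intro add_mono mult_left_mono mult_right_mono) auto
      finally show ?thesis by (simp add: algebra_simps)
    qed
    have half: "norm (f x - f y) \<le> (C + 1 / \<epsilon>) * norm b * dst D x y"
      if x: "x \<in> Xt D" and y: "y \<in> Xt D" and d: "dst D x y < \<epsilon>" and ex: "\<exists>g\<in>carrier (Grp D). dst D z (act D g x) < 2 * \<epsilon>" for x y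
    proof -
      obtain g where g: "g \<in> carrier (Grp D)" "dst D z (act D g x) < 2 * \<epsilon>" using ex by blast
      have "dst D z (act D g y) \<le> dst D z (act D g x) + dst D (act D g x) (act D g y)"
        using g x y z by (intro M.triangle act_mem)
      then have "dst D z (act D g y) < 3 * \<epsilon>" using g(2) d isometric[OF g(1) x y] by simp
      then have "f y = v g y" by (rule f_eq[OF g(1) y])
      moreover have "f x = v g x" using g(2) \<epsilon> by (intro f_eq g(1) x) simp
      ultimately show ?thesis using v_lip[OF g(1) x y] by simp
    qed
    have f_lip: "norm (f x - f y) \<le> Q * norm b * dst D x y" if x: "x \<in> Xt D" and y: "y \<in> Xt D" for x y
    proof -
      have "norm (f x - f y) \<le> ((C + 1 / \<epsilon>) * norm b + 2 * norm b / \<epsilon>) * dst D x y"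
      proof (rule lipschitz_from_local[OF \<epsilon> _ _ f_norm _ x y])
        fix x y assume xy: "x \<in> Xt D" "y \<in> Xt D" "dst D x y < \<epsilon>"
        show "norm (f x - f y) \<le> (C + 1 / \<epsilon>) * norm b * dst D x y"
        proof (cases "\<exists>g\<in>carrier (Grp D). dst D z (act D g x) < 2 * \<epsilon>")
          case True
          then show ?thesis by (rule half[OF xy])
        next
          case nx: False
          show ?thesis
          proof (cases "\<exists>g\<in>carrier (Grp D). dst D z (act D g y) < 2 * \<epsilon>")
            case True
            have "dst D y x < \<epsilon>" using xy(3) M.commute by simp
            then have "norm (f y - f x) \<le> (C + 1 / \<epsilon>) * norm b * dst D y x" by (rule half[OF xy(2,1) _ True])
            then show ?thesis by (simp add: norm_minus_commute M.commute)
          next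
            case False
            have "f x = 0" "f y = 0" using f_0[OF nx] f_0[OF False] by auto
            then show ?thesis using C(1) \<epsilon> by simp
          qed
        qed
      qed (use C(1) \<epsilon> in auto)
      also have "(C + 1 / \<epsilon>) * norm b + 2 * norm b / \<epsilon> = Q * norm b" by (simp add: Q_def algebra_simps)
      finally show ?thesis .
    qed
    let ?s = "descend_section f"
    have fs: "?s \<in> fibre_sections" by (rule descend_section_mem[OF eqv])
    have ps: "pull_section D ?s x = f x" if "x \<in> Xt D" for x by (rule pull_descend_section[OF eqv that])
    have Qt: "0 \<le> Q * norm b" using Q by simp
    have lip: "norm (pull_section D ?s x - pull_section D ?s y) \<le> Q * norm b * dst D x y"
      if "x \<in> Xt D" "y \<in> Xt D" for x y using f_lip[OF that] ps that by simp
    have bound: "norm (pull_section D ?s x) \<le> norm b" if "x \<in> Xt D" for x using f_norm[OF that] ps that by simp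
    have "lip_norm D ?s \<le> norm b + Q * norm b" by (rule lip_norm_le[OF fs Qt bound lip])
    also have "\<dots> = (1 + Q) * norm b" by (simp add: algebra_simps)
    also have "\<dots> \<le> (1 + Q) * t" using nb Q by (intro mult_left_mono) auto
    also have "\<dots> = 1" using Q by (simp add: t_def)
    finally have n1: "lip_norm D ?s \<le> 1" .
    have near: "pull_section D ?s x = t *\<^sub>R a" if x: "x \<in> Xt D" and d: "dst D z x < \<epsilon>" for x
    proof -
      have one: "act D \<one>\<^bsub>Grp D\<^esub> x = x" by (rule act_one[OF x])
      have "f x = v \<one>\<^bsub>Grp D\<^esub> x" using d \<epsilon> one by (intro f_eq x) auto
      also have "\<dots> = b" using one \<eta>1[OF d] by (simp add: v_def coc_one x)
      finally show ?thesis using ps[OF x] by (simp add: b_def)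
    qed
    show "\<exists>s\<in>lip_sections D. lip_norm D s \<le> 1 \<and> (\<forall>x\<in>Xt D. dst D z x < \<epsilon> \<longrightarrow> pull_section D s x = t *\<^sub>R a)"
      using lip_sectionsI[OF fs Qt lip] n1 near by blast
  qed
qed

end

text \<open>Stated for subsets \<open>H\<close> because \<open>finite_multiplicity\<close> also
  looks at the spectrum on an invariant complement.\<close>

lemma spectrum_cong:
  assumes "\<And>v. v \<in> V \<Longrightarrow> 0 \<le> N v" "\<And>v. v \<in> V \<Longrightarrow> 0 \<le> N' v" "0 \<le> C" "0 \<le> C'"
    and "\<And>v. v \<in> V \<Longrightarrow> N v \<le> C * N' v" "\<And>v. v \<in> V \<Longrightarrow> N' v \<le> C' * N v" and H: "H \<subseteq> V"
  shows "spectrum sc H N T = spectrum sc H N' T"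
proof -
  have *: "bounded_on H N2 f"
    if b: "bounded_on H N1 f" and f: "f ` H \<subseteq> H" and n: "\<And>v. v \<in> V \<Longrightarrow> 0 \<le> N1 v" "0 \<le> C1" "0 \<le> C2"
      and c: "\<And>v. v \<in> V \<Longrightarrow> N2 v \<le> C1 * N1 v" "\<And>v. v \<in> V \<Longrightarrow> N1 v \<le> C2 * N2 v"
    for f N1 N2 and C1 C2 :: real
  proof -
    obtain B where B: "\<And>v. v \<in> H \<Longrightarrow> N1 (f v) \<le> B * N1 v" using b by (auto simp: bounded_on_def)
    have "N2 (f v) \<le> (C1 * \<bar>B\<bar> * C2) * N2 v" if v: "v \<in> H" for v
    proof -
      have vV: "v \<in> V" and fV: "f v \<in> V" using v H f by auto
      have "N2 (f v) \<le> C1 * N1 (f v)" by (rule c(1)[OF fV])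
      also have "\<dots> \<le> C1 * (\<bar>B\<bar> * N1 v)"
        using B[OF v] mult_right_mono[OF abs_ge_self[of B] n(1)[OF vV]] n(2) by (intro mult_left_mono) auto
      also have "\<dots> \<le> C1 * (\<bar>B\<bar> * (C2 * N2 v))" by (intro mult_left_mono c(2)[OF vV] n(2)) auto
      finally show ?thesis by (simp add: mult_ac)
    qed
    then show ?thesis unfolding bounded_on_def by blast
  qed
  have "bounded_on H N (inv_into H f) \<longleftrightarrow> bounded_on H N' (inv_into H f)" if "bij_betw f H H" for f
  proof -
    have "inv_into H f ` H \<subseteq> H" using that by (metis bij_betw_def bij_betw_inv_into subset_refl)
    then show ?thesis using *[of N "inv_into H f" C' C N'] *[of N' "inv_into H f" C C' N] assms by blast
  qed
  then show ?thesis unfolding spectrum_def by blast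
qed

lemma essential_spectral_radius_cong:
  assumes "\<And>v. v \<in> V \<Longrightarrow> 0 \<le> N v" "\<And>v. v \<in> V \<Longrightarrow> 0 \<le> N' v" "0 \<le> C" "0 \<le> C'"
    and "\<And>v. v \<in> V \<Longrightarrow> N v \<le> C * N' v" "\<And>v. v \<in> V \<Longrightarrow> N' v \<le> C' * N v"
  shows "essential_spectral_radius sc V N T = essential_spectral_radius sc V N' T"
proof -
  have *: "spectrum sc H N T = spectrum sc H N' T" if "H \<subseteq> V" for H
    by (rule spectrum_cong[OF assms that])
  have "finite_multiplicity sc V N T z = finite_multiplicity sc V N' T z" for z
    unfolding finite_multiplicity_def by (intro conj_cong ex_cong1 refl) (simp add: *)
  then show ?thesis unfolding essential_spectral_radius_def *[OF order_refl] by simp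
qed

lemma clinear_op_norm_le_basis:
  fixes f :: "complex ^ 'n \<Rightarrow> complex ^ 'm"
  assumes f: "clinear_op f" and B: "\<And>j. norm (f (axis j 1)) \<le> B"
  shows "norm (f a) \<le> real CARD('n) * B * norm a"
proof -
  have B0: "0 \<le> B" using B[of undefined] norm_ge_zero order_trans by blast
  have "f a = (\<Sum>j\<in>UNIV. (a $ j) *s f (axis j 1))"
    by (subst vec_expand) (simp add: clinear_op_sum[OF f] clinear_op_scale[OF f])
  then have "norm (f a) \<le> (\<Sum>j\<in>UNIV. norm (a $ j) * norm (f (axis j 1)))"
    using norm_sum[of "\<lambda>j. (a $ j) *s f (axis j 1)" UNIV] by (simp add: norm_vector_scalar_mult)
  also have "\<dots> \<le> (\<Sum>j\<in>(UNIV :: 'n set). norm a * B)"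
    by (intro sum_mono mult_mono Finite_Cartesian_Product.norm_nth_le B) auto
  finally show ?thesis by (simp add: mult_ac)
qed

context bundle_setting
begin

lemma L_norm_nonneg: "h \<in> L_alg D \<Longrightarrow> 0 \<le> L_norm D h"
proof -
  assume h: "h \<in> L_alg D"
  have "induced h 0 \<in> lip_sections D"
    using h zero_lip_section unfolding L_alg_def module_endomorphism_def by blast
  then have "0 \<le> lip_norm D (induced h 0)" by (rule lip_norm_nonneg)
  also have "\<dots> \<le> L_norm D h"
    by (rule lip_norm_induced_le_L_norm[OF h zero_lip_section]) (simp add: lip_norm_0)
  finally show ?thesis .
qed

text \<open>Near \<open>z\<close>, applying \<open>h\<close> to a bump section with constant value
  \<open>t\<close> times a basis vector gives \<open>t\<close> times a column of
  \<open>pullf h\<close>. The size and the Lipschitz constant of that column are therefore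
  controlled by the operator norm; adding up the columns gives the factor \<open>CARD('d)\<close>,
  and \<open>1 / t\<close> undoes the normalization.\<close>

lemma L_norm_locally_bounds:
  assumes z: "z \<in> Xt D"
  obtains \<epsilon> K where "\<epsilon> > 0" "K \<ge> 0"
    "\<And>h x a. h \<in> L_alg D \<Longrightarrow> x \<in> Xt D \<Longrightarrow> dst D z x < \<epsilon> \<Longrightarrow> norm (pullf h x a) \<le> K * L_norm D h * norm a"
    "\<And>h x y a. h \<in> L_alg D \<Longrightarrow> x \<in> Xt D \<Longrightarrow> y \<in> Xt D \<Longrightarrow> dst D z x < \<epsilon> \<Longrightarrow> dst D z y < \<epsilon>
      \<Longrightarrow> norm (pullf h x a - pullf h y a) \<le> K * L_norm D h * dst D x y * norm a"
proof -
  obtain \<epsilon> t where \<epsilon>: "\<epsilon> > 0" and t: "t > 0" and s: "\<And>a. norm a \<le> 1 \<Longrightarrow> \<exists>s\<in>lip_sections D. lip_norm D s \<le> 1 \<and>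
    (\<forall>x\<in>Xt D. dst D z x < \<epsilon> \<longrightarrow> pull_section D s x = t *\<^sub>R a)"
    using bump_section[OF z] by blast
  have basis: "t * norm (pullf h x (axis j 1)) \<le> L_norm D h \<and>
      (y \<in> Xt D \<longrightarrow> dst D z y < \<epsilon> \<longrightarrow> t * norm (pullf h x (axis j 1) - pullf h y (axis j 1)) \<le> L_norm D h * dst D x y)"
    if h: "h \<in> L_alg D" and x: "x \<in> Xt D" "dst D z x < \<epsilon>" for h x y j
  proof -
    obtain s where s: "s \<in> lip_sections D" "lip_norm D s \<le> 1"
      "\<And>x. x \<in> Xt D \<Longrightarrow> dst D z x < \<epsilon> \<Longrightarrow> pull_section D s x = t *\<^sub>R axis j 1"
      using s[of "axis j 1"] by (auto simp: norm_axis_1)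
    have fs: "s \<in> fibre_sections" using lip_sectionsD[OF s(1)] by blast
    have fm: "h \<in> fibre_maps" by (rule L_alg_fibre_map[OF h])
    have hs: "induced h s \<in> lip_sections D"
      using h s(1) unfolding L_alg_def module_endomorphism_def by blast
    have le: "lip_norm D (induced h s) \<le> L_norm D h" by (rule lip_norm_induced_le_L_norm[OF h s(1,2)])
    have p: "pull_section D (induced h s) x = t *\<^sub>R pullf h x (axis j 1)" if "x \<in> Xt D" "dst D z x < \<epsilon>" for x
      using s(3)[OF that] clinear_op_scale[OF pullf_clinear[OF fm that(1)], of "complex_of_real t"]
      by (simp add: pull_induced[OF fs that(1)] of_real_vector_scalar_mult)
    have "t * norm (pullf h x (axis j 1)) \<le> L_norm D h"
      using norm_pull_section_le[OF hs x(1)] p[OF x] le t by simp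
    moreover have "t * norm (pullf h x (axis j 1) - pullf h y (axis j 1)) \<le> L_norm D h * dst D x y"
      if y: "y \<in> Xt D" "dst D z y < \<epsilon>"
    proof -
      have "t * norm (pullf h x (axis j 1) - pullf h y (axis j 1)) = norm (t *\<^sub>R (pullf h x (axis j 1) - pullf h y (axis j 1)))"
        using t by simp
      also have "\<dots> \<le> lip_norm D (induced h s) * dst D x y"
        using dist_pull_section_le[OF hs x(1) y(1)] unfolding p[OF x] p[OF y] by (simp add: scaleR_diff_right)
      also have "\<dots> \<le> L_norm D h * dst D x y" using le by (intro mult_right_mono) auto
      finally show ?thesis .
    qed
    ultimately show ?thesis by blast
  qed
  let ?K = "real CARD('d) * (1 / t)"
  show thesis
  proof (rule that[OF \<epsilon>, of ?K])
    fix h x a assume h: "h \<in> L_alg D" and x: "x \<in> Xt D" "dst D z x < \<epsilon>"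
    have fm: "h \<in> fibre_maps" by (rule L_alg_fibre_map[OF h])
    have "norm (pullf h x a) \<le> real CARD('d) * (L_norm D h / t) * norm a"
      by (rule clinear_op_norm_le_basis[OF pullf_clinear[OF fm x(1)]])
         (use basis[OF h x] t in \<open>simp add: le_divide_eq mult.commute\<close>)
    then show "norm (pullf h x a) \<le> ?K * L_norm D h * norm a" by simp
    fix y assume y: "y \<in> Xt D" "dst D z y < \<epsilon>"
    have lin: "clinear_op (\<lambda>a. pullf h x a - pullf h y a)"
      using pullf_clinear[OF fm x(1)] pullf_clinear[OF fm y(1)]
      by (simp add: linear_on_def vector_sub_rdistrib vector_ssub_ldistrib)
    have "norm (pullf h x a - pullf h y a) \<le> real CARD('d) * (L_norm D h * dst D x y / t) * norm a"
      by (rule clinear_op_norm_le_basis[OF lin])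
         (use basis[OF h x] y t in \<open>simp add: le_divide_eq mult.commute\<close>)
    then show "norm (pullf h x a - pullf h y a) \<le> ?K * L_norm D h * dst D x y * norm a" by simp
  qed (use t in auto)
qed

text \<open>Finitely many centres make the local constants uniform. Away from the centres, the
  coordinates of \<open>h\<close> are conjugated by the cocycle: the two outer factors cost
  \<open>C\<close> each and the middle one is covered by the local bound, whence
  \<open>2 * C + 1\<close>.\<close>

lemma L_norm_bounds:
  obtains C where "C \<ge> 0" "\<And>h. h \<in> L_alg D \<Longrightarrow> is_bounded_map h (C * L_norm D h)"
    "\<And>h. h \<in> L_alg D \<Longrightarrow> is_lipschitz_map h (C * L_norm D h)"
proof -
  define P where "P z \<epsilon> K \<longleftrightarrow> \<epsilon> > 0 \<and> K \<ge> 0 \<and>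
    (\<forall>h\<in>L_alg D. \<forall>x\<in>Xt D. dst D z x < \<epsilon> \<longrightarrow> (\<forall>a. norm (pullf h x a) \<le> K * L_norm D h * norm a) \<and>
      (\<forall>y\<in>Xt D. dst D z y < \<epsilon> \<longrightarrow> (\<forall>a. norm (pullf h x a - pullf h y a) \<le> K * L_norm D h * dst D x y * norm a)))" for z \<epsilon> K
  have "\<forall>z\<in>Xt D. \<exists>\<epsilon> K. P z \<epsilon> K"
  proof
    fix z assume z: "z \<in> Xt D"
    obtain \<epsilon> K where "\<epsilon> > 0" "K \<ge> 0"
      "\<And>h x a. h \<in> L_alg D \<Longrightarrow> x \<in> Xt D \<Longrightarrow> dst D z x < \<epsilon> \<Longrightarrow> norm (pullf h x a) \<le> K * L_norm D h * norm a"
      "\<And>h x y a. h \<in> L_alg D \<Longrightarrow> x \<in> Xt D \<Longrightarrow> y \<in> Xt D \<Longrightarrow> dst D z x < \<epsilon> \<Longrightarrow> dst D z y < \<epsilon>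
        \<Longrightarrow> norm (pullf h x a - pullf h y a) \<le> K * L_norm D h * dst D x y * norm a"
      by (rule L_norm_locally_bounds[OF z]) (rule that)
    then have "P z \<epsilon> K" unfolding P_def by (intro conjI ballI allI impI)
    then show "\<exists>\<epsilon> K. P z \<epsilon> K" by blast
  qed
  then obtain \<epsilon> K where P: "\<And>z. z \<in> Xt D \<Longrightarrow> P z (\<epsilon> z) (K z)" by metis
  have \<epsilon>: "\<epsilon> z > 0" if "z \<in> Xt D" for z using P[OF that] by (simp add: P_def)
  obtain F where F: "finite F" "F \<subseteq> Xt D" "\<And>x. x \<in> Xt D \<Longrightarrow> \<exists>z\<in>F. \<exists>g\<in>carrier (Grp D). dst D z (act D g x) < \<epsilon> z / 2"
    by (rule finite_cover[of "\<lambda>z. \<epsilon> z / 2"]) (use \<epsilon> in auto)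
  define \<delta> where "\<delta> = Min (insert 1 ((\<lambda>z. \<epsilon> z / 2) ` F))"
  have \<delta>: "\<delta> > 0" unfolding \<delta>_def using F(1,2) \<epsilon> by (subst Min_gr_iff) auto
  have \<delta>_le: "\<delta> \<le> \<epsilon> z / 2" if "z \<in> F" for z unfolding \<delta>_def using F(1) that by (intro Min_le) auto
  define M where "M = Max (insert 0 (K ` F))"
  have M: "M \<ge> 0" unfolding M_def using F(1) by (intro Max_ge) auto
  have K_le: "K z \<le> M" if "z \<in> F" for z unfolding M_def using F(1) that by (intro Max_ge) auto
  obtain C where C: "C \<ge> 0" "\<And>g x y a. g \<in> carrier (Grp D) \<Longrightarrow> x \<in> Xt D \<Longrightarrow> y \<in> Xt D
    \<Longrightarrow> norm (coc g x a - coc g y a) \<le> C * dst D x y * norm a"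
    using coc_uniformly_lipschitz by blast
  \<comment> \<open>Nearby pairs give the first summand and distant pairs the second; the last makes
    \<open>C'\<close> dominate \<open>M\<close>, so that one constant serves both
    conclusions.\<close>
  define C' where "C' = (2 * C + 1) * M + 2 * M / \<delta> + M"
  have C': "M \<le> C'" "0 \<le> C'" using M C(1) \<delta> by (auto simp: C'_def)
  have main: "is_bounded_map h (M * L_norm D h) \<and> is_lipschitz_map h (C' * L_norm D h)" if h: "h \<in> L_alg D" for h
  proof -
    define n where "n = L_norm D h"
    have n: "0 \<le> n" unfolding n_def by (rule L_norm_nonneg[OF h])
    have fm: "h \<in> fibre_maps" by (rule L_alg_fibre_map[OF h])
    have near: "norm (pullf h x a) \<le> M * n * norm a"
        "y \<in> Xt D \<Longrightarrow> dst D z y < \<epsilon> z \<Longrightarrow> norm (pullf h x a - pullf h y a) \<le> M * n * dst D x y * norm a"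
      if z: "z \<in> F" and x: "x \<in> Xt D" "dst D z x < \<epsilon> z" for z x y a
    proof -
      have zX: "z \<in> Xt D" using z F(2) by blast
      have "norm (pullf h x a) \<le> K z * n * norm a" using P[OF zX] h x unfolding P_def n_def by blast
      also have "\<dots> \<le> M * n * norm a" using K_le[OF z] n by (intro mult_right_mono) auto
      finally show "norm (pullf h x a) \<le> M * n * norm a" .
      assume y: "y \<in> Xt D" "dst D z y < \<epsilon> z"
      have "norm (pullf h x a - pullf h y a) \<le> K z * n * dst D x y * norm a" using P[OF zX] h x y unfolding P_def n_def by blast
      also have "\<dots> \<le> M * n * dst D x y * norm a" using K_le[OF z] n by (intro mult_right_mono) auto
      finally show "norm (pullf h x a - pullf h y a) \<le> M * n * dst D x y * norm a" .
    qed
    have bd: "norm (pullf h x a) \<le> M * n * norm a" if x: "x \<in> Xt D" for x a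
    proof -
      obtain z g where z: "z \<in> F" and g: "g \<in> carrier (Grp D)" and d: "dst D z (act D g x) < \<epsilon> z / 2" using F(3)[OF x] by blast
      have "dst D z (act D g x) < \<epsilon> z" using d \<epsilon> z F(2) by fastforce
      then have "norm (pullf h (act D g x) (coc g x a)) \<le> M * n * norm (coc g x a)"
        by (rule near(1)[OF z act_mem[OF g x]])
      then show ?thesis by (simp add: pullf_act fm g x norm_coc)
    qed
    have loc: "norm (pullf h x a - pullf h y a) \<le> ((2 * C + 1) * M * n * norm a) * dst D x y"
      if x: "x \<in> Xt D" and y: "y \<in> Xt D" and dxy: "dst D x y < \<delta>" for x y a
    proof -
      obtain z g where z: "z \<in> F" and g: "g \<in> carrier (Grp D)" and d: "dst D z (act D g x) < \<epsilon> z / 2" using F(3)[OF x] by blast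
      have zX: "z \<in> Xt D" using z F(2) by blast
      let ?x = "act D g x" and ?y = "act D g y" and ?g = "inv\<^bsub>Grp D\<^esub> g"
      have gi: "?g \<in> carrier (Grp D)" and xy: "?x \<in> Xt D" "?y \<in> Xt D" using g x y by (auto simp: act_mem)
      have dd: "dst D ?x ?y = dst D x y" by (rule isometric[OF g x y])
      have zx: "dst D z ?x < \<epsilon> z" using d \<epsilon>[OF zX] by simp
      have zy: "dst D z ?y < \<epsilon> z" using M.triangle[OF zX xy] d dd dxy \<delta>_le[OF z] by simp
      define b c where "b = coc g x a" and "c = coc g y a"
      have nc: "norm c = norm a" by (simp add: c_def norm_coc g y)
      have bc: "norm (b - c) \<le> C * dst D x y * norm a" unfolding b_def c_def by (rule C(2)[OF g x y])
      have px: "pullf h x a = coc ?g ?x (pullf h ?x b)" and py: "pullf h y a = coc ?g ?y (pullf h ?y c)"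
        by (simp_all add: b_def c_def pullf_act fm g x y coc_inv)
      have "pullf h x a - pullf h y a = coc ?g ?x (pullf h ?x (b - c)) + coc ?g ?x (pullf h ?x c - pullf h ?y c)
          + (coc ?g ?x (pullf h ?y c) - coc ?g ?y (pullf h ?y c))"
        unfolding px py
        by (simp add: clinear_op_diff[OF coc_clinear[OF gi xy(1)]] clinear_op_diff[OF pullf_clinear[OF fm xy(1)]])
      then have "norm (pullf h x a - pullf h y a) \<le> norm (coc ?g ?x (pullf h ?x (b - c))) + norm (coc ?g ?x (pullf h ?x c - pullf h ?y c))
          + norm (coc ?g ?x (pullf h ?y c) - coc ?g ?y (pullf h ?y c))"
        by (metis (no_types, lifting) norm_triangle_le order_refl add_mono)
      also have "\<dots> \<le> M * n * (C * dst D x y * norm a) + M * n * dst D x y * norm a + C * dst D x y * (M * n * norm a)"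
      proof (intro add_mono)
        show "norm (coc ?g ?x (pullf h ?x (b - c))) \<le> M * n * (C * dst D x y * norm a)"
          unfolding norm_coc[OF gi xy(1)]
          by (rule order_trans[OF near(1)[OF z xy(1) zx] mult_left_mono[OF bc]]) (use M n in simp)
        show "norm (coc ?g ?x (pullf h ?x c - pullf h ?y c)) \<le> M * n * dst D x y * norm a"
          unfolding norm_coc[OF gi xy(1)] using near(2)[OF z xy(1) zx xy(2) zy, of c] by (simp add: nc dd)
        show "norm (coc ?g ?x (pullf h ?y c) - coc ?g ?y (pullf h ?y c)) \<le> C * dst D x y * (M * n * norm a)"
          by (rule order_trans[OF C(2)[OF gi xy] mult_mono])
             (use near(1)[OF z xy(2) zy, of c] nc dd C(1) in auto)
      qed
      finally show ?thesis by (simp add: algebra_simps)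
    qed
    have lip: "norm (pullf h x a - pullf h y a) \<le> C' * n * dst D x y * norm a" if x: "x \<in> Xt D" and y: "y \<in> Xt D" for x y a
    proof -
      have "norm (pullf h x a - pullf h y a) \<le> ((2 * C + 1) * M * n * norm a + 2 * (M * n * norm a) / \<delta>) * dst D x y"
        by (rule lipschitz_from_local[OF \<delta> _ _ bd loc x y]) (use M n C(1) in auto)
      also have "\<dots> = ((2 * C + 1) * M + 2 * M / \<delta>) * (n * norm a * dst D x y)" by (simp add: algebra_simps)
      also have "\<dots> \<le> C' * (n * norm a * dst D x y)" using M n by (intro mult_right_mono) (auto simp: C'_def)
      finally show ?thesis by (simp add: mult_ac)
    qed
    show ?thesis unfolding is_bounded_map_def is_lipschitz_map_def
      using bd lip M n C'(2) by (auto simp flip: n_def)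
  qed
  show thesis
  proof (rule that[OF C'(2)])
    fix h assume h: "h \<in> L_alg D"
    have n: "0 \<le> L_norm D h" by (rule L_norm_nonneg[OF h])
    show "is_lipschitz_map h (C' * L_norm D h)" using main[OF h] by blast
    have b: "is_bounded_map h (M * L_norm D h)" using main[OF h] by blast
    have "M * L_norm D h * norm a \<le> C' * L_norm D h * norm a" for a :: "complex ^ 'd"
      using C'(1) n by (intro mult_right_mono) auto
    then show "is_bounded_map h (C' * L_norm D h)"
      using b C'(2) n unfolding is_bounded_map_def by (meson mult_nonneg_nonneg order_trans)
  qed
qed

definition W :: "('a set \<Rightarrow> 'e \<Rightarrow> 'e) \<Rightarrow> real" where
  "W h = best_const (Xt D \<times> UNIV) (\<lambda>(x, a). norm (pullf h x a)) (\<lambda>(x, a). norm a)"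

definition Lip :: "('a set \<Rightarrow> 'e \<Rightarrow> 'e) \<Rightarrow> real" where
  "Lip h = best_const (Xt D \<times> Xt D \<times> UNIV) (\<lambda>(x, y, a). norm (pullf h x a - pullf h y a)) (\<lambda>(x, y, a). dst D x y * norm a)"

lemma W_le: "is_bounded_map h B \<Longrightarrow> W h \<le> B"
  unfolding W_def is_bounded_map_def by (intro best_const_le) auto

lemma is_bounded_map_W: "is_bounded_map h B \<Longrightarrow> is_bounded_map h (W h)"
proof -
  assume h: "is_bounded_map h B"
  then have *: "0 \<le> B" "\<And>i. i \<in> Xt D \<times> UNIV \<Longrightarrow> (\<lambda>(x, a). norm (pullf h x a)) i \<le> B * (\<lambda>(x, a). norm a) i"
    by (auto simp: is_bounded_map_def)
  show ?thesis unfolding is_bounded_map_def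
  proof (intro conjI ballI allI)
    show "0 \<le> W h" unfolding W_def by (rule best_const_nonneg[OF *])
    show "norm (pullf h x a) \<le> W h * norm a" if "x \<in> Xt D" for x a
      using best_const_bound[where I = "Xt D \<times> UNIV" and p = "\<lambda>(x, a). norm (pullf h x a)" and q = "\<lambda>(x, a). norm a" and i = "(x, a)", OF *] that by (simp add: W_def)
  qed
qed

lemma Lip_le: "is_lipschitz_map h K \<Longrightarrow> Lip h \<le> K"
  unfolding Lip_def is_lipschitz_map_def by (intro best_const_le) (auto simp: mult_ac)

lemma is_lipschitz_map_Lip: "is_lipschitz_map h K \<Longrightarrow> is_lipschitz_map h (Lip h)"
proof -
  assume h: "is_lipschitz_map h K"
  then have *: "0 \<le> K" "\<And>i. i \<in> Xt D \<times> Xt D \<times> UNIV \<Longrightarrow>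
      (\<lambda>(x, y, a). norm (pullf h x a - pullf h y a)) i \<le> K * (\<lambda>(x, y, a). dst D x y * norm a) i"
    by (auto simp: is_lipschitz_map_def mult_ac)
  show ?thesis unfolding is_lipschitz_map_def
  proof (intro conjI ballI allI)
    show "0 \<le> Lip h" unfolding Lip_def by (rule best_const_nonneg[OF *])
    show "norm (pullf h x a - pullf h y a) \<le> Lip h * dst D x y * norm a" if "x \<in> Xt D" "y \<in> Xt D" for x y a
      using best_const_bound[where I = "Xt D \<times> Xt D \<times> UNIV" and p = "\<lambda>(x, y, a). norm (pullf h x a - pullf h y a)"
        and q = "\<lambda>(x, y, a). dst D x y * norm a" and i = "(x, y, a)", OF *] that by (simp add: Lip_def mult.assoc)
  qed
qed

text \<open>The converse of \<open>L_algI\<close> is where the bump sections enter: they make a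
  bounded module endomorphism Lipschitz in coordinates.\<close>

lemma L_alg_iff: "h \<in> L_alg D \<longleftrightarrow> h \<in> fibre_maps \<and> (\<exists>K. is_lipschitz_map h K)"
proof
  assume h: "h \<in> L_alg D"
  obtain C where "is_lipschitz_map h (C * L_norm D h)" using L_norm_bounds h by metis
  then show "h \<in> fibre_maps \<and> (\<exists>K. is_lipschitz_map h K)" using L_alg_fibre_map[OF h] by blast
qed (use L_algI in blast)

lemma L_alg_bounded: "h \<in> L_alg D \<Longrightarrow> is_bounded_map h (W h)"
  and L_alg_lipschitz: "h \<in> L_alg D \<Longrightarrow> is_lipschitz_map h (Lip h)"
  using lipschitz_map_bounded is_bounded_map_W is_lipschitz_map_Lip unfolding L_alg_iff by metis+

definition nrm :: "('a set \<Rightarrow> 'e \<Rightarrow> 'e) \<Rightarrow> real" where "nrm h = W h + Lip h"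

lemma W_nonneg: "h \<in> L_alg D \<Longrightarrow> 0 \<le> W h" and Lip_nonneg: "h \<in> L_alg D \<Longrightarrow> 0 \<le> Lip h"
  using L_alg_bounded L_alg_lipschitz by (auto simp: is_bounded_map_def is_lipschitz_map_def)

lemma nrm_nonneg: "h \<in> L_alg D \<Longrightarrow> 0 \<le> nrm h" and W_le_nrm: "h \<in> L_alg D \<Longrightarrow> W h \<le> nrm h"
  and Lip_le_nrm: "h \<in> L_alg D \<Longrightarrow> Lip h \<le> nrm h"
  using W_nonneg Lip_nonneg by (simp_all add: nrm_def)

lemma norm_pullf_le: "h \<in> L_alg D \<Longrightarrow> x \<in> Xt D \<Longrightarrow> norm (pullf h x a) \<le> W h * norm a"
  using L_alg_bounded unfolding is_bounded_map_def by blast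

lemma dist_pullf_le: "h \<in> L_alg D \<Longrightarrow> x \<in> Xt D \<Longrightarrow> y \<in> Xt D \<Longrightarrow> norm (pullf h x a - pullf h y a) \<le> Lip h * dst D x y * norm a"
  using L_alg_lipschitz unfolding is_lipschitz_map_def by blast

lemma L_norm_equivalent:
  obtains C where "0 \<le> C" "\<And>h. h \<in> L_alg D \<Longrightarrow> nrm h \<le> C * L_norm D h" "\<And>h. h \<in> L_alg D \<Longrightarrow> L_norm D h \<le> 2 * nrm h"
proof -
  obtain C where C: "C \<ge> 0" "\<And>h. h \<in> L_alg D \<Longrightarrow> is_bounded_map h (C * L_norm D h)"
    "\<And>h. h \<in> L_alg D \<Longrightarrow> is_lipschitz_map h (C * L_norm D h)" using L_norm_bounds by blast
  show thesis
  proof (rule that[of "2 * C"])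
    fix h assume h: "h \<in> L_alg D"
    show "nrm h \<le> 2 * C * L_norm D h"
      using W_le[OF C(2)[OF h]] Lip_le[OF C(3)[OF h]] by (simp add: nrm_def)
    have "L_norm D h \<le> 2 * W h + Lip h"
      by (rule L_norm_le[OF L_alg_fibre_map L_alg_lipschitz L_alg_bounded]) (use h in auto)
    then show "L_norm D h \<le> 2 * nrm h" using Lip_nonneg[OF h] by (simp add: nrm_def)
  qed (use C in simp)
qed

section \<open>\<open>L\<close> as a normed space: linearity, completeness and weak
  precompactness\<close>

lemma End_scale_apply: "End_scale D c h y v = scal D c (h y v)"
  by (simp add: End_scale_def)

lemma vector_space_End: "vector_space (End_scale D)"
  by unfold_locales
     (auto simp: End_scale_def fun_eq_iff E.scale_right_distrib E.scale_left_distrib)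

lemma fibre_maps_add: "h \<in> fibre_maps \<Longrightarrow> k \<in> fibre_maps \<Longrightarrow> h + k \<in> fibre_maps"
  by (rule fibre_mapsI)
     (simp_all add: fibre_map_mem fibre_map_add fibre_map_scale fibre_map_outside fibre_add E.scale_right_distrib)

lemma fibre_maps_scale: "h \<in> fibre_maps \<Longrightarrow> End_scale D c h \<in> fibre_maps"
  by (rule fibre_mapsI)
     (simp_all add: End_scale_apply fibre_map_mem fibre_map_add fibre_map_scale fibre_map_outside fibre_scale E.scale_right_distrib mult.commute)

lemma fibre_maps_0: "0 \<in> fibre_maps"
  by (rule fibre_mapsI) (simp_all add: fibre_0)

lemma pullf_add: "h \<in> fibre_maps \<Longrightarrow> k \<in> fibre_maps \<Longrightarrow> x \<in> Xt D \<Longrightarrow> pullf (h + k) x a = pullf h x a + pullf k x a"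
  by (simp add: pullf_def triv_inv_add fibre_map_mem triv_mem)

lemma pullf_scale: "h \<in> fibre_maps \<Longrightarrow> x \<in> Xt D \<Longrightarrow> pullf (End_scale D c h) x a = c *s pullf h x a"
  by (simp add: pullf_def End_scale_apply triv_inv_scale fibre_map_mem triv_mem)

lemma pullf_0: "x \<in> Xt D \<Longrightarrow> pullf 0 x a = 0"
  by (simp add: pullf_def)

lemma L_add:
  assumes h: "h \<in> L_alg D" and k: "k \<in> L_alg D"
  shows L_alg_add: "h + k \<in> L_alg D" and W_add: "W (h + k) \<le> W h + W k" and Lip_add: "Lip (h + k) \<le> Lip h + Lip k"
proof -
  have fm: "h \<in> fibre_maps" "k \<in> fibre_maps" using L_alg_fibre_map h k by auto
  have lip: "is_lipschitz_map (h + k) (Lip h + Lip k)"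
    unfolding is_lipschitz_map_def
  proof (intro conjI ballI allI)
    fix x y a assume xy: "x \<in> Xt D" "y \<in> Xt D"
    have "norm (pullf (h + k) x a - pullf (h + k) y a) \<le> norm (pullf h x a - pullf h y a) + norm (pullf k x a - pullf k y a)"
      using norm_triangle_ineq[of "pullf h x a - pullf h y a" "pullf k x a - pullf k y a"]
      by (simp add: pullf_add[OF fm] xy algebra_simps)
    also have "\<dots> \<le> Lip h * dst D x y * norm a + Lip k * dst D x y * norm a"
      by (intro add_mono dist_pullf_le h k xy)
    finally show "norm (pullf (h + k) x a - pullf (h + k) y a) \<le> (Lip h + Lip k) * dst D x y * norm a"
      by (simp add: algebra_simps)
  qed (use Lip_nonneg h k in simp)
  show "h + k \<in> L_alg D" by (rule L_algI[OF fibre_maps_add[OF fm] lip])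
  show "Lip (h + k) \<le> Lip h + Lip k" by (rule Lip_le[OF lip])
  have "is_bounded_map (h + k) (W h + W k)"
    unfolding is_bounded_map_def
  proof (intro conjI ballI allI)
    fix x a assume x: "x \<in> Xt D"
    have "norm (pullf (h + k) x a) \<le> norm (pullf h x a) + norm (pullf k x a)"
      unfolding pullf_add[OF fm x] by (rule norm_triangle_ineq)
    also have "\<dots> \<le> W h * norm a + W k * norm a" by (intro add_mono norm_pullf_le h k x)
    finally show "norm (pullf (h + k) x a) \<le> (W h + W k) * norm a" by (simp add: algebra_simps)
  qed (use W_nonneg h k in simp)
  then show "W (h + k) \<le> W h + W k" by (rule W_le)
qed

lemma L_scale_le:
  assumes h: "h \<in> L_alg D"
  shows L_alg_scale: "End_scale D c h \<in> L_alg D" and W_scale_le: "W (End_scale D c h) \<le> cmod c * W h"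
    and Lip_scale_le: "Lip (End_scale D c h) \<le> cmod c * Lip h"
proof -
  have fm: "h \<in> fibre_maps" using L_alg_fibre_map h by auto
  have lip: "is_lipschitz_map (End_scale D c h) (cmod c * Lip h)"
    unfolding is_lipschitz_map_def
  proof (intro conjI ballI allI)
    fix x y a assume xy: "x \<in> Xt D" "y \<in> Xt D"
    have "norm (pullf (End_scale D c h) x a - pullf (End_scale D c h) y a) = cmod c * norm (pullf h x a - pullf h y a)"
      by (simp add: pullf_scale[OF fm] xy norm_vector_scalar_mult flip: vector_ssub_ldistrib)
    also have "\<dots> \<le> cmod c * (Lip h * dst D x y * norm a)" by (intro mult_left_mono dist_pullf_le h xy) auto
    finally show "norm (pullf (End_scale D c h) x a - pullf (End_scale D c h) y a) \<le> cmod c * Lip h * dst D x y * norm a"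
      by (simp add: mult_ac)
  qed (use Lip_nonneg h in simp)
  show "End_scale D c h \<in> L_alg D" by (rule L_algI[OF fibre_maps_scale[OF fm] lip])
  show "Lip (End_scale D c h) \<le> cmod c * Lip h" by (rule Lip_le[OF lip])
  have "is_bounded_map (End_scale D c h) (cmod c * W h)"
    unfolding is_bounded_map_def
  proof (intro conjI ballI allI)
    fix x a assume x: "x \<in> Xt D"
    have "norm (pullf (End_scale D c h) x a) = cmod c * norm (pullf h x a)"
      by (simp add: pullf_scale[OF fm] x norm_vector_scalar_mult)
    also have "\<dots> \<le> cmod c * (W h * norm a)" by (intro mult_left_mono norm_pullf_le h x) auto
    finally show "norm (pullf (End_scale D c h) x a) \<le> cmod c * W h * norm a" by (simp add: mult_ac)
  qed (use W_nonneg h in simp)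
  then show "W (End_scale D c h) \<le> cmod c * W h" by (rule W_le)
qed

lemma nrm_add: "h \<in> L_alg D \<Longrightarrow> k \<in> L_alg D \<Longrightarrow> nrm (h + k) \<le> nrm h + nrm k"
  using W_add Lip_add by (fastforce simp: nrm_def)

lemma nrm_scale_le: "h \<in> L_alg D \<Longrightarrow> nrm (End_scale D c h) \<le> cmod c * nrm h"
  using W_scale_le[of h c] Lip_scale_le[of h c] by (simp add: nrm_def distrib_left)

lemma nrm_zero: "h \<in> L_alg D \<Longrightarrow> nrm h = 0 \<Longrightarrow> h = 0"
proof (rule fibre_maps_eqI)
  assume h: "h \<in> L_alg D" and "nrm h = 0"
  then have "W h = 0" using W_nonneg Lip_nonneg by (fastforce simp: nrm_def)
  then show "pullf h x a = pullf 0 x a" if "x \<in> Xt D" for x a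
    using norm_pullf_le[OF h that, of a] by (simp add: pullf_0 that)
qed (use L_alg_fibre_map fibre_maps_0 in auto)

lemma L_alg_0: "0 \<in> L_alg D"
  by (rule L_algI[OF fibre_maps_0, of 0]) (simp add: is_lipschitz_map_def pullf_0)

lemma nrm_0: "nrm 0 = 0"
proof -
  have "is_bounded_map 0 0" "is_lipschitz_map 0 0"
    by (simp_all add: is_bounded_map_def is_lipschitz_map_def pullf_0)
  then have "nrm 0 \<le> 0" using W_le Lip_le by (fastforce simp: nrm_def)
  then show ?thesis using nrm_nonneg[OF L_alg_0] by simp
qed

lemma nrm_scale:
  assumes h: "h \<in> L_alg D"
  shows "nrm (End_scale D c h) = cmod c * nrm h"
proof (cases "c = 0")
  case True
  then have "End_scale D c h = 0" by (simp add: End_scale_def fun_eq_iff)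
  then show ?thesis using True nrm_0 by simp
next
  case False
  have "End_scale D (inverse c) (End_scale D c h) = h"
    using False by (simp add: End_scale_def)
  then have "nrm h \<le> cmod (inverse c) * nrm (End_scale D c h)"
    using nrm_scale_le[OF L_alg_scale[OF h], of "inverse c" c] by simp
  then have "cmod c * nrm h \<le> nrm (End_scale D c h)"
    using False by (simp add: norm_inverse norm_divide field_simps)
  then show ?thesis using nrm_scale_le[OF h, of c] by simp
qed

lemma L_alg_diff: "h \<in> L_alg D \<Longrightarrow> k \<in> L_alg D \<Longrightarrow> h - k \<in> L_alg D"
proof -
  assume h: "h \<in> L_alg D" and k: "k \<in> L_alg D"
  have eq: "h - k = h + End_scale D (- 1) k" by (simp add: End_scale_def fun_eq_iff)
  show ?thesis unfolding eq by (rule L_alg_add[OF h L_alg_scale[OF k]])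
qed

lemma pullf_diff: "h \<in> fibre_maps \<Longrightarrow> k \<in> fibre_maps \<Longrightarrow> h - k \<in> fibre_maps \<Longrightarrow> x \<in> Xt D \<Longrightarrow> pullf (h - k) x a = pullf h x a - pullf k x a"
  using pullf_add[of "h - k" k x a] by simp

lemma fibre_maps_diff: "h \<in> fibre_maps \<Longrightarrow> k \<in> fibre_maps \<Longrightarrow> h - k \<in> fibre_maps"
proof -
  assume h: "h \<in> fibre_maps" and k: "k \<in> fibre_maps"
  have eq: "h - k = h + End_scale D (- 1) k" by (simp add: End_scale_def fun_eq_iff)
  show ?thesis unfolding eq by (rule fibre_maps_add[OF h fibre_maps_scale[OF k]])
qed

text \<open>Coordinates converge pointwise, and linearity and equivariance pass to the limit, so the
  limit descends to a bundle map. Fixing \<open>n\<close> and letting \<open>m\<close> tend to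
  infinity in the Cauchy estimates bounds \<open>f n - l\<close> in both parts of the norm.\<close>

lemma L_complete:
  assumes f: "\<And>n::nat. f n \<in> L_alg D"
    and cauchy: "\<And>e. e > 0 \<Longrightarrow> \<exists>M. \<forall>m\<ge>M. \<forall>n\<ge>M. nrm (f m - f n) < e"
  shows "\<exists>l\<in>L_alg D. (\<lambda>n. nrm (f n - l)) \<longlonglongrightarrow> 0"
proof -
  have fm: "f n \<in> fibre_maps" for n by (rule L_alg_fibre_map[OF f])
  have diff: "f m - f n \<in> L_alg D" for m n by (rule L_alg_diff[OF f f])
  have p_diff: "pullf (f m - f n) x a = pullf (f m) x a - pullf (f n) x a" if "x \<in> Xt D" for m n x a
    by (rule pullf_diff[OF fm fm L_alg_fibre_map[OF diff] that])
  have near: "norm (pullf (f m) x a - pullf (f n) x a) \<le> nrm (f m - f n) * norm a" if "x \<in> Xt D" for m n x a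
    unfolding p_diff[OF that, symmetric]
    by (rule order_trans[OF norm_pullf_le[OF diff that] mult_right_mono[OF W_le_nrm[OF diff]]]) simp
  define H where "H x a = lim (\<lambda>n. pullf (f n) x a)" for x a
  have lim: "(\<lambda>n. pullf (f n) x a) \<longlonglongrightarrow> H x a" if x: "x \<in> Xt D" for x a
  proof -
    have "Cauchy (\<lambda>n. pullf (f n) x a)"
    proof (rule metric_CauchyI)
      fix e :: real assume e: "e > 0"
      have "e / (norm a + 1) > 0" using e by (simp add: add_nonneg_pos)
      then obtain M where M: "\<And>m n. m \<ge> M \<Longrightarrow> n \<ge> M \<Longrightarrow> nrm (f m - f n) < e / (norm a + 1)" using cauchy by blast
      show "\<exists>M. \<forall>m\<ge>M. \<forall>n\<ge>M. dist (pullf (f m) x a) (pullf (f n) x a) < e"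
      proof (intro exI[of _ M] allI impI)
        fix m n assume mn: "m \<ge> M" "n \<ge> M"
        have "norm (pullf (f m) x a - pullf (f n) x a) \<le> nrm (f m - f n) * norm a" by (rule near[OF x])
        also have "\<dots> \<le> nrm (f m - f n) * (norm a + 1)" using nrm_nonneg[OF diff] by (intro mult_left_mono) auto
        also have "\<dots> < e" using M[OF mn] by (simp add: less_divide_eq add_nonneg_pos)
        finally show "dist (pullf (f m) x a) (pullf (f n) x a) < e" by (simp add: dist_norm)
      qed
    qed
    then show ?thesis unfolding H_def by (metis Cauchy_convergent convergent_LIMSEQ_iff)
  qed
  have lin: "clinear_op (H x)" if x: "x \<in> Xt D" for x
  proof (rule clinear_opI)
    fix a b c
    have "(\<lambda>n. pullf (f n) x (a + b)) \<longlonglongrightarrow> H x a + H x b"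
      unfolding clinear_op_add[OF pullf_clinear[OF fm x]] by (intro tendsto_add lim x)
    then show "H x (a + b) = H x a + H x b" by (rule LIMSEQ_unique[OF lim[OF x]])
    have "(\<lambda>n. pullf (f n) x (c *s a)) \<longlonglongrightarrow> c *s H x a"
      unfolding clinear_op_scale[OF pullf_clinear[OF fm x]]
      by (rule vec_tendstoI) (simp only: vector_smult_component, intro tendsto_mult_left tendsto_vec_nth lim x)
    then show "H x (c *s a) = c *s H x a" by (rule LIMSEQ_unique[OF lim[OF x]])
  qed
  have eqv: "H (act D g x) (coc g x a) = coc g x (H x a)" if g: "g \<in> carrier (Grp D)" and x: "x \<in> Xt D" for g x a
  proof (rule LIMSEQ_unique[OF lim[OF act_mem[OF g x]]])
    have eq: "norm (coc g x (pullf (f n) x a) - coc g x (H x a)) = norm (pullf (f n) x a - H x a)" for n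
      by (simp only: norm_coc[OF g x] clinear_op_diff[OF coc_clinear[OF g x], symmetric])
    have "(\<lambda>n. norm (coc g x (pullf (f n) x a) - coc g x (H x a))) \<longlonglongrightarrow> 0"
      unfolding eq by (rule tendsto_norm_zero[OF LIM_zero[OF lim[OF x]]])
    then have "(\<lambda>n. coc g x (pullf (f n) x a)) \<longlonglongrightarrow> coc g x (H x a)"
      by (rule LIM_zero_cancel[OF tendsto_norm_zero_cancel])
    then show "(\<lambda>n. pullf (f n) (act D g x) (coc g x a)) \<longlonglongrightarrow> coc g x (H x a)"
      by (simp add: pullf_act fm g x)
  qed
  define l where "l = descend_map H"
  have l: "l \<in> fibre_maps" unfolding l_def by (rule descend_map_mem[OF lin eqv])
  have pl: "pullf l x a = H x a" if "x \<in> Xt D" for x a unfolding l_def by (rule pullf_descend_map[OF lin eqv that])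
  have dl: "f n - l \<in> fibre_maps" for n by (rule fibre_maps_diff[OF fm l])
  have pdl: "pullf (f n - l) x a = pullf (f n) x a - H x a" if "x \<in> Xt D" for n x a
    using pullf_diff[OF fm l dl that] pl[OF that] by simp
  have est: "is_bounded_map (f n - l) e \<and> is_lipschitz_map (f n - l) e"
    if e: "0 \<le> e" and M: "\<And>m. m \<ge> M \<Longrightarrow> nrm (f n - f m) \<le> e" for n e M
    unfolding is_bounded_map_def is_lipschitz_map_def
  proof (intro conjI ballI allI e)
    fix x a assume x: "x \<in> Xt D"
    have "(\<lambda>m. norm (pullf (f n) x a - pullf (f m) x a)) \<longlonglongrightarrow> norm (pullf (f n - l) x a)"
      unfolding pdl[OF x] by (intro tendsto_intros lim x)
    moreover have "\<forall>m\<ge>M. norm (pullf (f n) x a - pullf (f m) x a) \<le> e * norm a"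
      using near[OF x] M by (meson mult_right_mono norm_ge_zero order_trans)
    ultimately show "norm (pullf (f n - l) x a) \<le> e * norm a" by (blast intro: LIMSEQ_le_const2)
  next
    fix x y a assume x: "x \<in> Xt D" and y: "y \<in> Xt D"
    have "(\<lambda>m. norm ((pullf (f n) x a - pullf (f m) x a) - (pullf (f n) y a - pullf (f m) y a)))
        \<longlonglongrightarrow> norm (pullf (f n - l) x a - pullf (f n - l) y a)"
      unfolding pdl[OF x] pdl[OF y] by (intro tendsto_intros lim x y)
    moreover have "\<forall>m\<ge>M. norm ((pullf (f n) x a - pullf (f m) x a) - (pullf (f n) y a - pullf (f m) y a)) \<le> e * dst D x y * norm a"
    proof (intro allI impI)
      fix m assume "m \<ge> M"
      then have "Lip (f n - f m) \<le> e" using Lip_le_nrm[OF diff] M order_trans by blast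
      then have "Lip (f n - f m) * dst D x y * norm a \<le> e * dst D x y * norm a" by (intro mult_right_mono) auto
      then show "norm ((pullf (f n) x a - pullf (f m) x a) - (pullf (f n) y a - pullf (f m) y a)) \<le> e * dst D x y * norm a"
        using dist_pullf_le[OF diff x y, of n m a] by (simp add: p_diff x y)
    qed
    ultimately show "norm (pullf (f n - l) x a - pullf (f n - l) y a) \<le> e * dst D x y * norm a"
      by (blast intro: LIMSEQ_le_const2)
  qed
  have small: "\<exists>M. \<forall>n\<ge>M. f n - l \<in> L_alg D \<and> nrm (f n - l) \<le> 2 * e" if e: "e > 0" for e
  proof -
    obtain M where M: "\<And>m n. m \<ge> M \<Longrightarrow> n \<ge> M \<Longrightarrow> nrm (f m - f n) < e" using cauchy[OF e] by blast
    have "f n - l \<in> L_alg D \<and> nrm (f n - l) \<le> 2 * e" if n: "n \<ge> M" for n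
    proof -
      have *: "is_bounded_map (f n - l) e" "is_lipschitz_map (f n - l) e"
        using est[of e M n] e M[OF n] less_imp_le by auto
      show ?thesis using L_algI[OF dl *(2)] W_le[OF *(1)] Lip_le[OF *(2)] by (simp add: nrm_def)
    qed
    then show ?thesis by blast
  qed
  \<comment> \<open>The limit enters \<open>L\<close> as the difference of a member of the sequence
    and a small Lipschitz error.\<close>
  obtain n0 where n0: "f n0 - l \<in> L_alg D" using small[of 1] by auto
  have "f n0 - (f n0 - l) \<in> L_alg D" by (rule L_alg_diff[OF f n0])
  then have lL: "l \<in> L_alg D" by simp
  have "(\<lambda>n. nrm (f n - l)) \<longlonglongrightarrow> 0"
  proof (rule LIMSEQ_I)
    fix r :: real assume r: "r > 0"
    then obtain M where M: "\<forall>n\<ge>M. f n - l \<in> L_alg D \<and> nrm (f n - l) \<le> 2 * (r / 4)" using small[of "r / 4"] by auto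
    show "\<exists>M. \<forall>n\<ge>M. norm (nrm (f n - l) - 0) < r"
    proof (intro exI[of _ M] allI impI)
      fix n assume "n \<ge> M"
      then have "f n - l \<in> L_alg D" "nrm (f n - l) \<le> 2 * (r / 4)" using M by auto
      then show "norm (nrm (f n - l) - 0) < r" using nrm_nonneg r by simp
    qed
  qed
  then show ?thesis using lL by blast
qed

text \<open>On the unit ball the Lipschitz bound reduces \<open>h\<close>, up to a small error, to
  its values on basis vectors at a finite net of centres. These values lie in a compact ball, and
  rounding them to a finite set sorts the unit ball into finitely many classes.\<close>

lemma L_weakly_totally_bounded:
  assumes e: "e > 0"
  shows "\<exists>\<C>. finite \<C> \<and> {v \<in> L_alg D. nrm v \<le> 1} \<subseteq> \<Union>\<C> \<and> (\<forall>C\<in>\<C>. \<forall>u\<in>C. \<forall>v\<in>C. W (u - v) < e)"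
proof -
  define N where "N = real CARD('d)"
  \<comment> \<open>Two members of a class differ by \<open>2 * \<delta>\<close> on each of
    \<open>N\<close> basis vectors at a centre, and moving off the centre costs another
    \<open>2 * \<delta>\<close>; altogether \<open>(2 * N + 2) * \<delta> = e / 2\<close>.\<close>
  define \<delta> where "\<delta> = e / (2 * (2 * N + 2))"
  have N: "N > 0" by (simp add: N_def)
  have \<delta>: "\<delta> > 0" using e N by (simp add: \<delta>_def)
  obtain F where F: "finite F" "F \<subseteq> Xt D" "\<And>x. x \<in> Xt D \<Longrightarrow> \<exists>z\<in>F. \<exists>g\<in>carrier (Grp D). dst D z (act D g x) < \<delta>"
    by (rule finite_cover[of "\<lambda>_. \<delta>"]) (use \<delta> in auto)
  obtain K where K: "finite K" "cball (0 :: complex ^ 'd) 1 \<subseteq> (\<Union>k\<in>K. ball k \<delta>)"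
    using seq_compact_imp_totally_bounded[OF compact_imp_seq_compact[OF compact_cball[of "0 :: complex ^ 'd" 1]]] \<delta> by blast
  define J where "J = F \<times> (UNIV :: 'd set)"
  define B where "B \<kappa> = {h \<in> L_alg D. nrm h \<le> 1 \<and> (\<forall>z\<in>F. \<forall>j. pullf h z (axis j 1) \<in> ball (\<kappa> (z, j)) \<delta>)}" for \<kappa> :: "'a \<times> 'd \<Rightarrow> complex ^ 'd"
  define \<C> where "\<C> = B ` PiE J (\<lambda>_. K)"
  have "finite \<C>" unfolding \<C>_def J_def using F(1) K(1) by (intro finite_imageI finite_PiE) auto
  moreover have "{v \<in> L_alg D. nrm v \<le> 1} \<subseteq> \<Union>\<C>"
  proof
    fix h assume "h \<in> {v \<in> L_alg D. nrm v \<le> 1}"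
    then have h: "h \<in> L_alg D" "nrm h \<le> 1" by auto
    have "\<exists>k\<in>K. pullf h z (axis j 1) \<in> ball k \<delta>" if z: "z \<in> F" for z j
    proof -
      have "norm (pullf h z (axis j 1)) \<le> W h * norm (axis j (1 :: complex))"
        using z F(2) by (intro norm_pullf_le h) auto
      also have "\<dots> \<le> 1" using W_le_nrm[OF h(1)] h(2) by (simp add: norm_axis_1)
      finally show ?thesis using K(2) by (auto simp: subset_iff)
    qed
    then have "\<forall>p\<in>J. \<exists>k\<in>K. pullf h (fst p) (axis (snd p) 1) \<in> ball k \<delta>" by (auto simp: J_def)
    then obtain \<kappa> where \<kappa>: "\<And>p. p \<in> J \<Longrightarrow> \<kappa> p \<in> K \<and> pullf h (fst p) (axis (snd p) 1) \<in> ball (\<kappa> p) \<delta>" by metis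
    have "restrict \<kappa> J \<in> PiE J (\<lambda>_. K)" using \<kappa> by auto
    moreover have "h \<in> B (restrict \<kappa> J)"
      unfolding B_def
    proof (intro CollectI conjI ballI allI h)
      fix z j assume "z \<in> F"
      then have "(z, j) \<in> J" by (simp add: J_def)
      then show "pullf h z (axis j 1) \<in> ball (restrict \<kappa> J (z, j)) \<delta>" using \<kappa>[of "(z, j)"] by simp
    qed
    ultimately show "h \<in> \<Union>\<C>" unfolding \<C>_def by blast
  qed
  moreover have "W (u - v) < e" if C: "C \<in> \<C>" and u: "u \<in> C" and v: "v \<in> C" for C u v
  proof -
    obtain \<kappa> where \<kappa>: "C = B \<kappa>" using C by (auto simp: \<C>_def)
    have uL: "u \<in> L_alg D" "nrm u \<le> 1" and vL: "v \<in> L_alg D" "nrm v \<le> 1" using u v by (auto simp: \<kappa> B_def)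
    have d: "u - v \<in> L_alg D" by (rule L_alg_diff[OF uL(1) vL(1)])
    have dm: "u - v \<in> fibre_maps" by (rule L_alg_fibre_map[OF d])
    have pd: "pullf (u - v) x a = pullf u x a - pullf v x a" if "x \<in> Xt D" for x a
      by (rule pullf_diff[OF L_alg_fibre_map[OF uL(1)] L_alg_fibre_map[OF vL(1)] dm that])
    have lip: "norm (pullf (u - v) x a - pullf (u - v) y a) \<le> 2 * dst D x y * norm a" if x: "x \<in> Xt D" and y: "y \<in> Xt D" for x y a
    proof -
      have "norm (pullf (u - v) x a - pullf (u - v) y a) \<le> norm (pullf u x a - pullf u y a) + norm (pullf v x a - pullf v y a)"
        using norm_triangle_ineq4[of "pullf u x a - pullf u y a" "pullf v x a - pullf v y a"]
        by (simp add: pd x y algebra_simps)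
      also have "\<dots> \<le> 1 * dst D x y * norm a + 1 * dst D x y * norm a"
        using Lip_le_nrm[OF uL(1)] Lip_le_nrm[OF vL(1)] uL(2) vL(2)
        by (intro add_mono order_trans[OF dist_pullf_le[OF uL(1) x y]] order_trans[OF dist_pullf_le[OF vL(1) x y]] mult_right_mono) auto
      finally show ?thesis by (simp add: mult_ac)
    qed
    have at_F: "norm (pullf (u - v) z a) \<le> N * (2 * \<delta>) * norm a" if z: "z \<in> F" for z a
      unfolding N_def
    proof (rule clinear_op_norm_le_basis)
      have zX: "z \<in> Xt D" using z F(2) by blast
      show "clinear_op (pullf (u - v) z)" by (rule pullf_clinear[OF dm zX])
      fix j
      have "dist (\<kappa> (z, j)) (pullf u z (axis j 1)) < \<delta>" "dist (\<kappa> (z, j)) (pullf v z (axis j 1)) < \<delta>"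
        using u v z by (auto simp: \<kappa> B_def)
      then have "dist (pullf u z (axis j 1)) (pullf v z (axis j 1)) \<le> 2 * \<delta>"
        using dist_triangle3[of "pullf u z (axis j 1)" "pullf v z (axis j 1)" "\<kappa> (z, j)"] by simp
      then show "norm (pullf (u - v) z (axis j 1)) \<le> 2 * \<delta>" by (simp add: pd zX dist_norm)
    qed
    have "is_bounded_map (u - v) (e / 2)"
      unfolding is_bounded_map_def
    proof (intro conjI ballI allI)
      fix x a assume x: "x \<in> Xt D"
      obtain z g where z: "z \<in> F" and g: "g \<in> carrier (Grp D)" and d: "dst D z (act D g x) < \<delta>" using F(3)[OF x] by blast
      have zX: "z \<in> Xt D" using z F(2) by blast
      let ?c = "coc g x a"
      have "norm (pullf (u - v) x a) = norm (pullf (u - v) (act D g x) ?c)"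
        by (simp add: pullf_act[OF dm g x] norm_coc[OF g x])
      also have "\<dots> \<le> norm (pullf (u - v) z ?c) + norm (pullf (u - v) z ?c - pullf (u - v) (act D g x) ?c)"
        using norm_triangle_ineq4[of "pullf (u - v) z ?c" "pullf (u - v) z ?c - pullf (u - v) (act D g x) ?c"] by simp
      also have "\<dots> \<le> N * (2 * \<delta>) * norm ?c + 2 * \<delta> * norm ?c"
        using d by (intro add_mono at_F z order_trans[OF lip[OF zX act_mem[OF g x]]] mult_right_mono mult_left_mono) auto
      also have "\<dots> = (2 * N + 2) * \<delta> * norm a" by (simp add: norm_coc g x algebra_simps)
      also have "(2 * N + 2) * \<delta> = e / 2" using N by (simp add: \<delta>_def field_simps)
      finally show "norm (pullf (u - v) x a) \<le> e / 2 * norm a" .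
    qed (use e in simp)
    then show ?thesis using W_le e by fastforce
  qed
  ultimately show ?thesis by (intro exI[of _ \<C>]) blast
qed

end

section \<open>The transfer operator\<close>

lemma cip_scale_right: "cip a (z *s b) = cnj z * cip a b"
  by (simp add: cip_def sum_distrib_left mult_ac)

lemma cip_sum_right: "cip a (\<Sum>i\<in>I. f i) = (\<Sum>i\<in>I. cip a (f i))"
proof -
  have "cip a (x + y) = cip a x + cip a y" for x y by (simp add: cip_def sum.distrib algebra_simps)
  moreover have "cip a 0 = 0" by (simp add: cip_def)
  ultimately show ?thesis by (induction I rule: infinite_finite_induct) auto
qed

lemma cip_ext: "(\<And>a. cip b a = cip c a) \<Longrightarrow> b = c"
  using cip_axis_right[of b] cip_axis_right[of c] by (simp add: vec_eq_iff)

lemma adjoint_exists: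
  assumes f: "clinear_op f"
  shows "\<exists>c. \<forall>a. cip c a = cip b (f a)"
proof (intro exI allI)
  fix a
  have "cip b (f a) = cip b (\<Sum>j\<in>UNIV. (a $ j) *s f (axis j 1))"
    by (subst vec_expand) (simp add: clinear_op_sum[OF f] clinear_op_scale[OF f])
  also have "\<dots> = (\<Sum>j\<in>UNIV. cnj (a $ j) * cip b (f (axis j 1)))"
    by (simp add: cip_sum_right cip_scale_right)
  finally show "cip (\<chi> j. cip b (f (axis j 1))) a = cip b (f a)"
    by (simp add: cip_def mult.commute)
qed

context transfer_setting
begin

section \<open>The bundle map \<open>m\<close> and its adjoint in coordinates\<close>

lemma mmap_mem: "y \<in> base D \<Longrightarrow> v \<in> fibre D (rmap D y) \<Longrightarrow> mmap D y v \<in> fibre D y"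
  and mmap_add: "y \<in> base D \<Longrightarrow> u \<in> fibre D (rmap D y) \<Longrightarrow> v \<in> fibre D (rmap D y) \<Longrightarrow> mmap D y (u + v) = mmap D y u + mmap D y v"
  and mmap_scale: "y \<in> base D \<Longrightarrow> v \<in> fibre D (rmap D y) \<Longrightarrow> mmap D y (scal D c v) = scal D c (mmap D y v)"
  using m_linear[of y] by (auto simp: linear_on_def image_subset_iff)

definition Mf :: "'a \<Rightarrow> complex ^ 'd \<Rightarrow> complex ^ 'd" where
  "Mf x a = triv_inv D x (mmap D (proj D x) (triv D (rt D x) a))"

lemma triv_rt_mem: "x \<in> Xt D \<Longrightarrow> triv D (rt D x) a \<in> fibre D (rmap D (proj D x))"
  by (simp add: rmap_proj triv_mem rt_mem)

lemma triv_Mf: "x \<in> Xt D \<Longrightarrow> triv D x (Mf x a) = mmap D (proj D x) (triv D (rt D x) a)"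
  by (simp add: Mf_def triv_triv_inv mmap_mem triv_rt_mem)

lemma Mf_clinear: "x \<in> Xt D \<Longrightarrow> clinear_op (Mf x)"
  by (rule clinear_opI)
     (simp_all add: Mf_def triv_add triv_scale rt_mem mmap_add mmap_scale triv_rt_mem triv_inv_add triv_inv_scale mmap_mem)

text \<open>The source fibre sits over \<open>rt D x\<close>, which \<open>g\<close> moves through
  \<open>endo D g\<close>; hence two different cocycle values appear.\<close>

lemma Mf_act:
  assumes g: "g \<in> carrier (Grp D)" and x: "x \<in> Xt D"
  shows "Mf (act D g x) (coc (endo D g) (rt D x) a) = coc g x (Mf x a)"
proof -
  have "triv D (rt D (act D g x)) (coc (endo D g) (rt D x) a) = triv D (rt D x) a"
    using triv_coc[OF endo_mem[OF g] rt_mem[OF x]] by (simp add: rt_equivariant g x)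
  then show ?thesis
    by (simp add: Mf_def proj_act g x coc_triv_inv mmap_mem triv_rt_mem)
qed

lemma Mf_lipschitz:
  obtains K where "0 \<le> K" "\<And>x y a. x \<in> Xt D \<Longrightarrow> y \<in> Xt D \<Longrightarrow> norm (Mf x a - Mf y a) \<le> K * dst D x y * norm a"
proof -
  have lip: "lipschitz_wrt (dst D) (Xt D) (\<lambda>x. matrix (Mf x))"
    using m_lipschitz unfolding Mf_def[abs_def] .
  show thesis by (rule lipschitz_matrix_op[OF lip Mf_clinear M.nonneg]) (assumption, rule that)
qed

lemma Mf_bounded: obtains B where "0 \<le> B" "\<And>x a. x \<in> Xt D \<Longrightarrow> norm (Mf x a) \<le> B * norm a"
proof -
  obtain K where K: "0 \<le> K" "\<And>x y a. x \<in> Xt D \<Longrightarrow> y \<in> Xt D \<Longrightarrow> norm (Mf x a - Mf y a) \<le> K * dst D x y * norm a"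
    using Mf_lipschitz by blast
  show thesis
  proof (rule equivariant_lipschitz_bounded[of Mf K])
    show "\<exists>B. \<forall>a. norm (Mf z a) \<le> B * norm a" if "z \<in> Xt D" for z
      using clinear_op_bounded[OF Mf_clinear[OF that]] by metis
    show "\<exists>b. norm b = norm a \<and> norm (Mf x a) = norm (Mf (act D g x) b)"
      if "g \<in> carrier (Grp D)" "x \<in> Xt D" for g x a
      using that by (intro exI[of _ "coc (endo D g) (rt D x) a"]) (simp add: norm_coc Mf_act endo_mem rt_mem)
  qed (use K that in auto)
qed

text \<open>The description by \<open>THE\<close> in \<open>m_adj\<close> has a witness because
  linear maps have adjoints in coordinates, and it is unique because the hermitian form separates
  points.\<close>

lemma m_adj:
  assumes y: "y \<in> base D" and w: "w \<in> fibre D y"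
  shows m_adj_mem: "m_adj D y w \<in> fibre D (rmap D y)"
    and herm_m_adj: "v \<in> fibre D (rmap D y) \<Longrightarrow> herm D (rmap D y) (m_adj D y w) v = herm D y w (mmap D y v)"
proof -
  obtain x where x: "x \<in> Xt D" "y = proj D x" using y by (auto simp: base_eq)
  let ?z = "rt D x"
  have z: "?z \<in> Xt D" "rmap D y = proj D ?z" using x by (simp_all add: rt_mem rmap_proj)
  let ?P = "\<lambda>u. u \<in> fibre D (rmap D y) \<and> (\<forall>v\<in>fibre D (rmap D y). herm D (rmap D y) u v = herm D y w (mmap D y v))"
  have rhs: "herm D y w (mmap D y (triv D ?z a)) = cip (triv_inv D x w) (Mf x a)" for a
    using herm_triv_inv[OF x(1)] w x mmap_mem[OF y] triv_rt_mem[OF x(1)] by (simp add: Mf_def)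
  have "\<exists>!u. ?P u"
  proof (rule ex_ex1I)
    obtain c where c: "\<And>a. cip c a = cip (triv_inv D x w) (Mf x a)"
      using adjoint_exists[OF Mf_clinear[OF x(1)]] by metis
    have "?P (triv D ?z c)"
    proof (intro conjI ballI)
      show "triv D ?z c \<in> fibre D (rmap D y)" using z triv_mem by simp
      fix v assume "v \<in> fibre D (rmap D y)"
      then have v: "v = triv D ?z (triv_inv D ?z v)" using z by (simp add: triv_triv_inv)
      show "herm D (rmap D y) (triv D ?z c) v = herm D y w (mmap D y v)"
        using c[of "triv_inv D ?z v"] rhs[of "triv_inv D ?z v"] herm_triv[OF z(1), of c "triv_inv D ?z v"] v z(2) by metis
    qed
    then show "\<exists>u. ?P u" ..
    fix u u' assume u: "?P u" and u': "?P u'"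
    have "cip (triv_inv D ?z u) a = cip (triv_inv D ?z u') a" for a
    proof -
      have "triv D ?z a \<in> fibre D (rmap D y)" using z triv_mem by simp
      then have "herm D (proj D ?z) u (triv D ?z a) = herm D (proj D ?z) u' (triv D ?z a)"
        using u u' z(2) by simp
      then show ?thesis using herm_triv_inv[OF z(1)] u u' z triv_mem[OF z(1)] by simp
    qed
    then have "triv_inv D ?z u = triv_inv D ?z u'" by (rule cip_ext)
    then show "u = u'" using triv_triv_inv[OF z(1)] u u' z(2) by metis
  qed
  then have "?P (m_adj D y w)" unfolding m_adj_def by (rule theI')
  then show "m_adj D y w \<in> fibre D (rmap D y)"
    "v \<in> fibre D (rmap D y) \<Longrightarrow> herm D (rmap D y) (m_adj D y w) v = herm D y w (mmap D y v)" by auto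
qed

lemma herm_add: "y \<in> base D \<Longrightarrow> u \<in> fibre D y \<Longrightarrow> v \<in> fibre D y \<Longrightarrow> w \<in> fibre D y \<Longrightarrow> herm D y (u + v) w = herm D y u w + herm D y v w"
  and herm_scale: "y \<in> base D \<Longrightarrow> v \<in> fibre D y \<Longrightarrow> w \<in> fibre D y \<Longrightarrow> herm D y (scal D c v) w = c * herm D y v w"
  using herm_linear[of y w] by (auto simp: linear_on_def)

lemma herm_sum:
  assumes y: "y \<in> base D" and w: "w \<in> fibre D y" and f: "\<And>i. i \<in> I \<Longrightarrow> f i \<in> fibre D y"
  shows "herm D y (\<Sum>i\<in>I. f i) w = (\<Sum>i\<in>I. herm D y (f i) w)"
proof -
  have zero: "herm D y 0 w = 0" using herm_scale[OF y fibre_0[OF y] w, of 0] by simp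
  show ?thesis
    using f
  proof (induction I rule: infinite_finite_induct)
    case (insert i I)
    have "(\<Sum>i\<in>I. f i) \<in> fibre D y" by (rule fibre_sum[OF y]) (simp add: insert.prems)
    then show ?case using insert by (simp add: herm_add[OF y _ _ w])
  qed (simp_all add: zero)
qed

lemma herm_ext:
  assumes y: "y \<in> base D" and u: "u \<in> fibre D y" and v: "v \<in> fibre D y"
    and eq: "\<And>w. w \<in> fibre D y \<Longrightarrow> herm D y u w = herm D y v w"
  shows "u = v"
proof -
  obtain x where x: "x \<in> Xt D" "y = proj D x" using y by (auto simp: base_eq)
  have mem: "u \<in> fibre D (proj D x)" "v \<in> fibre D (proj D x)" using u v unfolding x(2) .
  have "triv_inv D x u = triv_inv D x v"
  proof (rule cip_ext)
    fix a
    have t: "triv D x a \<in> fibre D (proj D x)" by (rule triv_mem[OF x(1)])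
    have "herm D (proj D x) u (triv D x a) = herm D (proj D x) v (triv D x a)"
      using eq[unfolded x(2), OF t] .
    then show "cip (triv_inv D x u) a = cip (triv_inv D x v) a"
      unfolding herm_triv_inv[OF x(1) mem(1) t] herm_triv_inv[OF x(1) mem(2) t] triv_inv_triv[OF x(1)] .
  qed
  then have "triv D x (triv_inv D x u) = triv D x (triv_inv D x v)" by (rule arg_cong)
  then show ?thesis unfolding triv_triv_inv[OF x(1) mem(1)] triv_triv_inv[OF x(1) mem(2)] .
qed

text \<open>\<open>rt D\<close> sends \<open>psi D i x\<close> to the translate of \<open>x\<close>
  by \<open>rep D i\<close>, not to \<open>x\<close> itself; the cocycle corrects for this, so that
  the map starts in the coordinates at \<open>x\<close>.\<close>

definition Mi :: "nat \<Rightarrow> 'a \<Rightarrow> complex ^ 'd \<Rightarrow> complex ^ 'd" where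
  "Mi i x a = Mf (psi D i x) (coc (rep D i) x a)"

lemma Mi_eq: "i \<in> {1..idx D} \<Longrightarrow> x \<in> Xt D \<Longrightarrow> triv D (psi D i x) (Mi i x a) = mmap D (proj D (psi D i x)) (triv D x a)"
  using triv_Mf[of "psi D i x" "coc (rep D i) x a"] triv_coc[OF rep_mem]
  by (simp add: Mi_def psi_mem rt_psi)

definition branch :: "('a set \<Rightarrow> 'e \<Rightarrow> 'e) \<Rightarrow> nat \<Rightarrow> 'a \<Rightarrow> 'e \<Rightarrow> 'e" where
  "branch h i x v = m_adj D (proj D (psi D i x)) (h (proj D (psi D i x)) (mmap D (proj D (psi D i x)) v))"

lemma transfer_eq:
  "transfer D h y v = (if y \<in> base D \<and> v \<in> fibre D y then \<Sum>i = 1..idx D. branch h i (lift y) v else 0)"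
  by (simp add: transfer_def branch_def lift_def Let_def)

lemma branch:
  assumes h: "h \<in> fibre_maps" and i: "i \<in> {1..idx D}" and x: "x \<in> Xt D" and v: "v \<in> fibre D (proj D x)"
  shows branch_mem: "branch h i x v \<in> fibre D (proj D x)"
    and herm_branch: "w \<in> fibre D (proj D x) \<Longrightarrow> herm D (proj D x) (branch h i x v) w =
      herm D (proj D (psi D i x)) (h (proj D (psi D i x)) (mmap D (proj D (psi D i x)) v)) (mmap D (proj D (psi D i x)) w)"
proof -
  let ?y = "proj D (psi D i x)"
  have y: "?y \<in> base D" "rmap D ?y = proj D x" using psi_mem[OF i x] rmap_psi[OF i x] by auto
  have m: "h ?y (mmap D ?y v) \<in> fibre D ?y" using fibre_map_mem[OF h y(1) mmap_mem[OF y(1)]] v y(2) by simp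
  show "branch h i x v \<in> fibre D (proj D x)"
    "w \<in> fibre D (proj D x) \<Longrightarrow> herm D (proj D x) (branch h i x v) w = herm D ?y (h ?y (mmap D ?y v)) (mmap D ?y w)"
    using m_adj_mem[OF y(1) m] herm_m_adj[OF y(1) m, of w] y(2) by (simp_all add: branch_def)
qed

text \<open>\<open>transfer\<close> is defined at one chosen representative of the orbit. Passing to
  an arbitrary \<open>x\<close> permutes the branches, by \<open>psi_act_permutes\<close>, and the
  sum stays the same. Testing against \<open>w\<close> moves the adjoint to the other side.\<close>

lemma herm_transfer:
  assumes h: "h \<in> fibre_maps" and x: "x \<in> Xt D" and v: "v \<in> fibre D (proj D x)" and w: "w \<in> fibre D (proj D x)"
  shows "transfer D h (proj D x) v \<in> fibre D (proj D x)"
    and "herm D (proj D x) (transfer D h (proj D x) v) w = (\<Sum>i = 1..idx D.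
      herm D (proj D (psi D i x)) (h (proj D (psi D i x)) (mmap D (proj D (psi D i x)) v)) (mmap D (proj D (psi D i x)) w))"
proof -
  let ?y = "proj D x" and ?l = "lift (proj D x)"
  let ?t = "\<lambda>u. herm D u (h u (mmap D u v)) (mmap D u w)"
  have y: "?y \<in> base D" using x by simp
  have l: "?l \<in> Xt D" "proj D ?l = ?y" using lift_mem proj_lift x by auto
  have T: "transfer D h ?y v = (\<Sum>i = 1..idx D. branch h i ?l v)" using y v by (simp add: transfer_eq)
  have b: "branch h i ?l v \<in> fibre D ?y" if "i \<in> {1..idx D}" for i
    using branch_mem[OF h that l(1)] v l(2) by simp
  show "transfer D h ?y v \<in> fibre D ?y" unfolding T by (rule fibre_sum[OF y b])
  obtain g where g: "g \<in> carrier (Grp D)" "?l = act D g x"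
    using proj_eqD[OF x l(1) l(2)[symmetric]] by blast
  obtain \<sigma> where \<sigma>: "bij_betw \<sigma> {1..idx D} {1..idx D}"
    "\<And>i. i \<in> {1..idx D} \<Longrightarrow> proj D (psi D i (act D g x)) = proj D (psi D (\<sigma> i) x)"
    using psi_act_permutes[OF g(1) x] by blast
  have "herm D ?y (transfer D h ?y v) w = (\<Sum>i = 1..idx D. herm D ?y (branch h i ?l v) w)"
    unfolding T by (rule herm_sum[OF y w b])
  also have "\<dots> = (\<Sum>i = 1..idx D. ?t (proj D (psi D i ?l)))"
    by (rule sum.cong[OF refl]) (use herm_branch[OF h _ l(1)] l(2) v w in simp)
  also have "\<dots> = (\<Sum>i = 1..idx D. ?t (proj D (psi D (\<sigma> i) x)))"
    using \<sigma>(2) by (intro sum.cong) (simp_all add: g(2))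
  also have "\<dots> = (\<Sum>i = 1..idx D. ?t (proj D (psi D i x)))"
    by (rule sum.reindex_bij_betw[OF \<sigma>(1)])
  finally show "herm D ?y (transfer D h ?y v) w = (\<Sum>i = 1..idx D. ?t (proj D (psi D i x)))" .
qed

lemma transfer_mem:
  assumes h: "h \<in> fibre_maps"
  shows "transfer D h \<in> fibre_maps"
proof (rule fibre_mapsI)
  fix y u v and c :: complex assume y: "y \<in> base D" and v: "v \<in> fibre D y"
  obtain x where x: "x \<in> Xt D" "y = proj D x" using y by (auto simp: base_eq)
  have mem: "transfer D h y v' \<in> fibre D y" if "v' \<in> fibre D y" for v'
    using herm_transfer(1)[OF h x(1)] that x(2) by simp
  show "transfer D h y v \<in> fibre D y" by (rule mem[OF v])
  have psi: "proj D (psi D i x) \<in> base D" "rmap D (proj D (psi D i x)) = y" if "i \<in> {1..idx D}" for i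
    using psi_mem[OF that x(1)] rmap_psi[OF that x(1)] x(2) by auto
  have m: "mmap D (proj D (psi D i x)) v' \<in> fibre D (proj D (psi D i x))" if "i \<in> {1..idx D}" "v' \<in> fibre D y" for i v'
    using mmap_mem[OF psi(1)[OF that(1)]] psi(2)[OF that(1)] that(2) by simp
  have hm: "h (proj D (psi D i x)) (mmap D (proj D (psi D i x)) v') \<in> fibre D (proj D (psi D i x))"
    if "i \<in> {1..idx D}" "v' \<in> fibre D y" for i v'
    by (rule fibre_map_mem[OF h psi(1)[OF that(1)] m[OF that]])
  show "transfer D h y (scal D c v) = scal D c (transfer D h y v)"
  proof (rule herm_ext[OF y mem[OF fibre_scale[OF y v]] fibre_scale[OF y mem[OF v]]])
    fix w assume w: "w \<in> fibre D y"
    show "herm D y (transfer D h y (scal D c v)) w = herm D y (scal D c (transfer D h y v)) w"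
      using herm_transfer(2)[OF h x(1), of "scal D c v" w] herm_transfer(2)[OF h x(1), of v w] fibre_scale[OF y v] v w mem[OF v] y
      by (simp add: herm_scale sum_distrib_left mmap_scale psi fibre_map_scale[OF h] m hm flip: x(2))
  qed
  assume u: "u \<in> fibre D y"
  show "transfer D h y (u + v) = transfer D h y u + transfer D h y v"
  proof (rule herm_ext[OF y mem[OF fibre_add[OF y u v]] fibre_add[OF y mem[OF u] mem[OF v]]])
    fix w assume w: "w \<in> fibre D y"
    show "herm D y (transfer D h y (u + v)) w = herm D y (transfer D h y u + transfer D h y v) w"
      using herm_transfer(2)[OF h x(1), of "u + v" w] herm_transfer(2)[OF h x(1), of v w] herm_transfer(2)[OF h x(1), of u w]
        fibre_add[OF y u v] v u w mem[OF v] mem[OF u] y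
      by (simp add: herm_add sum.distrib mmap_add psi fibre_map_add[OF h] m hm flip: x(2))
  qed
qed (auto simp: transfer_eq)

lemma cip_transfer:
  assumes h: "h \<in> fibre_maps" and x: "x \<in> Xt D"
  shows "cip (pullf (transfer D h) x a) b = (\<Sum>i = 1..idx D. cip (pullf h (psi D i x) (Mi i x a)) (Mi i x b))"
proof -
  have "cip (pullf (transfer D h) x a) b = herm D (proj D x) (triv D x (pullf (transfer D h) x a)) (triv D x b)"
    by (simp add: herm_triv x)
  also have "\<dots> = herm D (proj D x) (transfer D h (proj D x) (triv D x a)) (triv D x b)"
    by (simp add: triv_pullf[OF transfer_mem[OF h] x])
  also have "\<dots> = (\<Sum>i = 1..idx D. herm D (proj D (psi D i x)) (h (proj D (psi D i x)) (mmap D (proj D (psi D i x)) (triv D x a)))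
      (mmap D (proj D (psi D i x)) (triv D x b)))"
    by (rule herm_transfer(2)[OF h x triv_mem[OF x] triv_mem[OF x]])
  also have "\<dots> = (\<Sum>i = 1..idx D. cip (pullf h (psi D i x) (Mi i x a)) (Mi i x b))"
  proof (rule sum.cong[OF refl])
    fix i assume i: "i \<in> {1..idx D}"
    have p: "psi D i x \<in> Xt D" by (rule psi_mem[OF i x])
    show "herm D (proj D (psi D i x)) (h (proj D (psi D i x)) (mmap D (proj D (psi D i x)) (triv D x a)))
      (mmap D (proj D (psi D i x)) (triv D x b)) = cip (pullf h (psi D i x) (Mi i x a)) (Mi i x b)"
      unfolding Mi_eq[OF i x, symmetric] triv_pullf[OF h p, symmetric] by (rule herm_triv[OF p])
  qed
  finally show ?thesis .
qed

section \<open>Iterates of the operator as sums over words of inverse branches\<close>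

definition words :: "nat \<Rightarrow> nat list set" where
  "words k = {w. set w \<subseteq> {1..idx D} \<and> length w = k}"

lemma words_0: "words 0 = {[]}"
  by (auto simp: words_def)

lemma sum_words_Suc: "(\<Sum>w\<in>words (Suc k). F w) = (\<Sum>i = 1..idx D. \<Sum>w\<in>words k. F (i # w))"
proof -
  have words: "words (Suc k) = (\<lambda>(w, i). i # w) ` (words k \<times> {1..idx D})"
    unfolding words_def by (rule lists_length_Suc_eq)
  have inj: "inj_on (\<lambda>(w, i). i # w) (words k \<times> {1..idx D})" by (auto simp: inj_on_def)
  have "(\<Sum>w\<in>words (Suc k). F w) = (\<Sum>p\<in>words k \<times> {1..idx D}. F (snd p # fst p))"
    unfolding words sum.reindex[OF inj] by (simp add: case_prod_beta)
  also have "\<dots> = (\<Sum>w\<in>words k. \<Sum>i = 1..idx D. F (i # w))"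
    by (simp add: sum.cartesian_product case_prod_beta)
  also have "\<dots> = (\<Sum>i = 1..idx D. \<Sum>w\<in>words k. F (i # w))" by (rule sum.swap)
  finally show ?thesis .
qed

text \<open>The head letter acts first: the outermost application of the operator branches at
  \<open>x\<close>, and the remaining iterates branch at \<open>psi D i x\<close>. \<open>Mw\<close>
  follows the same order.\<close>

primrec psiw :: "nat list \<Rightarrow> 'a \<Rightarrow> 'a" where
  "psiw [] x = x"
| "psiw (i # w) x = psiw w (psi D i x)"

primrec Mw :: "nat list \<Rightarrow> 'a \<Rightarrow> complex ^ 'd \<Rightarrow> complex ^ 'd" where
  "Mw [] x a = a"
| "Mw (i # w) x a = Mw w (psi D i x) (Mi i x a)"

lemma psiw_mem: "set w \<subseteq> {1..idx D} \<Longrightarrow> x \<in> Xt D \<Longrightarrow> psiw w x \<in> Xt D"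
  by (induction w arbitrary: x) (auto simp: psi_mem)

lemma transfer_pow_mem: "h \<in> fibre_maps \<Longrightarrow> (transfer D ^^ k) h \<in> fibre_maps"
  by (induction k) (auto simp: transfer_mem)

lemma cip_transfer_pow:
  assumes h: "h \<in> fibre_maps"
  shows "x \<in> Xt D \<Longrightarrow> cip (pullf ((transfer D ^^ k) h) x a) b = (\<Sum>w\<in>words k. cip (pullf h (psiw w x) (Mw w x a)) (Mw w x b))"
proof (induction k arbitrary: x a b)
  case 0
  then show ?case by (simp add: words_0)
next
  case (Suc k)
  have "cip (pullf ((transfer D ^^ Suc k) h) x a) b
      = (\<Sum>i = 1..idx D. cip (pullf ((transfer D ^^ k) h) (psi D i x) (Mi i x a)) (Mi i x b))"
    using cip_transfer[OF transfer_pow_mem[OF h] Suc.prems] by simp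
  also have "\<dots> = (\<Sum>i = 1..idx D. \<Sum>w\<in>words k. cip (pullf h (psiw (i # w) x) (Mw (i # w) x a)) (Mw (i # w) x b))"
    using Suc by (intro sum.cong) (simp_all add: psi_mem)
  finally show ?case by (simp only: sum_words_Suc)
qed

lemma rt_pow_mem: "x \<in> Xt D \<Longrightarrow> (rt D ^^ k) x \<in> Xt D"
  by (induction k) (auto simp: rt_mem)

text \<open>Each letter adds one representative and pushes the earlier group element through
  \<open>endo D\<close>. The resulting \<open>g\<close> depends on the word but not on
  \<open>x\<close>, so \<open>rt D ^^ length w\<close> after \<open>psiw w\<close> is an isometry,
  and any expansion rate of the iterate becomes a contraction rate of the branch.\<close>

lemma rt_pow_psiw:
  "set w \<subseteq> {1..idx D} \<Longrightarrow> \<exists>g\<in>carrier (Grp D). \<forall>x\<in>Xt D. (rt D ^^ length w) (psiw w x) = act D g x"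
proof (induction w)
  case Nil
  then show ?case by (intro bexI[of _ "\<one>\<^bsub>Grp D\<^esub>"]) (auto simp: act_one)
next
  case (Cons i w)
  then obtain g where g: "g \<in> carrier (Grp D)" "\<And>x. x \<in> Xt D \<Longrightarrow> (rt D ^^ length w) (psiw w x) = act D g x" by auto
  have i: "i \<in> {1..idx D}" using Cons.prems by simp
  show ?case
  proof (intro bexI[of _ "endo D g \<otimes>\<^bsub>Grp D\<^esub> rep D i"] ballI)
    fix x assume x: "x \<in> Xt D"
    have "(rt D ^^ length (i # w)) (psiw (i # w) x) = rt D (act D g (psi D i x))"
      using g(2)[OF psi_mem[OF i x]] by simp
    also have "\<dots> = act D (endo D g) (act D (rep D i) x)"
      using rt_equivariant[OF g(1) psi_mem[OF i x]] rt_psi[OF i x] by simp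
    finally show "(rt D ^^ length (i # w)) (psiw (i # w) x) = act D (endo D g \<otimes>\<^bsub>Grp D\<^esub> rep D i) x"
      by (simp add: act_mult endo_mem[OF g(1)] rep_mem[OF i] x)
  qed (use endo_mem[OF g(1)] rep_mem[OF i] in simp)
qed

lemma rt_pow_expanding: "x \<in> Xt D \<Longrightarrow> y \<in> Xt D \<Longrightarrow> dst D x y \<le> theta D ^ k * dst D ((rt D ^^ k) x) ((rt D ^^ k) y)"
proof (induction k)
  case (Suc k)
  have "dst D x y \<le> theta D ^ k * dst D ((rt D ^^ k) x) ((rt D ^^ k) y)" using Suc by simp
  also have "\<dots> \<le> theta D ^ k * (theta D * dst D (rt D ((rt D ^^ k) x)) (rt D ((rt D ^^ k) y)))"
    using theta_range Suc.prems by (intro mult_left_mono rt_expanding rt_pow_mem) auto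
  finally show ?case by (simp add: mult_ac)
qed simp

definition lipschitz_family :: "('a \<Rightarrow> complex ^ 'd \<Rightarrow> complex ^ 'd) \<Rightarrow> real \<Rightarrow> real \<Rightarrow> bool" where
  "lipschitz_family P B K \<longleftrightarrow> 0 \<le> B \<and> 0 \<le> K \<and> (\<forall>x\<in>Xt D. clinear_op (P x)) \<and>
    (\<forall>x\<in>Xt D. \<forall>a. norm (P x a) \<le> B * norm a) \<and>
    (\<forall>x\<in>Xt D. \<forall>y\<in>Xt D. \<forall>a. norm (P x a - P y a) \<le> K * dst D x y * norm a)"

lemma lipschitz_familyD:
  assumes "lipschitz_family P B K"
  shows "0 \<le> B" "0 \<le> K" "\<And>x. x \<in> Xt D \<Longrightarrow> clinear_op (P x)"
    "\<And>x a. x \<in> Xt D \<Longrightarrow> norm (P x a) \<le> B * norm a"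
    "\<And>x y a. x \<in> Xt D \<Longrightarrow> y \<in> Xt D \<Longrightarrow> norm (P x a - P y a) \<le> K * dst D x y * norm a"
  using assms by (auto simp: lipschitz_family_def)

lemma lipschitz_family_compose:
  assumes P: "lipschitz_family P B K" and Q: "lipschitz_family Q B' K'"
    and f: "\<And>x. x \<in> Xt D \<Longrightarrow> f x \<in> Xt D" "\<And>x y. x \<in> Xt D \<Longrightarrow> y \<in> Xt D \<Longrightarrow> dst D (f x) (f y) \<le> dst D x y"
  shows "lipschitz_family (\<lambda>x a. P (f x) (Q x a)) (B * B') (B * K' + K * B')"
  unfolding lipschitz_family_def
proof (intro conjI ballI allI)
  note P = lipschitz_familyD[OF P] and Q = lipschitz_familyD[OF Q]
  show "0 \<le> B * B'" "0 \<le> B * K' + K * B'" using P(1,2) Q(1,2) by auto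
  fix x assume x: "x \<in> Xt D"
  show "clinear_op (\<lambda>a. P (f x) (Q x a))" by (rule clinear_op_compose[OF P(3)[OF f(1)[OF x]] Q(3)[OF x]])
  show "norm (P (f x) (Q x a)) \<le> B * B' * norm a" for a
    using order_trans[OF P(4)[OF f(1)[OF x]] mult_left_mono[OF Q(4)[OF x] P(1)], of a] by (simp add: mult.assoc)
  fix y a assume y: "y \<in> Xt D"
  have "P (f x) (Q x a) - P (f y) (Q y a) = P (f x) (Q x a - Q y a) + (P (f x) (Q y a) - P (f y) (Q y a))"
    by (simp add: clinear_op_diff[OF P(3)[OF f(1)[OF x]]])
  then have "norm (P (f x) (Q x a) - P (f y) (Q y a)) \<le> norm (P (f x) (Q x a - Q y a)) + norm (P (f x) (Q y a) - P (f y) (Q y a))"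
    using norm_triangle_ineq by metis
  also have "\<dots> \<le> B * (K' * dst D x y * norm a) + K * dst D x y * (B' * norm a)"
  proof (rule add_mono)
    show "norm (P (f x) (Q x a - Q y a)) \<le> B * (K' * dst D x y * norm a)"
      by (rule order_trans[OF P(4)[OF f(1)[OF x]] mult_left_mono[OF Q(5)[OF x y] P(1)]])
    have "norm (P (f x) (Q y a) - P (f y) (Q y a)) \<le> K * dst D (f x) (f y) * norm (Q y a)"
      by (rule P(5)[OF f(1)[OF x] f(1)[OF y]])
    also have "\<dots> \<le> K * dst D x y * (B' * norm a)"
      using P(2) by (intro mult_mono mult_left_mono f(2) x y Q(4)) auto
    finally show "norm (P (f x) (Q y a) - P (f y) (Q y a)) \<le> K * dst D x y * (B' * norm a)" .
  qed
  finally show "norm (P (f x) (Q x a) - P (f y) (Q y a)) \<le> (B * K' + K * B') * dst D x y * norm a"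
    by (simp add: algebra_simps)
qed

lemma psi_contracting:
  assumes i: "i \<in> {1..idx D}" and x: "x \<in> Xt D" and y: "y \<in> Xt D"
  shows "dst D (psi D i x) (psi D i y) \<le> dst D x y"
proof -
  have "dst D (psi D i x) (psi D i y) \<le> theta D * dst D (rt D (psi D i x)) (rt D (psi D i y))"
    by (rule rt_expanding[OF psi_mem[OF i x] psi_mem[OF i y]])
  also have "\<dots> = theta D * dst D x y"
    by (simp only: rt_psi[OF i x] rt_psi[OF i y] isometric[OF rep_mem[OF i] x y])
  also have "\<dots> \<le> 1 * dst D x y" using theta_range by (intro mult_right_mono) auto
  finally show ?thesis by simp
qed

lemma Mi_lipschitz_family:
  assumes i: "i \<in> {1..idx D}"
  shows "\<exists>B K. lipschitz_family (Mi i) B K"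
proof -
  obtain K where K: "0 \<le> K" "\<And>x y a. x \<in> Xt D \<Longrightarrow> y \<in> Xt D \<Longrightarrow> norm (Mf x a - Mf y a) \<le> K * dst D x y * norm a"
    using Mf_lipschitz by blast
  obtain B where B: "0 \<le> B" "\<And>x a. x \<in> Xt D \<Longrightarrow> norm (Mf x a) \<le> B * norm a" using Mf_bounded by blast
  obtain C where C: "C \<ge> 0" "\<And>g x y a. g \<in> carrier (Grp D) \<Longrightarrow> x \<in> Xt D \<Longrightarrow> y \<in> Xt D
    \<Longrightarrow> norm (coc g x a - coc g y a) \<le> C * dst D x y * norm a"
    using coc_uniformly_lipschitz by blast
  have P: "lipschitz_family Mf B K" using K B Mf_clinear by (simp add: lipschitz_family_def)
  have Q: "lipschitz_family (coc (rep D i)) 1 C"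
    using C rep_mem[OF i] coc_clinear by (simp add: lipschitz_family_def norm_coc)
  show ?thesis
    using lipschitz_family_compose[OF P Q psi_mem[OF i] psi_contracting[OF i]] unfolding Mi_def[abs_def] by blast
qed

lemma Mw_lipschitz_family: "set w \<subseteq> {1..idx D} \<Longrightarrow> \<exists>B K. lipschitz_family (Mw w) B K"
proof (induction w)
  case Nil
  have "lipschitz_family (Mw []) 1 0" by (simp add: lipschitz_family_def linear_on_def)
  then show ?case by blast
next
  case (Cons i w)
  then have i: "i \<in> {1..idx D}" by simp
  obtain B K where P: "lipschitz_family (Mw w) B K" using Cons by auto
  obtain B' K' where Q: "lipschitz_family (Mi i) B' K'" using Mi_lipschitz_family[OF i] by blast
  have "Mw (i # w) = (\<lambda>x a. Mw w (psi D i x) (Mi i x a))" by (simp add: fun_eq_iff)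
  then show ?case
    using lipschitz_family_compose[OF P Q psi_mem[OF i] psi_contracting[OF i]] by metis
qed

section \<open>The sup norm and the consequences of power boundedness\<close>

lemma fibre_norm_bound:
  assumes h: "h \<in> fibre_maps" and x: "x \<in> Xt D"
  shows "{fibre_norm D (proj D x) (h (proj D x) v) | v. v \<in> fibre D (proj D x) \<and> fibre_norm D (proj D x) v \<le> 1}
    = {norm (pullf h x a) | a. norm a \<le> 1}"
proof (intro Set.set_eqI iffI)
  let ?y = "proj D x"
  have y: "?y \<in> base D" using x by simp
  fix t assume "t \<in> {fibre_norm D ?y (h ?y v) | v. v \<in> fibre D ?y \<and> fibre_norm D ?y v \<le> 1}"
  then obtain v where v: "t = fibre_norm D ?y (h ?y v)" "v \<in> fibre D ?y" "fibre_norm D ?y v \<le> 1" by blast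
  have "t = norm (pullf h x (triv_inv D x v))"
    using v fibre_map_mem[OF h y v(2)] by (simp add: fibre_norm_triv_inv[OF x] pullf_def triv_triv_inv[OF x])
  then show "t \<in> {norm (pullf h x a) | a. norm a \<le> 1}" using v by (auto simp: fibre_norm_triv_inv[OF x])
next
  let ?y = "proj D x"
  have y: "?y \<in> base D" using x by simp
  fix t assume "t \<in> {norm (pullf h x a) | a. norm a \<le> 1}"
  then obtain a where a: "t = norm (pullf h x a)" "norm a \<le> 1" by blast
  have m: "triv D x a \<in> fibre D ?y" by (rule triv_mem[OF x])
  have "t = fibre_norm D ?y (h ?y (triv D x a))"
    using a fibre_map_mem[OF h y m] by (simp add: fibre_norm_triv_inv[OF x] pullf_def)
  then show "t \<in> {fibre_norm D ?y (h ?y v) | v. v \<in> fibre D ?y \<and> fibre_norm D ?y v \<le> 1}"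
    using a m by (auto simp: fibre_norm_triv_inv[OF x] x)
qed

lemma op_norm_fibre:
  assumes h: "h \<in> fibre_maps" and B: "is_bounded_map h B" and x: "x \<in> Xt D"
  shows op_norm_fibre_le: "op_norm (fibre D (proj D x)) (fibre_norm D (proj D x)) (h (proj D x)) \<le> B"
    and norm_pullf_le_op_norm: "norm (pullf h x a) \<le> op_norm (fibre D (proj D x)) (fibre_norm D (proj D x)) (h (proj D x)) * norm a"
proof -
  let ?S = "{norm (pullf h x a) | a. norm a \<le> 1}"
  have eq: "op_norm (fibre D (proj D x)) (fibre_norm D (proj D x)) (h (proj D x)) = Sup ?S"
    unfolding op_norm_def fibre_norm_bound[OF h x] ..
  have B0: "0 \<le> B" using B by (simp add: is_bounded_map_def)
  have le: "t \<le> B" if t: "t \<in> ?S" for t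
  proof -
    obtain a where a: "t = norm (pullf h x a)" "norm a \<le> 1" using t by blast
    have "t \<le> B * norm a" using B x a by (simp add: is_bounded_map_def)
    also have "\<dots> \<le> B * 1" by (rule mult_left_mono[OF a(2) B0])
    finally show ?thesis by simp
  qed
  have ne: "?S \<noteq> {}" by (auto intro: exI[of _ 0])
  show "op_norm (fibre D (proj D x)) (fibre_norm D (proj D x)) (h (proj D x)) \<le> B"
    unfolding eq by (rule cSup_least[OF ne le])
  show "norm (pullf h x a) \<le> op_norm (fibre D (proj D x)) (fibre_norm D (proj D x)) (h (proj D x)) * norm a"
  proof (cases "a = 0")
    case True
    then show ?thesis using clinear_op_0[OF pullf_clinear[OF h x]] by simp
  next
    case False
    define c where "c = complex_of_real (1 / norm a)"
    have c: "cmod c = 1 / norm a" by (simp add: c_def norm_divide)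
    have "norm (c *s a) = 1" using False by (simp add: norm_vector_scalar_mult c)
    then have "norm (pullf h x (c *s a)) \<in> ?S" by auto
    then have "norm (pullf h x (c *s a)) \<le> Sup ?S"
      by (rule cSup_upper[OF _ bdd_aboveI[OF le]])
    then have "norm (pullf h x a) / norm a \<le> Sup ?S"
      by (simp add: clinear_op_scale[OF pullf_clinear[OF h x]] norm_vector_scalar_mult c)
    then show ?thesis unfolding eq using False by (simp add: divide_le_eq)
  qed
qed

lemma sup_norm_End:
  assumes h: "h \<in> fibre_maps" and B: "is_bounded_map h B"
  shows sup_norm_End_le: "sup_norm_End D h \<le> B"
    and is_bounded_map_sup_norm_End: "is_bounded_map h (sup_norm_End D h)"
proof -
  let ?f = "\<lambda>y. op_norm (fibre D y) (fibre_norm D y) (h y)"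
  have le: "?f y \<le> B" if y: "y \<in> base D" for y
  proof -
    obtain x where x: "x \<in> Xt D" "y = proj D x" using y by (auto simp: base_eq)
    show ?thesis unfolding x(2) by (rule op_norm_fibre_le[OF h B x(1)])
  qed
  have ne: "base D \<noteq> {}" using fixed_point base_eq by auto
  show "sup_norm_End D h \<le> B" unfolding sup_norm_End_def by (rule cSUP_least[OF ne le])
  have up: "?f y \<le> sup_norm_End D h" if "y \<in> base D" for y
    unfolding sup_norm_End_def by (rule cSUP_upper[OF that bdd_aboveI2[OF le]])
  have bound: "norm (pullf h x a) \<le> sup_norm_End D h * norm a" if x: "x \<in> Xt D" for x a
    by (rule order_trans[OF norm_pullf_le_op_norm[OF h B x] mult_right_mono[OF up[OF proj_mem[OF x]]]]) simp
  have "norm (axis undefined 1 :: complex ^ 'd) = 1" by (simp add: norm_axis_1)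
  then have "0 \<le> sup_norm_End D h"
    using bound[OF fixed_point(1), of "axis undefined 1"] norm_ge_zero[of "pullf h (fixpt D) (axis undefined 1)"]
    by (metis mult.right_neutral order_trans)
  then show "is_bounded_map h (sup_norm_End D h)" using bound by (simp add: is_bounded_map_def)
qed

text \<open>In a chart the matrix of \<open>h\<close> stays within 1 of its value at
  \<open>z\<close> on a neighbourhood, and the coordinate changes are bounded there; a finite cover
  does the rest. This is what makes the real supremum in \<open>sup_norm_End\<close> informative for
  all continuous bundle maps.\<close>

lemma End_bundle_bounded:
  assumes h: "h \<in> End_bundle D"
  obtains B where "is_bounded_map h B"
proof -
  have fm: "h \<in> fibre_maps" using h by (simp add: End_bundle_def fibre_maps_def)
  have loc: "\<exists>r>0. \<exists>B\<ge>0. \<forall>x\<in>Xt D. dst D z x < r \<longrightarrow> (\<forall>a. norm (pullf h x a) \<le> B * norm a)" if z: "z \<in> Xt D" for z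
  proof -
    obtain U \<phi> where chart: "(U, \<phi>) \<in> charts D" and zU: "proj D z \<in> U" using chart_at[OF proj_mem[OF z]] by blast
    let ?A = "\<lambda>y. matrix (\<lambda>a. \<phi> y (h y (chart_inv D \<phi> y a)))"
    have cont: "continuous_map (subtopology (base_top D) U) euclidean ?A"
      using h chart unfolding End_bundle_def by blast
    obtain r K where r: "r > 0" "\<And>y. y \<in> Xt D \<Longrightarrow> dst D z y < r \<Longrightarrow> proj D y \<in> U" "0 \<le> K"
      "\<And>y a. y \<in> Xt D \<Longrightarrow> dst D z y < r \<Longrightarrow> norm (Phi \<phi> y a - Phi \<phi> z a) \<le> K * dst D z y * norm a"
      "\<And>y a. y \<in> Xt D \<Longrightarrow> dst D z y < r \<Longrightarrow> norm (Psi \<phi> y a - Psi \<phi> z a) \<le> K * dst D z y * norm a"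
      by (rule Phi_locally[OF chart z zU]) (rule that)
    let ?V = "{y \<in> topspace (subtopology (base_top D) U). ?A y \<in> ball (?A (proj D z)) 1}"
    have "openin (subtopology (base_top D) U) ?V"
      by (rule openin_continuous_map_preimage[OF cont]) simp
    then have V: "openin (base_top D) ?V" by (rule openin_trans_full[OF _ chart_open[OF chart]])
    have "proj D z \<in> ?V" using zU z by (simp add: topspace_base_top)
    then obtain s where s: "s > 0" "\<And>y. y \<in> Xt D \<Longrightarrow> dst D z y < s \<Longrightarrow> proj D y \<in> ?V"
      using preimage_ball[OF V z] by blast
    obtain B1 where B1: "B1 \<ge> 0" "\<And>a. norm (Phi \<phi> z a) \<le> B1 * norm a"
      using clinear_op_bounded[OF Phi_clinear[OF chart z zU]] by blast
    obtain B2 where B2: "B2 \<ge> 0" "\<And>a. norm (Psi \<phi> z a) \<le> B2 * norm a"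
      using clinear_op_bounded[OF Psi_clinear[OF chart z zU]] by blast
    have bd: "norm (F y a) \<le> (B + K * r) * norm a"
      if "norm (F z a) \<le> B * norm a" "norm (F y a - F z a) \<le> K * dst D z y * norm a" "dst D z y < r"
      for F :: "'a \<Rightarrow> complex ^ 'd \<Rightarrow> complex ^ 'd" and y a B
    proof -
      have "norm (F y a) \<le> norm (F z a) + norm (F y a - F z a)"
        using norm_triangle_ineq[of "F z a" "F y a - F z a"] by simp
      also have "\<dots> \<le> B * norm a + K * r * norm a"
        using that r(3) by (intro add_mono order_trans[OF that(2)] mult_right_mono mult_left_mono) auto
      finally show ?thesis by (simp add: algebra_simps)
    qed
    define N where "N = norm (?A (proj D z)) + 1"
    have N: "0 \<le> N" by (simp add: N_def)
    have main: "norm (pullf h x a) \<le> ((B2 + K * r) * (N * (B1 + K * r))) * norm a"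
      if x: "x \<in> Xt D" and d: "dst D z x < min r s" for x a
    proof -
      have d': "dst D z x < r" "dst D z x < s" using d by auto
      have xU: "proj D x \<in> U" by (rule r(2)[OF x d'(1)])
      have lin: "clinear_op (\<lambda>a. \<phi> (proj D x) (h (proj D x) (chart_inv D \<phi> (proj D x) a)))"
        using x xU fm chart_inv_mem[OF chart xU]
        by (simp add: linear_on_def chart_inv_add[OF chart] chart_inv_scale[OF chart] fibre_map_add fibre_map_scale
            chart_add[OF chart] chart_scale[OF chart] fibre_map_mem)
      have "?A (proj D x) \<in> ball (?A (proj D z)) 1" using s(2)[OF x d'(2)] by blast
      then have "dist (?A (proj D x)) (?A (proj D z)) < 1" by (simp add: dist_commute)
      then have nA: "norm (?A (proj D x)) \<le> N"
        using norm_triangle_ineq2[of "?A (proj D x)" "?A (proj D z)"] by (simp add: dist_norm N_def)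
      have eq: "pullf h x a = Psi \<phi> x (?A (proj D x) *v Phi \<phi> x a)"
        unfolding matrix_clinear_op[OF lin]
        using x xU fm by (simp add: Psi_def Phi_def chart_inv_chart[OF chart] triv_mem fibre_map_mem pullf_def)
      have "norm (pullf h x a) \<le> (B2 + K * r) * norm (?A (proj D x) *v Phi \<phi> x a)"
        unfolding eq by (rule bd[OF B2(2) r(5)[OF x d'(1)] d'(1)])
      also have "\<dots> \<le> (B2 + K * r) * (N * ((B1 + K * r) * norm a))"
      proof (rule mult_left_mono)
        have "norm (?A (proj D x) *v Phi \<phi> x a) \<le> norm (?A (proj D x)) * norm (Phi \<phi> x a)"
          by (rule norm_matrix_vector_mult_le)
        also have "\<dots> \<le> N * ((B1 + K * r) * norm a)"
          using N by (intro mult_mono nA bd[OF B1(2) r(4)[OF x d'(1)] d'(1)]) auto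
        finally show "norm (?A (proj D x) *v Phi \<phi> x a) \<le> N * ((B1 + K * r) * norm a)" .
      qed (use B2(1) r in simp)
      finally show ?thesis by (simp add: mult_ac)
    qed
    show ?thesis
    proof (intro exI conjI ballI impI allI)
      show "min r s > 0" using r s by simp
      show "0 \<le> (B2 + K * r) * (N * (B1 + K * r))" using B1(1) B2(1) N r(1,3) by simp
    qed (rule main)
  qed
  then obtain r B where rB: "\<And>z. z \<in> Xt D \<Longrightarrow> r z > 0" "\<And>z. z \<in> Xt D \<Longrightarrow> 0 \<le> B z"
    "\<And>z x a. z \<in> Xt D \<Longrightarrow> x \<in> Xt D \<Longrightarrow> dst D z x < r z \<Longrightarrow> norm (pullf h x a) \<le> B z * norm a"
    by metis
  obtain F where F: "finite F" "F \<subseteq> Xt D" "\<And>x. x \<in> Xt D \<Longrightarrow> \<exists>z\<in>F. \<exists>g\<in>carrier (Grp D). dst D z (act D g x) < r z"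
    by (rule finite_cover[OF rB(1)]) (assumption+, rule that)
  define C where "C = Max (insert 0 (B ` F))"
  have C0: "0 \<le> C" unfolding C_def using F(1) by (intro Max_ge) auto
  have C_le: "B z \<le> C" if "z \<in> F" for z unfolding C_def using F(1) that by (intro Max_ge) auto
  have "norm (pullf h x a) \<le> C * norm a" if x: "x \<in> Xt D" for x a
  proof -
    obtain z g where z: "z \<in> F" and g: "g \<in> carrier (Grp D)" and d: "dst D z (act D g x) < r z" using F(3)[OF x] by blast
    have zX: "z \<in> Xt D" using z F(2) by blast
    have "norm (pullf h x a) = norm (pullf h (act D g x) (coc g x a))"
      by (simp add: pullf_act[OF fm g x] norm_coc[OF g x])
    also have "\<dots> \<le> B z * norm (coc g x a)" by (rule rB(3)[OF zX act_mem[OF g x] d])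
    also have "\<dots> \<le> C * norm a" unfolding norm_coc[OF g x] by (intro mult_right_mono C_le z) simp
    finally show ?thesis .
  qed
  then show thesis using that[of C] C0 by (simp add: is_bounded_map_def)
qed

text \<open>A crude bound that may grow with \<open>k\<close>. It only ensures that the suprema in
  \<open>power_bounded\<close> are taken over bounded sets; the uniform bound is extracted
  afterwards.\<close>

lemma transfer_pow_bounded:
  obtains C where "0 \<le> C" "\<And>h B. h \<in> fibre_maps \<Longrightarrow> is_bounded_map h B \<Longrightarrow> is_bounded_map ((transfer D ^^ k) h) (B * C)"
proof -
  have "\<forall>w\<in>words k. \<exists>B K. lipschitz_family (Mw w) B K" using Mw_lipschitz_family by (auto simp: words_def)
  then obtain b where b: "\<And>w. w \<in> words k \<Longrightarrow> \<exists>K. lipschitz_family (Mw w) (b w) K" by metis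
  have b0: "0 \<le> b w" and bw: "x \<in> Xt D \<Longrightarrow> norm (Mw w x a) \<le> b w * norm a" if "w \<in> words k" for w x a
    using b[OF that] lipschitz_familyD by blast+
  show thesis
  proof (rule that[of "\<Sum>w\<in>words k. (b w)\<^sup>2"])
    fix h B assume h: "h \<in> fibre_maps" and B: "is_bounded_map h B"
    have B0: "0 \<le> B" and Bh: "\<And>x a. x \<in> Xt D \<Longrightarrow> norm (pullf h x a) \<le> B * norm a" using B by (auto simp: is_bounded_map_def)
    show "is_bounded_map ((transfer D ^^ k) h) (B * (\<Sum>w\<in>words k. (b w)\<^sup>2))"
      unfolding is_bounded_map_def
    proof (intro conjI ballI allI)
      fix x a assume x: "x \<in> Xt D"
      show "norm (pullf ((transfer D ^^ k) h) x a) \<le> B * (\<Sum>w\<in>words k. (b w)\<^sup>2) * norm a"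
      proof (rule norm_le_of_cip)
        fix c
        have "cmod (cip (pullf ((transfer D ^^ k) h) x a) c) \<le> (\<Sum>w\<in>words k. cmod (cip (pullf h (psiw w x) (Mw w x a)) (Mw w x c)))"
          unfolding cip_transfer_pow[OF h x] by (rule norm_sum)
        also have "\<dots> \<le> (\<Sum>w\<in>words k. (B * (b w * norm a)) * (b w * norm c))"
        proof (rule sum_mono)
          fix w assume w: "w \<in> words k"
          have p: "psiw w x \<in> Xt D" using w x by (auto simp: words_def psiw_mem)
          have "cmod (cip (pullf h (psiw w x) (Mw w x a)) (Mw w x c)) \<le> norm (pullf h (psiw w x) (Mw w x a)) * norm (Mw w x c)"
            by (rule cip_cauchy_schwarz)
          also have "\<dots> \<le> (B * (b w * norm a)) * (b w * norm c)"
            using B0 b0[OF w]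
            by (intro mult_mono bw[OF w x] order_trans[OF Bh[OF p] mult_left_mono[OF bw[OF w x]]]) auto
          finally show "cmod (cip (pullf h (psiw w x) (Mw w x a)) (Mw w x c)) \<le> (B * (b w * norm a)) * (b w * norm c)" .
        qed
        also have "\<dots> = B * (\<Sum>w\<in>words k. (b w)\<^sup>2) * norm a * norm c"
          by (simp add: sum_distrib_left sum_distrib_right power2_eq_square mult_ac)
        finally show "cmod (cip (pullf ((transfer D ^^ k) h) x a) c) \<le> B * (\<Sum>w\<in>words k. (b w)\<^sup>2) * norm a * norm c" .
      qed
    qed (use B0 in \<open>simp add: sum_nonneg\<close>)
  qed (simp add: sum_nonneg)
qed

definition ident :: "'a set \<Rightarrow> 'e \<Rightarrow> 'e" where
  "ident y v = (if y \<in> base D \<and> v \<in> fibre D y then v else 0)"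

lemma ident_mem: "ident \<in> fibre_maps"
  by (rule fibre_mapsI) (auto simp: ident_def fibre_add fibre_scale)

lemma pullf_ident: "x \<in> Xt D \<Longrightarrow> pullf ident x a = a"
  by (simp add: pullf_def ident_def triv_mem)

lemma ident_bounded: "is_bounded_map ident 1"
  by (simp add: is_bounded_map_def pullf_ident)

lemma ident_End: "ident \<in> End_bundle D"
proof -
  have "ident \<in> L_alg D" by (rule L_algI[OF ident_mem, of 0]) (simp add: is_lipschitz_map_def pullf_ident)
  then show ?thesis by (simp add: L_alg_def)
qed

text \<open>Power boundedness only enters through the identity, on which it bounds \<open>R\<^sup>k 1 = \<Sum>\<^sub>w M\<^sub>w\<^sup>* M\<^sub>w\<close>.\<close>

lemma Mw_square_sum:
  obtains K where "0 \<le> K" "\<And>k x a. x \<in> Xt D \<Longrightarrow> (\<Sum>w\<in>words k. (norm (Mw w x a))\<^sup>2) \<le> K * (norm a)\<^sup>2"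
proof -
  obtain K where K: "\<And>k. op_norm (End_bundle D) (sup_norm_End D) (transfer D ^^ k) \<le> K"
    using power_bounded by (auto simp: bdd_above_def)
  have sup_K: "sup_norm_End D ((transfer D ^^ k) ident) \<le> K" for k
  proof -
    obtain C where C: "0 \<le> C" "\<And>h B. h \<in> fibre_maps \<Longrightarrow> is_bounded_map h B \<Longrightarrow> is_bounded_map ((transfer D ^^ k) h) (B * C)"
      using transfer_pow_bounded by blast
    \<comment> \<open>The operator norm is the supremum of this set and dominates its members
      because the crude constant \<open>C\<close> bounds the set.\<close>
    let ?S = "{sup_norm_End D ((transfer D ^^ k) v) | v. v \<in> End_bundle D \<and> sup_norm_End D v \<le> 1}"
    have "t \<le> C" if t: "t \<in> ?S" for t
    proof -
      obtain v where v: "t = sup_norm_End D ((transfer D ^^ k) v)" "v \<in> End_bundle D" "sup_norm_End D v \<le> 1" using t by blast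
      have fm: "v \<in> fibre_maps" using v(2) by (simp add: End_bundle_def fibre_maps_def)
      obtain B where B: "is_bounded_map v B" using End_bundle_bounded[OF v(2)] .
      have "is_bounded_map v (sup_norm_End D v)" by (rule is_bounded_map_sup_norm_End[OF fm B])
      then have "is_bounded_map ((transfer D ^^ k) v) (sup_norm_End D v * C)" by (rule C(2)[OF fm])
      then have "t \<le> sup_norm_End D v * C" unfolding v(1) by (rule sup_norm_End_le[OF transfer_pow_mem[OF fm]])
      also have "\<dots> \<le> 1 * C" by (rule mult_right_mono[OF v(3) C(1)])
      finally show ?thesis by simp
    qed
    then have bdd: "bdd_above ?S" by (rule bdd_aboveI)
    have "sup_norm_End D ((transfer D ^^ k) ident) \<in> ?S"
      using ident_End sup_norm_End_le[OF ident_mem ident_bounded] by blast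
    then have "sup_norm_End D ((transfer D ^^ k) ident) \<le> op_norm (End_bundle D) (sup_norm_End D) (transfer D ^^ k)"
      unfolding op_norm_def by (rule cSup_upper[OF _ bdd])
    then show ?thesis using K order_trans by blast
  qed
  show thesis
  proof (rule that[of "\<bar>K\<bar>"])
    fix k x a assume x: "x \<in> Xt D"
    obtain C where C: "0 \<le> C" "\<And>h B. h \<in> fibre_maps \<Longrightarrow> is_bounded_map h B \<Longrightarrow> is_bounded_map ((transfer D ^^ k) h) (B * C)"
      using transfer_pow_bounded by blast
    let ?T = "(transfer D ^^ k) ident"
    have T: "is_bounded_map ?T (sup_norm_End D ?T)"
      by (rule is_bounded_map_sup_norm_End[OF transfer_pow_mem[OF ident_mem] C(2)[OF ident_mem ident_bounded]])
    have "complex_of_real (\<Sum>w\<in>words k. (norm (Mw w x a))\<^sup>2) = (\<Sum>w\<in>words k. cip (Mw w x a) (Mw w x a))"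
      by (simp add: cip_self)
    also have "\<dots> = (\<Sum>w\<in>words k. cip (pullf ident (psiw w x) (Mw w x a)) (Mw w x a))"
      by (rule sum.cong) (use x in \<open>auto simp: words_def pullf_ident psiw_mem\<close>)
    also have "\<dots> = cip (pullf ?T x a) a" by (rule cip_transfer_pow[OF ident_mem x, symmetric])
    finally have eq: "complex_of_real (\<Sum>w\<in>words k. (norm (Mw w x a))\<^sup>2) = cip (pullf ?T x a) a" .
    have "(\<Sum>w\<in>words k. (norm (Mw w x a))\<^sup>2) \<le> cmod (complex_of_real (\<Sum>w\<in>words k. (norm (Mw w x a))\<^sup>2))"
      unfolding norm_of_real by (rule abs_ge_self)
    also have "\<dots> \<le> norm (pullf ?T x a) * norm a" unfolding eq by (rule cip_cauchy_schwarz)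
    also have "\<dots> \<le> (\<bar>K\<bar> * norm a) * norm a"
    proof (rule mult_right_mono)
      have "norm (pullf ?T x a) \<le> sup_norm_End D ?T * norm a" using T x by (simp add: is_bounded_map_def)
      also have "\<dots> \<le> \<bar>K\<bar> * norm a" using sup_K[of k] by (intro mult_right_mono) auto
      finally show "norm (pullf ?T x a) \<le> \<bar>K\<bar> * norm a" .
    qed simp
    finally show "(\<Sum>w\<in>words k. (norm (Mw w x a))\<^sup>2) \<le> \<bar>K\<bar> * (norm a)\<^sup>2" by (simp add: power2_eq_square)
  qed simp
qed

text \<open>The term in which \<open>h\<close> is differentiated gains the contraction rate of
  the inverse branches, and the other two terms only involve the sup norm of \<open>h\<close>.\<close>

lemma lasota_yorke_transfer:
  obtains K where "0 \<le> K"
    "\<And>k h. h \<in> L_alg D \<Longrightarrow> is_bounded_map ((transfer D ^^ k) h) (K * W h)"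
    "\<And>k \<Theta>. 0 \<le> \<Theta> \<Longrightarrow> (\<And>x y. x \<in> Xt D \<Longrightarrow> y \<in> Xt D \<Longrightarrow> dst D x y \<le> \<Theta> * dst D ((rt D ^^ k) x) ((rt D ^^ k) y))
      \<Longrightarrow> \<exists>C\<ge>0. \<forall>h\<in>L_alg D. is_lipschitz_map ((transfer D ^^ k) h) (K * \<Theta> * Lip h + C * W h)"
proof -
  obtain K where K: "0 \<le> K" "\<And>k x a. x \<in> Xt D \<Longrightarrow> (\<Sum>w\<in>words k. (norm (Mw w x a))\<^sup>2) \<le> K * (norm a)\<^sup>2"
    using Mw_square_sum by blast
  \<comment> \<open>Cauchy--Schwarz over all words at once: the bound is independent of
    \<open>k\<close>, although the number of words may grow exponentially.\<close>
  have cs: "(\<Sum>w\<in>words k. norm (Mw w x a) * norm (Mw w x c)) \<le> K * norm a * norm c" if x: "x \<in> Xt D" for k x a c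
  proof -
    have "(\<Sum>w\<in>words k. norm (Mw w x a) * norm (Mw w x c)) \<le> L2_set (\<lambda>w. norm (Mw w x a)) (words k) * L2_set (\<lambda>w. norm (Mw w x c)) (words k)"
      using L2_set_mult_ineq[of "\<lambda>w. norm (Mw w x a)" "\<lambda>w. norm (Mw w x c)" "words k"] by simp
    also have "\<dots> \<le> (sqrt K * norm a) * (sqrt K * norm c)"
    proof -
      have "L2_set (\<lambda>w. norm (Mw w x a)) (words k) \<le> sqrt K * norm a" for a
      proof -
        have "sqrt (\<Sum>w\<in>words k. (norm (Mw w x a))\<^sup>2) \<le> sqrt (K * (norm a)\<^sup>2)"
          by (rule real_sqrt_le_mono[OF K(2)[OF x]])
        then show ?thesis by (simp add: L2_set_def real_sqrt_mult)
      qed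
      then show ?thesis by (intro mult_mono) (auto simp: K(1))
    qed
    also have "\<dots> = K * norm a * norm c" using K(1) by simp
    finally show ?thesis .
  qed
  show thesis
  proof (rule that[OF K(1)])
    fix k h assume h: "h \<in> L_alg D"
    have fm: "h \<in> fibre_maps" by (rule L_alg_fibre_map[OF h])
    show "is_bounded_map ((transfer D ^^ k) h) (K * W h)"
      unfolding is_bounded_map_def
    proof (intro conjI ballI allI)
      fix x a assume x: "x \<in> Xt D"
      show "norm (pullf ((transfer D ^^ k) h) x a) \<le> K * W h * norm a"
      proof (rule norm_le_of_cip)
        fix c
        have "cmod (cip (pullf ((transfer D ^^ k) h) x a) c) \<le> (\<Sum>w\<in>words k. cmod (cip (pullf h (psiw w x) (Mw w x a)) (Mw w x c)))"
          unfolding cip_transfer_pow[OF fm x] by (rule norm_sum)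
        also have "\<dots> \<le> (\<Sum>w\<in>words k. W h * (norm (Mw w x a) * norm (Mw w x c)))"
        proof (rule sum_mono)
          fix w assume w: "w \<in> words k"
          have p: "psiw w x \<in> Xt D" using w x by (auto simp: words_def psiw_mem)
          have "cmod (cip (pullf h (psiw w x) (Mw w x a)) (Mw w x c)) \<le> norm (pullf h (psiw w x) (Mw w x a)) * norm (Mw w x c)"
            by (rule cip_cauchy_schwarz)
          also have "\<dots> \<le> (W h * norm (Mw w x a)) * norm (Mw w x c)"
            by (intro mult_right_mono norm_pullf_le[OF h p]) auto
          finally show "cmod (cip (pullf h (psiw w x) (Mw w x a)) (Mw w x c)) \<le> W h * (norm (Mw w x a) * norm (Mw w x c))"
            by (simp add: mult.assoc)
        qed
        also have "\<dots> = W h * (\<Sum>w\<in>words k. norm (Mw w x a) * norm (Mw w x c))" by (simp add: sum_distrib_left)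
        also have "\<dots> \<le> W h * (K * norm a * norm c)" by (intro mult_left_mono cs x W_nonneg h)
        finally show "cmod (cip (pullf ((transfer D ^^ k) h) x a) c) \<le> K * W h * norm a * norm c" by (simp add: mult_ac)
      qed
    qed (use K(1) W_nonneg[OF h] in simp)
  next
    fix k :: nat and \<Theta> :: real
    assume \<Theta>: "0 \<le> \<Theta>" "\<And>x y. x \<in> Xt D \<Longrightarrow> y \<in> Xt D \<Longrightarrow> dst D x y \<le> \<Theta> * dst D ((rt D ^^ k) x) ((rt D ^^ k) y)"
    have "\<forall>w\<in>words k. \<exists>B L. lipschitz_family (Mw w) B L" using Mw_lipschitz_family by (auto simp: words_def)
    then obtain b l where bl: "\<And>w. w \<in> words k \<Longrightarrow> lipschitz_family (Mw w) (b w) (l w)" by metis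
    note M = lipschitz_familyD[OF bl]
    \<comment> \<open>The iterate of \<open>rt D\<close> undoes the word up to an isometry, so its
      expansion rate \<open>\<Theta>\<close> contracts every branch.\<close>
    have contr: "dst D (psiw w x) (psiw w y) \<le> \<Theta> * dst D x y" if w: "w \<in> words k" and x: "x \<in> Xt D" and y: "y \<in> Xt D" for w x y
    proof -
      have s: "set w \<subseteq> {1..idx D}" "length w = k" using w by (auto simp: words_def)
      obtain g where g: "g \<in> carrier (Grp D)" "\<And>x. x \<in> Xt D \<Longrightarrow> (rt D ^^ k) (psiw w x) = act D g x"
        using rt_pow_psiw[OF s(1)] s(2) by blast
      have "dst D (psiw w x) (psiw w y) \<le> \<Theta> * dst D (act D g x) (act D g y)"
        using \<Theta>(2)[OF psiw_mem[OF s(1) x] psiw_mem[OF s(1) y]] g(2) x y by simp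
      then show ?thesis by (simp add: isometric g(1) x y)
    qed
    \<comment> \<open>The Lipschitz constants of \<open>Mw w\<close> enter only here, so the
      dependence on \<open>k\<close> is confined to the weak term; the factor 2 counts the two terms
      in which \<open>Mw w\<close> varies.\<close>
    define C where "C = (\<Sum>w\<in>words k. 2 * b w * l w)"
    have C: "0 \<le> C" unfolding C_def using M(1,2) by (intro sum_nonneg) auto
    have "is_lipschitz_map ((transfer D ^^ k) h) (K * \<Theta> * Lip h + C * W h)" if h: "h \<in> L_alg D" for h
      unfolding is_lipschitz_map_def
    proof (intro conjI ballI allI)
      have fm: "h \<in> fibre_maps" by (rule L_alg_fibre_map[OF h])
      let ?T = "(transfer D ^^ k) h"
      have W0: "0 \<le> W h" and L0: "0 \<le> Lip h" using W_nonneg Lip_nonneg h by auto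
      show "0 \<le> K * \<Theta> * Lip h + C * W h" using K(1) \<Theta>(1) C W0 L0 by simp
      fix x y a assume x: "x \<in> Xt D" and y: "y \<in> Xt D"
      let ?d = "dst D x y"
      show "norm (pullf ?T x a - pullf ?T y a) \<le> (K * \<Theta> * Lip h + C * W h) * ?d * norm a"
      proof (rule norm_le_of_cip)
        fix c
        have "cip (pullf ?T x a - pullf ?T y a) c = (\<Sum>w\<in>words k. cip (pullf h (psiw w x) (Mw w x a)) (Mw w x c) - cip (pullf h (psiw w y) (Mw w y a)) (Mw w y c))"
          by (simp add: cip_diff_left cip_transfer_pow[OF fm x] cip_transfer_pow[OF fm y] sum_subtractf)
        then have "cmod (cip (pullf ?T x a - pullf ?T y a) c) \<le>
          (\<Sum>w\<in>words k. cmod (cip (pullf h (psiw w x) (Mw w x a)) (Mw w x c) - cip (pullf h (psiw w y) (Mw w y a)) (Mw w y c)))"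
          by (simp add: norm_sum)
        also have "\<dots> \<le> (\<Sum>w\<in>words k. Lip h * \<Theta> * ?d * (norm (Mw w x a) * norm (Mw w x c)) + (2 * b w * l w) * (W h * ?d * norm a * norm c))"
        proof (rule sum_mono)
          fix w assume w: "w \<in> words k"
          let ?u = "psiw w x" and ?v = "psiw w y" and ?a = "Mw w x a" and ?a' = "Mw w y a" and ?c = "Mw w x c" and ?c' = "Mw w y c"
          have u: "?u \<in> Xt D" and v: "?v \<in> Xt D" using w x y by (auto simp: words_def psiw_mem)
          have b0: "0 \<le> b w" and l0: "0 \<le> l w" using M(1,2)[OF w] by auto
          \<comment> \<open>Telescoping: the base point of \<open>h\<close>, the right factor and
            the left factor of the form are changed one at a time.\<close>
          have split: "cip (pullf h ?u ?a) ?c - cip (pullf h ?v ?a') ?c' =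
              cip (pullf h ?u ?a - pullf h ?v ?a) ?c + cip (pullf h ?v (?a - ?a')) ?c + cip (pullf h ?v ?a') (?c - ?c')"
            by (simp add: cip_diff_left cip_diff_right clinear_op_diff[OF pullf_clinear[OF fm v]])
          have t1: "cmod (cip (pullf h ?u ?a - pullf h ?v ?a) ?c) \<le> Lip h * \<Theta> * ?d * (norm ?a * norm ?c)"
          proof -
            have "norm (pullf h ?u ?a - pullf h ?v ?a) \<le> Lip h * dst D ?u ?v * norm ?a" by (rule dist_pullf_le[OF h u v])
            also have "\<dots> \<le> Lip h * (\<Theta> * ?d) * norm ?a" by (intro mult_right_mono mult_left_mono contr w x y L0) auto
            finally have "norm (pullf h ?u ?a - pullf h ?v ?a) * norm ?c \<le> Lip h * (\<Theta> * ?d) * norm ?a * norm ?c"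
              by (rule mult_right_mono) simp
            from order_trans[OF cip_cauchy_schwarz this] show ?thesis by (simp add: mult.assoc)
          qed
          have t2: "cmod (cip (pullf h ?v (?a - ?a')) ?c) \<le> (b w * l w) * (W h * ?d * norm a * norm c)"
          proof -
            have "norm (pullf h ?v (?a - ?a')) * norm ?c \<le> (W h * (l w * ?d * norm a)) * (b w * norm c)"
              using W0 l0
              by (intro mult_mono order_trans[OF norm_pullf_le[OF h v] mult_left_mono[OF M(5)[OF w x y] W0]] M(4)[OF w x]) auto
            from order_trans[OF cip_cauchy_schwarz this] show ?thesis by (simp add: mult_ac)
          qed
          have t3: "cmod (cip (pullf h ?v ?a') (?c - ?c')) \<le> (b w * l w) * (W h * ?d * norm a * norm c)"
          proof -
            have "norm (pullf h ?v ?a') * norm (?c - ?c') \<le> (W h * (b w * norm a)) * (l w * ?d * norm c)"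
              using W0 b0
              by (intro mult_mono order_trans[OF norm_pullf_le[OF h v] mult_left_mono[OF M(4)[OF w y] W0]] M(5)[OF w x y]) auto
            from order_trans[OF cip_cauchy_schwarz this] show ?thesis by (simp add: mult_ac)
          qed
          have "cmod (cip (pullf h ?u ?a) ?c - cip (pullf h ?v ?a') ?c') \<le>
              cmod (cip (pullf h ?u ?a - pullf h ?v ?a) ?c) + cmod (cip (pullf h ?v (?a - ?a')) ?c) + cmod (cip (pullf h ?v ?a') (?c - ?c'))"
            unfolding split by (intro order_trans[OF norm_triangle_ineq] add_right_mono norm_triangle_ineq)
          then show "cmod (cip (pullf h ?u ?a) ?c - cip (pullf h ?v ?a') ?c') \<le>
              Lip h * \<Theta> * ?d * (norm ?a * norm ?c) + (2 * b w * l w) * (W h * ?d * norm a * norm c)"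
            using t1 t2 t3 by linarith
        qed
        also have "\<dots> = Lip h * \<Theta> * ?d * (\<Sum>w\<in>words k. norm (Mw w x a) * norm (Mw w x c)) + C * (W h * ?d * norm a * norm c)"
          by (simp only: sum.distrib C_def sum_distrib_left sum_distrib_right)
        also have "\<dots> \<le> Lip h * \<Theta> * ?d * (K * norm a * norm c) + C * (W h * ?d * norm a * norm c)"
          using L0 \<Theta>(1) by (intro add_right_mono mult_left_mono cs x) auto
        finally show "cmod (cip (pullf ?T x a - pullf ?T y a) c) \<le> (K * \<Theta> * Lip h + C * W h) * ?d * norm a * norm c"
          by (simp add: algebra_simps)
      qed
    qed
    then show "\<exists>C\<ge>0. \<forall>h\<in>L_alg D. is_lipschitz_map ((transfer D ^^ k) h) (K * \<Theta> * Lip h + C * W h)" using C by blast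
  qed
qed

lemma transfer_add: "h \<in> fibre_maps \<Longrightarrow> k \<in> fibre_maps \<Longrightarrow> transfer D (h + k) = transfer D h + transfer D k"
proof -
  assume h: "h \<in> fibre_maps" and k: "k \<in> fibre_maps"
  show ?thesis
  proof (rule fibre_maps_eqI[OF transfer_mem[OF fibre_maps_add[OF h k]] fibre_maps_add[OF transfer_mem[OF h] transfer_mem[OF k]]])
    fix x a assume x: "x \<in> Xt D"
    show "pullf (transfer D (h + k)) x a = pullf (transfer D h + transfer D k) x a"
      unfolding pullf_add[OF transfer_mem[OF h] transfer_mem[OF k] x]
    proof (rule cip_ext)
      fix c
      show "cip (pullf (transfer D (h + k)) x a) c = cip (pullf (transfer D h) x a + pullf (transfer D k) x a) c"
        by (simp add: cip_add_left cip_transfer[OF _ x] h k fibre_maps_add pullf_add[OF h k] psi_mem x sum.distrib)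
    qed
  qed
qed

lemma transfer_scale: "h \<in> fibre_maps \<Longrightarrow> transfer D (End_scale D c h) = End_scale D c (transfer D h)"
proof -
  assume h: "h \<in> fibre_maps"
  show ?thesis
  proof (rule fibre_maps_eqI[OF transfer_mem[OF fibre_maps_scale[OF h]] fibre_maps_scale[OF transfer_mem[OF h]]])
    fix x a assume x: "x \<in> Xt D"
    show "pullf (transfer D (End_scale D c h)) x a = pullf (End_scale D c (transfer D h)) x a"
      unfolding pullf_scale[OF transfer_mem[OF h] x]
    proof (rule cip_ext)
      fix b
      show "cip (pullf (transfer D (End_scale D c h)) x a) b = cip (c *s pullf (transfer D h) x a) b"
        by (simp add: cip_scale_left cip_transfer[OF _ x] h fibre_maps_scale pullf_scale[OF h] psi_mem x sum_distrib_left)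
    qed
  qed
qed

text \<open>The rate \<open>\<Theta> = 1\<close> for a single step, which is enough for boundedness
  of the operator on \<open>L\<close>.\<close>

lemma rt_pow_trivial_bound:
  "x \<in> Xt D \<Longrightarrow> y \<in> Xt D \<Longrightarrow> dst D x y \<le> 1 * dst D ((rt D ^^ k) x) ((rt D ^^ k) y)"
proof -
  assume xy: "x \<in> Xt D" "y \<in> Xt D"
  have "theta D ^ k \<le> 1" using theta_range by (intro power_le_one) auto
  then have "theta D ^ k * dst D ((rt D ^^ k) x) ((rt D ^^ k) y) \<le> 1 * dst D ((rt D ^^ k) x) ((rt D ^^ k) y)"
    by (rule mult_right_mono) simp
  then show ?thesis using rt_pow_expanding[OF xy, of k] by simp
qed

text \<open>For \<open>t > \<tau>\<close> the factor \<open>K * c * (\<tau> / t) ^ n\<close> drops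
  below 1/8 for some \<open>n\<close>, whatever \<open>K\<close> and \<open>c\<close> are. The
  constant \<open>c\<close> leaves room for a change of norm, as needed for the torus.\<close>

lemma hennion_transfer:
  assumes \<tau>: "0 \<le> \<tau>" and c: "0 \<le> c"
    and expand: "\<And>k x y. x \<in> Xt D \<Longrightarrow> y \<in> Xt D \<Longrightarrow> dst D x y \<le> c * \<tau> ^ k * dst D ((rt D ^^ k) x) ((rt D ^^ k) y)"
  shows "hennion (End_scale D) (L_alg D) nrm W (transfer D) \<tau>"
proof -
  interpret EE: vector_space "End_scale D" by (rule vector_space_End)
  obtain K where K: "0 \<le> K"
    "\<And>k h. h \<in> L_alg D \<Longrightarrow> is_bounded_map ((transfer D ^^ k) h) (K * W h)"
    "\<And>k \<Theta>. 0 \<le> \<Theta> \<Longrightarrow> (\<And>x y. x \<in> Xt D \<Longrightarrow> y \<in> Xt D \<Longrightarrow> dst D x y \<le> \<Theta> * dst D ((rt D ^^ k) x) ((rt D ^^ k) y))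
      \<Longrightarrow> \<exists>C\<ge>0. \<forall>h\<in>L_alg D. is_lipschitz_map ((transfer D ^^ k) h) (K * \<Theta> * Lip h + C * W h)"
    using lasota_yorke_transfer by blast
  obtain C1 where C1: "0 \<le> C1" "\<And>h. h \<in> L_alg D \<Longrightarrow> is_lipschitz_map (transfer D h) (K * 1 * Lip h + C1 * W h)"
    using K(3)[of 1 1] rt_pow_trivial_bound[where k = 1] by fastforce
  show ?thesis
  proof
    show "EE.subspace (L_alg D)"
      by (rule EE.subspaceI) (auto simp: L_alg_0 L_alg_add L_alg_scale)
    show "\<exists>l\<in>L_alg D. (\<lambda>n. nrm (f n - l)) \<longlonglongrightarrow> 0"
      if "\<And>n. f n \<in> L_alg D" "\<And>e. e > 0 \<Longrightarrow> \<exists>M. \<forall>m\<ge>M. \<forall>n\<ge>M. nrm (f m - f n) < e" for f :: "nat \<Rightarrow> 'a set \<Rightarrow> 'e \<Rightarrow> 'e"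
      by (rule L_complete[OF that])
    show "linear_on (End_scale D) (End_scale D) (L_alg D) (transfer D)"
      unfolding linear_on_def by (simp add: transfer_add transfer_scale L_alg_fibre_map)
    show "transfer D h \<in> L_alg D" if "h \<in> L_alg D" for h
      by (rule L_algI[OF transfer_mem[OF L_alg_fibre_map[OF that]] C1(2)[OF that]])
    show "\<exists>C. \<forall>v\<in>L_alg D. nrm (transfer D v) \<le> C * nrm v"
    proof (intro exI[of _ "2 * K + C1"] ballI)
      fix h assume h: "h \<in> L_alg D"
      have "nrm (transfer D h) \<le> K * W h + (K * 1 * Lip h + C1 * W h)"
        unfolding nrm_def using W_le[OF K(2)[OF h, of 1]] Lip_le[OF C1(2)[OF h]] by simp
      also have "\<dots> \<le> K * nrm h + (K * 1 * nrm h + C1 * nrm h)"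
        using K(1) C1(1) by (intro add_mono mult_left_mono W_le_nrm Lip_le_nrm h) auto
      finally show "nrm (transfer D h) \<le> (2 * K + C1) * nrm h" by (simp add: algebra_simps)
    qed
    show "\<exists>n C. 0 \<le> C \<and> (\<forall>v\<in>L_alg D. nrm ((transfer D ^^ n) v) \<le> t ^ n / 8 * nrm v + C * W v)" if t: "\<tau> < t" for t
    proof -
      have t0: "0 < t" using t \<tau> by simp
      have "(\<lambda>n. K * c * (\<tau> / t) ^ n) \<longlonglongrightarrow> K * c * 0"
        using \<tau> t t0 by (intro tendsto_mult_left LIMSEQ_realpow_zero) auto
      then have "\<forall>\<^sub>F n in sequentially. K * c * (\<tau> / t) ^ n < 1 / 8"
        by (rule order_tendstoD(2)) simp
      then obtain n where n: "K * c * (\<tau> / t) ^ n < 1 / 8" by (auto simp: eventually_sequentially)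
      have Kn: "K * (c * \<tau> ^ n) \<le> t ^ n / 8"
      proof -
        have "K * (c * \<tau> ^ n) = K * c * (\<tau> / t) ^ n * t ^ n" using t0 by (simp add: power_divide)
        also have "\<dots> \<le> 1 / 8 * t ^ n" using n t0 by (intro mult_right_mono) auto
        finally show ?thesis by simp
      qed
      have "0 \<le> c * \<tau> ^ n" using c \<tau> by simp
      then obtain C where C: "0 \<le> C" "\<And>h. h \<in> L_alg D \<Longrightarrow> is_lipschitz_map ((transfer D ^^ n) h) (K * (c * \<tau> ^ n) * Lip h + C * W h)"
        using K(3)[OF _ expand] by blast
      show ?thesis
      proof (intro exI[of _ n] exI[of _ "K + C"] conjI ballI)
        fix h assume h: "h \<in> L_alg D"
        have "nrm ((transfer D ^^ n) h) \<le> K * W h + (K * (c * \<tau> ^ n) * Lip h + C * W h)"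
          unfolding nrm_def using W_le[OF K(2)[OF h, of n]] Lip_le[OF C(2)[OF h]] by simp
        also have "K * (c * \<tau> ^ n) * Lip h \<le> t ^ n / 8 * nrm h"
          using t0 Lip_nonneg[OF h] by (intro mult_mono Kn Lip_le_nrm h) auto
        finally show "nrm ((transfer D ^^ n) h) \<le> t ^ n / 8 * nrm h + (K + C) * W h" by (simp add: algebra_simps)
      qed (use K(1) C(1) in simp)
    qed
  qed (auto simp: nrm_nonneg nrm_zero nrm_scale nrm_add W_nonneg \<tau> intro: L_weakly_totally_bounded)
qed

text \<open>The bridge from the norm \<open>nrm\<close>, for which the abstract theory is verified,
  back to the operator norm of \<open>L\<close>.\<close>

lemma L_norm_cong:
  shows essential_spectral_radius_L_norm:
    "essential_spectral_radius (End_scale D) (L_alg D) (L_norm D) T = essential_spectral_radius (End_scale D) (L_alg D) nrm T"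
  and spectrum_L_norm: "spectrum (End_scale D) (L_alg D) (L_norm D) T = spectrum (End_scale D) (L_alg D) nrm T"
proof -
  obtain C where C: "0 \<le> C" "\<And>h. h \<in> L_alg D \<Longrightarrow> nrm h \<le> C * L_norm D h" "\<And>h. h \<in> L_alg D \<Longrightarrow> L_norm D h \<le> 2 * nrm h"
    using L_norm_equivalent by blast
  have two: "0 \<le> (2 :: real)" by simp
  show "essential_spectral_radius (End_scale D) (L_alg D) (L_norm D) T = essential_spectral_radius (End_scale D) (L_alg D) nrm T"
    by (rule essential_spectral_radius_cong[OF L_norm_nonneg nrm_nonneg two C(1) C(3,2)])
  show "spectrum (End_scale D) (L_alg D) (L_norm D) T = spectrum (End_scale D) (L_alg D) nrm T"
    by (rule spectrum_cong[OF L_norm_nonneg nrm_nonneg two C(1) C(3,2) order_refl])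
qed

theorem essential_spectral_radius_transfer_le:
  assumes "0 \<le> \<tau>" "0 \<le> c"
    and "\<And>k x y. x \<in> Xt D \<Longrightarrow> y \<in> Xt D \<Longrightarrow> dst D x y \<le> c * \<tau> ^ k * dst D ((rt D ^^ k) x) ((rt D ^^ k) y)"
  shows "essential_spectral_radius (End_scale D) (L_alg D) (L_norm D) (transfer D) \<le> ennreal \<tau>"
  unfolding essential_spectral_radius_L_norm
  by (rule hennion.essential_spectral_radius_le[OF hennion_transfer[OF assms]])

lemma theta_hennion: "hennion (End_scale D) (L_alg D) nrm W (transfer D) (theta D)"
  by (rule hennion_transfer[of _ 1]) (use theta_range rt_pow_expanding in auto)

text \<open>Outside the disc of radius \<open>\<theta> < 1\<close> the spectrum consists of eigenvalues, and an eigenvalue of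
  modulus greater than \<open>1\<close> contradicts the uniform bound on the powers in the sup norm.\<close>

theorem spectral_radius_transfer_le: "spectral_radius (End_scale D) (L_alg D) (L_norm D) (transfer D) \<le> 1"
  unfolding spectral_radius_def spectrum_L_norm
proof (rule SUP_least)
  fix z assume z: "z \<in> spectrum (End_scale D) (L_alg D) nrm (transfer D)"
  have "cmod z \<le> 1"
  proof (rule ccontr)
    assume "\<not> cmod z \<le> 1"
    then have z1: "1 < cmod z" by simp
    then have "theta D < cmod z" using theta_range by simp
    then have "is_eigenvalue (End_scale D) (L_alg D) (transfer D) z"
      using hennion.spectrum_eigenvalue[OF theta_hennion] z by blast
    then obtain h where h: "h \<in> L_alg D" "h \<noteq> 0" "transfer D h = End_scale D z h" by (auto simp: is_eigenvalue_def)
    have fm: "h \<in> fibre_maps" by (rule L_alg_fibre_map[OF h(1)])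
    have pow: "pullf ((transfer D ^^ k) h) x a = z ^ k *s pullf h x a" if x: "x \<in> Xt D" for k x a
    proof -
      have "(transfer D ^^ k) h = End_scale D (z ^ k) h"
      proof (induction k)
        case 0
        show ?case by (simp add: End_scale_def)
      next
        case (Suc k)
        have "transfer D (End_scale D (z ^ k) h) = End_scale D (z ^ k) (End_scale D z h)"
          by (simp add: transfer_scale[OF fm] h(3))
        then show ?case using Suc by (simp add: End_scale_def mult.commute)
      qed
      then show ?thesis by (simp add: pullf_scale[OF fm x])
    qed
    obtain K where K: "0 \<le> K" "\<And>k h. h \<in> L_alg D \<Longrightarrow> is_bounded_map ((transfer D ^^ k) h) (K * W h)"
      using lasota_yorke_transfer by metis
    have "pullf h x a = pullf 0 x a" if x: "x \<in> Xt D" for x a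
    proof (rule ccontr)
      assume "pullf h x a \<noteq> pullf 0 x a"
      then have pos: "0 < norm (pullf h x a)" by (simp add: pullf_0 x)
      obtain k where k: "K * W h * norm a / norm (pullf h x a) < cmod z ^ k"
        using real_arch_pow[OF z1] by blast
      have "norm (pullf ((transfer D ^^ k) h) x a) \<le> K * W h * norm a"
        using K(2)[OF h(1), of k] x by (simp add: is_bounded_map_def)
      then have "cmod z ^ k * norm (pullf h x a) \<le> K * W h * norm a"
        by (simp add: pow[OF x] norm_vector_scalar_mult norm_power)
      then show False using k pos by (simp add: divide_less_eq)
    qed
    then have "h = 0" using fibre_maps_eqI[OF fm fibre_maps_0] by blast
    then show False using h(2) by simp
  qed
  then show "ennreal (cmod z) \<le> 1" using ennreal_leI[of "cmod z" 1] by simp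
qed

theorem essential_spectral_radius_transfer_le_theta:
  "essential_spectral_radius (End_scale D) (L_alg D) (L_norm D) (transfer D) \<le> ennreal (theta D)"
  by (rule essential_spectral_radius_transfer_le[of _ 1]) (use theta_range rt_pow_expanding in auto)

end

section \<open>The torus\<close>

text \<open>The polynomial \<open>p\<close> of the operator \<open>B\<close>, applied to
  \<open>v\<close> and evaluated by Horner's scheme.\<close>

definition poly_op :: "(complex ^ 'n \<Rightarrow> complex ^ 'n) \<Rightarrow> complex poly \<Rightarrow> complex ^ 'n \<Rightarrow> complex ^ 'n" where
  "poly_op B p v = fold_coeffs (\<lambda>a u. a *s v + B u) p 0"

context
  fixes B :: "complex ^ 'n \<Rightarrow> complex ^ 'n"
  assumes B: "clinear_op B"
begin

lemma poly_op_0 [simp]: "poly_op B 0 v = 0"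
  by (simp add: poly_op_def)

lemma poly_op_pCons [simp]: "poly_op B (pCons a p) v = a *s v + B (poly_op B p v)"
  by (cases "a = 0 \<and> p = 0") (auto simp: poly_op_def clinear_op_0[OF B])

lemma poly_op_add: "poly_op B (p + q) v = poly_op B p v + poly_op B q v"
  by (induction p q rule: poly_induct2) (simp_all add: clinear_op_add[OF B] vector_sadd_rdistrib)

lemma poly_op_smult: "poly_op B (smult c p) v = c *s poly_op B p v"
  by (induction p rule: pCons_induct)
     (simp_all add: clinear_op_scale[OF B] vector_add_ldistrib vector_smult_assoc)

lemma poly_op_commute: "poly_op B p (B v - z *s v) = B (poly_op B p v) - z *s poly_op B p v"
proof (induction p rule: pCons_induct)
  case 0
  then show ?case by (simp add: clinear_op_0[OF B])
next
  case (pCons a p)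
  then show ?case
    by (simp add: clinear_op_add[OF B] clinear_op_diff[OF B] clinear_op_scale[OF B] vector_add_ldistrib
        vector_ssub_ldistrib vector_smult_assoc mult.commute)
qed

lemma poly_op_linear_factor: "poly_op B ([:- z, 1:] * q) v = B (poly_op B q v) - z *s poly_op B q v"
proof -
  have "[:- z, 1:] * q = smult (- z) q + pCons 0 q" by simp
  then have "poly_op B ([:- z, 1:] * q) v = poly_op B (smult (- z) q) v + poly_op B (pCons 0 q) v"
    by (simp only: poly_op_add)
  also have "\<dots> = (- z) *s poly_op B q v + B (poly_op B q v)" by (simp add: poly_op_smult del: smult_minus_left)
  finally show ?thesis by (simp add: vector_sneg_minus1[symmetric] vec_eq_iff)
qed

lemma poly_op_monom: "poly_op B (monom c i) v = c *s (B ^^ i) v"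
  by (induction i) (simp_all add: monom_0 monom_Suc clinear_op_scale[OF B] clinear_op_0[OF B])

lemma poly_op_sum: "poly_op B (\<Sum>i\<in>I. f i) v = (\<Sum>i\<in>I. poly_op B (f i) v)"
  by (induction I rule: infinite_finite_induct) (simp_all add: poly_op_add)

lemma annihilating_poly_exists: "\<exists>p. p \<noteq> 0 \<and> poly_op B p v = 0"
proof -
  let ?n = "CARD('n)" and ?f = "\<lambda>i. (B ^^ i) v"
  show ?thesis
  \<comment> \<open>Linear dependence is a property of sets, in which a repeated iterate would count
    once; repetitions are therefore treated apart, by a difference of two monomials.\<close>
  proof (cases "inj_on ?f {..?n}")
    case False
    then obtain i j where ij: "i \<noteq> j" "?f i = ?f j" by (auto simp: inj_on_def)
    let ?p = "monom 1 i + monom (- 1) j :: complex poly"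
    have "coeff ?p i \<noteq> 0" using ij(1) by simp
    then have "?p \<noteq> 0" by (metis coeff_0)
    moreover have "poly_op B ?p v = 0" using ij(2) by (simp add: poly_op_add poly_op_monom)
    ultimately show ?thesis by blast
  next
    case True
    let ?S = "?f ` {..?n}"
    have "vec.dim ?S \<le> ?n" using vec.dim_subset[OF subset_UNIV, of ?S] unfolding vec_dim_card .
    then have "vec.dim ?S < card ?S" using card_image[OF True] by simp
    then have "vec.dependent ?S" by (intro vec.dependent_biggerset_general) simp
    then obtain c s where c: "s \<in> ?S" "c s \<noteq> 0" "(\<Sum>u\<in>?S. c u *s u) = 0"
      by (subst (asm) vec.dependent_finite) auto
    let ?p = "\<Sum>i\<le>?n. monom (c (?f i)) i"
    obtain k where k: "k \<le> ?n" "s = ?f k" using c(1) by auto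
    have "coeff ?p k = (\<Sum>i\<le>?n. if i = k then c (?f i) else 0)"
      by (simp add: coeff_sum)
    also have "\<dots> = c (?f k)" using k(1) by simp
    finally have "?p \<noteq> 0" using c(2) k(2) by (metis coeff_0)
    moreover have "poly_op B ?p v = 0"
      using c(3) by (simp add: poly_op_sum poly_op_monom sum.reindex[OF True])
    ultimately show ?thesis by blast
  qed
qed

text \<open>The growth rate of the orbit of a vector is found by splitting an annihilating polynomial into linear
  factors: a factor \<open>B - z\<close> with \<open>z\<close> in the resolvent set is injective and can be cancelled, and
  the other ones have \<open>|z| < \<tau>\<close>.\<close>

lemma orbit_growth:
  assumes inj: "\<And>z v. \<tau> \<le> cmod z \<Longrightarrow> B v = z *s v \<Longrightarrow> v = 0" and \<tau>: "0 < \<tau>"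
    and p: "p \<noteq> 0" "poly_op B p v = 0"
  shows "\<exists>C. \<forall>k. norm ((B ^^ k) v) \<le> C * \<tau> ^ k"
  using p
proof (induction "degree p" arbitrary: p v)
  case 0
  then obtain a where "p = [:a:]" by (metis degree_eq_zeroE)
  then have "v = 0" using 0 clinear_op_0[OF B] by (auto simp: vector_mul_eq_0)
  moreover have "(B ^^ k) 0 = 0" for k by (induction k) (auto simp: clinear_op_0[OF B])
  ultimately show ?case by (auto intro: exI[of _ 0])
next
  case (Suc n)
  obtain z where "poly p z = 0" using fundamental_theorem_of_algebra[of p] Suc(2) by (auto simp: constant_degree)
  then obtain q where q: "p = [:- z, 1:] * q" by (auto simp: poly_eq_0_iff_dvd dvd_def)
  have q0: "q \<noteq> 0" using Suc(3) q by auto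
  have dq: "n = degree q" using Suc(2) q q0 by (simp add: degree_mult_eq del: mult_pCons_left)
  have zero: "B (poly_op B q v) - z *s poly_op B q v = 0"
    using Suc(4) unfolding q poly_op_linear_factor .
  show ?case
  proof (cases "\<tau> \<le> cmod z")
    case True
    then have "poly_op B q v = 0" using inj zero by (simp add: right_minus_eq)
    then show ?thesis using Suc(1)[OF dq q0] by blast
  next
    case False
    define w where "w = B v - z *s v"
    have "poly_op B q w = 0" unfolding w_def poly_op_commute by (rule zero)
    then obtain C where C: "\<And>k. norm ((B ^^ k) w) \<le> C * \<tau> ^ k" using Suc(1)[OF dq q0] by blast
    \<comment> \<open>Chosen to close the recursion \<open>step\<close>: the second entry gives
      \<open>cmod z * C' + C \<le> C' * \<tau>\<close>, the first starts the induction.\<close>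
    define C' where "C' = max (norm v) (C / (\<tau> - cmod z))"
    have step: "(B ^^ Suc k) v = z *s (B ^^ k) v + (B ^^ k) w" for k
    proof (induction k)
      case (Suc k)
      have "(B ^^ Suc (Suc k)) v = B (z *s (B ^^ k) v + (B ^^ k) w)" using Suc by simp
      then show ?case by (simp add: clinear_op_add[OF B] clinear_op_scale[OF B])
    qed (simp add: w_def)
    have "norm ((B ^^ k) v) \<le> C' * \<tau> ^ k" for k
    proof (induction k)
      case 0
      then show ?case by (simp add: C'_def)
    next
      case (Suc k)
      have "C / (\<tau> - cmod z) \<le> C'" by (simp add: C'_def)
      then have "C \<le> C' * (\<tau> - cmod z)" using False by (simp add: divide_le_eq)
      then have CC: "cmod z * C' + C \<le> C' * \<tau>" by (simp add: algebra_simps)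
      have "norm ((B ^^ Suc k) v) \<le> cmod z * norm ((B ^^ k) v) + norm ((B ^^ k) w)"
        unfolding step using norm_triangle_ineq[of "z *s (B ^^ k) v" "(B ^^ k) w"] by (simp add: norm_vector_scalar_mult)
      also have "\<dots> \<le> cmod z * (C' * \<tau> ^ k) + C * \<tau> ^ k" by (intro add_mono mult_left_mono Suc C) auto
      also have "\<dots> = (cmod z * C' + C) * \<tau> ^ k" by (simp add: algebra_simps)
      also have "\<dots> \<le> (C' * \<tau>) * \<tau> ^ k" using CC \<tau> by (intro mult_right_mono) auto
      finally show ?case by simp
    qed
    then show ?thesis by blast
  qed
qed

end

lemma matrix_clinear: "clinear_op ((*v) (B :: complex ^ 'n ^ 'm))"
  by (rule clinear_opI) (simp_all add: matrix_vector_right_distrib vec.scale)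

text \<open>Every \<open>z\<close> with \<open>\<tau> \<le> cmod z\<close> is outside the spectrum,
  so \<open>B - z\<close> is injective and \<open>orbit_growth\<close> applies to each vector. Its
  constant depends on the vector; the finitely many basis vectors and linearity make it
  uniform.\<close>

lemma power_bound_of_spectral_radius:
  fixes B :: "complex ^ 'n ^ 'n"
  assumes \<tau>: "0 < \<tau>" and r: "spectral_radius (*s) UNIV norm ((*v) B) < ennreal \<tau>"
  obtains C where "0 \<le> C" "\<And>k v. norm ((((*v) B) ^^ k) v) \<le> C * \<tau> ^ k * norm v"
proof -
  have inj: "v = 0" if z: "\<tau> \<le> cmod z" and v: "B *v v = z *s v" for z v
  proof -
    have "z \<notin> spectrum (*s) UNIV norm ((*v) B)"
    proof
      assume "z \<in> spectrum (*s) UNIV norm ((*v) B)"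
      then have "ennreal (cmod z) \<le> spectral_radius (*s) UNIV norm ((*v) B)"
        unfolding spectral_radius_def by (rule SUP_upper)
      also have "\<dots> < ennreal \<tau>" by (rule r)
      also have "\<dots> \<le> ennreal (cmod z)" by (rule ennreal_leI[OF z])
      finally show False by simp
    qed
    then have "inj (\<lambda>v. B *v v - z *s v)" by (simp add: spectrum_def bij_betw_def)
    moreover have "B *v v - z *s v = B *v 0 - z *s 0" using v by simp
    ultimately show "v = 0" by (rule injD)
  qed
  have "\<exists>C. \<forall>k. norm ((((*v) B) ^^ k) v) \<le> C * \<tau> ^ k" for v
  proof -
    obtain p where p: "p \<noteq> 0" "poly_op ((*v) B) p v = 0"
      using annihilating_poly_exists[OF matrix_clinear, of B v] by blast
    show ?thesis by (rule orbit_growth[OF matrix_clinear _ \<tau> p]) (rule inj)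
  qed
  then obtain c where c: "\<And>v k. norm ((((*v) B) ^^ k) v) \<le> c v * \<tau> ^ k" by metis
  define M where "M = Max (range (\<lambda>j. c (axis j 1)))"
  have M: "c (axis j 1) \<le> M" for j unfolding M_def by (intro Max_ge) auto
  have "0 \<le> c (axis undefined 1) * \<tau> ^ 0" using c norm_ge_zero order_trans by blast
  then have M0: "0 \<le> M" using M[of undefined] by simp
  show thesis
  proof (rule that[of "real CARD('n) * M"])
    fix k v
    have lin: "clinear_op (((*v) B) ^^ k)"
    proof (induction k)
      case (Suc k)
      then show ?case using clinear_op_compose[OF matrix_clinear[of B] Suc] by (simp add: o_def)
    qed (simp add: linear_on_def)
    have "norm ((((*v) B) ^^ k) v) \<le> real CARD('n) * (M * \<tau> ^ k) * norm v"
    proof (rule clinear_op_norm_le_basis[OF lin])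
      fix j
      show "norm ((((*v) B) ^^ k) (axis j 1)) \<le> M * \<tau> ^ k"
        by (rule order_trans[OF c mult_right_mono[OF M]]) (use \<tau> in simp)
    qed
    then show "norm ((((*v) B) ^^ k) v) \<le> real CARD('n) * M * \<tau> ^ k * norm v" by (simp add: mult.assoc)
  qed (use M0 in simp)
qed

definition cvec :: "real ^ 'n \<Rightarrow> complex ^ 'n" where "cvec x = (\<chi> i. complex_of_real (x $ i))"

lemma norm_cvec: "norm (cvec x) = norm x"
  by (simp add: cvec_def norm_vec_def)

lemma complexify_cvec: "complexify A *v cvec x = cvec (A *v x)"
  by (simp add: cvec_def matrix_vector_mult_def vec_eq_iff)

lemma complexify_pow_cvec: "(((*v) (complexify A)) ^^ k) (cvec x) = cvec ((((*v) A) ^^ k) x)"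
  by (induction k) (simp_all add: complexify_cvec)

context torus_setting
begin

section \<open>Comparison of \<open>normA\<close> with the euclidean norm\<close>

lemma normA_nonneg: "0 \<le> normA x"
proof -
  have "normA (- x) = normA x" using normA_scale[of "- 1" x] by simp
  then show ?thesis using normA_triangle[of x "- x"] normA_zero[of 0] by simp
qed

lemma normA_sum: "finite I \<Longrightarrow> normA (\<Sum>i\<in>I. f i) \<le> (\<Sum>i\<in>I. normA (f i))"
proof (induction I rule: finite_induct)
  case (insert i I)
  then show ?case using normA_triangle[of "f i" "\<Sum>i\<in>I. f i"] by simp
qed (use normA_zero[of 0] in simp)

lemma normA_le_norm: obtains c where "0 \<le> c" "\<And>x. normA x \<le> c * norm x"
proof (rule that[of "\<Sum>i\<in>UNIV. normA (axis i 1)"])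
  fix x :: "real ^ 'n"
  have "x = (\<Sum>i\<in>UNIV. (x $ i) *\<^sub>R axis i 1)"
    by (simp add: vec_eq_iff axis_def if_distrib if_distribR cong: if_cong)
  then have "normA x \<le> (\<Sum>i\<in>UNIV. normA ((x $ i) *\<^sub>R axis i 1))" using normA_sum[of UNIV "\<lambda>i. (x $ i) *\<^sub>R axis i 1"] by simp
  also have "\<dots> = (\<Sum>i\<in>UNIV. \<bar>x $ i\<bar> * normA (axis i 1))" by (simp only: normA_scale)
  also have "\<dots> \<le> (\<Sum>i\<in>UNIV. norm x * normA (axis i 1))"
    by (intro sum_mono mult_right_mono component_le_norm_cart normA_nonneg)
  finally show "normA x \<le> (\<Sum>i\<in>UNIV. normA (axis i 1)) * norm x" by (simp add: sum_distrib_left mult.commute)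
qed (simp add: sum_nonneg normA_nonneg)

text \<open>\<open>normA\<close> is Lipschitz for the euclidean norm, hence attains a minimum on the
  compact unit sphere, which is positive because \<open>normA\<close> vanishes only at 0.\<close>

lemma norm_le_normA: obtains c where "0 < c" "\<And>x. norm x \<le> c * normA x"
proof -
  obtain c where c: "0 \<le> c" "\<And>x. normA x \<le> c * norm x" using normA_le_norm by blast
  have lip: "\<bar>normA x - normA y\<bar> \<le> c * norm (x - y)" for x y
  proof -
    have "normA x \<le> normA y + normA (x - y)" using normA_triangle[of y "x - y"] by simp
    moreover have "normA y \<le> normA x + normA (y - x)" using normA_triangle[of x "y - x"] by simp
    moreover have "normA (y - x) \<le> c * norm (x - y)" using c(2)[of "y - x"] by (simp add: norm_minus_commute)
    ultimately show ?thesis using c(2)[of "x - y"] by simp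
  qed
  have "c-lipschitz_on (sphere 0 1) normA"
    by (rule lipschitz_onI) (use lip c(1) in \<open>auto simp: dist_norm\<close>)
  then have cont: "continuous_on (sphere 0 1) normA" by (rule lipschitz_on_continuous_on)
  have "axis undefined 1 \<in> sphere (0 :: real ^ 'n) 1" by (simp add: norm_axis_1)
  then obtain u where u: "u \<in> sphere 0 1" "\<And>x. x \<in> sphere 0 1 \<Longrightarrow> normA u \<le> normA x"
    using continuous_attains_inf[OF compact_sphere _ cont] by blast
  have "u \<noteq> 0" using u(1) by auto
  then have pos: "0 < normA u" using normA_nonneg[of u] normA_zero[of u] by linarith
  show thesis
  proof (rule that[of "1 / normA u"])
    fix x :: "real ^ 'n"
    show "norm x \<le> 1 / normA u * normA x"
    proof (cases "x = 0")
      case False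
      have "normA u \<le> normA ((1 / norm x) *\<^sub>R x)" by (rule u(2)) (use False in simp)
      also have "\<dots> = normA x / norm x" unfolding normA_scale by simp
      finally have "normA u * norm x \<le> normA x" using False by (simp add: le_divide_eq)
      then show ?thesis using pos by (simp add: field_simps)
    qed (simp add: normA_nonneg pos)
  qed (use pos in simp)
qed

lemma rt_pow_matrix_inv: "(((*v) (matrix_inv A)) ^^ k) ((rt D ^^ k) x - (rt D ^^ k) y) = x - y"
proof (induction k arbitrary: x y)
  case (Suc k)
  have "A ** matrix_inv A = mat 1 \<and> matrix_inv A ** A = mat 1"
    using A_invertible unfolding matrix_inv_def invertible_def by (rule someI_ex)
  then have inv: "matrix_inv A *v (A *v u) = u" for u
    by (simp add: matrix_vector_mul_assoc)
  have "(rt D ^^ Suc k) x - (rt D ^^ Suc k) y = A *v ((rt D ^^ k) x - (rt D ^^ k) y)"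
    by (simp add: rt_eq matrix_vector_mult_diff_distrib)
  then have "matrix_inv A *v ((rt D ^^ Suc k) x - (rt D ^^ Suc k) y) = (rt D ^^ k) x - (rt D ^^ k) y"
    by (simp only: inv)
  then show ?case using Suc by (simp only: funpow_Suc_right o_apply)
qed simp

text \<open>By density of the order it suffices to bound by each \<open>t\<close> above the spectral
  radius. The powers of the inverse matrix grow at most like \<open>t ^ k\<close> in the euclidean
  norm, and returning to \<open>normA\<close> costs only constants, which
  \<open>essential_spectral_radius_transfer_le\<close> admits. The asymptotic rate thus replaces
  \<open>theta D = 1 / \<rho>\<close>, which reflects the chosen norm.\<close>

theorem essential_spectral_radius_torus:
  "essential_spectral_radius (End_scale D) (L_alg D) (L_norm D) (transfer D)
    \<le> spectral_radius (*s) UNIV norm ((*v) (complexify (matrix_inv A)))"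
proof (rule dense_ge)
  fix t assume t: "spectral_radius (*s) UNIV norm ((*v) (complexify (matrix_inv A))) < t"
  show "essential_spectral_radius (End_scale D) (L_alg D) (L_norm D) (transfer D) \<le> t"
  proof (cases t)
    case top
    then show ?thesis by simp
  next
    case (real \<tau>)
    have \<tau>: "0 < \<tau>" using t real by (metis ennreal_0 less_eq_real_def not_less_zero)
    obtain C where C: "0 \<le> C" "\<And>k v. norm ((((*v) (complexify (matrix_inv A))) ^^ k) v) \<le> C * \<tau> ^ k * norm v"
      using power_bound_of_spectral_radius[OF \<tau>] t real(2) by blast
    obtain c where c: "0 \<le> c" "\<And>x. normA x \<le> c * norm x" using normA_le_norm by blast
    obtain c' where c': "0 < c'" "\<And>x. norm x \<le> c' * normA x" using norm_le_normA by blast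
    have "dst D x y \<le> c * C * c' * \<tau> ^ k * dst D ((rt D ^^ k) x) ((rt D ^^ k) y)" for k x y
    proof -
      let ?u = "(rt D ^^ k) x - (rt D ^^ k) y"
      have "norm (x - y) = norm (cvec ((((*v) (matrix_inv A)) ^^ k) ?u))" by (simp only: norm_cvec rt_pow_matrix_inv)
      also have "\<dots> \<le> C * \<tau> ^ k * norm ?u"
        unfolding complexify_pow_cvec[symmetric] using C(2)[of k "cvec ?u"] by (simp only: norm_cvec)
      also have "\<dots> \<le> C * \<tau> ^ k * (c' * normA ?u)" using C(1) \<tau> by (intro mult_left_mono c') auto
      finally have "c * norm (x - y) \<le> c * (C * \<tau> ^ k * (c' * normA ?u))" by (rule mult_left_mono[OF _ c(1)])
      then have "normA (x - y) \<le> c * (C * \<tau> ^ k * (c' * normA ?u))" using c(2) order_trans by blast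
      then show ?thesis by (simp add: dst_eq mult_ac)
    qed
    then show ?thesis
      unfolding real(2) using C(1) c(1) c'(1) real(1)
      by (intro essential_spectral_radius_transfer_le[of \<tau> "c * C * c'"]) auto
  qed
qed

end

theorem theorem3p6:
  fixes D :: "('a, 'g, 'e::ab_group_add, 'd::finite) transfer_system"
    and D' :: "(real ^ 'n, real ^ 'n, 'f::ab_group_add, 'k::finite) transfer_system"
    and A :: "real ^ 'n ^ 'n" and normA :: "real ^ 'n \<Rightarrow> real" and \<rho> :: real
  shows "(transfer_setting D \<longrightarrow>
            essential_spectral_radius (End_scale D) (L_alg D) (L_norm D) (transfer D) \<le> ennreal (theta D) \<and>
            spectral_radius (End_scale D) (L_alg D) (L_norm D) (transfer D) \<le> 1) \<and>
         (torus_setting D' A normA \<rho> \<longrightarrow>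
            essential_spectral_radius (End_scale D') (L_alg D') (L_norm D') (transfer D')
              \<le> spectral_radius (*s) UNIV norm ((*v) (complexify (matrix_inv A))))"
  using transfer_setting.essential_spectral_radius_transfer_le_theta transfer_setting.spectral_radius_transfer_le
    torus_setting.essential_spectral_radius_torus by blast

end
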